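(* Assume that $C\in L^1(\mathbb{R}^2)$ and $C(\mathbf 0)<\infty$. For $z\ge 0$ and $r,x,y,x_1,x_2,y_1,y_2\in\mathbb{R}^2$, let $$\mu_1^\varepsilon(z,r;x):=\mathbb E\Big[u^\varepsilon\big(\tfrac z\varepsilon,\tfrac r\varepsilon+x\big)\Big],\qquad \mu_2^\varepsilon(z,r;x,y):=\mathbb E\Big[u^\varepsilon\big(\tfrac z\varepsilon,\tfrac r\varepsilon+x\big)\overline{u^\varepsilon\big(\tfrac z\varepsilon,\tfrac r\varepsilon+y\big)}\Big],$$ $$\mu_4^\varepsilon(z,r;x_1,x_2,y_1,y_2):=\mathbb E\Big[u^\varepsilon\big(\tfrac z\varepsilon,\tfrac r\varepsilon+x_1\big)u^\varepsilon\big(\tfrac z\varepsilon,\tfrac r\varepsilon+x_2\big)\overline{u^\varepsilon\big(\tfrac z\varepsilon,\tfrac r\varepsilon+y_1\big)}\,\overline{u^\varepsilon\big(\tfrac z\varepsilon,\tfrac r\varepsilon+y_2\big)}\Big],$$ where $u^\varepsilon$ is the field defined in the context. Then, as $\varepsilon\to0$, the quantities $\mu_1^\varepsilon(z,r;x)$, $\mu_2^\varepsilon(z,r;x,y)$ and $\mu_4^\varepsilon(z,r;x_1,x_2,y_1,y_2)$ converge, and their limits, denoted $\mu_1^0,\mu_2^0,\mu_4^0$, satisfy the Gaussian summation rule $$\begin{aligned} \mu_4^0(z,r;x_1,x_2,y_1,y_2)={}&\mu_2^0(z,r;x_1,y_1)\,\mu_2^0(z,r;x_2,y_2)+\mu_2^0(z,r;x_1,y_2)\,\mu_2^0(z,r;x_2,y_1)\\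 &-\mu_1^0(z,r;x_1)\,\mu_1^0(z,r;x_2)\,\overline{\mu_1^0(z,r;y_1)}\,\overline{\mu_1^0(z,r;y_2)} . \end{aligned}$$
   Context: Fix $k_0>0$ and $r_0>0$. $C:\mathbb{R}^2\to\mathbb{R}$ is a covariance function of a real stationary field (real, even, positive definite). Under the assumption $C\in L^1(\mathbb{R}^2)$, $C(\mathbf 0)<\infty$, its Fourier transform $\hat C$ is continuous, bounded, nonnegative and integrable, and $C$ is continuous and bounded. For $\varepsilon>0$, $B^\varepsilon(z,x)$ is a real-valued Brownian field on $[0,\infty)\times\mathbb{R}^2$ with covariance $\mathbb E[B^\varepsilon(z,x)B^\varepsilon(z',x')]=\min\{z,z'\}\,\varepsilon\,C(x-x')$, and $u^\varepsilon$ is the ($L^2(\mathbb{R}^2)$-valued) solution of the Itô–Schrödinger equation $$du^\varepsilon(z,x)=\frac{i}{2k_0}\Delta_xu^\varepsilon(z,x)\,dz+\frac{ik_0}{2}u^\varepsilon(z,x)\circ dB^\varepsilon(z,x),\qquad u^\varepsilon(0,x)=\exp\Big(-\frac{\varepsilon^2|x|^2}{2r_0^2}\Big),$$ where $\circ$ denotes the Stratonovich integral. (This is the scintillation regime: covariance $\varepsilon C$, beam radius $r_0/\varepsilon$, propagation distance $z/\varepsilon$.) The moments of $u^\varepsilon$ are the continuous functions solving the closed moment equations: $m_1(z,x)=\mathbb E[u^\varepsilon(z,x)]$ solves $\partial_zm_1=\frac{i}{2k_0}\Delta_xm_1-\frac{k_0^2\varepsilon C(\mathbf 0)}{8}m_1$;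 and for $p=1,2$, $m_{2p}(z,(x_j)_{j\le p},(y_l)_{l\le p})=\mathbb E[\prod_ju^\varepsilon(z,x_j)\prod_l\overline{u^\varepsilon(z,y_l)}]$ solves, in $L^2((\mathbb{R}^2)^{2p})$, $$\partial_zm_{2p}=\frac{i}{2k_0}\Big(\sum_j\Delta_{x_j}-\sum_l\Delta_{y_l}\Big)m_{2p}+\frac{k_0^2\varepsilon}{4}\Big(\sum_{j,l}C(x_j-y_l)-\sum_{j<j'}C(x_j-x_{j'})-\sum_{l<l'}C(y_l-y_{l'})-pC(\mathbf 0)\Big)m_{2p},$$ with initial conditions given by the corresponding products of the initial field. *)

theory Defs
  imports "HOL-Probability.Probability"
begin

section \<open>Laplacian and Schwartz functions\<close>

definition partial :: "'e::euclidean_space \<Rightarrow> ('e \<Rightarrow> complex) \<Rightarrow> 'e \<Rightarrow> complex" where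
  "partial b f x = vector_derivative (\<lambda>t::real. f (x + t *\<^sub>R b)) (at 0)"

definition laplacian :: "('e::euclidean_space \<Rightarrow> complex) \<Rightarrow> 'e \<Rightarrow> complex" where
  "laplacian f x = (\<Sum>b\<in>Basis. partial b (partial b f) x)"

text \<open>Differentiability below is total (Frechet) differentiability of every iterated partial
  derivative, which is equivalent to being of class C-infinity.\<close>

definition schwartz :: "('e::euclidean_space \<Rightarrow> complex) \<Rightarrow> bool" where
  "schwartz f \<longleftrightarrow>
     (\<forall>bs. set bs \<subseteq> Basis \<longrightarrow>
        (\<forall>x. foldr partial bs f differentiable (at x)) \<and>
        (\<forall>n::nat. \<exists>K. \<forall>x. (1 + norm x) ^ n * norm (foldr partial bs f x) \<le> K))"

section \<open>Evolution equations in the square-integrable functions\<close>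

definition square_integrable :: "('e::euclidean_space \<Rightarrow> complex) \<Rightarrow> bool" where
  "square_integrable f \<longleftrightarrow>
     f \<in> borel_measurable borel \<and> integrable lborel (\<lambda>w. (norm (f w))\<^sup>2)"

definition continuous_L2_path :: "(real \<Rightarrow> 'e::euclidean_space \<Rightarrow> complex) \<Rightarrow> bool" where
  "continuous_L2_path m \<longleftrightarrow>
     (\<forall>z\<ge>0. square_integrable (m z)) \<and>
     (\<forall>z\<ge>0. ((\<lambda>s. LBINT w. (norm (m s w - m z w))\<^sup>2) \<longlongrightarrow> 0) (at z within {0..}))"

text \<open>
  \<open>m\<close> is a continuous function that solves \<open>\<partial>\<^sub>z m = A m + V m\<close>, \<open>m 0 = f0\<close> in L2. Since
  \<open>V\<close> need not be smooth, \<open>m z\<close> need not lie in the domain of \<open>A\<close>, and the equation is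
  understood in integrated form, tested against Schwartz functions. \<open>A\<close> is applied to the test
  function and so must be its own transpose for the bilinear pairing \<open>\<integral> f g\<close>, which is the case
  for complex combinations of partial Laplacians.
\<close>

definition solves_evolution ::
  "(('e::euclidean_space \<Rightarrow> complex) \<Rightarrow> 'e \<Rightarrow> complex) \<Rightarrow> ('e \<Rightarrow> real) \<Rightarrow> ('e \<Rightarrow> complex)
     \<Rightarrow> (real \<Rightarrow> 'e \<Rightarrow> complex) \<Rightarrow> bool" where
  "solves_evolution A V f0 m \<longleftrightarrow>
     continuous_on ({0..} \<times> UNIV) (\<lambda>(z, w). m z w) \<and>
     continuous_L2_path m \<and>
     (\<forall>\<phi>. schwartz \<phi> \<longrightarrow> (\<forall>z\<ge>0.
        (LBINT w. m z w * \<phi> w) =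
          (LBINT w. f0 w * \<phi> w)
          + (LBINT s:{0..z}. (LBINT w. m s w * (A \<phi> w + of_real (V w) * \<phi> w)))))"

section \<open>Covariance functions and Brownian fields\<close>

text \<open>Continuity belongs to the definition: a function that is positive definite in the
  algebraic sense and integrable need not be continuous (the indicator of the origin).\<close>

definition covariance_function :: "(real^2 \<Rightarrow> real) \<Rightarrow> bool" where
  "covariance_function C \<longleftrightarrow>
     continuous_on UNIV C \<and>
     (\<forall>x. C (- x) = C x) \<and>
     (\<forall>S c. finite S \<longrightarrow> 0 \<le> (\<Sum>x\<in>S. \<Sum>y\<in>S. c x * c y * C (x - y)))"

text \<open>Here \<open>\<sigma> = 0\<close> is the degenerate normal distribution at 0.\<close>

definition centered_normal :: "'a measure \<Rightarrow> ('a \<Rightarrow> real) \<Rightarrow> bool" where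
  "centered_normal M X \<longleftrightarrow>
     (\<exists>\<sigma>\<ge>0. if \<sigma> = 0 then X \<in> borel_measurable M \<and> (AE \<omega> in M. X \<omega> = 0)
            else distributed M lborel X (\<lambda>t. ennreal (normal_density 0 \<sigma> t)))"

definition brownian_field ::
  "'a measure \<Rightarrow> (real^2 \<Rightarrow> real) \<Rightarrow> (real \<Rightarrow> real^2 \<Rightarrow> 'a \<Rightarrow> real) \<Rightarrow> bool" where
  "brownian_field M C B \<longleftrightarrow>
     (\<forall>z\<ge>0. (\<lambda>(x, \<omega>). B z x \<omega>) \<in> borel_measurable (borel \<Otimes>\<^sub>M M)) \<and>
     (\<forall>S c. finite S \<and> S \<subseteq> {0..} \<times> UNIV \<longrightarrow>
        centered_normal M (\<lambda>\<omega>. \<Sum>(z, x)\<in>S. c (z, x) * B z x \<omega>)) \<and>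
     (\<forall>z\<ge>0. \<forall>z'\<ge>0. \<forall>x x'. (\<integral>\<omega>. B z x \<omega> * B z' x' \<omega> \<partial>M) = min z z' * C (x - x')) \<and>
     (\<forall>x. AE \<omega> in M. continuous_on {0..} (\<lambda>z. B z x \<omega>))"

section \<open>The Ito-Schroedinger equation\<close>

text \<open>The Stratonovich integral \<open>\<integral>\<^sub>0\<^sup>z \<langle>\<phi> u \<circ> dB\<rangle>\<close>, as the limit in probability of trapezoidal sums
  over partitions of \<open>[0, z]\<close> with mesh tending to 0.\<close>

definition stratonovich_sum ::
  "(real^2 \<Rightarrow> complex) \<Rightarrow> (real \<Rightarrow> real^2 \<Rightarrow> 'a \<Rightarrow> complex) \<Rightarrow> (real \<Rightarrow> real^2 \<Rightarrow> 'a \<Rightarrow> real)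
     \<Rightarrow> (nat \<Rightarrow> real) \<Rightarrow> nat \<Rightarrow> 'a \<Rightarrow> complex" where
  "stratonovich_sum \<phi> u B t N \<omega> =
     (\<Sum>k<N. LBINT x. \<phi> x * ((u (t k) x \<omega> + u (t (Suc k)) x \<omega>) / 2)
                       * of_real (B (t (Suc k)) x \<omega> - B (t k) x \<omega>))"

definition has_stratonovich_integral ::
  "'a measure \<Rightarrow> (real^2 \<Rightarrow> complex) \<Rightarrow> (real \<Rightarrow> real^2 \<Rightarrow> 'a \<Rightarrow> complex)
     \<Rightarrow> (real \<Rightarrow> real^2 \<Rightarrow> 'a \<Rightarrow> real) \<Rightarrow> real \<Rightarrow> ('a \<Rightarrow> complex) \<Rightarrow> bool" where
  "has_stratonovich_integral M \<phi> u B z I \<longleftrightarrow>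
     I \<in> borel_measurable M \<and>
     (\<forall>\<delta>>0. \<exists>h>0. \<forall>N t.
        t 0 = 0 \<and> t N = z \<and> (\<forall>k<N. t k \<le> t (Suc k) \<and> t (Suc k) - t k < h) \<longrightarrow>
        measure M {\<omega> \<in> space M. norm (stratonovich_sum \<phi> u B t N \<omega> - I \<omega>) > \<delta>} < \<delta>)"

definition nonanticipating ::
  "'a measure \<Rightarrow> (real \<Rightarrow> real^2 \<Rightarrow> 'a \<Rightarrow> complex) \<Rightarrow> (real \<Rightarrow> real^2 \<Rightarrow> 'a \<Rightarrow> real) \<Rightarrow> bool" where
  "nonanticipating M u B \<longleftrightarrow>
     (\<exists>F. filtration (space M) F \<and>
        (\<forall>z\<ge>0.
           (\<forall>x. B z x \<in> borel_measurable (F z) \<and> u z x \<in> borel_measurable (F z)) \<and>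
           prob_space.indep_set M (sets (F z))
             (sigma_sets (space M)
                {(\<lambda>\<omega>. B z' x \<omega> - B z x \<omega>) -` A \<inter> space M | z' x A. z \<le> z' \<and> A \<in> sets borel})))"

text \<open>\<open>u\<close> solves \<open>du = i/(2 k0) \<Delta>u dz + (i k0/2) u \<circ> dB\<close> with \<open>u 0 = f0\<close> as an L2-valued process,
  the equation being tested against Schwartz functions.\<close>

definition ito_schroedinger_solution ::
  "'a measure \<Rightarrow> real \<Rightarrow> (real \<Rightarrow> real^2 \<Rightarrow> 'a \<Rightarrow> real) \<Rightarrow> (real^2 \<Rightarrow> complex)
     \<Rightarrow> (real \<Rightarrow> real^2 \<Rightarrow> 'a \<Rightarrow> complex) \<Rightarrow> bool" where
  "ito_schroedinger_solution M k0 B f0 u \<longleftrightarrow>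
     (\<forall>z\<ge>0. (\<lambda>(x, \<omega>). u z x \<omega>) \<in> borel_measurable (borel \<Otimes>\<^sub>M M)) \<and>
     nonanticipating M u B \<and>
     (AE \<omega> in M. continuous_L2_path (\<lambda>z x. u z x \<omega>)) \<and>
     (\<forall>x. AE \<omega> in M. u 0 x \<omega> = f0 x) \<and>
     (\<forall>\<phi>. schwartz \<phi> \<longrightarrow> (\<forall>z\<ge>0. \<exists>I. has_stratonovich_integral M \<phi> u B z I \<and>
        (AE \<omega> in M.
           (LBINT x. u z x \<omega> * \<phi> x) =
             (LBINT x. f0 x * \<phi> x)
             + \<i> / (2 * of_real k0) * (LBINT s:{0..z}. (LBINT x. u s x \<omega> * laplacian \<phi> x))
             + \<i> * of_real k0 / 2 * I \<omega>)))"

definition gaussian_beam :: "real \<Rightarrow> real \<Rightarrow> real^2 \<Rightarrow> complex" where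
  "gaussian_beam r0 \<epsilon> x = of_real (exp (- (\<epsilon>\<^sup>2 * (norm x)\<^sup>2) / (2 * r0\<^sup>2)))"

section \<open>Moments and their equations\<close>

definition moment1 :: "'a measure \<Rightarrow> (real \<Rightarrow> real^2 \<Rightarrow> 'a \<Rightarrow> complex) \<Rightarrow> real \<Rightarrow> real^2 \<Rightarrow> complex" where
  "moment1 M u z x = (\<integral>\<omega>. u z x \<omega> \<partial>M)"

definition moment2 ::
  "'a measure \<Rightarrow> (real \<Rightarrow> real^2 \<Rightarrow> 'a \<Rightarrow> complex) \<Rightarrow> real \<Rightarrow> real^2 \<Rightarrow> real^2 \<Rightarrow> complex" where
  "moment2 M u z x y = (\<integral>\<omega>. u z x \<omega> * cnj (u z y \<omega>) \<partial>M)"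

definition moment4 ::
  "'a measure \<Rightarrow> (real \<Rightarrow> real^2 \<Rightarrow> 'a \<Rightarrow> complex) \<Rightarrow> real
     \<Rightarrow> real^2 \<Rightarrow> real^2 \<Rightarrow> real^2 \<Rightarrow> real^2 \<Rightarrow> complex" where
  "moment4 M u z x1 x2 y1 y2 =
     (\<integral>\<omega>. u z x1 \<omega> * u z x2 \<omega> * cnj (u z y1 \<omega>) * cnj (u z y2 \<omega>) \<partial>M)"

text \<open>
  In the following definition \<open>C\<close> is the covariance function of the driving Brownian field, that
  is \<open>\<epsilon> C\<close> in the scintillation regime. An L2-valued solution determines its moments only almost
  everywhere; the requirement that the moments be the continuous solutions of the closed moment
  equations is what fixes the pointwise values of \<open>u z x\<close> (up to null events for each \<open>(z, x)\<close>).
\<close>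

definition satisfies_moment_equations ::
  "'a measure \<Rightarrow> real \<Rightarrow> (real^2 \<Rightarrow> real) \<Rightarrow> (real^2 \<Rightarrow> complex)
     \<Rightarrow> (real \<Rightarrow> real^2 \<Rightarrow> 'a \<Rightarrow> complex) \<Rightarrow> bool" where
  "satisfies_moment_equations M k0 C f0 u \<longleftrightarrow>
     (\<forall>z\<ge>0. \<forall>x. integrable M (\<lambda>\<omega>. (norm (u z x \<omega>)) ^ 4)) \<and>
     solves_evolution
       (\<lambda>\<phi> x. \<i> / (2 * of_real k0) * laplacian \<phi> x)
       (\<lambda>x. - (k0\<^sup>2 * C 0 / 8))
       f0
       (moment1 M u) \<and>
     solves_evolution
       (\<lambda>\<phi> (x, y). \<i> / (2 * of_real k0) *
          (laplacian (\<lambda>\<xi>. \<phi> (\<xi>, y)) x - laplacian (\<lambda>\<xi>. \<phi> (x, \<xi>)) y))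
       (\<lambda>(x, y). k0\<^sup>2 / 4 * (C (x - y) - C 0))
       (\<lambda>(x, y). f0 x * cnj (f0 y))
       (\<lambda>z (x, y). moment2 M u z x y) \<and>
     solves_evolution
       (\<lambda>\<phi> (x1, x2, y1, y2). \<i> / (2 * of_real k0) *
          (laplacian (\<lambda>\<xi>. \<phi> (\<xi>, x2, y1, y2)) x1 + laplacian (\<lambda>\<xi>. \<phi> (x1, \<xi>, y1, y2)) x2
           - laplacian (\<lambda>\<xi>. \<phi> (x1, x2, \<xi>, y2)) y1 - laplacian (\<lambda>\<xi>. \<phi> (x1, x2, y1, \<xi>)) y2))
       (\<lambda>(x1, x2, y1, y2). k0\<^sup>2 / 4 *
          (C (x1 - y1) + C (x1 - y2) + C (x2 - y1) + C (x2 - y2)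
           - C (x1 - x2) - C (y1 - y2) - 2 * C 0))
       (\<lambda>(x1, x2, y1, y2). f0 x1 * f0 x2 * cnj (f0 y1) * cnj (f0 y2))
       (\<lambda>z (x1, x2, y1, y2). moment4 M u z x1 x2 y1 y2)"

end

theory Submission
  imports Defs
begin

text \<open>
  The second and the fourth moment solve Schroedinger equations with potentials built from
  \<open>\<epsilon> C\<close>, over the long distance \<open>z / \<epsilon>\<close>. The Gaussian beam is an average, over a Gaussian
  frequency \<open>k\<close>, of plane waves \<open>cis (\<epsilon> k \<bullet> x)\<close>, so it suffices to follow plane waves.

  For the first and second moments this can be done exactly. The potential \<open>C (x - y)\<close> only
  produces frequencies \<open>(k, - k)\<close>, on which the dispersion relation \<open>\<bar>p\<bar>\<^sup>2 - \<bar>q\<bar>\<^sup>2\<close> vanishes; hence a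
  plane wave stays a plane wave times the exponential of the potential accumulated along a straight
  characteristic (\<open>sol\<close>, \<open>sol_duhamel\<close>). After rescaling, the small parameter disappears
  from this phase (\<open>phs_rescaled\<close>), and dominated convergence gives the limits (\<open>msol_limit\<close>).

  For the fourth moment the same formula solves the equation in which only the interactions
  \<open>x1 y1\<close>, \<open>x2 y2\<close> are kept, and the equation in which only \<open>x1 y2\<close>, \<open>x2 y1\<close> are kept; averaged
  over \<open>k\<close> they are products of second moments, and without any interaction one gets a product of
  first moments. The sum of the first two minus the third (\<open>fourth_sol\<close>) is the Gaussian summation
  formula at positive \<open>\<epsilon>\<close> (\<open>fourth_average_factorises\<close>). It does not solve the fourth moment equation:
  the residual consists of cross terms, in which a potential acts on a wave scattered by a
  pairing that it does not belong to, and of the terms \<open>C (x1 - x2)\<close>, \<open>C (y1 - y2)\<close> acting on the unscattered wave.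
  All these oscillate with the propagation distance. The former gain a factor \<open>1 / sqrt Z\<close> after
  averaging over the two scattering frequencies (\<open>scattered_source\<close>), because \<open>C\<close> is integrable; the
  latter oscillate with frequency about \<open>\<bar>k\<bar>\<^sup>2 / k0\<close> (\<open>oscillating_source\<close>). With
  strength \<open>\<epsilon>\<close> and \<open>Z = z / \<epsilon>\<close> the residual tends to zero (\<open>fourth_error_limit\<close>).

  To turn a small residual into a small error, functions are compared through their pairings with
  Gaussian wave packets, a family that is invariant under the free evolution and under multiplication
  by plane waves. The potential is an average of plane waves, so multiplication by it costs only the
  constant \<open>C 0\<close> uniformly over all packets, and Gronwall's argument closes
  (\<open>packet_gronwall\<close>). Packets that shrink to a point then give the pointwise error
  (\<open>approximate_solution\<close>).
\<close>

section \<open>Gaussian integrals\<close>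


lemma borel_measurable_cis [measurable (raw)]:
  "f \<in> borel_measurable M \<Longrightarrow> (\<lambda>x. cis (f x)) \<in> borel_measurable M"
  by (rule borel_measurable_continuous_on[OF _ ]) (auto intro: continuous_intros)

lemma integral_lborel_translate:
  fixes f :: "'e::euclidean_space \<Rightarrow> 'b::{banach,second_countable_topology}"
  shows "(LBINT x. f (a + x)) = (LBINT x. f x)"
    and "integrable lborel (\<lambda>x. f (a + x)) \<longleftrightarrow> integrable lborel f"
proof -
  have *: "integrable lborel (\<lambda>x. g (b + x))" if "integrable lborel g"
    for g :: "'e \<Rightarrow> 'b" and b
  proof -
    have [measurable]: "g \<in> borel_measurable borel" using borel_measurable_integrable[OF that] by simp
    have "integrable (distr lborel borel ((+) b)) g" using that by (simp add: lborel_distr_plus)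
    then show ?thesis by (subst (asm) integrable_distr_eq) auto
  qed
  show **: "integrable lborel (\<lambda>x. f (a + x)) \<longleftrightarrow> integrable lborel f"
    using *[of f a] *[of "\<lambda>x. f (a + x)" "-a"] by auto
  show "(LBINT x. f (a + x)) = (LBINT x. f x)"
  proof (cases "integrable lborel f")
    case True
    then have [measurable]: "f \<in> borel_measurable borel" using borel_measurable_integrable by force
    have "(LBINT x. f x) = (LINT x|distr lborel borel ((+) a). f x)" by (simp add: lborel_distr_plus)
    also have "\<dots> = (LBINT x. f (a + x))" by (subst integral_distr) auto
    finally show ?thesis by simp
  next
    case False
    then show ?thesis using ** by (simp add: not_integrable_integral_eq)
  qed
qed

lemma lborel_distr_neg: "distr lborel borel (\<lambda>x. - x) = (lborel :: 'e::euclidean_space measure)"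
proof -
  have "(lborel :: 'e measure) = density (distr lborel borel (\<lambda>x. 0 + (-1) *\<^sub>R x)) (\<lambda>_. ennreal (\<bar>-1\<bar>^DIM('e)))"
    by (rule lborel_affine) simp
  then show ?thesis by (simp add: density_1)
qed

lemma integral_lborel_reflect:
  fixes f :: "'e::euclidean_space \<Rightarrow> 'b::{banach,second_countable_topology}"
  shows "(LBINT x. f (- x)) = (LBINT x. f x)"
    and "integrable lborel (\<lambda>x. f (- x)) \<longleftrightarrow> integrable lborel f"
proof -
  have *: "integrable lborel (\<lambda>x. g (- x))" if "integrable lborel g"
    for g :: "'e \<Rightarrow> 'b"
  proof -
    have [measurable]: "g \<in> borel_measurable borel" using borel_measurable_integrable[OF that] by simp
    have "integrable (distr lborel borel (\<lambda>x. - x)) g" using that by (simp add: lborel_distr_neg)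
    then show ?thesis by (subst (asm) integrable_distr_eq) auto
  qed
  show **: "integrable lborel (\<lambda>x. f (- x)) \<longleftrightarrow> integrable lborel f"
    using *[of f] *[of "\<lambda>x. f (- x)"] by auto
  show "(LBINT x. f (- x)) = (LBINT x. f x)"
  proof (cases "integrable lborel f")
    case True
    then have [measurable]: "f \<in> borel_measurable borel" using borel_measurable_integrable by force
    have "(LBINT x. f x) = (LINT x|distr lborel borel (\<lambda>x. - x). f x)" by (simp add: lborel_distr_neg)
    also have "\<dots> = (LBINT x. f (- x))" by (subst integral_distr) auto
    finally show ?thesis by simp
  next
    case False
    then show ?thesis using ** by (simp add: not_integrable_integral_eq)
  qed
qed

lemma integral_lborel_scale:
  fixes f :: "'e::euclidean_space \<Rightarrow> 'b::{banach,second_countable_topology}"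
  assumes "c > 0"
  shows "integrable lborel f \<Longrightarrow> integrable lborel (\<lambda>x. f (c *\<^sub>R x))"
    and "f \<in> borel_measurable borel \<Longrightarrow> (LBINT x. f (c *\<^sub>R x)) = (LBINT x. f x) /\<^sub>R c ^ DIM('e)"
proof -
  have c: "(lborel :: 'e measure) = density (distr lborel borel (\<lambda>x. 0 + c *\<^sub>R x)) (\<lambda>_. \<bar>c\<bar>^DIM('e))"
    by (rule lborel_affine) (use assms in simp)
  have I: "integrable lborel f \<longleftrightarrow> integrable lborel (\<lambda>x. f (c *\<^sub>R x))" if [measurable]: "f \<in> borel_measurable borel"
  proof -
    have "integrable lborel f \<longleftrightarrow> integrable lborel (\<lambda>x. (c ^ DIM('e)) *\<^sub>R f (c *\<^sub>R x))"
      by (subst c) (use assms in \<open>simp add: integrable_density integrable_distr_eq\<close>)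
    also have "\<dots> \<longleftrightarrow> integrable lborel (\<lambda>x. f (c *\<^sub>R x))"
    proof
      have "c ^ DIM('e) \<noteq> 0" using assms by simp
      assume "integrable lborel (\<lambda>x. (c ^ DIM('e)) *\<^sub>R f (c *\<^sub>R x))"
      then have "integrable lborel (\<lambda>x. inverse (c ^ DIM('e)) *\<^sub>R (c ^ DIM('e)) *\<^sub>R f (c *\<^sub>R x))"
        by (rule integrable_scaleR_right)
      then show "integrable lborel (\<lambda>x. f (c *\<^sub>R x))"
        using \<open>c ^ DIM('e) \<noteq> 0\<close> by (simp only: scaleR_scaleR left_inverse scaleR_one not_False_eq_True)
    qed auto
    finally show ?thesis .
  qed
  show "integrable lborel f \<Longrightarrow> integrable lborel (\<lambda>x. f (c *\<^sub>R x))"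
    using I borel_measurable_integrable by force
  assume [measurable]: "f \<in> borel_measurable borel"
  have "(LBINT x. f x) = c ^ DIM('e) *\<^sub>R (LBINT x. f (c *\<^sub>R x))"
    by (subst c) (use assms in \<open>simp add: integral_density integral_distr\<close>)
  then show "(LBINT x. f (c *\<^sub>R x)) = (LBINT x. f x) /\<^sub>R c ^ DIM('e)"
    using assms by simp
qed

text \<open>Integrals over a Euclidean space of products over the coordinates reduce to one dimension by
  identifying \<open>lborel\<close> with a product measure.\<close>

lemma prod_Basis_integral:
  fixes f :: "'e::euclidean_space \<Rightarrow> real \<Rightarrow> complex"
  assumes f: "\<And>b. b \<in> Basis \<Longrightarrow> integrable lborel (f b)"
  shows "integrable lborel (\<lambda>x::'e. \<Prod>b\<in>Basis. f b (x \<bullet> b))"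
    and "(LBINT x. (\<Prod>b\<in>Basis. f b (x \<bullet> b))) = (\<Prod>b\<in>Basis. LINT t|lborel. f b t)"
proof -
  interpret product_sigma_finite "\<lambda>_::'e. lborel :: real measure" ..
  have [measurable]: "f b \<in> borel_measurable borel" if "b \<in> Basis" for b
    using borel_measurable_integrable[OF f[OF that]] by simp
  have [measurable]: "(\<lambda>x. \<Prod>b\<in>Basis. f b (x \<bullet> b)) \<in> borel_measurable borel"
    by (intro borel_measurable_prod measurable_compose[OF _ \<open>_ \<Longrightarrow> f _ \<in> borel_measurable borel\<close>]) auto
  have eq: "(\<Prod>b\<in>Basis. f b ((\<Sum>c\<in>Basis. y c *\<^sub>R c) \<bullet> b)) = (\<Prod>b\<in>Basis. f b (y b))" for y
    by (intro prod.cong refl) (simp add: inner_sum_left inner_Basis if_distrib sum.delta cong: if_cong)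
  have T[measurable]: "(\<lambda>y::'e\<Rightarrow>real. \<Sum>b\<in>Basis. y b *\<^sub>R b) \<in> measurable (\<Pi>\<^sub>M b\<in>Basis. lborel) borel"
    by measurable
  show "integrable lborel (\<lambda>x::'e. \<Prod>b\<in>Basis. f b (x \<bullet> b))"
    by (subst lborel_eq, subst integrable_distr_eq[OF T])
       (auto simp: eq intro!: product_integrable_prod f)
  show "(LBINT x. (\<Prod>b\<in>Basis. f b (x \<bullet> b))) = (\<Prod>b\<in>Basis. LINT t|lborel. f b t)"
    by (subst lborel_eq, subst integral_distr[OF T])
       (auto simp: eq intro!: product_integral_prod f)
qed

lemma norm_sq_Basis: "(norm (x::'e::euclidean_space))\<^sup>2 = (\<Sum>b\<in>Basis. (x \<bullet> b)\<^sup>2)"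
  unfolding power2_norm_eq_inner by (subst euclidean_inner) (simp add: power2_eq_square)

lemma gaussian_integrable_1:
  assumes "d > 0" shows "integrable lborel (\<lambda>x::real. exp (- (x\<^sup>2 / (2 * d))))"
proof -
  have "integrable lborel (\<lambda>x. sqrt (2*pi*d) * normal_density 0 (sqrt d) x)"
    using assms by (intro integrable_mult_right integrable_normal_density) auto
  then show ?thesis using assms by (simp add: normal_density_def field_simps)
qed

lemma gaussian_fourier_1:
  assumes "d > 0"
  shows "(LBINT x. complex_of_real (exp (- (x\<^sup>2 / (2 * d)))) * cis (t * x)) = of_real (sqrt (2 * pi * d) * exp (- d * t\<^sup>2 / 2))"
proof -
  have 1: "(LBINT x. complex_of_real (normal_density 0 1 x) * cis (s * x)) = of_real (exp (- s\<^sup>2 / 2))" for s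
  proof -
    have "char std_normal_distribution s = of_real (exp (- s\<^sup>2 / 2))" by (simp add: char_std_normal_distribution)
    also have "char std_normal_distribution s = (LBINT x. normal_density 0 1 x *\<^sub>R cis (s * x))"
      unfolding char_def by (subst integral_density) (auto simp: cis_conv_exp)
    finally show ?thesis by (simp add: scaleR_conv_of_real)
  qed
  have "(LBINT x. complex_of_real (exp (- (x\<^sup>2 / (2 * d)))) * cis (t * x))
     = \<bar>sqrt d\<bar> *\<^sub>R (LBINT x. complex_of_real (exp (- ((0 + sqrt d * x)\<^sup>2 / (2 * d)))) * cis (t * (0 + sqrt d * x)))"
    using assms by (intro lborel_integral_real_affine) auto
  also have "\<dots> = sqrt d *\<^sub>R (LBINT x. complex_of_real (sqrt (2 * pi)) * (complex_of_real (normal_density 0 1 x) * cis ((t * sqrt d) * x)))"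
    using assms by (simp add: normal_density_def power_mult_distrib mult_ac)
  also have "\<dots> = sqrt d *\<^sub>R (complex_of_real (sqrt (2 * pi)) * of_real (exp (- (t * sqrt d)\<^sup>2 / 2)))"
    by (simp only: integral_mult_right_zero 1)
  also have "\<dots> = of_real (sqrt (2 * pi * d) * exp (- d * t\<^sup>2 / 2))"
    using assms by (simp add: scaleR_conv_of_real real_sqrt_mult power_mult_distrib mult_ac)
  finally show ?thesis .
qed

lemma gaussian_integrable:
  assumes "d > 0" shows "integrable lborel (\<lambda>x::'e::euclidean_space. exp (- ((norm x)\<^sup>2 / (2 * d))))"
proof -
  have "integrable lborel (\<lambda>x::'e. \<Prod>b\<in>Basis. complex_of_real (exp (- ((x \<bullet> b)\<^sup>2 / (2 * d)))))"
    using gaussian_integrable_1[OF assms] by (intro prod_Basis_integral) auto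
  also have "(\<lambda>x::'e. \<Prod>b\<in>Basis. complex_of_real (exp (- ((x \<bullet> b)\<^sup>2 / (2 * d))))) = (\<lambda>x. of_real (exp (- ((norm x)\<^sup>2 / (2 * d)))))"
    by (simp add: norm_sq_Basis exp_sum sum_divide_distrib flip: of_real_prod sum_negf)
  finally show ?thesis by (simp only: complex_of_real_integrable_eq)
qed

lemma gaussian_integrable':
  assumes "c > 0" shows "integrable lborel (\<lambda>x::'e::euclidean_space. exp (- c * (norm x)\<^sup>2))"
  using gaussian_integrable[of "1 / (2 * c)"] assms by (simp add: mult.commute)

lemma gaussian_fourier:
  assumes "d > 0"
  shows "(LBINT x. complex_of_real (exp (- ((norm (x::'e::euclidean_space))\<^sup>2 / (2 * d)))) * cis (k \<bullet> x))
    = of_real (sqrt (2 * pi * d) ^ DIM('e) * exp (- d * (norm k)\<^sup>2 / 2))"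
proof -
  have eq: "complex_of_real (exp (- ((norm (x::'e::euclidean_space))\<^sup>2 / (2 * d)))) * cis (k \<bullet> x)
    = (\<Prod>b\<in>Basis. complex_of_real (exp (- ((x \<bullet> b)\<^sup>2 / (2 * d)))) * cis ((k \<bullet> b) * (x \<bullet> b)))" for x
  proof -
    have "cis (k \<bullet> x) = (\<Prod>b\<in>Basis. cis ((k \<bullet> b) * (x \<bullet> b)))"
      by (subst euclidean_inner) (simp add: cis_conv_exp exp_sum sum_distrib_left)
    moreover have "complex_of_real (exp (- ((norm x)\<^sup>2 / (2 * d)))) = (\<Prod>b\<in>Basis. complex_of_real (exp (- ((x \<bullet> b)\<^sup>2 / (2 * d)))))"
      by (simp add: norm_sq_Basis exp_sum sum_divide_distrib flip: of_real_prod sum_negf)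
    ultimately show ?thesis by (simp add: prod.distrib)
  qed
  have int: "integrable lborel (\<lambda>x. complex_of_real (exp (- (x\<^sup>2 / (2 * d)))) * cis (s * x))" for s
    by (rule Bochner_Integration.integrable_bound[OF gaussian_integrable_1[OF assms]]) (auto simp: norm_mult)
  have e: "exp (- d * (norm k)\<^sup>2 / 2) = (\<Prod>b\<in>(Basis::'e set). exp (- d * (k \<bullet> b)\<^sup>2 / 2))"
    unfolding norm_sq_Basis exp_sum[OF finite_Basis, symmetric] by (simp add: sum_divide_distrib sum_distrib_left sum_negf)
  show ?thesis unfolding eq e
    by (subst prod_Basis_integral(2)[OF int])
       (simp add: gaussian_fourier_1[OF assms] prod.distrib flip: of_real_prod of_real_mult of_real_power)
qed

section \<open>Gaussians as an approximate identity\<close>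

definition gauss :: "real \<Rightarrow> 'e::euclidean_space \<Rightarrow> real" where
  "gauss d x = exp (- ((norm x)\<^sup>2 / (2 * d))) / sqrt (2 * pi * d) ^ DIM('e)"

lemma gauss_nonneg: "d > 0 \<Longrightarrow> 0 \<le> gauss d x"
  by (simp add: gauss_def)

lemma borel_measurable_gauss [measurable]: "gauss d \<in> borel_measurable borel"
  unfolding gauss_def by measurable

lemma integrable_gauss: "d > 0 \<Longrightarrow> integrable lborel (gauss d :: 'e::euclidean_space \<Rightarrow> real)"
  unfolding gauss_def by (intro integrable_divide gaussian_integrable)

lemma gauss_char:
  assumes "d > 0"
  shows "(LBINT x. of_real (gauss d (x::'e::euclidean_space)) * cis (k \<bullet> x)) = of_real (exp (- d * (norm k)\<^sup>2 / 2))"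
proof -
  have "(LBINT x. of_real (gauss d (x::'e)) * cis (k \<bullet> x))
     = (LBINT x. complex_of_real (exp (- ((norm x)\<^sup>2 / (2 * d)))) * cis (k \<bullet> x) / of_real (sqrt (2 * pi * d) ^ DIM('e)))"
    by (simp add: gauss_def)
  also have "\<dots> = of_real (exp (- d * (norm k)\<^sup>2 / 2))"
    by (subst integral_divide_zero, subst gaussian_fourier[OF assms]) (use assms in simp)
  finally show ?thesis .
qed

lemma integral_gauss: "d > 0 \<Longrightarrow> (LBINT x. gauss d (x::'e::euclidean_space)) = 1"
proof -
  assume "d > 0"
  from gauss_char[OF this, of "0::'e"] have "complex_of_real (LBINT x. gauss d (x::'e)) = of_real 1"
    by (simp del: of_real_1)
  then show ?thesis by (simp only: of_real_eq_iff)
qed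

text \<open>The exponential beats the power: with \<open>t = 1 / d\<close> the expression is a power of \<open>t\<close> times a
  decaying exponential.\<close>

lemma gauss_tail_tendsto_0:
  assumes "a > 0" shows "((\<lambda>d. exp (- (a / d)) / sqrt (2 * pi * d) ^ Suc n) \<longlongrightarrow> 0) (at_right 0)"
proof (rule Lim_null_comparison)
  let ?c = "fact (Suc n) / (a ^ Suc n * sqrt (2 * pi) ^ Suc n) :: real"
  show "((\<lambda>d. ?c * sqrt d ^ Suc n) \<longlongrightarrow> 0) (at_right 0)"
  proof -
    have "((\<lambda>d. ?c * sqrt d ^ Suc n) \<longlongrightarrow> ?c * sqrt 0 ^ Suc n) (at_right 0)"
      by (intro tendsto_intros)
    then show ?thesis by simp
  qed
  show "\<forall>\<^sub>F d in at_right 0. norm (exp (- (a / d)) / sqrt (2 * pi * d) ^ Suc n) \<le> ?c * sqrt d ^ Suc n"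
    using eventually_at_right_less[of "0::real"]
  proof eventually_elim
    case (elim d)
    have "(a / d) ^ Suc n / fact (Suc n) \<le> exp (a / d)"
    proof -
      have "(\<Sum>k\<in>{Suc n}. (a / d) ^ k /\<^sub>R fact k) \<le> exp (a / d)"
        unfolding exp_def using elim assms by (intro sum_le_suminf summable_exp_generic) auto
      then have "(a / d) ^ Suc n /\<^sub>R fact (Suc n) \<le> exp (a / d)"
        by (simp only: sum.insert sum.empty finite.intros empty_iff not_False_eq_True add_0_right)
      then show ?thesis unfolding real_scaleR_def by (metis divide_inverse_commute)
    qed
    then have "exp (- (a / d)) \<le> fact (Suc n) / (a / d) ^ Suc n"
      using elim assms by (simp add: exp_minus field_simps del: power_Suc fact_Suc)
    then have "exp (- (a / d)) / sqrt (2 * pi * d) ^ Suc n \<le> (fact (Suc n) / (a / d) ^ Suc n) / sqrt (2 * pi * d) ^ Suc n"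
      using elim by (intro divide_right_mono) auto
    also have "\<dots> = fact (Suc n) * d ^ Suc n / (a ^ Suc n * sqrt (2 * pi) ^ Suc n * sqrt d ^ Suc n)"
      using elim assms by (simp add: real_sqrt_mult power_mult_distrib power_divide del: power_Suc fact_Suc)
    also have "d ^ Suc n = sqrt d ^ Suc n * sqrt d ^ Suc n"
      using elim by (simp flip: power_mult_distrib del: power_Suc)
    also have "fact (Suc n) * (sqrt d ^ Suc n * sqrt d ^ Suc n) / (a ^ Suc n * sqrt (2 * pi) ^ Suc n * sqrt d ^ Suc n) = ?c * sqrt d ^ Suc n"
      using elim assms by (simp del: power_Suc fact_Suc)
    finally show ?case using elim by simp
  qed
qed

text \<open>Near 0 the function is close to its value; away from 0 a Gaussian of variance \<open>d\<close> is at most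
  a vanishing factor (\<open>gauss_tail_tendsto_0\<close>) times a fixed Gaussian, against which the function
  is integrable.\<close>

lemma gauss_approximate_identity:
  fixes f :: "'e::euclidean_space \<Rightarrow> complex"
  assumes cont: "isCont f 0" and [measurable]: "f \<in> borel_measurable borel"
    and int: "\<And>c. c > 0 \<Longrightarrow> integrable lborel (\<lambda>x. f x * of_real (exp (- c * (norm x)\<^sup>2)))"
  shows "((\<lambda>d. LINT x|lborel. of_real (gauss d x) * f x) \<longlongrightarrow> f 0) (at_right 0)"
proof -
  define g where "g x = f x - f 0" for x
  have [measurable]: "g \<in> borel_measurable borel" unfolding g_def by measurable
  have intg: "integrable lborel (\<lambda>x. g x * of_real (exp (- c * (norm x)\<^sup>2)))" if "c > 0" for c
  proof -
    have "integrable lborel (\<lambda>x. f x * of_real (exp (- c * (norm x)\<^sup>2)) - f 0 * of_real (exp (- c * (norm x)\<^sup>2)))"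
      using gaussian_integrable'[OF that, where 'e='e]
      by (intro Bochner_Integration.integrable_diff int[OF that] integrable_mult_right integrable_of_real)
    then show ?thesis by (simp add: g_def left_diff_distrib)
  qed
  have gaussg: "integrable lborel (\<lambda>x. of_real (gauss d x) * h x)" if "d > 0"
    and "\<And>c. c > 0 \<Longrightarrow> integrable lborel (\<lambda>x. h x * of_real (exp (- c * (norm x)\<^sup>2)))" for d and h :: "'e \<Rightarrow> complex"
  proof -
    have "integrable lborel (\<lambda>x. h x * of_real (exp (- (1 / (2 * d)) * (norm x)\<^sup>2)) * of_real (1 / sqrt (2 * pi * d) ^ DIM('e)))"
      by (rule integrable_mult_left, rule that(2)) (use that(1) in simp)
    then show ?thesis by (simp add: gauss_def mult_ac)
  qed
  define K where "K = (LBINT x. norm (g x) * exp (- (1/4) * (norm x)\<^sup>2))"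
  have intK: "integrable lborel (\<lambda>x. norm (g x) * exp (- (1/4) * (norm x)\<^sup>2))"
    using integrable_norm[OF intg[of "1/4"]] by (simp add: norm_mult)
  obtain n where n: "DIM('e) = Suc n" using DIM_positive[where 'a='e] by (metis Suc_pred')
  have "((\<lambda>d. LINT x|lborel. of_real (gauss d x) * g x) \<longlongrightarrow> 0) (at_right 0)"
  proof (rule tendstoI)
    fix e :: real assume e: "e > 0"
    obtain \<eta> where \<eta>: "\<eta> > 0" "\<And>x. norm x < \<eta> \<Longrightarrow> norm (g x) < e / 2"
      using cont[unfolded continuous_at_eps_delta, rule_format, of "e/2"] e by (auto simp: g_def dist_norm)
    have "((\<lambda>d. exp (- ((\<eta>\<^sup>2/4) / d)) / sqrt (2 * pi * d) ^ Suc n * K) \<longlongrightarrow> 0 * K) (at_right 0)"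
      by (intro tendsto_mult gauss_tail_tendsto_0 tendsto_const) (use \<eta> in auto)
    then have "\<forall>\<^sub>F d in at_right 0. exp (- ((\<eta>\<^sup>2/4) / d)) / sqrt (2 * pi * d) ^ Suc n * K < e / 2"
      using e by (intro order_tendstoD) auto
    moreover have "\<forall>\<^sub>F d in at_right (0::real). d < 1"
      using eventually_at_right_real[of 0 1] by (auto elim: eventually_mono)
    ultimately show "\<forall>\<^sub>F d in at_right 0. dist (LBINT x. of_real (gauss d x) * g x) 0 < e"
      using eventually_at_right_less[of "0::real"]
    proof eventually_elim
      case (elim d)
      let ?T = "exp (- ((\<eta>\<^sup>2/4) / d)) / sqrt (2 * pi * d) ^ Suc n"
      have pt: "norm (of_real (gauss d x) * g x) \<le> gauss d x * (e/2) + ?T * (norm (g x) * exp (- (1/4) * (norm x)\<^sup>2))" for x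
      proof (cases "norm x < \<eta>")
        case True
        have "gauss d x * norm (g x) \<le> gauss d x * (e/2)"
          using \<eta>(2)[OF True] gauss_nonneg[of d x] elim by (intro mult_left_mono) auto
        moreover have "0 \<le> ?T * (norm (g x) * exp (- (1/4) * (norm x)\<^sup>2))" using elim by simp
        moreover have "norm (of_real (gauss d x) * g x) = gauss d x * norm (g x)"
          using gauss_nonneg[of d x] elim by (simp add: norm_mult)
        ultimately show ?thesis by linarith
      next
        case False
        have "(norm x)\<^sup>2 / (2 * d) = (norm x)\<^sup>2 / (4 * d) + (norm x)\<^sup>2 / (4 * d)" using elim by (simp add: field_simps)
        moreover have "\<eta>\<^sup>2 / (4 * d) \<le> (norm x)\<^sup>2 / (4 * d)" using False \<eta> elim by (intro divide_right_mono power_mono) auto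
        moreover have "(norm x)\<^sup>2 / 4 \<le> (norm x)\<^sup>2 / (4 * d)" using elim by (intro divide_left_mono) auto
        ultimately have "(\<eta>\<^sup>2/4) / d + (1/4) * (norm x)\<^sup>2 \<le> (norm x)\<^sup>2 / (2 * d)" by simp
        then have "exp (- ((norm x)\<^sup>2 / (2 * d))) \<le> exp (- ((\<eta>\<^sup>2/4) / d)) * exp (- (1/4) * (norm x)\<^sup>2)"
          by (simp flip: exp_add)
        then have "gauss d x \<le> ?T * exp (- (1/4) * (norm x)\<^sup>2)"
          unfolding gauss_def n times_divide_eq_left by (rule divide_right_mono) (use elim in simp)
        then have "gauss d x * norm (g x) \<le> ?T * exp (- (1/4) * (norm x)\<^sup>2) * norm (g x)"
          by (intro mult_right_mono) auto
        moreover have "0 \<le> gauss d x * (e/2)" using e gauss_nonneg[of d x] elim by simp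
        moreover have "norm (of_real (gauss d x) * g x) = gauss d x * norm (g x)"
          using gauss_nonneg[of d x] elim by (simp add: norm_mult)
        moreover have "?T * exp (- (1/4) * (norm x)\<^sup>2) * norm (g x) = ?T * (norm (g x) * exp (- (1/4) * (norm x)\<^sup>2))"
          by (simp only: mult_ac)
        ultimately show ?thesis by linarith
      qed
      have "norm (LBINT x. of_real (gauss d x) * g x) \<le> (LBINT x. norm (of_real (gauss d x) * g x))"
        by (rule integral_norm_bound)
      also have "\<dots> \<le> (LBINT x. gauss d x * (e/2) + ?T * (norm (g x) * exp (- (1/4) * (norm x)\<^sup>2)))"
        by (intro integral_mono integrable_norm gaussg[OF elim(3) intg] Bochner_Integration.integrable_add integrable_mult_left integrable_mult_right integrable_gauss intK pt elim)
      also have "\<dots> = (LBINT x. gauss d (x::'e) * (e/2)) + (LBINT x. ?T * (norm (g x) * exp (- (1/4) * (norm x)\<^sup>2)))"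
        by (intro Bochner_Integration.integral_add integrable_mult_left integrable_mult_right integrable_gauss intK elim)
      also have "\<dots> = e / 2 + ?T * K"
        using elim(3) by (simp only: integral_mult_left_zero integral_mult_right_zero K_def integral_gauss mult_1)
      also have "\<dots> < e" using elim(1) by linarith
      finally show ?case by simp
    qed
  qed
  then have "((\<lambda>d. (LBINT x. of_real (gauss d x) * g x) + f 0) \<longlongrightarrow> 0 + f 0) (at_right 0)"
    by (intro tendsto_add tendsto_const)
  moreover have "\<forall>\<^sub>F d in at_right 0. (LBINT x. of_real (gauss d x) * g x) + f 0 = (LBINT x. of_real (gauss d x) * f x)"
    using eventually_at_right_less[of "0::real"]
  proof eventually_elim
    case (elim d)
    have "(LBINT x. of_real (gauss d x) * f x) = (LBINT x. of_real (gauss d x) * g x + of_real (gauss d x) * f 0)"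
      by (simp add: g_def algebra_simps)
    also have "\<dots> = (LBINT x. of_real (gauss d x) * g x) + (LBINT x. of_real (gauss d (x::'e)) * f 0)"
      using elim integrable_gauss[of d, where 'e='e] by (intro Bochner_Integration.integral_add gaussg[OF elim intg]) auto
    also have "(LBINT x. complex_of_real (gauss d (x::'e)) * f 0) = f 0"
      using integral_gauss[of d, where 'e='e] elim by simp
    finally show ?case by simp
  qed
  ultimately show ?thesis unfolding add_0_left by (rule Lim_transform_eventually)
qed

section \<open>A dual description of the Fourier-Stieltjes norm\<close>

text \<open>The Fourier transforms of complex measures on \<open>\<Lambda>\<close> of total variation at most \<open>m\<close> have this
  property. The dual form, in terms of test functions \<open>\<phi>\<close> whose Fourier transform is bounded on
  \<open>\<Lambda>\<close>, replaces measures and their convolutions by estimates of integrals.\<close>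

definition FS :: "'e::euclidean_space set \<Rightarrow> real \<Rightarrow> ('e \<Rightarrow> complex) \<Rightarrow> bool" where
  "FS \<Lambda> m G \<longleftrightarrow> G \<in> borel_measurable borel \<and> (\<forall>w. norm (G w) \<le> m) \<and>
     (\<forall>\<phi> B. integrable lborel \<phi> \<longrightarrow> (\<forall>l\<in>\<Lambda>. norm (LBINT w. cis (l \<bullet> w) * \<phi> w) \<le> B) \<longrightarrow>
        norm (LBINT w. G w * \<phi> w) \<le> m * B)"

lemma FS_I:
  assumes "G \<in> borel_measurable borel" "\<And>w. norm (G w) \<le> m"
    and "\<And>\<phi> B. integrable lborel \<phi> \<Longrightarrow> (\<And>l. l \<in> \<Lambda> \<Longrightarrow> norm (LBINT w. cis (l \<bullet> w) * \<phi> w) \<le> B) \<Longrightarrow>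
        norm (LBINT w. G w * \<phi> w) \<le> m * B"
  shows "FS \<Lambda> m G"
  using assms unfolding FS_def by blast

lemma FS_measurable [measurable_dest]: "FS \<Lambda> m G \<Longrightarrow> G \<in> borel_measurable borel"
  and FS_bound: "FS \<Lambda> m G \<Longrightarrow> norm (G w) \<le> m"
  and FS_dual: "FS \<Lambda> m G \<Longrightarrow> integrable lborel \<phi> \<Longrightarrow>
     (\<And>l. l \<in> \<Lambda> \<Longrightarrow> norm (LBINT w. cis (l \<bullet> w) * \<phi> w) \<le> B) \<Longrightarrow>
     norm (LBINT w. G w * \<phi> w) \<le> m * B"
  unfolding FS_def by auto

lemma FS_nonneg: "FS \<Lambda> m G \<Longrightarrow> 0 \<le> m"
  using FS_bound[of \<Lambda> m G undefined] norm_ge_zero order_trans by blast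

lemma integrable_bounded_mult:
  fixes \<phi> G :: "'a \<Rightarrow> complex"
  assumes "integrable M \<phi>" "G \<in> borel_measurable M" "\<And>w. norm (G w) \<le> m"
  shows "integrable M (\<lambda>w. G w * \<phi> w)"
proof (rule Bochner_Integration.integrable_bound)
  show "integrable M (\<lambda>w. m * norm (\<phi> w))" using assms by auto
  show "AE x in M. norm (G x * \<phi> x) \<le> norm (m * norm (\<phi> x))"
  proof (rule AE_I2)
    fix x
    have "0 \<le> m" using assms(3)[of x] norm_ge_zero order_trans by blast
    then show "norm (G x * \<phi> x) \<le> norm (m * norm (\<phi> x))"
      using assms(3)[of x] by (simp add: norm_mult mult_right_mono)
  qed
qed (use assms in measurable)

lemma FS_integrable: "FS \<Lambda> m G \<Longrightarrow> integrable lborel \<phi> \<Longrightarrow> integrable lborel (\<lambda>w. G w * \<phi> w)"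
  by (rule integrable_bounded_mult) (auto dest: FS_measurable FS_bound)

lemma FS_cis: "l \<in> \<Lambda> \<Longrightarrow> FS \<Lambda> 1 (\<lambda>w. cis (l \<bullet> w))"
  by (rule FS_I) auto

lemma FS_mono:
  assumes "FS \<Lambda> m G" "\<Lambda> \<subseteq> \<Lambda>'" "\<Lambda>' \<noteq> {}" "m \<le> m'"
  shows "FS \<Lambda>' m' G"
proof (rule FS_I)
  fix \<phi> B assume \<phi>: "integrable lborel \<phi>" "\<And>l. l \<in> \<Lambda>' \<Longrightarrow> norm (LBINT w. cis (l \<bullet> w) * \<phi> w) \<le> B"
  then have "norm (LBINT w. G w * \<phi> w) \<le> m * B" using assms(2) by (intro FS_dual[OF assms(1)]) auto
  also have "0 \<le> B" using \<phi>(2) assms(3) norm_ge_zero order_trans by blast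
  then have "m * B \<le> m' * B" using assms by (intro mult_right_mono)
  finally show "norm (LBINT w. G w * \<phi> w) \<le> m' * B" .
qed (use assms FS_bound[OF assms(1)] in \<open>auto dest: FS_measurable intro: order_trans\<close>)

lemma FS_cmult:
  assumes "FS \<Lambda> m G" shows "FS \<Lambda> (norm c * m) (\<lambda>w. c * G w)"
proof (rule FS_I)
  fix \<phi> B assume \<phi>: "integrable lborel \<phi>" "\<And>l. l \<in> \<Lambda> \<Longrightarrow> norm (LBINT w. cis (l \<bullet> w) * \<phi> w) \<le> B"
  have "norm (LBINT w. c * G w * \<phi> w) = norm c * norm (LBINT w. G w * \<phi> w)"
    by (simp add: mult.assoc norm_mult)
  also have "\<dots> \<le> norm c * (m * B)" by (intro mult_left_mono FS_dual[OF assms \<phi>]) auto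
  finally show "norm (LBINT w. c * G w * \<phi> w) \<le> norm c * m * B" by (simp add: mult.assoc)
qed (use assms in \<open>auto dest: FS_measurable FS_bound simp: norm_mult intro!: mult_left_mono\<close>)

lemma FS_const: "0 \<in> \<Lambda> \<Longrightarrow> FS \<Lambda> (norm c) (\<lambda>w. c)"
  using FS_cmult[OF FS_cis[of 0 \<Lambda>], of c] by simp

lemma FS_add:
  assumes "FS \<Lambda> m G" "FS \<Lambda> m' G'" shows "FS \<Lambda> (m + m') (\<lambda>w. G w + G' w)"
proof (rule FS_I)
  fix \<phi> B assume \<phi>: "integrable lborel \<phi>" "\<And>l. l \<in> \<Lambda> \<Longrightarrow> norm (LBINT w. cis (l \<bullet> w) * \<phi> w) \<le> B"
  have "(LBINT w. (G w + G' w) * \<phi> w) = (LBINT w. G w * \<phi> w) + (LBINT w. G' w * \<phi> w)"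
    unfolding distrib_right by (intro Bochner_Integration.integral_add FS_integrable[OF assms(1) \<phi>(1)] FS_integrable[OF assms(2) \<phi>(1)])
  also have "norm \<dots> \<le> m * B + m' * B"
    by (intro norm_triangle_mono FS_dual[OF assms(1) \<phi>] FS_dual[OF assms(2) \<phi>])
  finally show "norm (LBINT w. (G w + G' w) * \<phi> w) \<le> (m + m') * B" by (simp add: distrib_right)
next
  note [measurable] = FS_measurable[OF assms(1)] FS_measurable[OF assms(2)]
  show "(\<lambda>w. G w + G' w) \<in> borel_measurable borel" by measurable
  show "norm (G w + G' w) \<le> m + m'" for w
    by (intro norm_triangle_mono FS_bound[OF assms(1)] FS_bound[OF assms(2)])
qed

lemma FS_sum:
  assumes "\<And>i. i \<in> I \<Longrightarrow> FS \<Lambda> (m i) (G i)" "0 \<in> \<Lambda>"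
  shows "FS \<Lambda> (\<Sum>i\<in>I. m i) (\<lambda>w. \<Sum>i\<in>I. G i w)"
  using assms(1)
proof (induction I rule: infinite_finite_induct)
  case (insert x F)
  then show ?case by (auto intro!: FS_add)
qed (use FS_const[OF assms(2), of 0] in auto)

text \<open>The dual counterpart of the inequality \<open>\<bar>\<mu> * \<nu>\<bar> \<le> \<bar>\<mu>\<bar> \<bar>\<nu>\<bar>\<close> for convolutions: absorb one
  factor into the test function and use that \<open>\<Lambda>\<close> is closed under addition.\<close>

lemma FS_mult:
  assumes "FS \<Lambda> m G" "FS \<Lambda> m' G'" and add: "\<And>k l. k \<in> \<Lambda> \<Longrightarrow> l \<in> \<Lambda> \<Longrightarrow> k + l \<in> \<Lambda>"
  shows "FS \<Lambda> (m * m') (\<lambda>w. G w * G' w)"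
proof (rule FS_I)
  fix \<phi> B assume \<phi>: "integrable lborel \<phi>" "\<And>l. l \<in> \<Lambda> \<Longrightarrow> norm (LBINT w. cis (l \<bullet> w) * \<phi> w) \<le> B"
  have "norm (LBINT w. G w * (G' w * \<phi> w)) \<le> m * (m' * B)"
  proof (rule FS_dual[OF assms(1) FS_integrable[OF assms(2) \<phi>(1)]])
    fix k assume k: "k \<in> \<Lambda>"
    have "norm (LBINT w. G' w * (cis (k \<bullet> w) * \<phi> w)) \<le> m' * B"
    proof (rule FS_dual[OF assms(2) FS_integrable[OF FS_cis[OF k] \<phi>(1)]])
      fix l assume l: "l \<in> \<Lambda>"
      have "cis (l \<bullet> w) * (cis (k \<bullet> w) * \<phi> w) = cis ((l + k) \<bullet> w) * \<phi> w" for w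
        by (simp add: inner_add_left cis_mult flip: mult.assoc)
      then show "norm (LBINT w. cis (l \<bullet> w) * (cis (k \<bullet> w) * \<phi> w)) \<le> B"
        using \<phi>(2)[OF add[OF l k]] by (simp only:)
    qed
    then show "norm (LBINT w. cis (k \<bullet> w) * (G' w * \<phi> w)) \<le> m' * B" by (simp add: mult_ac)
  qed
  then show "norm (LBINT w. G w * G' w * \<phi> w) \<le> m * m' * B" by (simp add: mult_ac)
next
  note [measurable] = FS_measurable[OF assms(1)] FS_measurable[OF assms(2)]
  show "(\<lambda>w. G w * G' w) \<in> borel_measurable borel" by measurable
  show "norm (G w * G' w) \<le> m * m'" for w unfolding norm_mult
    by (intro mult_mono FS_bound[OF assms(1)] FS_bound[OF assms(2)] FS_nonneg[OF assms(1)]) auto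
qed

lemma FS_translate:
  assumes "FS \<Lambda> m G" shows "FS \<Lambda> m (\<lambda>w. G (w - a))"
proof (rule FS_I)
  fix \<phi> B assume \<phi>: "integrable lborel \<phi>" "\<And>l. l \<in> \<Lambda> \<Longrightarrow> norm (LBINT w. cis (l \<bullet> w) * \<phi> w) \<le> B"
  have "(LBINT w. G (w - a) * \<phi> w) = (LBINT w. G w * \<phi> (a + w))"
    by (subst integral_lborel_translate(1)[symmetric, of _ a]) simp
  also have "norm \<dots> \<le> m * B"
  proof (rule FS_dual[OF assms])
    show "integrable lborel (\<lambda>w. \<phi> (a + w))" using \<phi>(1) by (simp add: integral_lborel_translate)
    fix l assume l: "l \<in> \<Lambda>"
    have "(LBINT w. cis (l \<bullet> w) * \<phi> w) = (LBINT w. cis (l \<bullet> (a + w)) * \<phi> (a + w))"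
      by (subst integral_lborel_translate(1)[symmetric, of _ a]) simp
    also have "\<dots> = (LBINT w. cis (l \<bullet> a) * (cis (l \<bullet> w) * \<phi> (a + w)))"
      by (simp add: inner_add_right cis_mult flip: mult.assoc)
    also have "norm \<dots> = norm (LBINT w. cis (l \<bullet> w) * \<phi> (a + w))"
      by (simp add: norm_mult)
    finally show "norm (LBINT w. cis (l \<bullet> w) * \<phi> (a + w)) \<le> B" using \<phi>(2)[OF l] by simp
  qed
  finally show "norm (LBINT w. G (w - a) * \<phi> w) \<le> m * B" .
next
  note [measurable] = FS_measurable[OF assms(1)]
  show "(\<lambda>w. G (w - a)) \<in> borel_measurable borel" by measurable
  show "norm (G (w - a)) \<le> m" for w by (rule FS_bound[OF assms(1)])
qed

lemma integrable_pair_bound: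
  fixes H :: "'a \<Rightarrow> 'b \<Rightarrow> complex"
  assumes "sigma_finite_measure M" "sigma_finite_measure N"
    and [measurable]: "(\<lambda>(s, w). H s w) \<in> borel_measurable (M \<Otimes>\<^sub>M N)"
    and b: "integrable M b" and \<phi>: "integrable N \<phi>"
    and bd: "\<And>s w. s \<in> space M \<Longrightarrow> w \<in> space N \<Longrightarrow> norm (H s w) \<le> b s * norm (\<phi> w :: complex)"
  shows "integrable (M \<Otimes>\<^sub>M N) (\<lambda>(s, w). H s w)"
proof -
  interpret M: sigma_finite_measure M by fact
  interpret N: sigma_finite_measure N by fact
  interpret pair_sigma_finite M N ..
  have [measurable]: "b \<in> borel_measurable M" "\<phi> \<in> borel_measurable N" using b \<phi> by auto
  have "integrable (M \<Otimes>\<^sub>M N) (\<lambda>(s, w). b s * norm (\<phi> w))"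
  proof (rule Fubini_integrable)
    show "(\<lambda>(s, w). b s * norm (\<phi> w)) \<in> borel_measurable (M \<Otimes>\<^sub>M N)" by measurable
    show "integrable M (\<lambda>x. LINT y|N. norm (case (x, y) of (s, w) \<Rightarrow> b s * norm (\<phi> w)))"
      using b by (simp add: abs_mult)
    show "AE x in M. integrable N (\<lambda>y. case (x, y) of (s, w) \<Rightarrow> b s * norm (\<phi> w))"
      using \<phi> by auto
  qed
  then show ?thesis
  proof (rule Bochner_Integration.integrable_bound)
    show "AE x in M \<Otimes>\<^sub>M N. norm (case x of (s, w) \<Rightarrow> H s w) \<le> norm (case x of (s, w) \<Rightarrow> b s * norm (\<phi> w))"
    proof (rule AE_I2)
      fix x assume "x \<in> space (M \<Otimes>\<^sub>M N)"
      then obtain s w where x: "x = (s, w)" "s \<in> space M" "w \<in> space N" by (auto simp: space_pair_measure)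
      show "norm (case x of (s, w) \<Rightarrow> H s w) \<le> norm (case x of (s, w) \<Rightarrow> b s * norm (\<phi> w))"
        using bd[OF x(2,3)] by (simp add: x(1))
    qed
  qed measurable
qed

text \<open>The form in which Fubini is used below: one variable carries an integrable weight, the other
  an integrable test function.\<close>

lemma Fubini_bound:
  fixes H :: "'a \<Rightarrow> 'b \<Rightarrow> complex"
  assumes "sigma_finite_measure M" "sigma_finite_measure N"
    and [measurable]: "(\<lambda>(s, w). H s w) \<in> borel_measurable (M \<Otimes>\<^sub>M N)"
    and b: "integrable M b" and \<phi>: "integrable N \<phi>"
    and bd: "\<And>s w. s \<in> space M \<Longrightarrow> w \<in> space N \<Longrightarrow> norm (H s w) \<le> b s * norm (\<phi> w :: complex)"
  shows "(LINT w|N. (LINT s|M. H s w)) = (LINT s|M. (LINT w|N. H s w))"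
    and "integrable M (\<lambda>s. LINT w|N. H s w)"
    and "integrable N (\<lambda>w. LINT s|M. H s w)"
proof -
  interpret M: sigma_finite_measure M by fact
  interpret N: sigma_finite_measure N by fact
  interpret pair_sigma_finite M N ..
  note I = integrable_pair_bound[OF assms]
  show "(LINT w|N. (LINT s|M. H s w)) = (LINT s|M. (LINT w|N. H s w))"
    by (rule Fubini_integral[OF I])
  show "integrable M (\<lambda>s. LINT w|N. H s w)" by (rule integrable_fst[OF I])
  show "integrable N (\<lambda>w. LINT s|M. H s w)" by (rule integrable_snd[OF I])
qed

text \<open>Fubini moves the test function inside the average.\<close>

lemma FS_average:
  assumes "sigma_finite_measure M" and b: "integrable M b"
    and [measurable]: "(\<lambda>(s, w). H s w) \<in> borel_measurable (M \<Otimes>\<^sub>M borel)"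
    and H: "\<And>s. s \<in> space M \<Longrightarrow> FS \<Lambda> (b s) (H s)"
  shows "FS \<Lambda> (LINT s|M. b s) (\<lambda>w. LINT s|M. H s w)"
proof (rule FS_I)
  interpret M: sigma_finite_measure M by fact
  interpret P: pair_sigma_finite M lborel ..
  show "(\<lambda>w. LINT s|M. H s w) \<in> borel_measurable borel" by measurable
  fix w
  have "norm (LINT s|M. H s w) \<le> (LINT s|M. norm (H s w))" by (rule integral_norm_bound)
  also have "\<dots> \<le> (LINT s|M. b s)"
    using b by (intro integral_mono' FS_bound[OF H] FS_nonneg[OF H]) auto
  finally show "norm (LINT s|M. H s w) \<le> (LINT s|M. b s)" .
next
  interpret M: sigma_finite_measure M by fact
  fix \<phi> B assume \<phi>: "integrable lborel \<phi>" "\<And>l. l \<in> \<Lambda> \<Longrightarrow> norm (LBINT w. cis (l \<bullet> w) * \<phi> w) \<le> B"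
  have [measurable]: "\<phi> \<in> borel_measurable borel" using \<phi> by auto
  have m: "(\<lambda>(s, w). H s w * \<phi> w) \<in> borel_measurable (M \<Otimes>\<^sub>M lborel)" by measurable
  have bd: "norm (H s w * \<phi> w) \<le> b s * norm (\<phi> w)" if "s \<in> space M" for s w
    using FS_bound[OF H[OF that]] by (auto simp: norm_mult intro!: mult_right_mono)
  note F = Fubini_bound[OF assms(1) lborel.sigma_finite_measure_axioms m b \<phi>(1) bd]
  have "(LBINT w. (LINT s|M. H s w) * \<phi> w) = (LBINT w. (LINT s|M. H s w * \<phi> w))" by simp
  also have "\<dots> = (LINT s|M. (LBINT w. H s w * \<phi> w))" by (rule F) auto
  also have "norm \<dots> \<le> (LINT s|M. norm (LBINT w. H s w * \<phi> w))" by (rule integral_norm_bound)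
  also have "\<dots> \<le> (LINT s|M. b s * B)"
    by (intro integral_mono integrable_norm F FS_dual[OF H \<phi>] integrable_mult_left b) auto
  finally show "norm (LBINT w. (LINT s|M. H s w) * \<phi> w) \<le> (LINT s|M. b s) * B" by simp
qed

lemma FS_power:
  assumes "FS \<Lambda> m G" "0 \<in> \<Lambda>" and add: "\<And>k l. k \<in> \<Lambda> \<Longrightarrow> l \<in> \<Lambda> \<Longrightarrow> k + l \<in> \<Lambda>"
  shows "FS \<Lambda> (m ^ n) (\<lambda>w. G w ^ n)"
proof (induction n)
  case 0 show ?case using FS_const[OF assms(2), of 1] by simp
next
  case (Suc n) show ?case using FS_mult[OF assms(1) Suc add] by simp
qed

text \<open>The partial sums of the exponential series lie in the class by \<open>FS_mult\<close>, and dominated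
  convergence passes to the limit.\<close>

lemma FS_exp:
  assumes "FS \<Lambda> m G" "0 \<in> \<Lambda>" and add: "\<And>k l. k \<in> \<Lambda> \<Longrightarrow> l \<in> \<Lambda> \<Longrightarrow> k + l \<in> \<Lambda>"
  shows "FS \<Lambda> (exp m) (\<lambda>w. exp (G w))"
proof (rule FS_I)
  note [measurable] = FS_measurable[OF assms(1)]
  show "(\<lambda>w. exp (G w)) \<in> borel_measurable borel" by measurable
  show "norm (exp (G w)) \<le> exp m" for w
    using FS_bound[OF assms(1), of w] norm_exp[of "G w"] order_trans by (metis exp_le_cancel_iff)
  fix \<phi> B assume \<phi>: "integrable lborel \<phi>" "\<And>l. l \<in> \<Lambda> \<Longrightarrow> norm (LBINT w. cis (l \<bullet> w) * \<phi> w) \<le> B"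
  have [measurable]: "\<phi> \<in> borel_measurable borel" using \<phi> by auto
  have m: "0 \<le> m" by (rule FS_nonneg[OF assms(1)])
  have B: "0 \<le> B" using \<phi>(2)[OF assms(2)] norm_ge_zero order_trans by blast
  let ?S = "\<lambda>N w. \<Sum>n<N. (1 / fact n) * G w ^ n"
  have S: "FS \<Lambda> (\<Sum>n<N. norm (1 / fact n :: complex) * m ^ n) (?S N)" for N
    by (intro FS_sum FS_cmult FS_power assms)
  have le: "(\<Sum>n<N. norm (1 / fact n :: complex) * m ^ n) \<le> exp m" for N
  proof -
    have "(\<Sum>n<N. norm (1 / fact n :: complex) * m ^ n) = (\<Sum>n<N. m ^ n /\<^sub>R fact n)"
      by (simp add: norm_divide norm_fact field_simps)
    also have "\<dots> \<le> exp m"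
      unfolding exp_def using m by (intro sum_le_suminf summable_exp_generic) auto
    finally show ?thesis .
  qed
  have "(\<lambda>N. LINT w|lborel. ?S N w * \<phi> w) \<longlonglongrightarrow> (LBINT w. exp (G w) * \<phi> w)"
  proof (rule integral_dominated_convergence[where w="\<lambda>w. exp m * norm (\<phi> w)"])
    show "AE w in lborel. (\<lambda>N. ?S N w * \<phi> w) \<longlonglongrightarrow> exp (G w) * \<phi> w"
    proof (rule AE_I2)
      fix w
      have "(\<lambda>n. G w ^ n /\<^sub>R fact n) sums exp (G w)" by (rule exp_converges)
      then have "(\<lambda>N. ?S N w) \<longlonglongrightarrow> exp (G w)"
        by (simp add: sums_def scaleR_conv_of_real divide_inverse)
      then show "(\<lambda>N. ?S N w * \<phi> w) \<longlonglongrightarrow> exp (G w) * \<phi> w" by (intro tendsto_intros)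
    qed
    show "AE w in lborel. norm (?S N w * \<phi> w) \<le> exp m * norm (\<phi> w)" for N
      using order_trans[OF FS_bound[OF S] le] by (auto simp: norm_mult intro!: mult_right_mono)
  qed (use \<phi> in auto)
  then have "(\<lambda>N. norm (LBINT w. ?S N w * \<phi> w)) \<longlonglongrightarrow> norm (LBINT w. exp (G w) * \<phi> w)"
    by (rule tendsto_norm)
  then show "norm (LBINT w. exp (G w) * \<phi> w) \<le> exp m * B"
  proof (rule LIMSEQ_le_const2, intro exI allI impI)
    fix N
    have "norm (LBINT w. ?S N w * \<phi> w) \<le> (\<Sum>n<N. norm (1 / fact n :: complex) * m ^ n) * B"
      by (rule FS_dual[OF S \<phi>])
    also have "\<dots> \<le> exp m * B" by (intro mult_right_mono le B)
    finally show "norm (LBINT w. ?S N w * \<phi> w) \<le> exp m * B" .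
  qed
qed

section \<open>Functions with Gaussian decay as test functions\<close>

inductive cpoly :: "('e::euclidean_space \<Rightarrow> complex) \<Rightarrow> bool" where
  cpoly_const: "cpoly (\<lambda>_. c)"
| cpoly_coord: "cpoly (\<lambda>w. of_real (w \<bullet> b))"
| cpoly_add: "cpoly f \<Longrightarrow> cpoly g \<Longrightarrow> cpoly (\<lambda>w. f w + g w)"
| cpoly_mult: "cpoly f \<Longrightarrow> cpoly g \<Longrightarrow> cpoly (\<lambda>w. f w * g w)"

lemma cpoly_sum: "(\<And>i. i \<in> I \<Longrightarrow> cpoly (f i)) \<Longrightarrow> cpoly (\<lambda>w. \<Sum>i\<in>I. f i w)"
  by (induction I rule: infinite_finite_induct) (auto intro: cpoly.intros)

lemma cpoly_power: "cpoly f \<Longrightarrow> cpoly (\<lambda>w. f w ^ n)"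
  by (induction n) (auto intro: cpoly.intros)

lemma cpoly_derivative:
  "cpoly f \<Longrightarrow> \<exists>f'. (\<forall>x. (f has_derivative (\<lambda>h. f' h x)) (at x)) \<and> (\<forall>h. cpoly (f' h))"
proof (induction rule: cpoly.induct)
  case (cpoly_const c)
  show ?case by (rule exI[of _ "\<lambda>h x. 0"]) (auto intro: cpoly.intros)
next
  case (cpoly_coord b)
  show ?case
    by (rule exI[of _ "\<lambda>h x. of_real (h \<bullet> b)"]) (auto intro!: cpoly.intros derivative_eq_intros)
next
  case (cpoly_add f g)
  then obtain f' g' where "\<forall>x. (f has_derivative (\<lambda>h. f' h x)) (at x)" "\<forall>h. cpoly (f' h)"
    "\<forall>x. (g has_derivative (\<lambda>h. g' h x)) (at x)" "\<forall>h. cpoly (g' h)" by auto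
  then show ?case
    by (intro exI[of _ "\<lambda>h x. f' h x + g' h x"]) (auto intro!: cpoly.intros has_derivative_add)
next
  case (cpoly_mult f g)
  then obtain f' g' where "\<forall>x. (f has_derivative (\<lambda>h. f' h x)) (at x)" "\<forall>h. cpoly (f' h)"
    "\<forall>x. (g has_derivative (\<lambda>h. g' h x)) (at x)" "\<forall>h. cpoly (g' h)" by auto
  then show ?case using cpoly_mult.hyps
    by (intro exI[of _ "\<lambda>h x. f x * g' h x + f' h x * g x"]) (auto intro!: cpoly.intros has_derivative_mult)
qed

lemma cpoly_bound: "cpoly f \<Longrightarrow> \<exists>K N. 0 \<le> K \<and> (\<forall>w. norm (f w) \<le> K * (1 + norm w) ^ N)"
proof (induction rule: cpoly.induct)
  case (cpoly_const c)
  show ?case by (rule exI[of _ "norm c"], rule exI[of _ 0]) auto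
next
  case (cpoly_coord b)
  show ?case
  proof (rule exI[of _ "norm b"], rule exI[of _ 1], intro conjI allI)
    fix w :: 'a
    have "norm (of_real (w \<bullet> b) :: complex) \<le> norm w * norm b" using Cauchy_Schwarz_ineq2[of w b] by simp
    also have "\<dots> \<le> norm b * (1 + norm w) ^ 1" by (simp add: algebra_simps)
    finally show "norm (of_real (w \<bullet> b) :: complex) \<le> norm b * (1 + norm w) ^ 1" .
  qed simp
next
  case (cpoly_add f g)
  then obtain K N K' N' where *: "0 \<le> K" "\<And>w. norm (f w) \<le> K * (1 + norm w) ^ N" "0 \<le> K'" "\<And>w. norm (g w) \<le> K' * (1 + norm w) ^ N'"
    by blast
  show ?case
  proof (rule exI[of _ "K + K'"], rule exI[of _ "N + N'"], intro conjI allI)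
    fix w
    have "norm (f w + g w) \<le> K * (1 + norm w) ^ N + K' * (1 + norm w) ^ N'"
      by (intro norm_triangle_mono *)
    also have "\<dots> \<le> K * (1 + norm w) ^ (N + N') + K' * (1 + norm w) ^ (N + N')"
      by (intro add_mono mult_left_mono power_increasing *) auto
    finally show "norm (f w + g w) \<le> (K + K') * (1 + norm w) ^ (N + N')" by (simp add: distrib_right)
  qed (use * in simp)
next
  case (cpoly_mult f g)
  then obtain K N K' N' where *: "0 \<le> K" "\<And>w. norm (f w) \<le> K * (1 + norm w) ^ N" "0 \<le> K'" "\<And>w. norm (g w) \<le> K' * (1 + norm w) ^ N'"
    by blast
  show ?case
  proof (rule exI[of _ "K * K'"], rule exI[of _ "N + N'"], intro conjI allI)
    fix w
    have "norm (f w * g w) \<le> (K * (1 + norm w) ^ N) * (K' * (1 + norm w) ^ N')"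
      unfolding norm_mult by (intro mult_mono *) (use * in auto)
    then show "norm (f w * g w) \<le> (K * K') * (1 + norm w) ^ (N + N')" by (simp add: power_add mult_ac)
  qed (use * in simp)
qed

lemma partial_eqI:
  assumes "(f has_derivative f') (at x)" shows "partial b f x = f' b"
proof -
  have g: "((\<lambda>t::real. x + t *\<^sub>R b) has_derivative (\<lambda>t. t *\<^sub>R b)) (at 0)"
    by (auto intro!: derivative_eq_intros)
  have "(f has_derivative f') (at (x + 0 *\<^sub>R b))" using assms by simp
  from has_derivative_compose[OF g this]
  have "((\<lambda>t::real. f (x + t *\<^sub>R b)) has_derivative (\<lambda>t. f' (t *\<^sub>R b))) (at 0)" .
  moreover have "linear f'" using assms has_derivative_linear by blast
  ultimately have "((\<lambda>t::real. f (x + t *\<^sub>R b)) has_vector_derivative f' b) (at 0)"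
    by (simp add: has_vector_derivative_def linear_cmul)
  then show ?thesis unfolding partial_def by (rule vector_derivative_at)
qed

text \<open>Complete the square after \<open>1 + r \<le> exp r\<close>.\<close>

lemma power_exp_quadratic_bound:
  fixes r c :: real assumes "c > 0" "r \<ge> 0"
  shows "(1 + r) ^ M * exp (- c * r\<^sup>2) \<le> exp ((real M)\<^sup>2 / (4 * c))"
proof -
  have "(1 + r) ^ M \<le> exp r ^ M" using assms by (intro power_mono exp_ge_add_one_self) auto
  also have "\<dots> = exp (M * r)" by (simp add: exp_of_nat_mult)
  finally have "(1 + r) ^ M * exp (- c * r\<^sup>2) \<le> exp (M * r) * exp (- c * r\<^sup>2)" by simp
  also have "\<dots> = exp (M * r - c * r\<^sup>2)" by (simp flip: exp_add)
  also have "M * r - c * r\<^sup>2 \<le> (real M)\<^sup>2 / (4 * c)"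
  proof -
    have "0 \<le> (real M - 2 * c * r)\<^sup>2" by simp
    then have "4 * c * (M * r - c * r\<^sup>2) \<le> (real M)\<^sup>2" by (simp add: power2_eq_square algebra_simps)
    then show ?thesis using assms by (simp add: field_simps)
  qed
  finally show ?thesis by simp
qed

text \<open>Every derivative is a polynomial times the exponential, so a real part that decays
  quadratically makes all of them rapidly decreasing.\<close>

lemma schwartz_exp_cpoly:
  assumes q: "cpoly q" and c: "c > 0" and Re: "\<And>w. Re (q w) \<le> K - c * (norm w)\<^sup>2"
  shows "schwartz (\<lambda>w. exp (q w))"
proof -
  obtain q' where q': "\<And>x. (q has_derivative (\<lambda>h. q' h x)) (at x)" "\<And>h. cpoly (q' h)"
    using cpoly_derivative[OF q] by auto
  have D: "\<exists>P'. (\<forall>x. ((\<lambda>w. P w * exp (q w)) has_derivative (\<lambda>h. P' h x * exp (q x))) (at x)) \<and> (\<forall>h. cpoly (P' h))"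
    if P: "cpoly P" for P
  proof -
    obtain P' where P': "\<And>x. (P has_derivative (\<lambda>h. P' h x)) (at x)" "\<And>h. cpoly (P' h)"
      using cpoly_derivative[OF P] by auto
    have E: "((\<lambda>w. exp (q w)) has_derivative (\<lambda>h. exp (q x) * q' h x)) (at x)" for x
    proof -
      have "(exp has_derivative (\<lambda>h. exp (q x) * h)) (at (q x))"
        using DERIV_exp[of "q x"] by (simp add: has_field_derivative_def)
      from has_derivative_compose[OF q'(1) this] show ?thesis .
    qed
    have "((\<lambda>w. P w * exp (q w)) has_derivative (\<lambda>h. (P w0 * q' h w0 + P' h w0) * exp (q w0))) (at w0)" for w0
    proof -
      have "((\<lambda>w. P w * exp (q w)) has_derivative (\<lambda>h. P w0 * (exp (q w0) * q' h w0) + P' h w0 * exp (q w0))) (at w0)"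
        by (rule has_derivative_mult[OF P'(1) E])
      then show ?thesis by (simp add: algebra_simps)
    qed
    then show ?thesis using P P' q'
      by (intro exI[of _ "\<lambda>h w. P w * q' h w + P' h w"]) (auto intro!: cpoly.intros)
  qed
  have F: "\<exists>P. cpoly P \<and> foldr partial bs (\<lambda>w. exp (q w)) = (\<lambda>w. P w * exp (q w))" for bs
  proof (induction bs)
    case Nil
    show ?case by (rule exI[of _ "\<lambda>_. 1"]) (auto intro: cpoly.intros)
  next
    case (Cons b bs)
    then obtain P where P: "cpoly P" "foldr partial bs (\<lambda>w. exp (q w)) = (\<lambda>w. P w * exp (q w))" by auto
    from D[OF P(1)] obtain P' where P': "\<And>x. ((\<lambda>w. P w * exp (q w)) has_derivative (\<lambda>h. P' h x * exp (q x))) (at x)" "\<And>h. cpoly (P' h)" by auto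
    have "partial b (\<lambda>w. P w * exp (q w)) = (\<lambda>w. P' b w * exp (q w))"
      using partial_eqI[OF P'(1)] by auto
    then show ?case using P P' by (auto intro!: exI[of _ "P' b"])
  qed
  show ?thesis unfolding schwartz_def
  proof (intro allI impI conjI)
    fix bs :: "'a list"
    obtain P where P: "cpoly P" "foldr partial bs (\<lambda>w. exp (q w)) = (\<lambda>w. P w * exp (q w))" using F by blast
    show "foldr partial bs (\<lambda>w. exp (q w)) differentiable at x" for x
      using D[OF P(1)] unfolding P(2) differentiable_def by blast
    fix n :: nat
    obtain K' N where K': "0 \<le> K'" "\<And>w. norm (P w) \<le> K' * (1 + norm w) ^ N" using cpoly_bound[OF P(1)] by auto
    show "\<exists>K. \<forall>x. (1 + norm x) ^ n * norm (foldr partial bs (\<lambda>w. exp (q w)) x) \<le> K"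
    proof (intro exI allI)
      fix x
      have "(1 + norm x) ^ n * norm (foldr partial bs (\<lambda>w. exp (q w)) x) = (1 + norm x) ^ n * (norm (P x) * exp (Re (q x)))"
        by (simp add: P(2) norm_mult)
      also have "\<dots> \<le> (1 + norm x) ^ n * ((K' * (1 + norm x) ^ N) * exp (K - c * (norm x)\<^sup>2))"
        by (intro mult_left_mono mult_mono K') (use K' Re in auto)
      also have "\<dots> = K' * exp K * ((1 + norm x) ^ (n + N) * exp (- c * (norm x)\<^sup>2))"
        by (simp add: exp_diff exp_minus power_add field_simps)
      also have "\<dots> \<le> K' * exp K * exp ((real (n + N))\<^sup>2 / (4 * c))"
        by (intro mult_left_mono power_exp_quadratic_bound c) (use K' in auto)
      finally show "(1 + norm x) ^ n * norm (foldr partial bs (\<lambda>w. exp (q w)) x) \<le> K' * exp K * exp ((real (n + N))\<^sup>2 / (4 * c))" .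
    qed
  qed
qed

section \<open>Gaussian wave packets\<close>

text \<open>The group velocity of the frequency \<open>p\<close> for the operator \<open>(\<i> / 2) (\<Sum>e. \<kappa> e \<partial>\<^sub>e\<^sup>2)\<close>. The
  signs of the weights \<open>\<kappa>\<close> distinguish fields from conjugated fields.\<close>

definition vel :: "('e::euclidean_space \<Rightarrow> real) \<Rightarrow> 'e \<Rightarrow> 'e" where
  "vel \<kappa> p = (\<Sum>e\<in>Basis. (\<kappa> e * (p \<bullet> e)) *\<^sub>R e)"

text \<open>A plane wave of frequency \<open>p\<close> acquires the phase \<open>- \<tau> symb \<kappa> p\<close> in time \<open>\<tau>\<close>.\<close>

definition symb :: "('e::euclidean_space \<Rightarrow> real) \<Rightarrow> 'e \<Rightarrow> real" where
  "symb \<kappa> p = (p \<bullet> vel \<kappa> p) / 2"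

lemma vel_inner_Basis: "e \<in> Basis \<Longrightarrow> vel \<kappa> p \<bullet> e = \<kappa> e * (p \<bullet> e)"
  unfolding vel_def by (simp add: inner_sum_left inner_Basis if_distrib sum.delta cong: if_cong)

lemma inner_vel: "q \<bullet> vel \<kappa> p = (\<Sum>e\<in>Basis. \<kappa> e * ((q \<bullet> e) * (p \<bullet> e)))"
  by (subst euclidean_inner) (auto simp: vel_inner_Basis intro!: sum.cong)

lemma inner_vel_commute: "q \<bullet> vel \<kappa> p = p \<bullet> vel \<kappa> q"
  unfolding inner_vel by (simp add: mult_ac)

lemma vel_add: "vel \<kappa> (p + q) = vel \<kappa> p + vel \<kappa> q"
  by (rule euclidean_eqI) (simp add: vel_inner_Basis inner_add_left algebra_simps)

lemma vel_scaleR: "vel \<kappa> (c *\<^sub>R p) = c *\<^sub>R vel \<kappa> p"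
  by (rule euclidean_eqI) (simp add: vel_inner_Basis algebra_simps)

lemma linear_vel: "linear (vel \<kappa>)"
  by (rule linearI) (auto simp: vel_add vel_scaleR)

lemma symb_add: "symb \<kappa> (p + q) = symb \<kappa> p + q \<bullet> vel \<kappa> p + symb \<kappa> q"
  using inner_vel_commute[of p \<kappa> q] by (simp add: symb_def vel_add inner_add_left inner_add_right)

lemma symb_eq_sum: "symb \<kappa> p = (\<Sum>e\<in>Basis. \<kappa> e * (p \<bullet> e)\<^sup>2) / 2"
  by (simp add: symb_def inner_vel power2_eq_square)

text \<open>The complex squared width, in direction \<open>e\<close>, of a Gaussian of squared width \<open>d\<close> after free
  evolution for a time \<open>\<tau>\<close>.\<close>

definition wid :: "('e \<Rightarrow> real) \<Rightarrow> real \<Rightarrow> real \<Rightarrow> 'e \<Rightarrow> complex" where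
  "wid \<kappa> d \<tau> e = of_real d + \<i> * of_real (\<kappa> e) * of_real \<tau>"

text \<open>The Gaussian of width \<open>wid\<close>. The logarithms in the exponent select a branch of the square
  roots in its normalisation that is smooth in \<open>\<tau>\<close>.\<close>

definition ker :: "('e::euclidean_space \<Rightarrow> real) \<Rightarrow> real \<Rightarrow> real \<Rightarrow> 'e \<Rightarrow> complex" where
  "ker \<kappa> d \<tau> w = exp (- ((\<Sum>e\<in>Basis. Ln (2 * pi * wid \<kappa> d \<tau> e) + of_real (w \<bullet> e) ^ 2 / wid \<kappa> d \<tau> e) / 2))"

text \<open>The free evolution of a Gaussian of squared width \<open>d\<close> centred at \<open>a\<close> and modulated by the
  frequency \<open>p\<close>.\<close>

definition packet :: "('e::euclidean_space \<Rightarrow> real) \<Rightarrow> real \<Rightarrow> 'e \<Rightarrow> 'e \<Rightarrow> real \<Rightarrow> 'e \<Rightarrow> complex" where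
  "packet \<kappa> d a p \<tau> w = cis (p \<bullet> w - \<tau> * symb \<kappa> p) * ker \<kappa> d \<tau> (w - a - \<tau> *\<^sub>R vel \<kappa> p)"

lemma Re_wid [simp]: "Re (wid \<kappa> d \<tau> e) = d" and Im_wid [simp]: "Im (wid \<kappa> d \<tau> e) = \<kappa> e * \<tau>"
  by (simp_all add: wid_def)

lemma wid_nonzero: "d > 0 \<Longrightarrow> wid \<kappa> d \<tau> e \<noteq> 0"
  by (metis Re_wid less_irrefl zero_complex.sel(1))

lemma wid_not_nonpos: "d > 0 \<Longrightarrow> 2 * complex_of_real pi * wid \<kappa> d \<tau> e \<notin> \<real>\<^sub>\<le>\<^sub>0"
  using mult_pos_pos[OF pi_gt_zero, of d] by (simp add: complex_nonpos_Reals_iff not_le)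

lemma continuous_ker:
  assumes "d > 0" shows "continuous_on UNIV (\<lambda>x. ker \<kappa> d (fst x) (snd x))"
  unfolding ker_def wid_def
  by (intro continuous_intros) (use assms wid_nonzero[OF assms, of \<kappa>] wid_not_nonpos[OF assms, of \<kappa>] in \<open>auto simp: wid_def\<close>)

lemma borel_measurable_packet [measurable (raw)]:
  assumes "d > 0" "f \<in> borel_measurable M" "g \<in> measurable M borel"
  shows "(\<lambda>x. packet \<kappa> d a p (f x) (g x)) \<in> borel_measurable M"
proof -
  have "continuous_on UNIV (\<lambda>x. packet \<kappa> d a p (fst x) (snd x))"
    unfolding packet_def
    by (intro continuous_intros continuous_on_compose2[OF continuous_ker[OF assms(1), of \<kappa>], of _ "\<lambda>x. (fst x, snd x - a - fst x *\<^sub>R vel \<kappa> p)", simplified])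
  then have "(\<lambda>x. packet \<kappa> d a p (fst x) (snd x)) \<in> borel_measurable (borel \<Otimes>\<^sub>M borel)"
    unfolding borel_prod by (rule borel_measurable_continuous_onI)
  from measurable_compose[OF measurable_Pair[OF assms(2,3)] this] show ?thesis by simp
qed

text \<open>Galilean invariance: multiplying by a plane wave shifts the frequency and the centre, at the
  price of a phase. This is why packets are the right test functions for a potential that is an
  average of plane waves.\<close>

lemma packet_modulate:
  "cis (k \<bullet> w) * packet \<kappa> d a p \<tau> w
     = cis (\<tau> * (k \<bullet> vel \<kappa> p + symb \<kappa> k)) * packet \<kappa> d (a - \<tau> *\<^sub>R vel \<kappa> k) (p + k) \<tau> w"
proof -
  have 1: "w - (a - \<tau> *\<^sub>R vel \<kappa> k) - \<tau> *\<^sub>R vel \<kappa> (p + k) = w - a - \<tau> *\<^sub>R vel \<kappa> p"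
    by (simp add: vel_add algebra_simps)
  have 2: "cis (k \<bullet> w) * cis (p \<bullet> w - \<tau> * symb \<kappa> p) = cis (\<tau> * (k \<bullet> vel \<kappa> p + symb \<kappa> k)) * cis ((p + k) \<bullet> w - \<tau> * symb \<kappa> (p + k))"
    by (simp add: cis_mult symb_add inner_add_left inner_vel_commute[of p \<kappa> k] algebra_simps)
  show ?thesis unfolding packet_def 1 mult.assoc[symmetric] 2 ..
qed

lemma norm_packet: "norm (packet \<kappa> d a p \<tau> w) = norm (ker \<kappa> d \<tau> (w - a - \<tau> *\<^sub>R vel \<kappa> p))"
  by (simp add: packet_def norm_mult)

lemma packet_0:
  assumes "d > 0" shows "packet \<kappa> d a p 0 w = cis (p \<bullet> w) * of_real (gauss d (w - a))"
proof -
  let ?x = "w - a"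
  have "ker \<kappa> d 0 ?x = exp (of_real (- ((\<Sum>e\<in>(Basis::'a set). ln (2 * pi * d) + (?x \<bullet> e)\<^sup>2 / d) / 2)))"
  proof -
    have "Ln (2 * complex_of_real pi * wid \<kappa> d 0 e) = of_real (ln (2 * pi * d))" for e
      using Ln_of_real[of "2 * pi * d"] assms by (simp add: wid_def)
    then show ?thesis by (simp add: ker_def) (simp add: wid_def)
  qed
  also have "\<dots> = of_real (exp (- ((norm ?x)\<^sup>2 / (2 * d))) * exp (- (real DIM('a) * (ln (2 * pi * d) / 2))))"
  proof -
    have "- ((\<Sum>e\<in>(Basis::'a set). ln (2 * pi * d) + (?x \<bullet> e)\<^sup>2 / d) / 2)
        = - ((norm ?x)\<^sup>2 / (2 * d)) + - (real DIM('a) * (ln (2 * pi * d) / 2))"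
      by (simp add: norm_sq_Basis sum.distrib add_divide_distrib flip: sum_divide_distrib)
    then show ?thesis by (simp only: exp_of_real exp_add)
  qed
  also have "exp (- (real DIM('a) * (ln (2 * pi * d) / 2))) = 1 / sqrt (2 * pi * d) ^ DIM('a)"
    using assms by (simp add: exp_minus exp_of_nat_mult ln_sqrt[symmetric] field_simps)
  finally show ?thesis by (simp add: packet_def gauss_def)
qed

lemma Re_power2_divide: "Re (of_real x ^ 2 / z) = x\<^sup>2 * Re z / (norm z)\<^sup>2"
  by (simp add: Re_divide cmod_power2 flip: of_real_power)

text \<open>For bounded \<open>\<tau>\<close> the real part of \<open>1 / wid\<close> stays away from 0.\<close>

lemma ker_bound:
  fixes \<kappa> :: "'e::euclidean_space \<Rightarrow> real"
  assumes d: "d > 0"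
  shows "\<exists>K c. K \<ge> 0 \<and> c > 0 \<and> (\<forall>\<tau> w. \<bar>\<tau>\<bar> \<le> T \<longrightarrow> norm (ker \<kappa> d \<tau> w) \<le> K * exp (- c * (norm w)\<^sup>2))"
proof -
  define k where "k = (\<Sum>e\<in>(Basis::'e set). \<bar>\<kappa> e\<bar>)"
  define D where "D = d\<^sup>2 + (k * T)\<^sup>2"
  define c where "c = d / (2 * D)"
  have c: "c > 0" unfolding c_def D_def using d by (intro divide_pos_pos mult_pos_pos add_pos_nonneg) auto
  have "norm (ker \<kappa> d \<tau> w) \<le> exp (- (real DIM('e) * ln (2 * pi * d) / 2)) * exp (- c * (norm w)\<^sup>2)"
    if T: "\<bar>\<tau>\<bar> \<le> T" for \<tau> w
  proof -
    have 1: "ln (2 * pi * d) \<le> Re (Ln (2 * pi * wid \<kappa> d \<tau> e))" for e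
    proof -
      have "d \<le> norm (wid \<kappa> d \<tau> e)" using complex_Re_le_cmod[of "wid \<kappa> d \<tau> e"] by simp
      then have "ln (2 * pi * d) \<le> ln (2 * pi * norm (wid \<kappa> d \<tau> e))" using d by (intro ln_mono) auto
      also have "\<dots> = Re (Ln (2 * pi * wid \<kappa> d \<tau> e))" using wid_nonzero[OF d, of \<kappa> \<tau> e] by (subst Re_Ln) (auto simp: norm_mult)
      finally show ?thesis .
    qed
    have 2: "2 * c * (w \<bullet> e)\<^sup>2 \<le> Re (of_real (w \<bullet> e) ^ 2 / wid \<kappa> d \<tau> e)" if e: "e \<in> Basis" for e
    proof -
      have "\<bar>\<kappa> e\<bar> \<le> k" unfolding k_def using e by (intro member_le_sum) auto
      then have "(\<kappa> e * \<tau>)\<^sup>2 \<le> (k * T)\<^sup>2" using T by (intro power2_le_iff_abs_le[THEN iffD2]) (auto simp: abs_mult intro!: mult_mono)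
      then have "(norm (wid \<kappa> d \<tau> e))\<^sup>2 \<le> d\<^sup>2 + (k * T)\<^sup>2" by (simp add: cmod_power2)
      then have "(w \<bullet> e)\<^sup>2 * d / (d\<^sup>2 + (k * T)\<^sup>2) \<le> (w \<bullet> e)\<^sup>2 * d / (norm (wid \<kappa> d \<tau> e))\<^sup>2"
        using d wid_nonzero[OF d, of \<kappa> \<tau> e] by (intro divide_left_mono mult_pos_pos) (auto intro: add_pos_nonneg)
      then show ?thesis unfolding D_def[symmetric] by (simp add: Re_power2_divide c_def mult_ac)
    qed
    have "real DIM('e) * ln (2 * pi * d) + 2 * c * (norm w)\<^sup>2 = (\<Sum>e\<in>(Basis::'e set). ln (2 * pi * d) + 2 * c * (w \<bullet> e)\<^sup>2)"
      by (simp add: sum.distrib norm_sq_Basis sum_distrib_left)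
    also have "\<dots> \<le> (\<Sum>e\<in>(Basis::'e set). Re (Ln (2 * pi * wid \<kappa> d \<tau> e) + of_real (w \<bullet> e) ^ 2 / wid \<kappa> d \<tau> e))"
      by (intro sum_mono) (use 1 2 in \<open>simp add: add_mono\<close>)
    finally have "- (Re (\<Sum>e\<in>(Basis::'e set). Ln (2 * pi * wid \<kappa> d \<tau> e) + of_real (w \<bullet> e) ^ 2 / wid \<kappa> d \<tau> e) / 2)
       \<le> - (real DIM('e) * ln (2 * pi * d) / 2) + - c * (norm w)\<^sup>2" by simp
    then have "exp (- (Re (\<Sum>e\<in>(Basis::'e set). Ln (2 * pi * wid \<kappa> d \<tau> e) + of_real (w \<bullet> e) ^ 2 / wid \<kappa> d \<tau> e) / 2))
       \<le> exp (- (real DIM('e) * ln (2 * pi * d) / 2) + - c * (norm w)\<^sup>2)" by (rule exp_le_cancel_iff[THEN iffD2])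
    then show ?thesis unfolding ker_def norm_exp_eq_Re exp_add by simp
  qed
  then show ?thesis using c by (intro exI[of _ "exp (- (real DIM('e) * ln (2 * pi * d) / 2))"] exI[of _ c]) auto
qed

text \<open>The logarithmic derivative of a packet in the direction \<open>e\<close>.\<close>

definition dcoef :: "('e::euclidean_space \<Rightarrow> real) \<Rightarrow> real \<Rightarrow> 'e \<Rightarrow> 'e \<Rightarrow> real \<Rightarrow> 'e \<Rightarrow> 'e \<Rightarrow> complex" where
  "dcoef \<kappa> d a p \<tau> e w = \<i> * of_real (p \<bullet> e) - of_real ((w - a - \<tau> *\<^sub>R vel \<kappa> p) \<bullet> e) / wid \<kappa> d \<tau> e"

definition schr :: "('e::euclidean_space \<Rightarrow> real) \<Rightarrow> ('e \<Rightarrow> complex) \<Rightarrow> 'e \<Rightarrow> complex" where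
  "schr \<kappa> \<phi> w = (\<i> / 2) * (\<Sum>e\<in>Basis. of_real (\<kappa> e) * partial e (partial e \<phi>) w)"

lemma packet_eq_exp:
  "packet \<kappa> d a p \<tau> w = exp (\<i> * of_real (p \<bullet> w) - \<i> * of_real \<tau> * of_real (symb \<kappa> p)
     - (\<Sum>e\<in>Basis. Ln (2 * pi * wid \<kappa> d \<tau> e)
          + (of_real ((w - a) \<bullet> e) - of_real \<tau> * of_real (\<kappa> e * (p \<bullet> e))) ^ 2 / wid \<kappa> d \<tau> e) / 2)"
proof -
  have "(\<Sum>e\<in>Basis. Ln (2 * pi * wid \<kappa> d \<tau> e) + of_real ((w - a - \<tau> *\<^sub>R vel \<kappa> p) \<bullet> e) ^ 2 / wid \<kappa> d \<tau> e)
    = (\<Sum>e\<in>Basis. Ln (2 * pi * wid \<kappa> d \<tau> e)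
          + (of_real ((w - a) \<bullet> e) - of_real \<tau> * of_real (\<kappa> e * (p \<bullet> e))) ^ 2 / wid \<kappa> d \<tau> e)"
    by (intro sum.cong refl) (simp add: inner_diff_left vel_inner_Basis)
  then show ?thesis unfolding packet_def ker_def cis_conv_exp exp_add[symmetric]
    by (simp add: algebra_simps)
qed

lemma packet_directional:
  fixes e :: "'e::euclidean_space"
  assumes d: "d > 0" and e: "e \<in> Basis"
  shows "((\<lambda>t. packet \<kappa> d a p \<tau> (w + t *\<^sub>R e)) has_vector_derivative dcoef \<kappa> d a p \<tau> e w * packet \<kappa> d a p \<tau> w) (at 0)"
proof -
  let ?X = "\<lambda>b. complex_of_real ((w - a) \<bullet> b) - of_real \<tau> * of_real (\<kappa> b * (p \<bullet> b))"
  let ?f = "\<lambda>z. exp (\<i> * (of_real (p \<bullet> w) + z * of_real (p \<bullet> e)) - \<i> * of_real \<tau> * of_real (symb \<kappa> p)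
     - (\<Sum>b\<in>Basis. Ln (2 * pi * wid \<kappa> d \<tau> b) + (?X b + z * of_real (e \<bullet> b)) ^ 2 / wid \<kappa> d \<tau> b) / 2)"
  have eq: "packet \<kappa> d a p \<tau> (w + t *\<^sub>R e) = ?f (of_real t)" for t
    unfolding packet_eq_exp by (simp add: inner_add_left inner_add_right inner_diff_left algebra_simps)
  have "(?f has_field_derivative ?f 0 * (\<i> * of_real (p \<bullet> e)
     - (\<Sum>b\<in>Basis. 2 * ?X b * of_real (e \<bullet> b) / wid \<kappa> d \<tau> b) / 2)) (at (of_real 0))"
    by (auto intro!: derivative_eq_intros DERIV_sum sum.cong simp: wid_nonzero[OF d])
  then have D: "((\<lambda>t. ?f (of_real t)) has_vector_derivative ?f 0 * (\<i> * of_real (p \<bullet> e)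
     - (\<Sum>b\<in>Basis. 2 * ?X b * of_real (e \<bullet> b) / wid \<kappa> d \<tau> b) / 2)) (at 0)"
    by (rule has_vector_derivative_real_field)
  have S: "(\<Sum>b\<in>Basis. 2 * ?X b * of_real (e \<bullet> b) / wid \<kappa> d \<tau> b) = 2 * (?X e / wid \<kappa> d \<tau> e)"
  proof -
    have "(\<Sum>b\<in>Basis. 2 * ?X b * of_real (e \<bullet> b) / wid \<kappa> d \<tau> b) = (\<Sum>b\<in>Basis. if b = e then 2 * (?X e / wid \<kappa> d \<tau> e) else 0)"
      using e by (intro sum.cong refl) (auto simp: inner_Basis)
    then show ?thesis using e by simp
  qed
  have X: "?X e = of_real ((w - a - \<tau> *\<^sub>R vel \<kappa> p) \<bullet> e)"
    using e by (simp add: inner_diff_left vel_inner_Basis)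
  have F: "?f 0 = packet \<kappa> d a p \<tau> w" using eq[of 0] by simp
  have V: "?f 0 * (\<i> * of_real (p \<bullet> e) - (\<Sum>b\<in>Basis. 2 * ?X b * of_real (e \<bullet> b) / wid \<kappa> d \<tau> b) / 2)
    = dcoef \<kappa> d a p \<tau> e w * packet \<kappa> d a p \<tau> w"
    unfolding S F unfolding X dcoef_def by (simp add: mult.commute)
  show ?thesis using D unfolding V by (simp only: eq)
qed

lemma dcoef_directional:
  fixes e :: "'e::euclidean_space"
  assumes e: "e \<in> Basis"
  shows "((\<lambda>t. dcoef \<kappa> d a p \<tau> e (w + t *\<^sub>R e)) has_vector_derivative - 1 / wid \<kappa> d \<tau> e) (at 0)"
proof -
  have eq: "dcoef \<kappa> d a p \<tau> e (w + t *\<^sub>R e) = dcoef \<kappa> d a p \<tau> e w + t *\<^sub>R (- 1 / wid \<kappa> d \<tau> e)" for t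
    using e by (simp add: dcoef_def inner_add_left inner_diff_left scaleR_conv_of_real diff_divide_distrib add_divide_distrib)
  show ?thesis unfolding eq by (auto intro!: derivative_eq_intros)
qed

lemma packet_directional2:
  fixes e :: "'e::euclidean_space"
  assumes d: "d > 0" and e: "e \<in> Basis"
  shows "((\<lambda>t. dcoef \<kappa> d a p \<tau> e (w + t *\<^sub>R e) * packet \<kappa> d a p \<tau> (w + t *\<^sub>R e)) has_vector_derivative
     ((dcoef \<kappa> d a p \<tau> e w)\<^sup>2 - 1 / wid \<kappa> d \<tau> e) * packet \<kappa> d a p \<tau> w) (at 0)"
  using has_vector_derivative_mult[OF dcoef_directional[OF e, of \<kappa> d a p \<tau> w] packet_directional[OF d e, of \<kappa> a p \<tau> w]]
  by (simp add: algebra_simps power2_eq_square)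

text \<open>An explicit formula for both \<open>schr \<kappa> (packet \<dots>)\<close> and the time derivative of the packet; the
  equality of the two is the free equation.\<close>

definition packet' :: "('e::euclidean_space \<Rightarrow> real) \<Rightarrow> real \<Rightarrow> 'e \<Rightarrow> 'e \<Rightarrow> real \<Rightarrow> 'e \<Rightarrow> complex" where
  "packet' \<kappa> d a p \<tau> w = (\<i> / 2) * (\<Sum>e\<in>Basis. of_real (\<kappa> e) *
     (((dcoef \<kappa> d a p \<tau> e w)\<^sup>2 - 1 / wid \<kappa> d \<tau> e) * packet \<kappa> d a p \<tau> w))"

lemma schr_packet:
  assumes d: "d > 0" shows "schr \<kappa> (packet \<kappa> d a p \<tau>) = packet' \<kappa> d a p \<tau>"
proof
  fix w
  have 1: "partial e (packet \<kappa> d a p \<tau>) = (\<lambda>w. dcoef \<kappa> d a p \<tau> e w * packet \<kappa> d a p \<tau> w)" if "e \<in> Basis" for e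
    unfolding partial_def by (rule ext, rule vector_derivative_at) (rule packet_directional[OF d that])
  have "partial e (partial e (packet \<kappa> d a p \<tau>)) w = ((dcoef \<kappa> d a p \<tau> e w)\<^sup>2 - 1 / wid \<kappa> d \<tau> e) * packet \<kappa> d a p \<tau> w"
    if "e \<in> Basis" for e
    unfolding 1[OF that] unfolding partial_def by (rule vector_derivative_at) (rule packet_directional2[OF d that])
  then show "schr \<kappa> (packet \<kappa> d a p \<tau>) w = packet' \<kappa> d a p \<tau> w"
    unfolding schr_def packet'_def by simp
qed

lemma packet_time_derivative:
  fixes a :: "'e::euclidean_space"
  assumes d: "d > 0"
  shows "((\<lambda>\<tau>. packet \<kappa> d a p \<tau> w) has_vector_derivative packet' \<kappa> d a p \<tau> w) (at \<tau>)"
proof -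
  let ?W = "\<lambda>e z. of_real d + \<i> * of_real (\<kappa> e) * z"
  let ?X = "\<lambda>e z. complex_of_real ((w - a) \<bullet> e) - z * of_real (\<kappa> e * (p \<bullet> e))"
  let ?f = "\<lambda>z. exp (\<i> * of_real (p \<bullet> w) - \<i> * z * of_real (symb \<kappa> p)
     - (\<Sum>e\<in>Basis. Ln (2 * pi * ?W e z) + (?X e z) ^ 2 / ?W e z) / 2)"
  have eq: "packet \<kappa> d a p t w = ?f (of_real t)" for t
    unfolding packet_eq_exp wid_def ..
  have W: "?W e (of_real \<tau>) \<noteq> 0" "2 * pi * ?W e (of_real \<tau>) \<notin> \<real>\<^sub>\<le>\<^sub>0" for e
    using wid_nonzero[OF d, of \<kappa> \<tau> e] wid_not_nonpos[OF d, of \<kappa> \<tau> e] by (auto simp: wid_def)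
  have D: "((\<lambda>z. Ln (2 * pi * ?W e z) + (?X e z) ^ 2 / ?W e z) has_field_derivative
      (\<i> * \<kappa> e / ?W e \<tau> + (- 2 * ?X e \<tau> * of_real (\<kappa> e * (p \<bullet> e)) / ?W e \<tau> - (?X e \<tau>)\<^sup>2 * (\<i> * \<kappa> e) / (?W e \<tau>)\<^sup>2))) (at (of_real \<tau>))" for e
  proof (rule DERIV_add)
    show "((\<lambda>z. Ln (2 * pi * ?W e z)) has_field_derivative \<i> * \<kappa> e / ?W e \<tau>) (at (of_real \<tau>))"
    proof -
      have "((\<lambda>z. 2 * pi * ?W e z) has_field_derivative 2 * pi * (\<i> * \<kappa> e)) (at (of_real \<tau>))"
        by (auto intro!: derivative_eq_intros)
      from DERIV_chain2[OF has_field_derivative_Ln[OF W(2)] this]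
      have L: "((\<lambda>z. Ln (2 * pi * ?W e z)) has_field_derivative inverse (2 * pi * ?W e \<tau>) * (2 * pi * (\<i> * \<kappa> e))) (at (of_real \<tau>))" .
      have "inverse (2 * pi * V) * (2 * pi * (\<i> * \<kappa> e)) = \<i> * \<kappa> e / V" if "V \<noteq> 0" for V :: complex
        using that by (simp add: field_simps)
      from DERIV_cong[OF L this[OF W(1)]] show ?thesis .
    qed
    show "((\<lambda>z. (?X e z) ^ 2 / ?W e z) has_field_derivative
       - 2 * ?X e \<tau> * of_real (\<kappa> e * (p \<bullet> e)) / ?W e \<tau> - (?X e \<tau>)\<^sup>2 * (\<i> * \<kappa> e) / (?W e \<tau>)\<^sup>2) (at (of_real \<tau>))"
      using W[of e] by (auto intro!: derivative_eq_intros simp: divide_simps) (simp add: algebra_simps power2_eq_square)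
  qed
  have "(?f has_field_derivative ?f (of_real \<tau>) * (- (\<i> * of_real (symb \<kappa> p))
     - (\<Sum>e\<in>Basis. (\<i> * \<kappa> e / ?W e \<tau> + (- 2 * ?X e \<tau> * of_real (\<kappa> e * (p \<bullet> e)) / ?W e \<tau> - (?X e \<tau>)\<^sup>2 * (\<i> * \<kappa> e) / (?W e \<tau>)\<^sup>2))) / 2)) (at (of_real \<tau>))"
    by (rule derivative_eq_intros DERIV_sum D refl | simp)+
  then have "((\<lambda>t. ?f (of_real t)) has_vector_derivative ?f (of_real \<tau>) * (- (\<i> * of_real (symb \<kappa> p))
     - (\<Sum>e\<in>Basis. (\<i> * \<kappa> e / ?W e \<tau> + (- 2 * ?X e \<tau> * of_real (\<kappa> e * (p \<bullet> e)) / ?W e \<tau> - (?X e \<tau>)\<^sup>2 * (\<i> * \<kappa> e) / (?W e \<tau>)\<^sup>2))) / 2)) (at \<tau>)"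
    by (rule has_vector_derivative_real_field)
  then have *: "((\<lambda>t. packet \<kappa> d a p t w) has_vector_derivative packet \<kappa> d a p \<tau> w * (- (\<i> * of_real (symb \<kappa> p))
     - (\<Sum>e\<in>Basis. (\<i> * \<kappa> e / ?W e \<tau> + (- 2 * ?X e \<tau> * of_real (\<kappa> e * (p \<bullet> e)) / ?W e \<tau> - (?X e \<tau>)\<^sup>2 * (\<i> * \<kappa> e) / (?W e \<tau>)\<^sup>2))) / 2)) (at \<tau>)"
    unfolding eq .
  have s: "of_real (symb \<kappa> p) = (\<Sum>e\<in>Basis. complex_of_real (\<kappa> e * (p \<bullet> e)\<^sup>2) / 2)"
    by (simp add: symb_eq_sum sum_divide_distrib)
  have coef_eq: "- (\<i> * (complex_of_real (\<kappa> e * (p \<bullet> e)\<^sup>2) / 2)) - (\<i> * \<kappa> e / ?W e \<tau> + (- 2 * ?X e \<tau> * of_real (\<kappa> e * (p \<bullet> e)) / ?W e \<tau> - (?X e \<tau>)\<^sup>2 * (\<i> * \<kappa> e) / (?W e \<tau>)\<^sup>2)) / 2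
    = (\<i> / 2) * (of_real (\<kappa> e) * ((dcoef \<kappa> d a p \<tau> e w)\<^sup>2 - 1 / wid \<kappa> d \<tau> e))" if e: "e \<in> Basis" for e
  proof -
    have X: "of_real ((w - a - \<tau> *\<^sub>R vel \<kappa> p) \<bullet> e) = ?X e \<tau>"
      using e by (simp add: inner_diff_left vel_inner_Basis)
    have i: "\<i> * (\<i> * z) = - z" for z by (simp flip: mult.assoc)
    define X W where "X = ?X e \<tau>" and "W = ?W e \<tau>"
    show ?thesis unfolding dcoef_def X unfolding wid_def X_def[symmetric] W_def[symmetric]
      using W(1)[of e] unfolding W_def[symmetric]
      by (simp add: field_simps power2_eq_square i)
  qed
  have "- (\<i> * of_real (symb \<kappa> p))
     - (\<Sum>e\<in>Basis. (\<i> * \<kappa> e / ?W e \<tau> + (- 2 * ?X e \<tau> * of_real (\<kappa> e * (p \<bullet> e)) / ?W e \<tau> - (?X e \<tau>)\<^sup>2 * (\<i> * \<kappa> e) / (?W e \<tau>)\<^sup>2))) / 2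
    = (\<Sum>e\<in>Basis. - (\<i> * (complex_of_real (\<kappa> e * (p \<bullet> e)\<^sup>2) / 2)) - (\<i> * \<kappa> e / ?W e \<tau> + (- 2 * ?X e \<tau> * of_real (\<kappa> e * (p \<bullet> e)) / ?W e \<tau> - (?X e \<tau>)\<^sup>2 * (\<i> * \<kappa> e) / (?W e \<tau>)\<^sup>2)) / 2)"
    unfolding s sum_subtractf sum_negf sum_distrib_left sum_divide_distrib ..
  also have "\<dots> = (\<Sum>e\<in>Basis. (\<i> / 2) * (of_real (\<kappa> e) * ((dcoef \<kappa> d a p \<tau> e w)\<^sup>2 - 1 / wid \<kappa> d \<tau> e)))"
    by (intro sum.cong refl coef_eq)
  finally have "packet \<kappa> d a p \<tau> w * (- (\<i> * of_real (symb \<kappa> p))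
     - (\<Sum>e\<in>Basis. (\<i> * \<kappa> e / ?W e \<tau> + (- 2 * ?X e \<tau> * of_real (\<kappa> e * (p \<bullet> e)) / ?W e \<tau> - (?X e \<tau>)\<^sup>2 * (\<i> * \<kappa> e) / (?W e \<tau>)\<^sup>2))) / 2)
    = packet' \<kappa> d a p \<tau> w"
    by (simp add: packet'_def sum_distrib_left mult_ac)
  with * show ?thesis by simp
qed

lemma cpoly_packet_exponent:
  "cpoly (\<lambda>w. \<i> * of_real (p \<bullet> w) - \<i> * of_real \<tau> * of_real (symb \<kappa> p)
     - (\<Sum>e\<in>Basis. Ln (2 * pi * wid \<kappa> d \<tau> e)
          + (of_real ((w - a) \<bullet> e) - of_real \<tau> * of_real (\<kappa> e * (p \<bullet> e))) ^ 2 / wid \<kappa> d \<tau> e) / 2)"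
proof -
  have "cpoly (\<lambda>w. (\<i> * of_real (w \<bullet> p) + (- \<i> * of_real \<tau> * of_real (symb \<kappa> p)))
     + (- 1 / 2) * (\<Sum>e\<in>Basis. Ln (2 * pi * wid \<kappa> d \<tau> e)
          + (of_real (w \<bullet> e) + (- of_real (a \<bullet> e) - of_real \<tau> * of_real (\<kappa> e * (p \<bullet> e)))) ^ 2 * (1 / wid \<kappa> d \<tau> e)))"
    by (intro cpoly_add cpoly_mult cpoly_sum cpoly_power cpoly_const cpoly_coord)
  then show ?thesis by (rule back_subst[of cpoly]) (auto simp: inner_diff_left inner_commute algebra_simps)
qed

text \<open>A Gaussian bound that is uniform on bounded time intervals, so that packets at different
  times have a common dominating function.\<close>

lemma packet_decay:
  fixes a :: "'e::euclidean_space"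
  assumes d: "d > 0"
  shows "\<exists>K c. K \<ge> 0 \<and> c > 0 \<and> (\<forall>\<tau> w. \<bar>\<tau>\<bar> \<le> T \<longrightarrow> norm (packet \<kappa> d a p \<tau> w) \<le> K * exp (- c * (norm w)\<^sup>2))"
proof -
  obtain K c where K: "K \<ge> 0" "c > 0" "\<And>\<tau> w. \<bar>\<tau>\<bar> \<le> T \<Longrightarrow> norm (ker \<kappa> d \<tau> w) \<le> K * exp (- c * (norm w)\<^sup>2)"
    using ker_bound[OF d, of T \<kappa>] by blast
  define R where "R = norm a + T * norm (vel \<kappa> p)"
  have "norm (packet \<kappa> d a p \<tau> w) \<le> (K * exp (c * R\<^sup>2)) * exp (- (c / 2) * (norm w)\<^sup>2)" if T: "\<bar>\<tau>\<bar> \<le> T" for \<tau> w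
  proof -
    let ?b = "a + \<tau> *\<^sub>R vel \<kappa> p"
    have "norm ?b \<le> R" unfolding R_def using T by (intro norm_triangle_mono) (auto intro!: mult_right_mono)
    then have b: "(norm ?b)\<^sup>2 \<le> R\<^sup>2" by (intro power_mono) auto
    have "norm w \<le> norm (w - ?b) + norm ?b" using norm_triangle_sub[of w ?b] by simp
    then have "(norm w)\<^sup>2 \<le> (norm (w - ?b) + norm ?b)\<^sup>2" by (intro power_mono) auto
    also have "\<dots> \<le> 2 * (norm (w - ?b))\<^sup>2 + 2 * (norm ?b)\<^sup>2" using sum_squares_bound[of "norm (w - ?b)" "norm ?b"] by (simp add: power2_sum)
    finally have "(norm w)\<^sup>2 / 2 \<le> (norm (w - ?b))\<^sup>2 + R\<^sup>2" using b by simp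
    then have "c * ((norm w)\<^sup>2 / 2) \<le> c * ((norm (w - ?b))\<^sup>2 + R\<^sup>2)" using K by (intro mult_left_mono) auto
    then have "exp (- c * (norm (w - ?b))\<^sup>2) \<le> exp (c * R\<^sup>2) * exp (- (c / 2) * (norm w)\<^sup>2)"
      by (simp add: algebra_simps flip: exp_add)
    then have "K * exp (- c * (norm (w - ?b))\<^sup>2) \<le> K * (exp (c * R\<^sup>2) * exp (- (c / 2) * (norm w)\<^sup>2))"
      using K by (intro mult_left_mono) auto
    moreover have "norm (packet \<kappa> d a p \<tau> w) \<le> K * exp (- c * (norm (w - ?b))\<^sup>2)"
      unfolding norm_packet using K(3)[OF T, of "w - a - \<tau> *\<^sub>R vel \<kappa> p"] by (simp add: algebra_simps)
    ultimately show ?thesis by (simp add: mult.assoc)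
  qed
  then show ?thesis using K by (intro exI[of _ "K * exp (c * R\<^sup>2)"] exI[of _ "c / 2"]) auto
qed

lemma dcoef_bound:
  fixes a :: "'e::euclidean_space"
  assumes d: "d > 0"
  shows "\<exists>A\<ge>0. \<forall>\<tau> w. \<forall>e\<in>Basis. \<bar>\<tau>\<bar> \<le> T \<longrightarrow> norm (dcoef \<kappa> d a p \<tau> e w) \<le> A * (1 + norm w)"
proof -
  define R where "R = norm a + T * norm (vel \<kappa> p)"
  have "norm (dcoef \<kappa> d a p \<tau> e w) \<le> (norm p + (1 + \<bar>R\<bar>) / d) * (1 + norm w)" if e: "e \<in> Basis" and T: "\<bar>\<tau>\<bar> \<le> T" for \<tau> w e
  proof -
    have "norm (w - a - \<tau> *\<^sub>R vel \<kappa> p) \<le> norm w + norm a + norm (\<tau> *\<^sub>R vel \<kappa> p)"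
      by (meson add_right_mono norm_triangle_ineq4 order_trans)
    also have "norm (\<tau> *\<^sub>R vel \<kappa> p) \<le> T * norm (vel \<kappa> p)" using T by (auto intro!: mult_right_mono)
    finally have 1: "norm (w - a - \<tau> *\<^sub>R vel \<kappa> p) \<le> norm w + R" by (simp add: R_def)
    have 2: "\<bar>(w - a - \<tau> *\<^sub>R vel \<kappa> p) \<bullet> e\<bar> \<le> norm w + \<bar>R\<bar>" using Basis_le_norm[OF e, of "w - a - \<tau> *\<^sub>R vel \<kappa> p"] 1 by linarith
    have 3: "d \<le> norm (wid \<kappa> d \<tau> e)" using complex_Re_le_cmod[of "wid \<kappa> d \<tau> e"] by simp
    have "norm (dcoef \<kappa> d a p \<tau> e w) \<le> norm (\<i> * of_real (p \<bullet> e)) + norm (of_real ((w - a - \<tau> *\<^sub>R vel \<kappa> p) \<bullet> e) / wid \<kappa> d \<tau> e)"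
      unfolding dcoef_def by (rule norm_triangle_ineq4)
    also have "\<dots> \<le> norm p + (norm w + \<bar>R\<bar>) / d"
      using Basis_le_norm[OF e, of p] 2 3 d by (intro add_mono) (auto simp: norm_mult norm_divide intro!: frac_le)
    also have "\<dots> \<le> (norm p + (1 + \<bar>R\<bar>) / d) * (1 + norm w)"
    proof -
      have "(norm w + \<bar>R\<bar>) / d \<le> ((1 + \<bar>R\<bar>) * (1 + norm w)) / d" using d by (intro divide_right_mono) (auto simp: algebra_simps)
      moreover have "norm p \<le> norm p * (1 + norm w)" by (simp add: algebra_simps)
      moreover have "(norm p + (1 + \<bar>R\<bar>) / d) * (1 + norm w) = norm p * (1 + norm w) + ((1 + \<bar>R\<bar>) * (1 + norm w)) / d"
        by (simp add: distrib_right)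
      ultimately show ?thesis by linarith
    qed
    finally show ?thesis .
  qed
  then show ?thesis using d by (intro exI[of _ "norm p + (1 + \<bar>R\<bar>) / d"]) auto
qed

lemma integrable_of_decay:
  fixes f :: "'e::euclidean_space \<Rightarrow> complex"
  assumes "f \<in> borel_measurable borel" "c > 0" "\<And>w. norm (f w) \<le> K * exp (- c * (norm w)\<^sup>2)"
  shows "integrable lborel f"
proof (rule Bochner_Integration.integrable_bound)
  show "integrable lborel (\<lambda>w::'e. K * exp (- c * (norm w)\<^sup>2))"
    using assms by (intro integrable_mult_right gaussian_integrable')
  show "AE w in lborel. norm (f w) \<le> norm (K * exp (- c * (norm w)\<^sup>2))"
    using assms(3) by (auto intro!: AE_I2 order_trans[OF assms(3)])
qed (use assms in auto)

lemma packet_dominated: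
  fixes a :: "'e::euclidean_space"
  assumes d: "d > 0"
  shows "\<exists>K c. K \<ge> 0 \<and> c > 0 \<and> (\<forall>\<tau> w. \<bar>\<tau>\<bar> \<le> T \<longrightarrow>
     norm (packet \<kappa> d a p \<tau> w) \<le> K * exp (- c * (norm w)\<^sup>2) \<and>
     norm (packet' \<kappa> d a p \<tau> w) \<le> K * exp (- c * (norm w)\<^sup>2) \<and>
     (\<forall>e\<in>Basis. norm (dcoef \<kappa> d a p \<tau> e w * packet \<kappa> d a p \<tau> w) \<le> K * exp (- c * (norm w)\<^sup>2) \<and>
      norm (((dcoef \<kappa> d a p \<tau> e w)\<^sup>2 - 1 / wid \<kappa> d \<tau> e) * packet \<kappa> d a p \<tau> w) \<le> K * exp (- c * (norm w)\<^sup>2)))"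
proof -
  obtain K0 c0 where K0: "K0 \<ge> 0" "c0 > 0" "\<And>\<tau> w. \<bar>\<tau>\<bar> \<le> T \<Longrightarrow> norm (packet \<kappa> d a p \<tau> w) \<le> K0 * exp (- c0 * (norm w)\<^sup>2)"
    using packet_decay[OF d, of T \<kappa> a p] by blast
  obtain A where A: "A \<ge> 0" "\<And>\<tau> w e. e \<in> Basis \<Longrightarrow> \<bar>\<tau>\<bar> \<le> T \<Longrightarrow> norm (dcoef \<kappa> d a p \<tau> e w) \<le> A * (1 + norm w)"
    using dcoef_bound[OF d, of T \<kappa> a p] by blast
  define c where "c = c0 / 2"
  define E where "E w = exp (- c * (norm w)\<^sup>2)" for w :: 'e
  define G where "G = exp (1 / c)"
  define S where "S = (\<Sum>e\<in>(Basis::'e set). \<bar>\<kappa> e\<bar>)"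
  define H where "H = 1 + A + A\<^sup>2 + 1 / d"
  define K where "K = (K0 * G) * H * (1 + S)"
  have c: "c > 0" using K0 by (simp add: c_def)
  have nn: "0 \<le> S" "0 \<le> G" "0 \<le> H" "0 \<le> K0 * G" "1 \<le> H" "A \<le> H" "A\<^sup>2 + 1/d \<le> H"
    unfolding S_def G_def H_def using A d K0 by (auto intro!: sum_nonneg add_nonneg_nonneg)
  have E: "0 \<le> E w" for w by (simp add: E_def)
  have base: "(1 + norm w)\<^sup>2 * norm (packet \<kappa> d a p \<tau> w) \<le> K0 * G * E w" if "\<bar>\<tau>\<bar> \<le> T" for \<tau> w
  proof -
    have "exp (- c0 * (norm w)\<^sup>2) = exp (- c * (norm w)\<^sup>2) * E w" by (simp add: E_def c_def field_simps flip: exp_add)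
    then have "(1 + norm w)\<^sup>2 * norm (packet \<kappa> d a p \<tau> w) \<le> (1 + norm w)\<^sup>2 * (K0 * (exp (- c * (norm w)\<^sup>2) * E w))"
      using K0(3)[OF that, of w] by (intro mult_left_mono) auto
    also have "\<dots> = K0 * ((1 + norm w)\<^sup>2 * exp (- c * (norm w)\<^sup>2)) * E w" by (simp add: mult_ac)
    also have "\<dots> \<le> K0 * exp ((real 2)\<^sup>2 / (4 * c)) * E w"
      by (intro mult_right_mono mult_left_mono power_exp_quadratic_bound c K0 E) auto
    finally show ?thesis by (simp add: G_def)
  qed
  have up: "x \<le> K * E w" if "x \<le> (H * (1 + S)) * ((1 + norm w)\<^sup>2 * norm (packet \<kappa> d a p \<tau> w))" "\<bar>\<tau>\<bar> \<le> T" for x w \<tau>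
  proof -
    have "x \<le> (H * (1 + S)) * (K0 * G * E w)"
      using order_trans[OF that(1) mult_left_mono[OF base[OF that(2)]]] nn by simp
    then show ?thesis by (simp add: K_def mult_ac)
  qed
  have one: "1 \<le> (1 + norm w)\<^sup>2" and one': "1 + norm w \<le> (1 + norm w)\<^sup>2" for w :: 'e
    by (auto simp: power2_eq_square algebra_simps)
  have S1: "H \<le> H * (1 + S)" using nn by (simp add: algebra_simps)
  have "norm (packet \<kappa> d a p \<tau> w) \<le> K * E w \<and> norm (packet' \<kappa> d a p \<tau> w) \<le> K * E w \<and>
     (\<forall>e\<in>Basis. norm (dcoef \<kappa> d a p \<tau> e w * packet \<kappa> d a p \<tau> w) \<le> K * E w \<and>
      norm (((dcoef \<kappa> d a p \<tau> e w)\<^sup>2 - 1 / wid \<kappa> d \<tau> e) * packet \<kappa> d a p \<tau> w) \<le> K * E w)" if T: "\<bar>\<tau>\<bar> \<le> T" for \<tau> w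
  proof -
    let ?P = "norm (packet \<kappa> d a p \<tau> w)"
    have 1: "?P \<le> (H * (1 + S)) * ((1 + norm w)\<^sup>2 * ?P)"
    proof -
      have "1 * 1 \<le> (H * (1 + S)) * (1 + norm w)\<^sup>2" using nn order_trans[OF nn(5) S1] one[of w] by (intro mult_mono) auto
      then have "1 * ?P \<le> (H * (1 + S)) * (1 + norm w)\<^sup>2 * ?P" by (intro mult_right_mono) auto
      then show ?thesis by (simp add: mult.assoc)
    qed
    have 2: "norm (dcoef \<kappa> d a p \<tau> e w * packet \<kappa> d a p \<tau> w) \<le> (H * (1 + S)) * ((1 + norm w)\<^sup>2 * ?P)" if e: "e \<in> Basis" for e
    proof -
      have "norm (dcoef \<kappa> d a p \<tau> e w) \<le> A * (1 + norm w)" by (rule A(2)[OF e T])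
      also have "\<dots> \<le> (H * (1 + S)) * (1 + norm w)\<^sup>2" using nn order_trans[OF nn(6) S1] one'[of w] A by (intro mult_mono) auto
      finally have "norm (dcoef \<kappa> d a p \<tau> e w) * ?P \<le> (H * (1 + S)) * (1 + norm w)\<^sup>2 * ?P" by (intro mult_right_mono) auto
      then show ?thesis by (simp add: norm_mult mult.assoc)
    qed
    have 3: "norm (((dcoef \<kappa> d a p \<tau> e w)\<^sup>2 - 1 / wid \<kappa> d \<tau> e) * packet \<kappa> d a p \<tau> w) \<le> H * ((1 + norm w)\<^sup>2 * ?P)" if e: "e \<in> Basis" for e
    proof -
      have w: "d \<le> norm (wid \<kappa> d \<tau> e)" using complex_Re_le_cmod[of "wid \<kappa> d \<tau> e"] by simp
      have "norm ((dcoef \<kappa> d a p \<tau> e w)\<^sup>2 - 1 / wid \<kappa> d \<tau> e) \<le> (norm (dcoef \<kappa> d a p \<tau> e w))\<^sup>2 + 1 / norm (wid \<kappa> d \<tau> e)"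
        using norm_triangle_ineq4[of "(dcoef \<kappa> d a p \<tau> e w)\<^sup>2" "1 / wid \<kappa> d \<tau> e"] by (simp add: norm_power norm_divide)
      also have "\<dots> \<le> (A * (1 + norm w))\<^sup>2 + 1 / d"
        using w d by (intro add_mono power_mono A(2)[OF e T] divide_left_mono mult_pos_pos) auto
      also have "\<dots> \<le> (A * (1 + norm w))\<^sup>2 + 1 / d * (1 + norm w)\<^sup>2" using one[of w] d by (simp add: field_simps)
      also have "\<dots> = (A\<^sup>2 + 1 / d) * (1 + norm w)\<^sup>2" by (simp only: power_mult_distrib distrib_right)
      also have "\<dots> \<le> H * (1 + norm w)\<^sup>2" using nn by (intro mult_right_mono) auto
      finally have "norm ((dcoef \<kappa> d a p \<tau> e w)\<^sup>2 - 1 / wid \<kappa> d \<tau> e) * ?P \<le> H * (1 + norm w)\<^sup>2 * ?P" by (intro mult_right_mono) auto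
      then show ?thesis by (simp add: norm_mult mult.assoc)
    qed
    have 4: "norm (packet' \<kappa> d a p \<tau> w) \<le> (H * (1 + S)) * ((1 + norm w)\<^sup>2 * ?P)"
    proof -
      have "norm (packet' \<kappa> d a p \<tau> w) \<le> (1/2) * (\<Sum>e\<in>Basis. norm (of_real (\<kappa> e) * (((dcoef \<kappa> d a p \<tau> e w)\<^sup>2 - 1 / wid \<kappa> d \<tau> e) * packet \<kappa> d a p \<tau> w)))"
        unfolding packet'_def norm_mult[of "\<i> / 2"] by (intro mult_mono norm_sum) (auto simp: norm_divide)
      also have "\<dots> \<le> (1/2) * (\<Sum>e\<in>Basis. \<bar>\<kappa> e\<bar> * (H * ((1 + norm w)\<^sup>2 * ?P)))"
        unfolding norm_mult[of "of_real _"] norm_of_real by (intro mult_left_mono sum_mono 3) auto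
      also have "\<dots> = (1/2) * (S * (H * ((1 + norm w)\<^sup>2 * ?P)))" by (simp add: S_def sum_distrib_right)
      also have "\<dots> \<le> (1 + S) * (H * ((1 + norm w)\<^sup>2 * ?P))"
      proof -
        have "0 \<le> H * ((1 + norm w)\<^sup>2 * ?P)" using nn by auto
        moreover have "S / 2 \<le> 1 + S" using nn by simp
        ultimately have "S / 2 * (H * ((1 + norm w)\<^sup>2 * ?P)) \<le> (1 + S) * (H * ((1 + norm w)\<^sup>2 * ?P))" by (rule mult_right_mono[rotated])
        then show ?thesis by simp
      qed
      finally show ?thesis by (simp add: mult_ac)
    qed
    have 5: "H * ((1 + norm w)\<^sup>2 * ?P) \<le> (H * (1 + S)) * ((1 + norm w)\<^sup>2 * ?P)"
      by (rule mult_right_mono[OF S1]) auto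
    show ?thesis using up[OF 1 T] up[OF 4 T] up[OF 2 T] up[OF order_trans[OF 3 5] T] by blast
  qed
  moreover have "0 \<le> K" unfolding K_def using nn by auto
  ultimately show ?thesis using c unfolding E_def by blast
qed

lemma schwartz_packet:
  fixes a :: "'e::euclidean_space"
  assumes d: "d > 0"
  shows "schwartz (packet \<kappa> d a p \<tau>)"
proof -
  obtain K c where K: "K \<ge> 0" "c > 0" "\<And>t w. \<bar>t\<bar> \<le> \<bar>\<tau>\<bar> \<Longrightarrow> norm (packet \<kappa> d a p t w) \<le> K * exp (- c * (norm w)\<^sup>2)"
    using packet_decay[OF d, of "\<bar>\<tau>\<bar>" \<kappa> a p] by blast
  show ?thesis unfolding packet_eq_exp[abs_def]
  proof (rule schwartz_exp_cpoly[OF cpoly_packet_exponent K(2)])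
    fix w
    let ?q = "\<i> * of_real (p \<bullet> w) - \<i> * of_real \<tau> * of_real (symb \<kappa> p)
     - (\<Sum>e\<in>Basis. Ln (2 * pi * wid \<kappa> d \<tau> e)
          + (of_real ((w - a) \<bullet> e) - of_real \<tau> * of_real (\<kappa> e * (p \<bullet> e))) ^ 2 / wid \<kappa> d \<tau> e) / 2"
    have le: "exp (Re ?q) \<le> K * exp (- c * (norm w)\<^sup>2)"
      using K(3)[of \<tau> w] unfolding packet_eq_exp norm_exp_eq_Re by simp
    have "K \<noteq> 0"
    proof
      assume "K = 0"
      then have "exp (Re ?q) \<le> 0" using le by simp
      then show False using exp_gt_zero[of "Re ?q"] by linarith
    qed
    then have "K * exp (- c * (norm w)\<^sup>2) = exp (ln K - c * (norm w)\<^sup>2)" using K(1) by (simp add: exp_diff exp_minus divide_inverse)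
    with le have "exp (Re ?q) \<le> exp (ln K - c * (norm w)\<^sup>2)" by (simp only:)
    then show "Re ?q \<le> ln K - c * (norm w)\<^sup>2" by (simp only: exp_le_cancel_iff)
  qed
qed

lemma borel_measurable_dcoef [measurable (raw)]:
  assumes [measurable]: "f \<in> borel_measurable M" "g \<in> measurable M borel"
  shows "(\<lambda>x. dcoef \<kappa> d a p (f x) e (g x)) \<in> borel_measurable M"
  unfolding dcoef_def wid_def by measurable

lemma borel_measurable_packet' [measurable (raw)]:
  assumes d: "d > 0" and [measurable]: "f \<in> borel_measurable M" "g \<in> measurable M borel"
  shows "(\<lambda>x. packet' \<kappa> d a p (f x) (g x)) \<in> borel_measurable M"
proof -
  note [measurable] = borel_measurable_packet[OF d]
  show ?thesis unfolding packet'_def wid_def by measurable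
qed

lemma integrable_packet:
  fixes a :: "'e::euclidean_space"
  assumes d: "d > 0"
  shows "integrable lborel (packet \<kappa> d a p \<tau>)"
    and "integrable lborel (packet' \<kappa> d a p \<tau>)"
    and "e \<in> Basis \<Longrightarrow> integrable lborel (\<lambda>w. dcoef \<kappa> d a p \<tau> e w * packet \<kappa> d a p \<tau> w)"
    and "e \<in> Basis \<Longrightarrow> integrable lborel (\<lambda>w. ((dcoef \<kappa> d a p \<tau> e w)\<^sup>2 - 1 / wid \<kappa> d \<tau> e) * packet \<kappa> d a p \<tau> w)"
proof -
  note [measurable] = borel_measurable_packet[OF d] borel_measurable_packet'[OF d]
  obtain K c where K: "K \<ge> 0" "c > 0" "\<And>t w. \<bar>t\<bar> \<le> \<bar>\<tau>\<bar> \<Longrightarrow>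
     norm (packet \<kappa> d a p t w) \<le> K * exp (- c * (norm w)\<^sup>2) \<and>
     norm (packet' \<kappa> d a p t w) \<le> K * exp (- c * (norm w)\<^sup>2) \<and>
     (\<forall>e\<in>Basis. norm (dcoef \<kappa> d a p t e w * packet \<kappa> d a p t w) \<le> K * exp (- c * (norm w)\<^sup>2) \<and>
      norm (((dcoef \<kappa> d a p t e w)\<^sup>2 - 1 / wid \<kappa> d t e) * packet \<kappa> d a p t w) \<le> K * exp (- c * (norm w)\<^sup>2))"
    using packet_dominated[OF d, of "\<bar>\<tau>\<bar>" \<kappa> a p] by blast
  note K' = K(3)[of \<tau>, simplified]
  show "integrable lborel (packet \<kappa> d a p \<tau>)"
    by (rule integrable_of_decay[OF _ K(2), of _ K]) (use K' in auto)
  show "integrable lborel (packet' \<kappa> d a p \<tau>)"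
    by (rule integrable_of_decay[OF _ K(2), of _ K]) (use K' in auto)
  assume e: "e \<in> Basis"
  show "integrable lborel (\<lambda>w. dcoef \<kappa> d a p \<tau> e w * packet \<kappa> d a p \<tau> w)"
    by (rule integrable_of_decay[OF _ K(2), of _ K]) (use K' e in auto)
  show "integrable lborel (\<lambda>w. ((dcoef \<kappa> d a p \<tau> e w)\<^sup>2 - 1 / wid \<kappa> d \<tau> e) * packet \<kappa> d a p \<tau> w)"
    by (rule integrable_of_decay[OF _ K(2), of _ K]) (use K' e in auto)
qed

text \<open>The integral of \<open>f (w + e) - f w\<close> vanishes by translation invariance; by the fundamental
  theorem of calculus and Fubini it is also the integral of the derivative.\<close>

lemma integral_directional_derivative_zero:
  fixes f f' :: "'e::euclidean_space \<Rightarrow> complex"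
  assumes D: "\<And>w. ((\<lambda>t. f (w + t *\<^sub>R e)) has_vector_derivative f' w) (at 0)"
    and f: "integrable lborel f" and f': "integrable lborel f'" and cont: "continuous_on UNIV f'"
  shows "(LBINT w. f' w) = 0"
proof -
  have [measurable]: "f' \<in> borel_measurable borel" using f' by auto
  have D': "((\<lambda>t. f (w + t *\<^sub>R e)) has_vector_derivative f' (w + t *\<^sub>R e)) (at t)" for w t
  proof -
    have "((\<lambda>s. s - t) has_vector_derivative 1) (at t)"
      by (auto intro!: derivative_eq_intros)
    moreover have "((\<lambda>s. f ((w + t *\<^sub>R e) + s *\<^sub>R e)) has_vector_derivative f' (w + t *\<^sub>R e)) (at (t - t))"
      using D[of "w + t *\<^sub>R e"] by simp
    ultimately have "(((\<lambda>s. f ((w + t *\<^sub>R e) + s *\<^sub>R e)) \<circ> (\<lambda>s. s - t)) has_vector_derivative (1 *\<^sub>R f' (w + t *\<^sub>R e))) (at t)"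
      by (rule vector_diff_chain_at)
    then show ?thesis by (simp add: o_def scaleR_left_diff_distrib)
  qed
  have ftc: "(LBINT t. indicator {0..1} t *\<^sub>R f' (w + t *\<^sub>R e)) = f (w + e) - f w" for w
  proof -
    have "(LBINT t. indicator {0..1} t *\<^sub>R f' (w + t *\<^sub>R e)) = f (w + 1 *\<^sub>R e) - f (w + 0 *\<^sub>R e)"
      by (intro integral_FTC_atLeastAtMost has_vector_derivative_at_within[OF D'] continuous_on_compose2[OF cont] continuous_intros) auto
    then show ?thesis by simp
  qed
  have I: "integrable (lborel \<Otimes>\<^sub>M lborel) (\<lambda>(t, w). indicator {0..1::real} t *\<^sub>R f' (w + t *\<^sub>R e))"
  proof (rule lborel_pair.Fubini_integrable)
    have eq: "(LBINT w. norm (case (t, w) of (t, w) \<Rightarrow> indicator {0..1::real} t *\<^sub>R f' (w + t *\<^sub>R e))) = indicator {0..1} t * (LBINT w. norm (f' w))" for t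
      using integral_lborel_translate(1)[of "\<lambda>w. norm (f' w)" "t *\<^sub>R e"] by (simp add: add.commute)
    then show "integrable lborel (\<lambda>t. LINT w|lborel. norm (case (t, w) of (t, w) \<Rightarrow> indicator {0..1::real} t *\<^sub>R f' (w + t *\<^sub>R e)))"
      unfolding eq by (intro integrable_mult_left) simp
    show "AE t in lborel. integrable lborel (\<lambda>w. case (t, w) of (t, w) \<Rightarrow> indicator {0..1::real} t *\<^sub>R f' (w + t *\<^sub>R e))"
    proof (rule AE_I2)
      fix t
      have "integrable lborel (\<lambda>w. f' (t *\<^sub>R e + w))" using f' by (simp add: integral_lborel_translate(2))
      then show "integrable lborel (\<lambda>w. case (t, w) of (t, w) \<Rightarrow> indicator {0..1::real} t *\<^sub>R f' (w + t *\<^sub>R e))"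
        by (simp add: add.commute)
    qed
  qed measurable
  have "0 = (LBINT w. f (e + w)) - (LBINT w. f w)" by (simp add: integral_lborel_translate)
  also have "\<dots> = (LBINT w. f (e + w) - f w)"
    using f by (intro Bochner_Integration.integral_diff[symmetric]) (auto simp: integral_lborel_translate)
  also have "\<dots> = (LBINT w. LINT t|lborel. indicator {0..1} t *\<^sub>R f' (w + t *\<^sub>R e))"
    unfolding ftc by (simp add: add.commute)
  also have "\<dots> = (LBINT t. LINT w|lborel. indicator {0..1} t *\<^sub>R f' (w + t *\<^sub>R e))"
    by (rule lborel_pair.Fubini_integral[OF I])
  also have "\<dots> = (LBINT t. indicator {0..1::real} t *\<^sub>R (LBINT w. f' w))"
  proof -
    have "(LBINT w. f' (w + t *\<^sub>R e)) = (LBINT w. f' w)" for t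
      using integral_lborel_translate(1)[of f' "t *\<^sub>R e"] by (simp add: add.commute)
    then show ?thesis by simp
  qed
  also have "\<dots> = (LBINT w. f' w)" by simp
  finally show ?thesis by simp
qed

lemma continuous_packet: "d > 0 \<Longrightarrow> continuous_on UNIV (packet \<kappa> d a p \<tau>)"
  unfolding packet_eq_exp[abs_def] by (intro continuous_intros) (auto simp: wid_nonzero)

lemma integral_packet'_zero:
  fixes a :: "'e::euclidean_space"
  assumes d: "d > 0"
  shows "(LBINT w. packet' \<kappa> d a p \<tau> w) = 0"
proof -
  have "(LBINT w. ((dcoef \<kappa> d a p \<tau> e w)\<^sup>2 - 1 / wid \<kappa> d \<tau> e) * packet \<kappa> d a p \<tau> w) = 0" if e: "e \<in> Basis" for e
    by (rule integral_directional_derivative_zero[OF packet_directional2[OF d e] integrable_packet(3)[OF d e] integrable_packet(4)[OF d e]])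
       (auto simp: dcoef_def wid_nonzero[OF d] intro!: continuous_intros continuous_packet[OF d])
  then show ?thesis
    unfolding packet'_def
    by (subst integral_mult_right_zero, subst Bochner_Integration.integral_sum) (auto intro: integrable_packet[OF d])
qed

lemma integral_packet_const:
  fixes a :: "'e::euclidean_space"
  assumes d: "d > 0" and t: "\<tau> \<ge> 0"
  shows "(LBINT w. packet \<kappa> d a p \<tau> w) = (LBINT w. packet \<kappa> d a p 0 w)"
proof -
  note [measurable] = borel_measurable_packet[OF d] borel_measurable_packet'[OF d]
  obtain K c where K: "K \<ge> 0" "c > 0" "\<And>t w. \<bar>t\<bar> \<le> \<tau> \<Longrightarrow> norm (packet' \<kappa> d a p t w) \<le> K * exp (- c * (norm w)\<^sup>2)"
    using packet_dominated[OF d, of \<tau> \<kappa> a p] by blast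
  have pc: "continuous_on UNIV (\<lambda>t. packet \<kappa> d a p t w)" for w
    by (intro continuous_at_imp_continuous_on ballI has_vector_derivative_continuous[OF packet_time_derivative[OF d]])
  have ftc: "(LBINT s. indicator {0..\<tau>} s *\<^sub>R packet' \<kappa> d a p s w) = packet \<kappa> d a p \<tau> w - packet \<kappa> d a p 0 w" for w
  proof (intro integral_FTC_atLeastAtMost has_vector_derivative_at_within[OF packet_time_derivative[OF d]] t)
    show "continuous_on {0..\<tau>} (\<lambda>s. packet' \<kappa> d a p s w)"
      unfolding packet'_def dcoef_def wid_def
      using wid_nonzero[OF d, of \<kappa>]
      by (intro continuous_intros continuous_on_subset[OF pc]) (auto simp: wid_def)
  qed
  have "(LBINT w. packet \<kappa> d a p \<tau> w) - (LBINT w. packet \<kappa> d a p 0 w)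
     = (LBINT w. LINT s|lborel. indicator {0..\<tau>} s *\<^sub>R packet' \<kappa> d a p s w)"
    unfolding ftc by (intro Bochner_Integration.integral_diff[symmetric] integrable_packet d)
  also have "\<dots> = (LBINT s. LINT w|lborel. indicator {0..\<tau>} s *\<^sub>R packet' \<kappa> d a p s w)"
  proof (rule Fubini_bound(1)[where b="\<lambda>s. indicator {0..\<tau>} s * K" and \<phi>="\<lambda>w. of_real (exp (- c * (norm w)\<^sup>2))"])
    show "integrable lborel (\<lambda>w::'e. complex_of_real (exp (- c * (norm w)\<^sup>2)))"
      using gaussian_integrable'[OF K(2), where 'e='e] by (intro integrable_of_real)
    show "norm (indicator {0..\<tau>} s *\<^sub>R packet' \<kappa> d a p s w) \<le> indicator {0..\<tau>} s * K * norm (complex_of_real (exp (- c * (norm w)\<^sup>2)))" for s w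
      using K(3)[of s w] by (auto simp: indicator_def)
    show "integrable lborel (\<lambda>s. indicator {0..\<tau>} s * K)"
      by (intro integrable_mult_left integrable_real_indicator) (use t in auto)
  qed (use lborel.sigma_finite_measure_axioms in measurable)
  also have "\<dots> = 0" by (simp add: integral_packet'_zero[OF d])
  finally show ?thesis by simp
qed

text \<open>On the Fourier side the free evolution is multiplication by a phase. Modulating the packet
  reduces the claim to frequency 0, where the integral is conserved.\<close>

lemma packet_fourier:
  fixes a :: "'e::euclidean_space"
  assumes d: "d > 0" and t: "\<tau> \<ge> 0"
  shows "(LBINT w. cis (l \<bullet> w) * packet \<kappa> d a p \<tau> w) = cis (- \<tau> * symb \<kappa> l) * (LBINT w. cis (l \<bullet> w) * packet \<kappa> d a p 0 w)"
proof -
  let ?b = "\<tau> *\<^sub>R vel \<kappa> l"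
  have "(LBINT w. cis (l \<bullet> w) * packet \<kappa> d a p \<tau> w)
     = cis (\<tau> * (l \<bullet> vel \<kappa> p + symb \<kappa> l)) * (LBINT w. packet \<kappa> d (a - ?b) (p + l) \<tau> w)"
    by (simp add: packet_modulate)
  also have "(LBINT w. packet \<kappa> d (a - ?b) (p + l) \<tau> w) = (LBINT w. packet \<kappa> d (a - ?b) (p + l) 0 (- ?b + w))"
    unfolding integral_packet_const[OF d t] by (rule integral_lborel_translate(1)[symmetric])
  also have "\<dots> = (LBINT w. cis (- ((p + l) \<bullet> ?b)) * (cis (l \<bullet> w) * packet \<kappa> d a p 0 w))"
  proof (rule Bochner_Integration.integral_cong[OF refl])
    fix w
    show "packet \<kappa> d (a - ?b) (p + l) 0 (- ?b + w) = cis (- ((p + l) \<bullet> ?b)) * (cis (l \<bullet> w) * packet \<kappa> d a p 0 w)"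
      by (simp add: packet_0[OF d] inner_add_left inner_add_right inner_diff_right flip: mult.assoc) (simp add: cis_mult algebra_simps)
  qed
  also have "\<dots> = cis (- ((p + l) \<bullet> ?b)) * (LBINT w. cis (l \<bullet> w) * packet \<kappa> d a p 0 w)" by simp
  also have "cis (\<tau> * (l \<bullet> vel \<kappa> p + symb \<kappa> l)) * (cis (- ((p + l) \<bullet> ?b)) * (LBINT w. cis (l \<bullet> w) * packet \<kappa> d a p 0 w))
     = cis (- \<tau> * symb \<kappa> l) * (LBINT w. cis (l \<bullet> w) * packet \<kappa> d a p 0 w)"
  proof -
    have "\<tau> * (l \<bullet> vel \<kappa> p + symb \<kappa> l) + - ((p + l) \<bullet> ?b) = - \<tau> * symb \<kappa> l"
      using inner_vel_commute[of p \<kappa> l] by (simp add: symb_def inner_add_left algebra_simps)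
    then show ?thesis by (simp add: cis_mult flip: mult.assoc)
  qed
  finally show ?thesis .
qed

lemma norm_packet_fourier_0:
  fixes a :: "'e::euclidean_space"
  assumes d: "d > 0"
  shows "norm (LBINT w. cis (l \<bullet> w) * packet \<kappa> d a p 0 w) \<le> 1"
proof -
  have "norm (LBINT w. cis (l \<bullet> w) * packet \<kappa> d a p 0 w) \<le> (LBINT w. norm (cis (l \<bullet> w) * packet \<kappa> d a p 0 w))"
    by (rule integral_norm_bound)
  also have "\<dots> = (LBINT w. gauss d (w - a))"
    by (simp add: packet_0[OF d] norm_mult gauss_nonneg[OF d])
  also have "\<dots> = 1" using integral_lborel_translate(1)[of "gauss d" "- a"] integral_gauss[OF d, where 'e='e] by simp
  finally show ?thesis .
qed

text \<open>Bounds that do not depend on the centre \<open>a\<close> and the frequency \<open>p\<close>: these only translate and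
  modulate.\<close>

lemma packet_norms_bounded:
  fixes \<kappa> :: "'e::euclidean_space \<Rightarrow> real"
  assumes d: "d > 0"
  shows "\<exists>M\<ge>0. \<forall>a p \<tau>. \<bar>\<tau>\<bar> \<le> T \<longrightarrow> (LBINT w. norm (packet \<kappa> d a p \<tau> w)) \<le> M \<and>
     integrable lborel (\<lambda>w. (norm (packet \<kappa> d a p \<tau> w))\<^sup>2) \<and> (LBINT w. (norm (packet \<kappa> d a p \<tau> w))\<^sup>2) \<le> M"
proof -
  note [measurable] = borel_measurable_packet[OF d]
  obtain K c where K: "K \<ge> 0" "c > 0" "\<And>\<tau> w. \<bar>\<tau>\<bar> \<le> T \<Longrightarrow> norm (ker \<kappa> d \<tau> w) \<le> K * exp (- c * (norm w)\<^sup>2)"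
    using ker_bound[OF d, of T \<kappa>] by blast
  define G where "G = (LBINT w. exp (- c * (norm (w::'e))\<^sup>2))"
  have Gi: "integrable lborel (\<lambda>w. exp (- c * (norm (- b + w::'e))\<^sup>2))" "(LBINT w. exp (- c * (norm (- b + w))\<^sup>2)) = G" for b
    using gaussian_integrable'[OF K(2), where 'e='e]
      integral_lborel_translate[of "\<lambda>w. exp (- c * (norm (w::'e))\<^sup>2)" "- b"] by (simp_all add: G_def)
  have G: "0 \<le> G" unfolding G_def by (intro integral_nonneg_AE) auto
  have "(LBINT w. norm (packet \<kappa> d a p \<tau> w)) \<le> K * G \<and>
     integrable lborel (\<lambda>w. (norm (packet \<kappa> d a p \<tau> w))\<^sup>2) \<and> (LBINT w. (norm (packet \<kappa> d a p \<tau> w))\<^sup>2) \<le> K\<^sup>2 * G" if T: "\<bar>\<tau>\<bar> \<le> T" for a p \<tau>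
  proof -
    let ?b = "a + \<tau> *\<^sub>R vel \<kappa> p" let ?E = "\<lambda>w. exp (- c * (norm (- ?b + w))\<^sup>2)"
    have 1: "norm (packet \<kappa> d a p \<tau> w) \<le> K * ?E w" for w
      unfolding norm_packet using K(3)[OF T, of "w - a - \<tau> *\<^sub>R vel \<kappa> p"] by (simp add: algebra_simps)
    have 2: "(norm (packet \<kappa> d a p \<tau> w))\<^sup>2 \<le> K\<^sup>2 * ?E w" for w
    proof -
      have "(norm (packet \<kappa> d a p \<tau> w))\<^sup>2 \<le> (K * ?E w)\<^sup>2" by (intro power_mono 1) auto
      also have "\<dots> = K\<^sup>2 * (?E w * ?E w)" by (simp add: power2_eq_square mult_ac)
      also have "\<dots> \<le> K\<^sup>2 * (?E w * 1)" using K by (intro mult_left_mono) auto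
      finally show ?thesis by simp
    qed
    have I2: "integrable lborel (\<lambda>w. (norm (packet \<kappa> d a p \<tau> w))\<^sup>2)"
      by (rule Bochner_Integration.integrable_bound[OF integrable_mult_right[OF Gi(1)[of ?b], of "K\<^sup>2"]]) (use 2 in auto)
    have "(LBINT w. norm (packet \<kappa> d a p \<tau> w)) \<le> (LBINT w. K * ?E w)"
      by (intro integral_mono integrable_norm integrable_packet d integrable_mult_right Gi 1)
    moreover have "(LBINT w. (norm (packet \<kappa> d a p \<tau> w))\<^sup>2) \<le> (LBINT w. K\<^sup>2 * ?E w)"
      by (intro integral_mono I2 integrable_mult_right Gi 2)
    ultimately show ?thesis using I2 Gi(2)[of ?b] by simp
  qed
  moreover have "K * G \<le> K * G + K\<^sup>2 * G" "K\<^sup>2 * G \<le> K * G + K\<^sup>2 * G" "0 \<le> K * G + K\<^sup>2 * G" using K G by auto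
  ultimately show ?thesis by (intro exI[of _ "K * G + K\<^sup>2 * G"]) (meson order_trans)
qed

section \<open>Pairing square-integrable functions\<close>

lemma square_integrable_mult:
  assumes "square_integrable f" "square_integrable g"
  shows "integrable lborel (\<lambda>w. f w * g w)"
    and "norm (LBINT w. f w * g w) \<le> sqrt (LBINT w. (norm (f w))\<^sup>2) * sqrt (LBINT w. (norm (g w))\<^sup>2)"
proof -
  have [measurable]: "f \<in> borel_measurable borel" "g \<in> borel_measurable borel"
    and f: "integrable lborel (\<lambda>w. (norm (f w))\<^sup>2)" and g: "integrable lborel (\<lambda>w. (norm (g w))\<^sup>2)"
    using assms by (auto simp: square_integrable_def)
  have le: "norm (f w * g w) \<le> (norm (f w))\<^sup>2 + (norm (g w))\<^sup>2" for w
  proof -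
    have "0 \<le> norm (f w) * norm (g w)" by simp
    then show ?thesis unfolding norm_mult using sum_squares_bound[of "norm (f w)" "norm (g w)"] by linarith
  qed
  show I: "integrable lborel (\<lambda>w. f w * g w)"
  proof (rule Bochner_Integration.integrable_bound[OF Bochner_Integration.integrable_add[OF f g]])
    show "AE x in lborel. norm (f x * g x) \<le> norm ((norm (f x))\<^sup>2 + (norm (g x))\<^sup>2)"
      using le by (auto intro!: AE_I2 order_trans[OF le])
  qed measurable
  define u v x where "u = (LBINT w. (norm (f w))\<^sup>2)" and "v = (LBINT w. (norm (g w))\<^sup>2)" and "x = (LBINT w. norm (f w) * norm (g w))"
  have u0: "0 \<le> u" and v0: "0 \<le> v" unfolding u_def v_def by auto
  have I': "integrable lborel (\<lambda>w. norm (f w) * norm (g w))" using integrable_norm[OF I] by (simp add: norm_mult)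
  have nx: "norm (LBINT w. f w * g w) \<le> x"
    unfolding x_def using integral_norm_bound[of lborel "\<lambda>w. f w * g w"] by (simp add: norm_mult)
  have x2: "x\<^sup>2 \<le> u * v"
  proof (cases "u = 0")
    case True
    then have "AE w in lborel. (norm (f w))\<^sup>2 = 0"
      unfolding u_def using f by (subst (asm) integral_nonneg_eq_0_iff_AE) auto
    then have "x = (LINT w|(lborel::'a measure). 0)" unfolding x_def by (intro integral_cong_AE) auto
    then show ?thesis using True by simp
  next
    case False
    define s where "s = x / u"
    have "0 \<le> (LBINT w. (s * norm (f w) - norm (g w))\<^sup>2)" by simp
    also have "\<dots> = (LBINT w. s\<^sup>2 * (norm (f w))\<^sup>2 + (norm (g w))\<^sup>2 - 2 * s * (norm (f w) * norm (g w)))"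
      by (intro Bochner_Integration.integral_cong refl) (simp add: power2_eq_square algebra_simps)
    also have "\<dots> = s\<^sup>2 * u + v - 2 * s * x"
      unfolding u_def v_def x_def using f g I'
      by (subst Bochner_Integration.integral_diff; (subst Bochner_Integration.integral_add)?) auto
    finally have "2 * s * x - s\<^sup>2 * u \<le> v" by simp
    moreover have "2 * s * x - s\<^sup>2 * u = x\<^sup>2 / u" using False by (simp add: s_def power2_eq_square field_simps)
    ultimately have "x\<^sup>2 / u \<le> v" by simp
    moreover have "0 < u" using False u0 by simp
    ultimately show ?thesis by (simp add: pos_divide_le_eq mult.commute)
  qed
  have "x \<le> sqrt (u * v)" using x2 by (rule real_le_rsqrt)
  then show "norm (LBINT w. f w * g w) \<le> sqrt (LBINT w. (norm (f w))\<^sup>2) * sqrt (LBINT w. (norm (g w))\<^sup>2)"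
    using nx by (simp add: real_sqrt_mult u_def v_def)
qed

lemma square_integrable_diff:
  assumes "square_integrable f" "square_integrable g"
  shows "square_integrable (\<lambda>w. f w - g w)"
proof -
  have [measurable]: "f \<in> borel_measurable borel" "g \<in> borel_measurable borel"
    and f: "integrable lborel (\<lambda>w. (norm (f w))\<^sup>2)" and g: "integrable lborel (\<lambda>w. (norm (g w))\<^sup>2)"
    using assms by (auto simp: square_integrable_def)
  have le: "(norm (f w - g w))\<^sup>2 \<le> 2 * (norm (f w))\<^sup>2 + 2 * (norm (g w))\<^sup>2" for w
  proof -
    have "(norm (f w - g w))\<^sup>2 \<le> (norm (f w) + norm (g w))\<^sup>2" by (intro power_mono norm_triangle_ineq4) auto
    then show ?thesis using sum_squares_bound[of "norm (f w)" "norm (g w)"] by (simp add: power2_sum)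
  qed
  have "integrable lborel (\<lambda>w. (norm (f w - g w))\<^sup>2)"
    by (rule Bochner_Integration.integrable_bound[of _ "\<lambda>w. 2 * (norm (f w))\<^sup>2 + 2 * (norm (g w))\<^sup>2"])
       (use f g in \<open>auto intro!: AE_I2 order_trans[OF le]\<close>)
  then show ?thesis unfolding square_integrable_def by auto
qed

text \<open>Joint continuity of the bilinear pairing, by the Cauchy-Schwarz inequality.\<close>

lemma L2_pairing_tendsto:
  fixes f g :: "'b \<Rightarrow> 'e::euclidean_space \<Rightarrow> complex"
  assumes f: "\<And>t. t \<in> S \<Longrightarrow> square_integrable (f t)" and g: "\<And>t. t \<in> S \<Longrightarrow> square_integrable (g t)"
    and ev: "\<forall>\<^sub>F t in F. t \<in> S"
    and f0: "square_integrable f0" and g0: "square_integrable g0"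
    and fl: "((\<lambda>t. LINT w|lborel. (norm (f t w - f0 w))\<^sup>2) \<longlongrightarrow> 0) F"
    and gl: "((\<lambda>t. LINT w|lborel. (norm (g t w - g0 w))\<^sup>2) \<longlongrightarrow> 0) F"
  shows "((\<lambda>t. LINT w|lborel. f t w * g t w) \<longlongrightarrow> (LBINT w. f0 w * g0 w)) F"
proof -
  let ?n = "\<lambda>h. sqrt (LBINT w. (norm (h w))\<^sup>2)"
  have fl': "((\<lambda>t. ?n (\<lambda>w. f t w - f0 w)) \<longlongrightarrow> 0) F" using tendsto_real_sqrt[OF fl] by simp
  have gl': "((\<lambda>t. ?n (\<lambda>w. g t w - g0 w)) \<longlongrightarrow> 0) F" using tendsto_real_sqrt[OF gl] by simp
  let ?B = "\<lambda>t. ?n (\<lambda>w. f t w - f0 w) * ?n (\<lambda>w. g t w - g0 w) + ?n (\<lambda>w. f t w - f0 w) * ?n g0 + ?n f0 * ?n (\<lambda>w. g t w - g0 w)"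
  have B: "(?B \<longlongrightarrow> 0) F"
    using tendsto_add[OF tendsto_add[OF tendsto_mult[OF fl' gl'] tendsto_mult_right[OF fl', of "?n g0"]] tendsto_mult_left[OF gl', of "?n f0"]] by simp
  have "((\<lambda>t. (LBINT w. f t w * g t w) - (LBINT w. f0 w * g0 w)) \<longlongrightarrow> 0) F"
  proof (rule Lim_null_comparison[OF _ B])
    show "\<forall>\<^sub>F t in F. norm ((LBINT w. f t w * g t w) - (LBINT w. f0 w * g0 w)) \<le> ?B t"
      using ev
    proof eventually_elim
      case (elim t)
      note ft = f[OF elim] and gt = g[OF elim]
      note df = square_integrable_diff[OF ft f0] and dg = square_integrable_diff[OF gt g0]
      have "(LBINT w. f t w * g t w) - (LBINT w. f0 w * g0 w) = (LBINT w. f t w * g t w - f0 w * g0 w)"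
        by (intro Bochner_Integration.integral_diff[symmetric] square_integrable_mult ft gt f0 g0)
      also have "\<dots> = (LBINT w. ((f t w - f0 w) * (g t w - g0 w) + (f t w - f0 w) * g0 w) + f0 w * (g t w - g0 w))"
        by (intro Bochner_Integration.integral_cong refl) (simp add: algebra_simps)
      also have "\<dots> = (LBINT w. (f t w - f0 w) * (g t w - g0 w)) + (LBINT w. (f t w - f0 w) * g0 w) + (LBINT w. f0 w * (g t w - g0 w))"
      proof -
        note I = square_integrable_mult(1)[OF df dg] square_integrable_mult(1)[OF df g0] square_integrable_mult(1)[OF f0 dg]
        show ?thesis
          by (simp only: Bochner_Integration.integral_add[OF Bochner_Integration.integrable_add[OF I(1,2)] I(3)] Bochner_Integration.integral_add[OF I(1,2)])
      qed
      finally have eq: "(LBINT w. f t w * g t w) - (LBINT w. f0 w * g0 w)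
         = (LBINT w. (f t w - f0 w) * (g t w - g0 w)) + (LBINT w. (f t w - f0 w) * g0 w) + (LBINT w. f0 w * (g t w - g0 w))" .
      show ?case unfolding eq
        by (rule norm_triangle_mono[OF norm_triangle_mono[OF square_integrable_mult(2)[OF df dg] square_integrable_mult(2)[OF df g0]] square_integrable_mult(2)[OF f0 dg]])
    qed
  qed
  then show ?thesis by (rule LIM_zero_cancel)
qed

lemma square_integrable_decay:
  fixes f :: "'e::euclidean_space \<Rightarrow> complex"
  assumes [measurable]: "f \<in> borel_measurable borel" and c: "c > 0" and b: "\<And>w. norm (f w) \<le> K * exp (- c * (norm w)\<^sup>2)"
  shows "square_integrable f"
proof -
  have "norm ((norm (f w))\<^sup>2) \<le> norm (K\<^sup>2 * exp (- c * (norm w)\<^sup>2))" for w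
  proof -
    have "(norm (f w))\<^sup>2 \<le> (K * exp (- c * (norm w)\<^sup>2))\<^sup>2" by (intro power_mono b) auto
    also have "\<dots> = K\<^sup>2 * (exp (- c * (norm w)\<^sup>2) * exp (- c * (norm w)\<^sup>2))" by (simp add: power2_eq_square mult_ac)
    also have "\<dots> \<le> K\<^sup>2 * (exp (- c * (norm w)\<^sup>2) * 1)" using c by (intro mult_left_mono) auto
    finally show ?thesis by simp
  qed
  then have "integrable lborel (\<lambda>w. (norm (f w))\<^sup>2)"
    by (intro Bochner_Integration.integrable_bound[OF integrable_mult_right[OF gaussian_integrable'[OF c], of "K\<^sup>2"]]) auto
  then show ?thesis unfolding square_integrable_def by auto
qed

lemma decay_L2_tendsto:
  fixes g :: "real \<Rightarrow> 'e::euclidean_space \<Rightarrow> complex"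
  assumes [measurable]: "\<And>t. t \<in> S \<Longrightarrow> g t \<in> borel_measurable borel" "g0 \<in> borel_measurable borel"
    and c: "c > 0" and b: "\<And>t w. t \<in> S \<Longrightarrow> norm (g t w) \<le> K * exp (- c * (norm w)\<^sup>2)"
    and b0: "\<And>w. norm (g0 w) \<le> K * exp (- c * (norm w)\<^sup>2)"
    and lim: "\<And>w. ((\<lambda>t. g t w) \<longlongrightarrow> g0 w) (at s within S)"
  shows "((\<lambda>t. LINT w|lborel. (norm (g t w - g0 w))\<^sup>2) \<longlongrightarrow> 0) (at s within S)"
  unfolding tendsto_at_iff_sequentially comp_def
proof (intro allI impI)
  fix X assume X: "\<forall>i. X i \<in> S - {s}" "X \<longlonglongrightarrow> s"
  have "(\<lambda>i. LINT w|lborel. (norm (g (X i) w - g0 w))\<^sup>2) \<longlonglongrightarrow> (LINT w|(lborel::'e measure). 0)"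
  proof (rule integral_dominated_convergence[where w="\<lambda>w. (2 * K)\<^sup>2 * exp (- c * (norm w)\<^sup>2)"])
    show "(\<lambda>w. (norm (g (X i) w - g0 w))\<^sup>2) \<in> borel_measurable lborel" for i using X by auto
    show "AE w in lborel. (\<lambda>i. (norm (g (X i) w - g0 w))\<^sup>2) \<longlonglongrightarrow> 0"
    proof (rule AE_I2)
      fix w :: 'e
      have "(\<lambda>i. g (X i) w) \<longlonglongrightarrow> g0 w" using lim[of w, unfolded tendsto_at_iff_sequentially comp_def] X by blast
      then have "(\<lambda>i. (norm (g (X i) w - g0 w))\<^sup>2) \<longlonglongrightarrow> (norm (g0 w - g0 w))\<^sup>2" by (intro tendsto_intros)
      then show "(\<lambda>i. (norm (g (X i) w - g0 w))\<^sup>2) \<longlonglongrightarrow> 0" by simp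
    qed
    show "AE w in lborel. norm ((norm (g (X i) w - g0 w))\<^sup>2) \<le> (2 * K)\<^sup>2 * exp (- c * (norm w)\<^sup>2)" for i
    proof (rule AE_I2)
      fix w :: 'e
      let ?E = "exp (- c * (norm w)\<^sup>2)"
      have "norm (g (X i) w - g0 w) \<le> norm (g (X i) w) + norm (g0 w)" by (rule norm_triangle_ineq4)
      also have "\<dots> \<le> 2 * K * ?E" using b[of "X i" w] b0[of w] X by simp
      finally have "(norm (g (X i) w - g0 w))\<^sup>2 \<le> (2 * K * ?E)\<^sup>2" by (intro power_mono) auto
      also have "\<dots> = (2 * K)\<^sup>2 * (?E * ?E)" by (simp add: power2_eq_square mult_ac)
      also have "\<dots> \<le> (2 * K)\<^sup>2 * (?E * 1)" using c by (intro mult_left_mono) auto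
      finally show "norm ((norm (g (X i) w - g0 w))\<^sup>2) \<le> (2 * K)\<^sup>2 * ?E" by simp
    qed
    show "integrable lborel (\<lambda>w::'e. (2 * K)\<^sup>2 * exp (- c * (norm w)\<^sup>2))"
      by (intro integrable_mult_right gaussian_integrable' c)
  qed simp
  then show "(\<lambda>i. LINT w|lborel. (norm (g (X i) w - g0 w))\<^sup>2) \<longlonglongrightarrow> 0" by simp
qed

lemma has_vector_derivativeI_quotient:
  fixes F :: "real \<Rightarrow> 'b::real_normed_vector"
  assumes "((\<lambda>t. (F t - F s) /\<^sub>R (t - s)) \<longlongrightarrow> D) (at s within S)"
  shows "(F has_vector_derivative D) (at s within S)"
  unfolding has_vector_derivative_def has_derivative_within
proof
  show "bounded_linear (\<lambda>x. x *\<^sub>R D)" by (rule bounded_linear_scaleR_left)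
  have "((\<lambda>t. (F t - F s) /\<^sub>R (t - s) - D) \<longlongrightarrow> 0) (at s within S)"
    using tendsto_diff[OF assms tendsto_const[of D]] by simp
  then have 1: "((\<lambda>t. norm ((F t - F s) /\<^sub>R (t - s) - D)) \<longlongrightarrow> 0) (at s within S)" by (rule tendsto_norm_zero)
  show "((\<lambda>t. (1 / norm (t - s)) *\<^sub>R (F t - (F s + (t - s) *\<^sub>R D))) \<longlongrightarrow> 0) (at s within S)"
  proof (rule Lim_null_comparison[OF _ 1])
    show "\<forall>\<^sub>F t in at s within S. norm ((1 / norm (t - s)) *\<^sub>R (F t - (F s + (t - s) *\<^sub>R D))) \<le> norm ((F t - F s) /\<^sub>R (t - s) - D)"
      unfolding eventually_at_filter
    proof (rule always_eventually, intro allI impI)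
      fix t assume "t \<noteq> s"
      then have "(F t - F s) /\<^sub>R (t - s) - D = (F t - (F s + (t - s) *\<^sub>R D)) /\<^sub>R (t - s)"
        by (simp add: scaleR_diff_right scaleR_add_right)
      then show "norm ((1 / norm (t - s)) *\<^sub>R (F t - (F s + (t - s) *\<^sub>R D))) \<le> norm ((F t - F s) /\<^sub>R (t - s) - D)"
        by (simp add: divide_inverse)
    qed
  qed
qed

lemma packet_lipschitz:
  fixes a :: "'e::euclidean_space"
  assumes d: "d > 0" and B: "\<And>t. \<bar>t\<bar> \<le> T \<Longrightarrow> norm (packet' \<kappa> d a p t w) \<le> B" and "\<bar>s\<bar> \<le> T" "\<bar>t\<bar> \<le> T"
  shows "norm (packet \<kappa> d a p s w - packet \<kappa> d a p t w) \<le> B * \<bar>s - t\<bar>"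
proof -
  have "norm (packet \<kappa> d a p s w - packet \<kappa> d a p t w) \<le> B * norm (s - t)"
  proof (rule differentiable_bound[where S="{-T..T}" and f'="\<lambda>x h. h *\<^sub>R packet' \<kappa> d a p x w"])
    show "((\<lambda>t. packet \<kappa> d a p t w) has_derivative (\<lambda>h. h *\<^sub>R packet' \<kappa> d a p x w)) (at x within {-T..T})" for x
      using packet_time_derivative[OF d, of \<kappa> a p w x] by (auto simp: has_vector_derivative_def intro: has_derivative_at_withinI)
    show "onorm (\<lambda>h. h *\<^sub>R packet' \<kappa> d a p x w) \<le> B" if "x \<in> {-T..T}" for x
      using B[of x] that by (intro onorm_le) (auto simp: mult.commute[of _ B] mult.commute[of _ "norm (packet' _ _ _ _ _ _)"] intro!: mult_right_mono)
  qed (use assms in auto)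
  then show ?thesis by simp
qed

section \<open>Duhamel formula against wave packets\<close>

text \<open>Let the test function evolve backwards: the derivative in \<open>s\<close> of the pairing of \<open>m s\<close> with
  the packet at time \<open>\<sigma> + z - s\<close> loses the free parts of both and only the potential term remains.
  The pairing is continuous in both of its arguments, and the weak equation is used for each fixed
  packet.\<close>

lemma packet_duhamel:
  fixes m :: "real \<Rightarrow> 'e::euclidean_space \<Rightarrow> complex"
  assumes sol: "solves_evolution A V f0 m"
    and A: "\<And>\<tau>. A (packet \<kappa> d a p \<tau>) = schr \<kappa> (packet \<kappa> d a p \<tau>)"
    and [measurable]: "V \<in> borel_measurable borel" and V: "\<And>w. \<bar>V w\<bar> \<le> v"
    and d: "d > 0" and z: "z \<ge> 0"
  shows "(LBINT w. m z w * packet \<kappa> d a p \<sigma> w) = (LBINT w. f0 w * packet \<kappa> d a p (\<sigma> + z) w)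
     + (LBINT s:{0..z}. (LBINT w. m s w * (of_real (V w) * packet \<kappa> d a p (\<sigma> + z - s) w)))" (is ?eq)
    and "set_integrable lborel {0..z} (\<lambda>s. LINT w|lborel. m s w * (of_real (V w) * packet \<kappa> d a p (\<sigma> + z - s) w))" (is ?int)
proof -
  note [measurable] = borel_measurable_packet[OF d] borel_measurable_packet'[OF d]
  let ?\<Phi> = "packet \<kappa> d a p" let ?\<Phi>' = "packet' \<kappa> d a p"
  define \<theta> where "\<theta> = \<sigma> + z"
  define T where "T = \<bar>\<theta>\<bar> + z"
  have T: "\<bar>\<theta> - s\<bar> \<le> T" if "s \<in> {0..z}" for s using that by (auto simp: T_def)
  obtain K c where K: "K \<ge> 0" "c > 0" and dom: "\<And>\<tau> w. \<bar>\<tau>\<bar> \<le> T \<Longrightarrow> norm (?\<Phi> \<tau> w) \<le> K * exp (- c * (norm w)\<^sup>2)"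
     "\<And>\<tau> w. \<bar>\<tau>\<bar> \<le> T \<Longrightarrow> norm (?\<Phi>' \<tau> w) \<le> K * exp (- c * (norm w)\<^sup>2)"
    using packet_dominated[OF d, of T \<kappa> a p] by blast
  have v0: "0 \<le> v" using V[of undefined] by linarith
  have path: "continuous_L2_path m" using sol by (simp add: solves_evolution_def)
  have m: "square_integrable (m s)" if "0 \<le> s" for s using path that by (simp add: continuous_L2_path_def)
  have mlim: "((\<lambda>t. LINT w|lborel. (norm (m t w - m s w))\<^sup>2) \<longlongrightarrow> 0) (at s within {0..z})" if "0 \<le> s" for s
    using path that by (auto simp: continuous_L2_path_def intro: tendsto_within_subset)
  have weak: "(LBINT w. m s w * \<phi> w) = (LBINT w. f0 w * \<phi> w)
      + (LBINT r:{0..s}. (LBINT w. m r w * (A \<phi> w + of_real (V w) * \<phi> w)))" if "schwartz \<phi>" "0 \<le> s" for \<phi> s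
    using sol that by (auto simp: solves_evolution_def)
  have sq: "square_integrable (?\<Phi> \<tau>)" "square_integrable (?\<Phi>' \<tau>)" if "\<bar>\<tau>\<bar> \<le> T" for \<tau>
    using dom that by (auto intro!: square_integrable_decay[OF _ K(2)])
  have sqV: "square_integrable (\<lambda>w. of_real (V w) * ?\<Phi> \<tau> w)" if "\<bar>\<tau>\<bar> \<le> T" for \<tau>
  proof (rule square_integrable_decay[OF _ K(2), of _ "v * K"])
    show "norm (of_real (V w) * ?\<Phi> \<tau> w) \<le> v * K * exp (- c * (norm w)\<^sup>2)" for w
      using mult_mono[OF V[of w] dom(1)[OF that, of w]] v0 by (simp add: norm_mult mult_ac)
  qed measurable
  define g where "g \<tau> r = (LBINT w. m r w * (?\<Phi>' \<tau> w + of_real (V w) * ?\<Phi> \<tau> w))" for \<tau> r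
  define h where "h s = (LBINT w. m s w * (of_real (V w) * ?\<Phi> (\<theta> - s) w))" for s
  have gsplit: "g \<tau> r = (LBINT w. m r w * ?\<Phi>' \<tau> w) + (LBINT w. m r w * (of_real (V w) * ?\<Phi> \<tau> w))" if "\<bar>\<tau>\<bar> \<le> T" "0 \<le> r" for \<tau> r
    unfolding g_def distrib_left by (intro Bochner_Integration.integral_add square_integrable_mult m sq sqV that)
  have constL2: "((\<lambda>t. LINT w|lborel. (norm (f w - f w))\<^sup>2) \<longlongrightarrow> 0) (at s within {0..z})" for f :: "'e \<Rightarrow> complex" and s
    by simp
  have evS: "\<forall>\<^sub>F t in at s within {0..z}. t \<in> {0..z}" for s by (simp add: eventually_at_filter)
  have gcont: "continuous_on {0..z} (g \<tau>)" if t: "\<bar>\<tau>\<bar> \<le> T" for \<tau>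
    unfolding continuous_on_def
  proof
    fix s assume s: "s \<in> {0..z}"
    have "((\<lambda>t. (LBINT w. m t w * ?\<Phi>' \<tau> w) + (LBINT w. m t w * (of_real (V w) * ?\<Phi> \<tau> w))) \<longlongrightarrow>
         (LBINT w. m s w * ?\<Phi>' \<tau> w) + (LBINT w. m s w * (of_real (V w) * ?\<Phi> \<tau> w))) (at s within {0..z})"
      by (intro tendsto_add L2_pairing_tendsto[where S="{0..z}"] m sq sqV t mlim constL2 evS) (use s in auto)
    then have "((\<lambda>t. (LBINT w. m t w * ?\<Phi>' \<tau> w) + (LBINT w. m t w * (of_real (V w) * ?\<Phi> \<tau> w))) \<longlongrightarrow> g \<tau> s) (at s within {0..z})"
      using gsplit[OF t, of s] s by simp
    then show "(g \<tau> \<longlongrightarrow> g \<tau> s) (at s within {0..z})"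
      by (rule Lim_transform_eventually) (use gsplit[OF t] in \<open>auto simp: eventually_at_filter intro!: always_eventually\<close>)
  qed
  have Bderiv: "((\<lambda>t. LINT w|lborel. m t w * ?\<Phi> \<tau> w) has_vector_derivative g \<tau> s) (at s within {0..z})"
    if t: "\<bar>\<tau>\<bar> \<le> T" and s: "s \<in> {0..z}" for \<tau> s
  proof -
    have "((\<lambda>t. (LBINT w. f0 w * ?\<Phi> \<tau> w) + integral {0..t} (g \<tau>)) has_vector_derivative 0 + g \<tau> s) (at s within {0..z})"
      by (intro has_vector_derivative_add has_vector_derivative_const integral_has_vector_derivative gcont t s)
    moreover have "(LBINT w. m t w * ?\<Phi> \<tau> w) = (LBINT w. f0 w * ?\<Phi> \<tau> w) + integral {0..t} (g \<tau>)" if "t \<in> {0..z}" for t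
    proof -
      have "continuous_on {0..t} (g \<tau>)" using gcont[OF \<open>\<bar>\<tau>\<bar> \<le> T\<close>] that by (rule_tac continuous_on_subset) auto
      then have "(LBINT r:{0..t}. g \<tau> r) = integral {0..t} (g \<tau>)"
        by (intro set_borel_integral_eq_integral borel_integrable_atLeastAtMost')
      then show ?thesis
        using weak[OF schwartz_packet[OF d], of t \<kappa> a p \<tau>] that unfolding A schr_packet[OF d] g_def by simp
    qed
    ultimately show ?thesis unfolding add_0_left by (rule has_vector_derivative_transform[OF s, rotated])
  qed
  define F where "F s = (LBINT w. m s w * ?\<Phi> (\<theta> - s) w)" for s
  have Fderiv: "(F has_vector_derivative h s) (at s within {0..z})" if s: "s \<in> {0..z}" for s
  proof -
    define q where "q t w = (?\<Phi> (\<theta> - t) w - ?\<Phi> (\<theta> - s) w) /\<^sub>R (t - s)" for t w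
    have qbound: "norm (q t w) \<le> K * exp (- c * (norm w)\<^sup>2)" if "t \<in> {0..z}" for t w
    proof -
      have "norm (?\<Phi> (\<theta> - t) w - ?\<Phi> (\<theta> - s) w) \<le> K * exp (- c * (norm w)\<^sup>2) * \<bar>(\<theta> - t) - (\<theta> - s)\<bar>"
        by (rule packet_lipschitz[OF d dom(2) T[OF that] T[OF s]])
      then have *: "norm (?\<Phi> (\<theta> - t) w - ?\<Phi> (\<theta> - s) w) \<le> K * exp (- c * (norm w)\<^sup>2) * \<bar>t - s\<bar>"
        by (simp add: abs_minus_commute)
      show ?thesis
      proof (cases "t = s")
        case False
        have "norm (q t w) = norm (?\<Phi> (\<theta> - t) w - ?\<Phi> (\<theta> - s) w) / \<bar>t - s\<bar>"
          unfolding q_def norm_scaleR by (simp add: divide_inverse mult.commute)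
        also have "\<dots> \<le> K * exp (- c * (norm w)\<^sup>2)" using * False by (subst pos_divide_le_eq) auto
        finally show ?thesis .
      qed (use K in \<open>simp add: q_def\<close>)
    qed
    have qlim: "((\<lambda>t. q t w) \<longlongrightarrow> - ?\<Phi>' (\<theta> - s) w) (at s within {0..z})" for w
    proof -
      have a: "((\<lambda>t. \<theta> - t) has_vector_derivative - 1) (at s)" by (auto intro!: derivative_eq_intros)
      have "(((\<lambda>\<tau>. ?\<Phi> \<tau> w) \<circ> (\<lambda>t. \<theta> - t)) has_vector_derivative (- 1) *\<^sub>R ?\<Phi>' (\<theta> - s) w) (at s)"
        by (rule vector_diff_chain_at[OF a packet_time_derivative[OF d]])
      then have "((\<lambda>t. ?\<Phi> (\<theta> - t) w) has_vector_derivative - ?\<Phi>' (\<theta> - s) w) (at s within {0..z})"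
        by (simp add: o_def has_vector_derivative_at_within)
      then have "((\<lambda>t. (?\<Phi> (\<theta> - t) w - ?\<Phi> (\<theta> - s) w - (t - s) *\<^sub>R (- ?\<Phi>' (\<theta> - s) w)) /\<^sub>R norm (t - s)) \<longlongrightarrow> 0) (at s within {0..z})"
        unfolding has_vector_derivative_def has_derivative_at_within by auto
      then have n: "((\<lambda>t. norm ((?\<Phi> (\<theta> - t) w - ?\<Phi> (\<theta> - s) w - (t - s) *\<^sub>R (- ?\<Phi>' (\<theta> - s) w)) /\<^sub>R norm (t - s))) \<longlongrightarrow> 0) (at s within {0..z})"
        by (rule tendsto_norm_zero)
      have "((\<lambda>t. q t w - (- ?\<Phi>' (\<theta> - s) w)) \<longlongrightarrow> 0) (at s within {0..z})"
      proof (rule Lim_null_comparison[OF _ n])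
        show "\<forall>\<^sub>F t in at s within {0..z}. norm (q t w - - ?\<Phi>' (\<theta> - s) w) \<le> norm ((?\<Phi> (\<theta> - t) w - ?\<Phi> (\<theta> - s) w - (t - s) *\<^sub>R (- ?\<Phi>' (\<theta> - s) w)) /\<^sub>R norm (t - s))"
          unfolding eventually_at_filter
        proof (rule always_eventually, intro allI impI)
          fix t assume "t \<noteq> s"
          then have "q t w - - ?\<Phi>' (\<theta> - s) w = (?\<Phi> (\<theta> - t) w - ?\<Phi> (\<theta> - s) w - (t - s) *\<^sub>R (- ?\<Phi>' (\<theta> - s) w)) /\<^sub>R (t - s)"
            by (simp add: q_def scaleR_diff_right scaleR_add_right)
          then show "norm (q t w - - ?\<Phi>' (\<theta> - s) w) \<le> norm ((?\<Phi> (\<theta> - t) w - ?\<Phi> (\<theta> - s) w - (t - s) *\<^sub>R (- ?\<Phi>' (\<theta> - s) w)) /\<^sub>R norm (t - s))"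
            by simp
        qed
      qed
      then show ?thesis by (rule LIM_zero_cancel)
    qed
    have qm: "q t \<in> borel_measurable borel" for t unfolding q_def by measurable
    have lim2: "((\<lambda>t. LINT w|lborel. m t w * q t w) \<longlongrightarrow> (LBINT w. m s w * (- ?\<Phi>' (\<theta> - s) w))) (at s within {0..z})"
    proof (rule L2_pairing_tendsto[where S="{0..z}"])
      show "((\<lambda>t. LINT w|lborel. (norm (q t w - - ?\<Phi>' (\<theta> - s) w))\<^sup>2) \<longlongrightarrow> 0) (at s within {0..z})"
        by (rule decay_L2_tendsto[OF _ _ K(2) qbound _ qlim]) (use dom(2)[OF T[OF s]] qm in auto)
      show "square_integrable (q t)" if "t \<in> {0..z}" for t
        by (rule square_integrable_decay[OF qm K(2) qbound[OF that]])
      show "square_integrable (\<lambda>w. - ?\<Phi>' (\<theta> - s) w)"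
        by (rule square_integrable_decay[OF _ K(2), of _ K]) (use dom(2)[OF T[OF s]] in auto)
      show "\<forall>\<^sub>F t in at s within {0..z}. t \<in> {0..z}" by (rule evS)
    qed (use s in \<open>auto intro!: m mlim\<close>)
    have d2: "((\<lambda>t. LINT w|lborel. m t w * (?\<Phi> (\<theta> - t) w - ?\<Phi> (\<theta> - s) w)) has_vector_derivative (LBINT w. m s w * (- ?\<Phi>' (\<theta> - s) w))) (at s within {0..z})"
    proof (rule has_vector_derivativeI_quotient)
      have "((LBINT w. m t w * (?\<Phi> (\<theta> - t) w - ?\<Phi> (\<theta> - s) w)) - (LBINT w. m s w * (?\<Phi> (\<theta> - s) w - ?\<Phi> (\<theta> - s) w))) /\<^sub>R (t - s)
         = (LBINT w. m t w * q t w)" for t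
        by (simp add: q_def flip: integral_scaleR_right)
      then show "((\<lambda>t. ((LBINT w. m t w * (?\<Phi> (\<theta> - t) w - ?\<Phi> (\<theta> - s) w)) - (LBINT w. m s w * (?\<Phi> (\<theta> - s) w - ?\<Phi> (\<theta> - s) w))) /\<^sub>R (t - s))
         \<longlongrightarrow> (LBINT w. m s w * (- ?\<Phi>' (\<theta> - s) w))) (at s within {0..z})"
        using lim2 by (simp only:)
    qed
    have sum: "F t = (LBINT w. m t w * ?\<Phi> (\<theta> - s) w) + (LBINT w. m t w * (?\<Phi> (\<theta> - t) w - ?\<Phi> (\<theta> - s) w))" if t: "t \<in> {0..z}" for t
    proof -
      have "F t = (LBINT w. m t w * ?\<Phi> (\<theta> - s) w + m t w * (?\<Phi> (\<theta> - t) w - ?\<Phi> (\<theta> - s) w))"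
        unfolding F_def by (simp add: algebra_simps)
      also have "\<dots> = (LBINT w. m t w * ?\<Phi> (\<theta> - s) w) + (LBINT w. m t w * (?\<Phi> (\<theta> - t) w - ?\<Phi> (\<theta> - s) w))"
        by (intro Bochner_Integration.integral_add square_integrable_mult square_integrable_diff m sq T t s) (use t in auto)
      finally show ?thesis .
    qed
    have "((\<lambda>t. (LBINT w. m t w * ?\<Phi> (\<theta> - s) w) + (LBINT w. m t w * (?\<Phi> (\<theta> - t) w - ?\<Phi> (\<theta> - s) w)))
       has_vector_derivative g (\<theta> - s) s + (LBINT w. m s w * (- ?\<Phi>' (\<theta> - s) w))) (at s within {0..z})"
      by (intro has_vector_derivative_add Bderiv d2 T s)
    moreover have "g (\<theta> - s) s + (LBINT w. m s w * (- ?\<Phi>' (\<theta> - s) w)) = h s"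
      using gsplit[OF T[OF s], of s] s by (simp add: h_def)
    ultimately have "((\<lambda>t. (LBINT w. m t w * ?\<Phi> (\<theta> - s) w) + (LBINT w. m t w * (?\<Phi> (\<theta> - t) w - ?\<Phi> (\<theta> - s) w)))
       has_vector_derivative h s) (at s within {0..z})" by (simp only:)
    then show ?thesis by (rule has_vector_derivative_transform[OF s, rotated]) (rule sum)
  qed
  have hcont: "continuous_on {0..z} h"
    unfolding continuous_on_def h_def
  proof
    fix s assume s: "s \<in> {0..z}"
    show "((\<lambda>t. LINT w|lborel. m t w * (of_real (V w) * ?\<Phi> (\<theta> - t) w)) \<longlongrightarrow> (LBINT w. m s w * (of_real (V w) * ?\<Phi> (\<theta> - s) w))) (at s within {0..z})"
    proof (rule L2_pairing_tendsto[where S="{0..z}"])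
      show "((\<lambda>t. LINT w|lborel. (norm (of_real (V w) * ?\<Phi> (\<theta> - t) w - of_real (V w) * ?\<Phi> (\<theta> - s) w))\<^sup>2) \<longlongrightarrow> 0) (at s within {0..z})"
      proof (rule decay_L2_tendsto[OF _ _ K(2), of _ _ _ "v * K"])
        show "norm (of_real (V w) * ?\<Phi> (\<theta> - t) w) \<le> v * K * exp (- c * (norm w)\<^sup>2)" if "t \<in> {0..z}" for w t
          using mult_mono[OF V[of w] dom(1)[OF T[OF that], of w]] v0 by (simp add: norm_mult mult_ac)
        show "norm (of_real (V w) * ?\<Phi> (\<theta> - s) w) \<le> v * K * exp (- c * (norm w)\<^sup>2)" for w
          using mult_mono[OF V[of w] dom(1)[OF T[OF s], of w]] v0 by (simp add: norm_mult mult_ac)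
        show "((\<lambda>t. of_real (V w) * ?\<Phi> (\<theta> - t) w) \<longlongrightarrow> of_real (V w) * ?\<Phi> (\<theta> - s) w) (at s within {0..z})" for w
        proof -
          have "isCont (\<lambda>\<tau>. ?\<Phi> \<tau> w) (\<theta> - s)" using packet_time_derivative[OF d] by (rule has_vector_derivative_continuous)
          then have "((\<lambda>t. ?\<Phi> (\<theta> - t) w) \<longlongrightarrow> ?\<Phi> (\<theta> - s) w) (at s within {0..z})"
            by (rule isCont_tendsto_compose) (intro tendsto_intros)
          then show ?thesis by (intro tendsto_intros)
        qed
      qed measurable
      show "\<forall>\<^sub>F t in at s within {0..z}. t \<in> {0..z}" by (rule evS)
    qed (use s in \<open>auto intro!: m mlim sqV T\<close>)
  qed
  have "(LBINT s:{0..z}. h s) = F z - F 0"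
    unfolding set_lebesgue_integral_def by (intro integral_FTC_atLeastAtMost z Fderiv hcont) auto
  moreover have "F z = (LBINT w. m z w * ?\<Phi> \<sigma> w)" by (simp add: F_def \<theta>_def)
  moreover have "F 0 = (LBINT w. f0 w * ?\<Phi> (\<sigma> + z) w)"
  proof -
    have "(LBINT r:{0..0::real}. k r) = 0" for k :: "real \<Rightarrow> complex"
      unfolding set_lebesgue_integral_def
    proof (rule integral_eq_zero_AE)
      show "AE r in lborel. indicator {0..0} r *\<^sub>R k r = 0"
        using AE_lborel_singleton[of "0::real"] by eventually_elim (simp add: indicator_def)
    qed
    then show ?thesis using weak[OF schwartz_packet[OF d], of 0 \<kappa> a p "\<sigma> + z"] by (simp add: F_def \<theta>_def)
  qed
  ultimately show ?eq unfolding h_def \<theta>_def by (simp add: algebra_simps)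
  show ?int using borel_integrable_atLeastAtMost'[OF hcont] unfolding h_def \<theta>_def .
qed

section \<open>Gronwall inequality for packet pairings\<close>

lemma integral_exp_interval:
  fixes l s B :: real
  assumes "l > 0" "s \<ge> 0"
  shows "integrable lborel (\<lambda>r. indicator {0..s} r * (B * exp (l * r)))"
    and "(LBINT r. indicator {0..s} r * (B * exp (l * r))) \<le> \<bar>B\<bar> / l * exp (l * s)"
proof -
  have "set_integrable lborel {0..s} (\<lambda>r. B * exp (l * r))"
    by (intro borel_integrable_atLeastAtMost' continuous_intros)
  then show "integrable lborel (\<lambda>r. indicator {0..s} r * (B * exp (l * r)))" by (simp add: set_integrable_def)
  have "(LBINT r. indicator {0..s} r *\<^sub>R (B * exp (l * r))) = (B / l) * exp (l * s) - (B / l) * exp (l * 0)"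
    by (intro integral_FTC_atLeastAtMost assms continuous_intros)
       (use assms in \<open>auto intro!: derivative_eq_intros simp flip: has_real_derivative_iff_has_vector_derivative\<close>)
  also have "\<dots> = (B / l) * (exp (l * s) - 1)" by (simp add: algebra_simps)
  also have "\<dots> \<le> \<bar>B\<bar> / l * exp (l * s)" using assms by (intro mult_mono divide_right_mono) auto
  finally show "(LBINT r. indicator {0..s} r * (B * exp (l * r))) \<le> \<bar>B\<bar> / l * exp (l * s)" by simp
qed

text \<open>By Galilean invariance the hypothesis holds with the same constants for all modulated
  packets, so multiplying by \<open>V\<close> costs the factor \<open>b\<close> (\<open>FS_dual\<close>). The growth rate \<open>2 * b\<close> instead
  of \<open>b\<close> leaves room for a contraction factor of one half at each iteration.\<close>

lemma packet_gronwall: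
  fixes D :: "real \<Rightarrow> 'e::euclidean_space \<Rightarrow> complex"
  assumes d: "d > 0" and b: "b > 0" and V: "FS UNIV b V"
    and int: "\<And>s a p \<tau>. 0 \<le> s \<Longrightarrow> 0 \<le> \<tau> \<Longrightarrow> s + \<tau> \<le> Z \<Longrightarrow> integrable lborel (\<lambda>w. D s w * packet \<kappa> d a p \<tau> w)"
    and bdd: "\<And>s a p \<tau>. 0 \<le> s \<Longrightarrow> 0 \<le> \<tau> \<Longrightarrow> s + \<tau> \<le> Z \<Longrightarrow> norm (LBINT w. D s w * packet \<kappa> d a p \<tau> w) \<le> M"
    and eq: "\<And>s a p \<tau>. 0 \<le> s \<Longrightarrow> 0 \<le> \<tau> \<Longrightarrow> s + \<tau> \<le> Z \<Longrightarrow>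
       norm ((LBINT w. D s w * packet \<kappa> d a p \<tau> w) - (LBINT r:{0..s}. (LBINT w. D r w * (V w * packet \<kappa> d a p (\<tau> + s - r) w)))) \<le> \<alpha>"
    and s: "0 \<le> s" "0 \<le> \<tau>" "s + \<tau> \<le> Z"
  shows "norm (LBINT w. D s w * packet \<kappa> d a p \<tau> w) \<le> 2 * \<alpha> * exp (2 * b * s)"
proof -
  have \<alpha>: "0 \<le> \<alpha>" using eq[OF s, of a p] norm_ge_zero order_trans by blast
  have M: "0 \<le> M" using bdd[OF s, of a p] norm_ge_zero order_trans by blast
  \<comment> \<open>Each use of the equation halves the contribution of the a priori bound \<open>M\<close>.\<close>
  have step: "norm (LBINT w. D s w * packet \<kappa> d a p \<tau> w) \<le> (2 * \<alpha> + M / 2 ^ n) * exp (2 * b * s)"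
    if "0 \<le> s" "0 \<le> \<tau>" "s + \<tau> \<le> Z" for n s \<tau> a p
    using that
  proof (induction n arbitrary: s \<tau> a p)
    case 0
    have "M * 1 \<le> (2 * \<alpha> + M) * exp (2 * b * s)" using \<alpha> M b 0 by (intro mult_mono) auto
    then show ?case using bdd[OF 0, of a p] by simp
  next
    case (Suc n)
    let ?A = "2 * \<alpha> + M / 2 ^ n"
    have A: "0 \<le> ?A" using \<alpha> M by simp
    have V1: "norm (LBINT w. D r w * (V w * packet \<kappa> d a p (\<tau> + s - r) w)) \<le> b * (?A * exp (2 * b * r))" if r: "r \<in> {0..s}" for r
    proof -
      have r': "0 \<le> r" "0 \<le> \<tau> + s - r" "r + (\<tau> + s - r) \<le> Z" using r Suc.prems by auto
      have "norm (LBINT w. V w * (D r w * packet \<kappa> d a p (\<tau> + s - r) w)) \<le> b * (?A * exp (2 * b * r))"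
      proof (rule FS_dual[OF V int[OF r']])
        fix l :: 'e
        have "(LBINT w. cis (l \<bullet> w) * (D r w * packet \<kappa> d a p (\<tau> + s - r) w))
          = (LBINT w. cis ((\<tau> + s - r) * (l \<bullet> vel \<kappa> p + symb \<kappa> l)) * (D r w * packet \<kappa> d (a - (\<tau> + s - r) *\<^sub>R vel \<kappa> l) (p + l) (\<tau> + s - r) w))"
          by (intro Bochner_Integration.integral_cong refl)
             (use packet_modulate[of l _ \<kappa> d a p "\<tau> + s - r"] in \<open>simp add: mult.left_commute\<close>)
        then show "norm (LBINT w. cis (l \<bullet> w) * (D r w * packet \<kappa> d a p (\<tau> + s - r) w)) \<le> ?A * exp (2 * b * r)"
          using Suc.IH[OF r', of "a - (\<tau> + s - r) *\<^sub>R vel \<kappa> l" "p + l"] by (simp add: norm_mult)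
      qed
      then show ?thesis by (simp add: mult.left_commute)
    qed
    have "norm (LBINT r:{0..s}. (LBINT w. D r w * (V w * packet \<kappa> d a p (\<tau> + s - r) w)))
       \<le> (LBINT r. norm (indicator {0..s} r *\<^sub>R (LBINT w. D r w * (V w * packet \<kappa> d a p (\<tau> + s - r) w))))"
      unfolding set_lebesgue_integral_def by (rule integral_norm_bound)
    also have "\<dots> \<le> (LBINT r. indicator {0..s} r * (b * ?A * exp (2 * b * r)))"
      using b Suc.prems A V1
      by (intro integral_mono' integral_exp_interval(1)) (auto simp: indicator_def mult.assoc)
    also have "\<dots> \<le> \<bar>b * ?A\<bar> / (2 * b) * exp (2 * b * s)"
      using b Suc.prems by (intro integral_exp_interval(2)) auto
    also have "\<bar>b * ?A\<bar> / (2 * b) = ?A / 2" using b A by (simp add: abs_mult)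
    finally have 1: "norm (LBINT r:{0..s}. (LBINT w. D r w * (V w * packet \<kappa> d a p (\<tau> + s - r) w))) \<le> ?A / 2 * exp (2 * b * s)" .
    have "norm (LBINT w. D s w * packet \<kappa> d a p \<tau> w) \<le> \<alpha> + ?A / 2 * exp (2 * b * s)"
      using norm_triangle_sub[of "LBINT w. D s w * packet \<kappa> d a p \<tau> w" "LBINT r:{0..s}. (LBINT w. D r w * (V w * packet \<kappa> d a p (\<tau> + s - r) w))"]
        eq[OF Suc.prems, of a p] 1 by linarith
    moreover have "\<alpha> \<le> \<alpha> * exp (2 * b * s)" using \<alpha> b Suc.prems by (simp add: mult_le_cancel_left1)
    moreover have "\<alpha> * exp (2 * b * s) + ?A / 2 * exp (2 * b * s) = (2 * \<alpha> + M / 2 ^ Suc n) * exp (2 * b * s)"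
      by (simp add: field_simps)
    ultimately show ?case by linarith
  qed
  have L: "(\<lambda>n. (2 * \<alpha> + M / 2 ^ n) * exp (2 * b * s)) \<longlonglongrightarrow> (2 * \<alpha> + 0) * exp (2 * b * s)"
    by (intro tendsto_intros LIMSEQ_divide_realpow_zero) auto
  have "norm (LBINT w. D s w * packet \<kappa> d a p \<tau> w) \<le> (2 * \<alpha> + 0) * exp (2 * b * s)"
    by (rule LIMSEQ_le_const[OF L]) (use step[OF s] in blast)
  then show ?thesis by simp
qed

text \<open>At time 0 a packet of frequency 0 is a real Gaussian, and these form an approximate identity
  as \<open>d\<close> tends to 0.\<close>

lemma pointwise_bound_from_packets:
  fixes f :: "'e::euclidean_space \<Rightarrow> complex"
  assumes cont: "isCont f a" and [measurable]: "f \<in> borel_measurable borel"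
    and int: "\<And>c. c > 0 \<Longrightarrow> integrable lborel (\<lambda>x. f x * of_real (exp (- c * (norm (x - a))\<^sup>2)))"
    and b: "\<And>d. d > 0 \<Longrightarrow> norm (LBINT w. f w * packet \<kappa> d a 0 0 w) \<le> B"
  shows "norm (f a) \<le> B"
proof -
  have "((\<lambda>d. LINT x|lborel. of_real (gauss d x) * f (a + x)) \<longlongrightarrow> f (a + 0)) (at_right 0)"
  proof (rule gauss_approximate_identity)
    show "isCont (\<lambda>x. f (a + x)) 0" using cont by (simp add: isCont_iff continuous_at LIM_offset_zero_iff[of a])
    show "integrable lborel (\<lambda>x. f (a + x) * of_real (exp (- c * (norm x)\<^sup>2)))" if "c > 0" for c
      using int[OF that] integral_lborel_translate(2)[of "\<lambda>x. f x * of_real (exp (- c * (norm (x - a))\<^sup>2))" a] by simp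
  qed measurable
  then have "((\<lambda>d. norm (LBINT x. of_real (gauss d x) * f (a + x))) \<longlongrightarrow> norm (f a)) (at_right 0)"
    by (intro tendsto_norm) simp
  moreover have "\<forall>\<^sub>F d in at_right 0. norm (LBINT x. of_real (gauss d x) * f (a + x)) \<le> B"
    using eventually_at_right_less[of "0::real"]
  proof eventually_elim
    case (elim d)
    have "(LBINT x. of_real (gauss d x) * f (a + x)) = (LBINT w. f w * packet \<kappa> d a 0 0 w)"
      by (subst integral_lborel_translate(1)[symmetric, of _ a]) (simp add: packet_0[OF elim] mult.commute)
    then show ?case using b[OF elim] by simp
  qed
  ultimately show ?thesis by (intro tendsto_upperbound[of _ "norm (f a)" "at_right 0" B]) auto
qed

section \<open>The spectral density of an integrable covariance function\<close>

text \<open>Positive definiteness for families in which points may repeat: collect the coefficients of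
  equal points.\<close>

lemma covariance_multiset:
  fixes I :: "'a set"
  assumes C: "covariance_function C" and I: "finite I"
  shows "0 \<le> (\<Sum>i\<in>I. \<Sum>j\<in>I. a i * a j * C (X i - X j))"
proof -
  define c where "c x = (\<Sum>i\<in>{i\<in>I. X i = x}. a i)" for x
  have "(\<Sum>i\<in>I. \<Sum>j\<in>I. a i * a j * C (X i - X j)) = (\<Sum>x\<in>X ` I. \<Sum>i\<in>{i\<in>I. X i = x}. \<Sum>y\<in>X ` I. \<Sum>j\<in>{j\<in>I. X j = y}. a i * a j * C (X i - X j))"
  proof -
    have g: "(\<Sum>j\<in>I. f j) = (\<Sum>y\<in>X ` I. \<Sum>j\<in>{j\<in>I. X j = y}. f j)" for f :: "'a \<Rightarrow> real"
      by (rule sum.image_gen[OF I])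
    show ?thesis by (simp only: g[symmetric])
  qed
  also have "\<dots> = (\<Sum>x\<in>X ` I. \<Sum>y\<in>X ` I. \<Sum>i\<in>{i\<in>I. X i = x}. \<Sum>j\<in>{j\<in>I. X j = y}. a i * a j * C (X i - X j))"
    by (intro sum.cong refl sum.swap)
  also have "\<dots> = (\<Sum>x\<in>X ` I. \<Sum>y\<in>X ` I. c x * c y * C (x - y))"
  proof (intro sum.cong refl)
    fix x y
    have "(\<Sum>i\<in>{i\<in>I. X i = x}. \<Sum>j\<in>{j\<in>I. X j = y}. a i * a j * C (X i - X j))
      = (\<Sum>i\<in>{i\<in>I. X i = x}. \<Sum>j\<in>{j\<in>I. X j = y}. a i * a j * C (x - y))"
      by (intro sum.cong refl) auto
    also have "\<dots> = c x * c y * C (x - y)" unfolding c_def sum_product by (simp only: sum_distrib_right)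
    finally show "(\<Sum>i\<in>{i\<in>I. X i = x}. \<Sum>j\<in>{j\<in>I. X j = y}. a i * a j * C (X i - X j)) = c x * c y * C (x - y)" .
  qed
  finally show ?thesis using C I by (simp add: covariance_function_def)
qed

text \<open>The positive definite form on the two points \<open>x\<close> and 0 with coefficients 1 and \<open>\<plusminus>1\<close>.\<close>

lemma covariance_bound:
  assumes C: "covariance_function C"
  shows "\<bar>C x\<bar> \<le> C 0"
proof -
  have e: "C (- x) = C x" using C by (simp add: covariance_function_def)
  have "0 \<le> (\<Sum>i\<in>{False, True}. \<Sum>j\<in>{False, True}. (if i then s else 1) * (if j then s else 1) * C ((if i then x else 0) - (if j then x else 0)))" for s
    by (rule covariance_multiset[OF C]) simp
  from this[of 1] this[of "-1"] show ?thesis by (simp add: e)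
qed

text \<open>Replace the points \<open>x\<close> by the values of simple functions converging to the identity; the
  integral becomes a finite positive definite form, and dominated convergence removes the
  approximation.\<close>

lemma covariance_pos_integral:
  fixes C :: "real^2 \<Rightarrow> real" and g :: "real^2 \<Rightarrow> real"
  assumes C: "covariance_function C" and g: "integrable lborel g"
  shows "0 \<le> (LBINT x. LINT y|lborel. g x * g y * C (x - y))"
proof -
  have cont: "continuous_on UNIV C" using C by (simp add: covariance_function_def)
  have [measurable]: "C \<in> borel_measurable borel" using cont by (rule borel_measurable_continuous_onI)
  have [measurable]: "g \<in> borel_measurable borel" using g by auto
  \<comment> \<open>Simple functions with finitely many values that converge to the identity.\<close>
  obtain s :: "nat \<Rightarrow> real^2 \<Rightarrow> real^2" where s: "\<And>n. simple_function borel (s n)" "\<And>x. (\<lambda>n. s n x) \<longlonglongrightarrow> x"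
    using borel_measurable_implies_sequence_metric[of "\<lambda>x::real^2. x" borel 0] by (auto simp: space_borel)
  have [measurable]: "s n \<in> borel_measurable borel" for n using s(1) by (rule borel_measurable_simple_function)
  have fin: "finite (range (s n))" for n using s(1)[of n] by (simp add: simple_function_def)
  have bnd: "\<bar>g x * g y * C u\<bar> \<le> \<bar>g x\<bar> * \<bar>g y\<bar> * C 0" for x y u
    using covariance_bound[OF C, of u] by (simp add: abs_mult mult_left_mono)
  have gi: "integrable lborel (\<lambda>y. \<bar>g x\<bar> * \<bar>g y\<bar> * C 0)" for x
    using g by (intro integrable_mult_left integrable_mult_right integrable_abs)
  have pos: "0 \<le> (LBINT x. LINT y|lborel. g x * g y * C (s n x - s n y))" for n
  proof -
    let ?R = "range (s n)" let ?A = "\<lambda>a. s n -` {a}"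
    have [measurable]: "?A a \<in> sets borel" for a
      using measurable_sets[OF \<open>s n \<in> borel_measurable borel\<close>, of "{a}"] by simp
    define G where "G a = (LBINT x. g x * indicator (?A a) x)" for a
    have Gi: "integrable lborel (\<lambda>x. g x * indicator (?A a) x)" for a
      using g by (intro integrable_mult_indicator[where f=g, simplified mult.commute[of "indicator _ _"] real_scaleR_def]) auto
    have inner: "(LBINT y. g x * g y * C (s n x - s n y)) = g x * (\<Sum>b\<in>?R. G b * C (s n x - b))" for x
    proof -
      have eq: "g x * g y * C (s n x - s n y) = g x * (\<Sum>b\<in>?R. g y * indicator (?A b) y * C (s n x - b))" for y
      proof -
        have "(\<Sum>b\<in>?R. g y * indicator (?A b) y * C (s n x - b)) = (\<Sum>b\<in>?R. if b = s n y then g y * C (s n x - b) else 0)"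
          by (intro sum.cong refl) (auto simp: indicator_def)
        also have "\<dots> = g y * C (s n x - s n y)" using fin by simp
        finally show ?thesis by simp
      qed
      have "(LBINT y. g x * g y * C (s n x - s n y)) = (LBINT y. g x * (\<Sum>b\<in>?R. g y * indicator (?A b) y * C (s n x - b)))"
        by (intro Bochner_Integration.integral_cong refl eq)
      also have "\<dots> = g x * (\<Sum>b\<in>?R. G b * C (s n x - b))"
        unfolding G_def using Gi by (subst integral_mult_right_zero, subst Bochner_Integration.integral_sum) auto
      finally show ?thesis .
    qed
    have "g x * (\<Sum>b\<in>?R. G b * C (s n x - b)) = (\<Sum>a\<in>?R. g x * indicator (?A a) x * (\<Sum>b\<in>?R. G b * C (a - b)))" for x
    proof -
      have "(\<Sum>a\<in>?R. g x * indicator (?A a) x * (\<Sum>b\<in>?R. G b * C (a - b))) = (\<Sum>a\<in>?R. if a = s n x then g x * (\<Sum>b\<in>?R. G b * C (a - b)) else 0)"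
        by (intro sum.cong refl) (auto simp: indicator_def)
      then show ?thesis using fin by simp
    qed
    then have "(LBINT x. LINT y|lborel. g x * g y * C (s n x - s n y)) = (LBINT x. (\<Sum>a\<in>?R. g x * indicator (?A a) x * (\<Sum>b\<in>?R. G b * C (a - b))))"
      unfolding inner by simp
    also have "\<dots> = (\<Sum>a\<in>?R. G a * (\<Sum>b\<in>?R. G b * C (a - b)))"
      unfolding G_def using Gi by (subst Bochner_Integration.integral_sum) auto
    also have "\<dots> = (\<Sum>a\<in>?R. \<Sum>b\<in>?R. G a * G b * C (a - b))" by (simp add: sum_distrib_left mult_ac)
    finally show ?thesis using covariance_multiset[OF C fin, of G "\<lambda>x. x"] by simp
  qed
  have "(\<lambda>n. LINT x|lborel. LINT y|lborel. g x * g y * C (s n x - s n y)) \<longlonglongrightarrow> (LBINT x. LINT y|lborel. g x * g y * C (x - y))"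
  proof (rule integral_dominated_convergence[where w="\<lambda>x. \<bar>g x\<bar> * (LBINT y. \<bar>g y\<bar>) * C 0"])
    show "AE x in lborel. (\<lambda>n. LINT y|lborel. g x * g y * C (s n x - s n y)) \<longlonglongrightarrow> (LBINT y. g x * g y * C (x - y))"
    proof (rule AE_I2)
      fix x
      show "(\<lambda>n. LINT y|lborel. g x * g y * C (s n x - s n y)) \<longlonglongrightarrow> (LBINT y. g x * g y * C (x - y))"
      proof (rule integral_dominated_convergence[OF _ _ gi[of x]])
        show "AE y in lborel. (\<lambda>n. g x * g y * C (s n x - s n y)) \<longlonglongrightarrow> g x * g y * C (x - y)"
        proof (rule AE_I2)
          fix y
          have "(\<lambda>n. C (s n x - s n y)) \<longlonglongrightarrow> C (x - y)"
            by (rule continuous_on_tendsto_compose[OF cont]) (auto intro: tendsto_diff s)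
          then show "(\<lambda>n. g x * g y * C (s n x - s n y)) \<longlonglongrightarrow> g x * g y * C (x - y)" by (intro tendsto_intros)
        qed
      qed (use bnd in auto)
    qed
    show "AE x in lborel. norm (LBINT y. g x * g y * C (s n x - s n y)) \<le> \<bar>g x\<bar> * (LBINT y. \<bar>g y\<bar>) * C 0" for n
    proof (rule AE_I2)
      fix x
      have "norm (LBINT y. g x * g y * C (s n x - s n y)) \<le> (LBINT y. norm (g x * g y * C (s n x - s n y)))" by (rule integral_norm_bound)
      also have "\<dots> \<le> (LBINT y. \<bar>g x\<bar> * \<bar>g y\<bar> * C 0)"
        by (rule integral_mono'[OF gi]) (use bnd covariance_bound[OF C, of 0] in auto)
      finally show "norm (LBINT y. g x * g y * C (s n x - s n y)) \<le> \<bar>g x\<bar> * (LBINT y. \<bar>g y\<bar>) * C 0" by simp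
    qed
    show "integrable lborel (\<lambda>x. \<bar>g x\<bar> * (LBINT y. \<bar>g y\<bar>) * C 0)"
      using g by (intro integrable_mult_left integrable_abs)
  qed measurable
  then show ?thesis by (rule LIMSEQ_le_const) (use pos in auto)
qed

text \<open>The Fourier transform of the even function \<open>C\<close>; the sine part vanishes.\<close>

definition spec :: "(real^2 \<Rightarrow> real) \<Rightarrow> real^2 \<Rightarrow> real" where
  "spec C k = (LBINT x. C x * cos (k \<bullet> x)) / (2 * pi)\<^sup>2"

lemma spec_complex:
  assumes C: "covariance_function C" and int: "integrable lborel C"
  shows "(LBINT x. of_real (C x) * cis (k \<bullet> x)) = of_real ((2 * pi)\<^sup>2 * spec C k)"
proof -
  have [measurable]: "C \<in> borel_measurable borel" using int by auto
  have ic: "integrable lborel (\<lambda>x. C x * cos (k \<bullet> x))" and isn: "integrable lborel (\<lambda>x. C x * sin (k \<bullet> x))"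
    by (rule Bochner_Integration.integrable_bound[OF int]; auto simp: abs_mult mult_left_le)+
  have "(LBINT x. C x * sin (k \<bullet> x)) = (LBINT x. C (- x) * sin (k \<bullet> - x))"
    by (rule integral_lborel_reflect(1)[symmetric])
  also have "\<dots> = - (LBINT x. C x * sin (k \<bullet> x))"
    using C by (simp add: covariance_function_def)
  finally have z: "(LBINT x. C x * sin (k \<bullet> x)) = 0" by simp
  have "of_real (C x) * cis (k \<bullet> x) = of_real (C x * cos (k \<bullet> x)) + \<i> * of_real (C x * sin (k \<bullet> x))" for x
    by (simp add: cis.ctr complex_eq_iff)
  then have "(LBINT x. of_real (C x) * cis (k \<bullet> x)) = (LBINT x. of_real (C x * cos (k \<bullet> x)) + \<i> * of_real (C x * sin (k \<bullet> x)))"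
    by simp
  also have "\<dots> = of_real (LBINT x. C x * cos (k \<bullet> x)) + \<i> * of_real (LBINT x. C x * sin (k \<bullet> x))"
    using ic isn by (subst Bochner_Integration.integral_add) (auto simp del: of_real_mult)
  finally show ?thesis by (simp add: z spec_def)
qed

text \<open>Bochner's argument: \<open>covariance_pos_integral\<close> for Gaussians times cosine and sine, added up,
  gives \<open>cos (k \<bullet> (x - y)) C (x - y)\<close>, and the Gaussian weight in the remaining variable
  integrates out.\<close>

lemma gaussian_regularised_nonneg:
  assumes C: "covariance_function C" and int: "integrable lborel C" and d: "d > 0"
  shows "0 \<le> (LBINT q. C q * cos (k \<bullet> q) * exp (- (d / 2) * (norm q)\<^sup>2))"
proof -
  have [measurable]: "C \<in> borel_measurable borel" using int by auto
  let ?g = "\<lambda>x::real^2. exp (- d * (norm x)\<^sup>2)"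
  have g: "integrable lborel ?g" by (rule gaussian_integrable'[OF d])
  have p: "0 \<le> (LBINT x. LINT y|lborel. (?g x * h (k \<bullet> x)) * (?g y * h (k \<bullet> y)) * C (x - y))"
    if [measurable]: "h \<in> borel_measurable borel" and "\<And>t. \<bar>h t\<bar> \<le> 1" for h :: "real \<Rightarrow> real"
    using that by (intro covariance_pos_integral[OF C] Bochner_Integration.integrable_bound[OF g]) (auto simp: abs_mult mult_left_le)
  have I: "integrable (lborel \<Otimes>\<^sub>M lborel) (\<lambda>(x, y). (?g x * h (k \<bullet> x)) * (?g y * h (k \<bullet> y)) * C (x - y))"
    if [measurable]: "h \<in> borel_measurable borel" and h: "\<And>t. \<bar>h t\<bar> \<le> 1" for h :: "real \<Rightarrow> real"
  proof -
    have "integrable (lborel \<Otimes>\<^sub>M lborel) (\<lambda>(x, y). complex_of_real ((?g x * h (k \<bullet> x)) * (?g y * h (k \<bullet> y)) * C (x - y)))"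
    proof (rule integrable_pair_bound[where b="\<lambda>x. ?g x * C 0" and \<phi>="\<lambda>y. of_real (?g y)"])
      show "norm (complex_of_real ((?g x * h (k \<bullet> x)) * (?g y * h (k \<bullet> y)) * C (x - y))) \<le> ?g x * C 0 * norm (complex_of_real (?g y))" for x y
      proof -
        have "\<bar>(?g x * h (k \<bullet> x)) * (?g y * h (k \<bullet> y)) * C (x - y)\<bar> \<le> (?g x * 1) * (?g y * 1) * C 0"
          unfolding abs_mult using h covariance_bound[OF C]
          by (intro mult_mono) (auto intro: order_trans[OF abs_ge_zero])
        then show ?thesis unfolding norm_of_real by (simp add: mult_ac)
      qed
    qed (use g lborel.sigma_finite_measure_axioms in \<open>auto intro!: integrable_of_real\<close>)
    then show ?thesis by (simp only: case_prod_beta' complex_of_real_integrable_eq)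
  qed
  let ?F = "\<lambda>x y. ?g x * ?g y * (cos (k \<bullet> (x - y)) * C (x - y))"
  have split: "(?g x * cos (k \<bullet> x)) * (?g y * cos (k \<bullet> y)) * C (x - y) + (?g x * sin (k \<bullet> x)) * (?g y * sin (k \<bullet> y)) * C (x - y) = ?F x y" for x y
    by (simp add: inner_diff_right cos_diff algebra_simps)
  note Ic = I[of cos] and Is = I[of sin]
  have Fint: "integrable (lborel \<Otimes>\<^sub>M lborel) (\<lambda>(x, y). ?F x y)"
    using Bochner_Integration.integrable_add[OF Ic Is] unfolding case_prod_beta' split by simp
  have "0 \<le> (LINT z|(lborel \<Otimes>\<^sub>M lborel). (case z of (x, y) \<Rightarrow> (?g x * cos (k \<bullet> x)) * (?g y * cos (k \<bullet> y)) * C (x - y)))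
     + (LINT z|(lborel \<Otimes>\<^sub>M lborel). (case z of (x, y) \<Rightarrow> (?g x * sin (k \<bullet> x)) * (?g y * sin (k \<bullet> y)) * C (x - y)))"
    using p[of cos] p[of sin] lborel_pair.integral_fst'[OF Ic] lborel_pair.integral_fst'[OF Is]
    by (simp add: case_prod_beta')
  also have "\<dots> = (LINT z|(lborel \<Otimes>\<^sub>M lborel). (case z of (x, y) \<Rightarrow> ?F x y))"
  proof -
    have "(\<lambda>z. (case z of (x, y) \<Rightarrow> (?g x * cos (k \<bullet> x)) * (?g y * cos (k \<bullet> y)) * C (x - y))
       + (case z of (x, y) \<Rightarrow> (?g x * sin (k \<bullet> x)) * (?g y * sin (k \<bullet> y)) * C (x - y))) = (\<lambda>z. case z of (x, y) \<Rightarrow> ?F x y)"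
      by (rule ext) (simp only: split case_prod_beta')
    then show ?thesis using Bochner_Integration.integral_add[OF Ic Is] by simp
  qed
  also have "\<dots> = (LBINT x. LINT y|lborel. ?F x y)"
    using lborel_pair.integral_fst'[OF Fint] by simp
  also have "\<dots> = (LBINT x. LINT q|lborel. ?g x * ?g (x - q) * (cos (k \<bullet> q) * C q))"
  proof (rule Bochner_Integration.integral_cong[OF refl])
    fix x
    show "(LBINT y. ?F x y) = (LBINT q. ?g x * ?g (x - q) * (cos (k \<bullet> q) * C q))"
      by (subst integral_lborel_translate(1)[symmetric, of _ x], subst integral_lborel_reflect(1)[symmetric]) simp
  qed
  also have "\<dots> = (LBINT q. LINT x|lborel. ?g x * ?g (x - q) * (cos (k \<bullet> q) * C q))"
  proof (rule lborel_pair.Fubini_integral[symmetric])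
    have "integrable (lborel \<Otimes>\<^sub>M lborel) (\<lambda>(x, q). complex_of_real (?g x * ?g (x - q) * (cos (k \<bullet> q) * C q)))"
    proof (rule integrable_pair_bound[where b="?g" and \<phi>="\<lambda>q. of_real (C q)"])
      show "norm (complex_of_real (?g x * ?g (x - q) * (cos (k \<bullet> q) * C q))) \<le> ?g x * norm (complex_of_real (C q))" for x q
      proof -
        have "\<bar>?g x * ?g (x - q) * (cos (k \<bullet> q) * C q)\<bar> \<le> (?g x * 1) * (1 * \<bar>C q\<bar>)"
          unfolding abs_mult using d by (intro mult_mono) (auto)
        then show ?thesis unfolding norm_of_real by simp
      qed
    qed (use g int lborel.sigma_finite_measure_axioms in auto)
    then show "integrable (lborel \<Otimes>\<^sub>M lborel) (\<lambda>(x, q). ?g x * ?g (x - q) * (cos (k \<bullet> q) * C q))"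
      by (simp only: case_prod_beta' complex_of_real_integrable_eq)
  qed
  also have "\<dots> = (LBINT q. (LBINT x. exp (- (2 * d) * (norm (x::real^2))\<^sup>2)) * (C q * cos (k \<bullet> q) * exp (- (d / 2) * (norm q)\<^sup>2)))"
  proof (rule Bochner_Integration.integral_cong[OF refl])
    fix q :: "real^2"
    have sq: "?g x * ?g (x - q) = exp (- (2 * d) * (norm (x - q /\<^sub>R 2))\<^sup>2) * exp (- (d / 2) * (norm q)\<^sup>2)" for x
      by (simp add: power2_norm_eq_inner inner_diff_left inner_diff_right inner_commute algebra_simps flip: exp_add)
    have "(LBINT x. ?g x * ?g (x - q) * (cos (k \<bullet> q) * C q)) = (LBINT x. exp (- (2 * d) * (norm (x - q /\<^sub>R 2))\<^sup>2)) * (C q * cos (k \<bullet> q) * exp (- (d / 2) * (norm q)\<^sup>2))"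
      unfolding sq by (simp add: mult_ac)
    also have "(LBINT x. exp (- (2 * d) * (norm (x - q /\<^sub>R 2))\<^sup>2)) = (LBINT x. exp (- (2 * d) * (norm (x::real^2))\<^sup>2))"
      by (subst integral_lborel_translate(1)[symmetric, of _ "q /\<^sub>R 2"]) simp
    finally show "(LBINT x. ?g x * ?g (x - q) * (cos (k \<bullet> q) * C q)) = (LBINT x. exp (- (2 * d) * (norm (x::real^2))\<^sup>2)) * (C q * cos (k \<bullet> q) * exp (- (d / 2) * (norm q)\<^sup>2))" .
  qed
  also have "\<dots> = (LBINT x. exp (- (2 * d) * (norm (x::real^2))\<^sup>2)) * (LBINT q. C q * cos (k \<bullet> q) * exp (- (d / 2) * (norm q)\<^sup>2))"
    by simp
  finally have *: "0 \<le> (LBINT x. exp (- (2 * d) * (norm (x::real^2))\<^sup>2)) * (LBINT q. C q * cos (k \<bullet> q) * exp (- (d / 2) * (norm q)\<^sup>2))" .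
  have "0 < (LBINT x. exp (- (2 * d) * (norm (x::real^2))\<^sup>2))"
  proof -
    have "(LBINT x. exp (- (2 * d) * (norm (x::real^2))\<^sup>2)) = (LBINT x. sqrt (2 * pi * (1 / (4 * d))) ^ DIM(real^2) * gauss (1 / (4 * d)) (x::real^2))"
      using d by (simp add: gauss_def mult_ac)
    also have "\<dots> = sqrt (2 * pi * (1 / (4 * d))) ^ DIM(real^2)" using d by (simp add: integral_gauss)
    finally show ?thesis using d by simp
  qed
  with * show ?thesis by (simp add: zero_le_mult_iff)
qed

text \<open>Remove the Gaussian regularisation by dominated convergence.\<close>

lemma spec_nonneg:
  assumes C: "covariance_function C" and int: "integrable lborel C"
  shows "0 \<le> spec C k"
proof -
  have [measurable]: "C \<in> borel_measurable borel" using int by auto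
  have "(\<lambda>n. LINT q|lborel. C q * cos (k \<bullet> q) * exp (- (1 / real (Suc n) / 2) * (norm q)\<^sup>2)) \<longlonglongrightarrow> (LBINT q. C q * cos (k \<bullet> q))"
  proof (rule integral_dominated_convergence[where w="\<lambda>q. \<bar>C q\<bar>"])
    show "AE q in lborel. (\<lambda>n. C q * cos (k \<bullet> q) * exp (- (1 / real (Suc n) / 2) * (norm q)\<^sup>2)) \<longlonglongrightarrow> C q * cos (k \<bullet> q)"
    proof (rule AE_I2)
      fix q
      have "(\<lambda>n. C q * cos (k \<bullet> q) * exp (- (1 / real (Suc n) / 2) * (norm q)\<^sup>2)) \<longlonglongrightarrow> C q * cos (k \<bullet> q) * exp (- (0 / 2) * (norm q)\<^sup>2)"
        by (intro tendsto_intros LIMSEQ_Suc[OF lim_1_over_n]) auto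
      then show "(\<lambda>n. C q * cos (k \<bullet> q) * exp (- (1 / real (Suc n) / 2) * (norm q)\<^sup>2)) \<longlonglongrightarrow> C q * cos (k \<bullet> q)" by simp
    qed
    show "AE q in lborel. norm (C q * cos (k \<bullet> q) * exp (- (1 / real (Suc n) / 2) * (norm q)\<^sup>2)) \<le> \<bar>C q\<bar>" for n
    proof (rule AE_I2)
      fix q
      have "\<bar>C q\<bar> * \<bar>cos (k \<bullet> q)\<bar> * exp (- (1 / real (Suc n) / 2) * (norm q)\<^sup>2) \<le> \<bar>C q\<bar> * 1 * 1"
        by (intro mult_mono) auto
      then show "norm (C q * cos (k \<bullet> q) * exp (- (1 / real (Suc n) / 2) * (norm q)\<^sup>2)) \<le> \<bar>C q\<bar>" by (simp add: abs_mult)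
    qed
  qed (use int in auto)
  then have "0 \<le> (LBINT q. C q * cos (k \<bullet> q))"
    by (rule LIMSEQ_le_const) (intro exI allI impI gaussian_regularised_nonneg[OF C int]; simp)
  then show ?thesis by (simp add: spec_def)
qed

lemma spec_bound:
  assumes int: "integrable lborel C"
  shows "\<bar>spec C k\<bar> \<le> (LBINT x. \<bar>C x\<bar>)"
proof -
  have "\<bar>LBINT x. C x * cos (k \<bullet> x)\<bar> \<le> (LBINT x. \<bar>C x * cos (k \<bullet> x)\<bar>)" by (rule integral_abs_bound)
  also have "\<dots> \<le> (LBINT x. \<bar>C x\<bar>)"
    using int by (intro integral_mono') (auto simp: abs_mult mult_left_le)
  finally have 1: "\<bar>LBINT x. C x * cos (k \<bullet> x)\<bar> \<le> (LBINT x. \<bar>C x\<bar>)" .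
  have "1 * 1 \<le> (2 * pi) * (2 * pi)" using pi_gt3 by (intro mult_mono) auto
  then have "1 \<le> (2 * pi)\<^sup>2" by (simp add: power2_eq_square)
  then have "\<bar>LBINT x. C x * cos (k \<bullet> x)\<bar> / (2 * pi)\<^sup>2 \<le> \<bar>LBINT x. C x * cos (k \<bullet> x)\<bar>"
    by (intro divide_le_eq[THEN iffD2]) (auto simp: mult_le_cancel_left1)
  then show ?thesis using 1 by (simp add: spec_def)
qed

lemma borel_measurable_spec [measurable]:
  assumes [measurable]: "C \<in> borel_measurable borel"
  shows "spec C \<in> borel_measurable borel"
  unfolding spec_def[abs_def] by measurable

text \<open>The Fourier transform of a Gaussian is a Gaussian, so Fubini turns the regularised inversion
  integral into a Gaussian average of \<open>C\<close>.\<close>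

lemma spec_regularised:
  assumes C: "covariance_function C" and int: "integrable lborel C" and d: "d > 0"
  shows "integrable lborel (\<lambda>k. spec C k * exp (- (d * (norm k)\<^sup>2 / 2)))"
    and "(LBINT k. of_real (spec C k * exp (- (d * (norm k)\<^sup>2 / 2))) * cis (k \<bullet> x)) = (LBINT y. of_real (gauss d y) * of_real (C (x + y)))"
proof -
  have [measurable]: "C \<in> borel_measurable borel" using int by auto
  have g: "integrable lborel (\<lambda>k::real^2. exp (- (d * (norm k)\<^sup>2 / 2)))" using gaussian_integrable'[of "d/2", where 'e="real^2"] d by simp
  show I: "integrable lborel (\<lambda>k. spec C k * exp (- (d * (norm k)\<^sup>2 / 2)))"
  proof (rule Bochner_Integration.integrable_bound[OF integrable_mult_right[OF g, of "LBINT x. \<bar>C x\<bar>"]])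
    show "AE k in lborel. norm (spec C k * exp (- (d * (norm k)\<^sup>2 / 2))) \<le> norm ((LBINT x. \<bar>C x\<bar>) * exp (- (d * (norm k)\<^sup>2 / 2)))"
      using spec_bound[OF int] by (auto simp: abs_mult intro!: AE_I2 mult_right_mono order_trans[OF spec_bound[OF int]])
  qed measurable
  let ?e = "\<lambda>k::real^2. exp (- (d * (norm k)\<^sup>2 / 2))"
  have gk: "(LBINT k. complex_of_real (?e k) * cis (q \<bullet> k)) = of_real ((2 * pi)\<^sup>2 * gauss d q)" for q :: "real^2"
  proof -
    have "gauss d q = exp (- ((norm q)\<^sup>2 / (2 * d))) / (2 * pi * d)" using d by (simp add: gauss_def)
    then have "(2 * pi)\<^sup>2 * gauss d q = 2 * pi / d * exp (- ((norm q)\<^sup>2 / (2 * d)))" using d by (simp add: power2_eq_square)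
    moreover have "sqrt (2 * pi * (1 / d)) ^ DIM(real^2) = 2 * pi / d" using d by simp
    moreover have "- (1 / d) * (norm q)\<^sup>2 / 2 = - ((norm q)\<^sup>2 / (2 * d))" by simp
    moreover have "(norm k)\<^sup>2 / (2 * (1 / d)) = d * (norm k)\<^sup>2 / 2" for k :: "real^2" by simp
    ultimately show ?thesis
      using gaussian_fourier[of "1/d" q] d by (simp only: zero_less_divide_1_iff simp_thms)
  qed
  have "of_real ((2 * pi)\<^sup>2) * (LBINT k. of_real (spec C k * ?e k) * cis (k \<bullet> x))
     = (LBINT k. (LBINT y. of_real (C y) * cis (k \<bullet> y)) * (of_real (?e k) * cis (k \<bullet> x)))"
    unfolding spec_complex[OF C int] by (simp add: mult_ac flip: integral_mult_right_zero)
  also have "\<dots> = (LBINT k. LINT y|lborel. of_real (C y) * of_real (?e k) * cis ((x + y) \<bullet> k))"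
  proof (rule Bochner_Integration.integral_cong[OF refl])
    fix k :: "real^2"
    have "of_real (C y) * cis (k \<bullet> y) * (of_real (?e k) * cis (k \<bullet> x)) = of_real (C y) * of_real (?e k) * cis ((x + y) \<bullet> k)" for y
    proof -
      have "cis ((x + y) \<bullet> k) = cis (k \<bullet> y) * cis (k \<bullet> x)" by (simp add: cis_mult inner_add_left inner_add_right inner_commute[of _ k] add.commute)
      then show ?thesis by (simp only: mult_ac)
    qed
    then show "(LBINT y. of_real (C y) * cis (k \<bullet> y)) * (of_real (?e k) * cis (k \<bullet> x)) = (LBINT y. of_real (C y) * of_real (?e k) * cis ((x + y) \<bullet> k))"
      by (simp only: integral_mult_left_zero[symmetric])
  qed
  also have "\<dots> = (LBINT y. LINT k|lborel. of_real (C y) * of_real (?e k) * cis ((x + y) \<bullet> k))"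
    by (rule Fubini_bound(1)[where b="\<lambda>y. \<bar>C y\<bar>" and \<phi>="\<lambda>k. of_real (?e k)"])
       (use int g lborel.sigma_finite_measure_axioms in \<open>auto simp: norm_mult\<close>)
  also have "\<dots> = (LBINT y. of_real ((2 * pi)\<^sup>2) * (of_real (gauss d (x + y)) * of_real (C y)))"
  proof (rule Bochner_Integration.integral_cong[OF refl])
    fix y
    have "(LBINT k. of_real (C y) * of_real (?e k) * cis ((x + y) \<bullet> k)) = of_real (C y) * of_real ((2 * pi)\<^sup>2 * gauss d (x + y))"
      unfolding mult.assoc integral_mult_right_zero gk ..
    then show "(LBINT k. of_real (C y) * of_real (?e k) * cis ((x + y) \<bullet> k)) = of_real ((2 * pi)\<^sup>2) * (of_real (gauss d (x + y)) * of_real (C y))"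
      by (simp only: of_real_mult mult_ac)
  qed
  also have "\<dots> = of_real ((2 * pi)\<^sup>2) * (LBINT y. of_real (gauss d (x + y)) * of_real (C y))"
    by (rule integral_mult_right_zero)
  also have "(LBINT y. complex_of_real (gauss d (x + y)) * of_real (C y)) = (LBINT y. of_real (gauss d y) * of_real (C (- x + y)))"
    by (subst integral_lborel_translate(1)[symmetric, of _ "- x"]) simp
  also have "\<dots> = (LBINT y. of_real (gauss d (- y)) * of_real (C (- x + - y)))"
    by (rule integral_lborel_reflect(1)[symmetric])
  also have "\<dots> = (LBINT y. of_real (gauss d y) * of_real (C (x + y)))"
  proof -
    have "C (- x + - y) = C (x + y)" for y
      using C unfolding covariance_function_def by (metis minus_add_distrib)
    then show ?thesis by (simp add: gauss_def)
  qed
  finally show "(LBINT k. of_real (spec C k * ?e k) * cis (k \<bullet> x)) = (LBINT y. of_real (gauss d y) * of_real (C (x + y)))"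
    using pi_gt_zero by simp
qed

text \<open>Since the spectral density is nonnegative, the regularised integrals are monotone, and they
  are bounded by \<open>C 0\<close> because Gaussian averages of \<open>C\<close> are; hence integrability. Inversion then
  follows from the approximate identity.\<close>

lemma spec_inversion:
  assumes C: "covariance_function C" and int: "integrable lborel C"
  shows "integrable lborel (spec C)"
    and "(LBINT k. of_real (spec C k) * cis (k \<bullet> x)) = of_real (C x)"
proof -
  have [measurable]: "C \<in> borel_measurable borel" using int by auto
  have cont: "continuous_on UNIV C" using C by (simp add: covariance_function_def)
  let ?d = "\<lambda>n. 1 / real (Suc n)"
  let ?e = "\<lambda>n k. exp (- (?d n * (norm (k::real^2))\<^sup>2 / 2))"
  have elim: "(\<lambda>n. ?e n k) \<longlonglongrightarrow> 1" for k
  proof -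
    have "(\<lambda>n. ?e n k) \<longlonglongrightarrow> exp (- (0 * (norm k)\<^sup>2 / 2))"
      by (intro tendsto_intros LIMSEQ_Suc[OF lim_1_over_n]) auto
    then show ?thesis by simp
  qed
  have reg: "(LBINT k. spec C k * ?e n k) \<le> C 0" for n
  proof -
    have "complex_of_real (LBINT k. spec C k * ?e n k) = of_real (LBINT y. gauss (?d n) (y::real^2) * C y)"
      using spec_regularised(2)[OF C int, of "?d n" 0] by (simp flip: of_real_mult)
    then have "(LBINT k. spec C k * ?e n k) = (LBINT y. gauss (?d n) (y::real^2) * C y)" by (simp only: of_real_eq_iff)
    also have "\<dots> \<le> (LBINT y. gauss (?d n) (y::real^2) * C 0)"
    proof (rule integral_mono')
      show "integrable lborel (\<lambda>y::real^2. gauss (?d n) y * C 0)" by (intro integrable_mult_left integrable_gauss) simp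
      fix y :: "real^2"
      have "C y \<le> C 0" "0 \<le> C 0" using covariance_bound[OF C, of y] covariance_bound[OF C, of 0] by auto
      then show "gauss (?d n) y * C y \<le> gauss (?d n) y * C 0" "0 \<le> gauss (?d n) y * C 0" using gauss_nonneg[of "?d n" y] by (auto intro: mult_left_mono)
    qed
    also have "\<dots> = C 0" by (simp add: integral_gauss)
    finally show ?thesis .
  qed
  show I: "integrable lborel (spec C)"
  proof (rule integrable_monotone_convergence[where f="\<lambda>n k. spec C k * ?e n k" and x="lim (\<lambda>n. LINT k|lborel. spec C k * ?e n k)"])
    show "integrable lborel (\<lambda>k. spec C k * ?e n k)" for n by (rule spec_regularised(1)[OF C int]) simp
    show m: "AE k in lborel. mono (\<lambda>n. spec C k * ?e n k)"
    proof (rule AE_I2, rule monoI)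
      fix k :: "real^2" and a b :: nat assume "a \<le> b"
      then have "?d b \<le> ?d a" by (simp add: frac_le)
      then have "?d b * (norm k)\<^sup>2 \<le> ?d a * (norm k)\<^sup>2" by (rule mult_right_mono) simp
      then have "?d b * (norm k)\<^sup>2 / 2 \<le> ?d a * (norm k)\<^sup>2 / 2" by (rule divide_right_mono) simp
      then have "- (?d a * (norm k)\<^sup>2 / 2) \<le> - (?d b * (norm k)\<^sup>2 / 2)" by (rule le_imp_neg_le)
      then have "?e a k \<le> ?e b k" by (rule exp_le_cancel_iff[THEN iffD2])
      then show "spec C k * ?e a k \<le> spec C k * ?e b k" using spec_nonneg[OF C int, of k] by (rule mult_left_mono)
    qed
    show "AE k in lborel. (\<lambda>n. spec C k * ?e n k) \<longlonglongrightarrow> spec C k"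
    proof (rule AE_I2)
      fix k :: "real^2"
      have "(\<lambda>n. spec C k * ?e n k) \<longlonglongrightarrow> spec C k * 1" by (intro tendsto_intros elim)
      then show "(\<lambda>n. spec C k * ?e n k) \<longlonglongrightarrow> spec C k" by simp
    qed
    have "incseq (\<lambda>n. LINT k|lborel. spec C k * ?e n k)"
    proof (rule incseq_SucI)
      fix n
      show "(LBINT k. spec C k * ?e n k) \<le> (LBINT k. spec C k * ?e (Suc n) k)"
      proof (rule integral_mono_AE)
        show "AE k in lborel. spec C k * ?e n k \<le> spec C k * ?e (Suc n) k"
          using m by eventually_elim (erule monoD, simp)
      qed (rule spec_regularised(1)[OF C int], simp)+
    qed
    then have "convergent (\<lambda>n. LINT k|lborel. spec C k * ?e n k)"
      using incseq_convergent[of "\<lambda>n. LINT k|lborel. spec C k * ?e n k" "C 0"] reg unfolding convergent_def by blast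
    then show "(\<lambda>n. LINT k|lborel. spec C k * ?e n k) \<longlonglongrightarrow> lim (\<lambda>n. LINT k|lborel. spec C k * ?e n k)"
      by (simp add: convergent_LIMSEQ_iff)
  qed measurable
  have "(\<lambda>n. LINT k|lborel. of_real (spec C k * ?e n k) * cis (k \<bullet> x)) \<longlonglongrightarrow> (LBINT k. of_real (spec C k) * cis (k \<bullet> x))"
  proof (rule integral_dominated_convergence[where w="spec C"])
    show "AE k in lborel. (\<lambda>n. of_real (spec C k * ?e n k) * cis (k \<bullet> x)) \<longlonglongrightarrow> of_real (spec C k) * cis (k \<bullet> x)"
    proof (rule AE_I2)
      fix k :: "real^2"
      have "(\<lambda>n. of_real (spec C k * ?e n k) * cis (k \<bullet> x)) \<longlonglongrightarrow> of_real (spec C k * 1) * cis (k \<bullet> x)" by (intro tendsto_intros elim)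
      then show "(\<lambda>n. of_real (spec C k * ?e n k) * cis (k \<bullet> x)) \<longlonglongrightarrow> of_real (spec C k) * cis (k \<bullet> x)" by simp
    qed
    show "AE k in lborel. norm (of_real (spec C k * ?e n k) * cis (k \<bullet> x)) \<le> spec C k" for n
      using spec_nonneg[OF C int] by (auto simp: norm_mult abs_mult mult_left_le intro!: AE_I2)
  qed (use I in auto)
  moreover have "(\<lambda>n. LINT k|lborel. of_real (spec C k * ?e n k) * cis (k \<bullet> x)) \<longlonglongrightarrow> of_real (C x)"
  proof -
    have "((\<lambda>d. LINT y|lborel. of_real (gauss d y) * complex_of_real (C (x + y))) \<longlongrightarrow> of_real (C (x + 0))) (at_right 0)"
    proof (rule gauss_approximate_identity)
      have "isCont C x" using cont by (simp add: continuous_on_eq_continuous_at)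
      then show "isCont (\<lambda>y. complex_of_real (C (x + y))) 0"
        by (intro isCont_of_real isCont_o2[where f="\<lambda>y. x + y" and a=0 and g=C]) auto
      show "integrable lborel (\<lambda>y. complex_of_real (C (x + y)) * of_real (exp (- c * (norm y)\<^sup>2)))" if "c > 0" for c
        using gaussian_integrable'[OF that, where 'e="real^2"]
        by (intro integrable_bounded_mult[where m="C 0"] integrable_of_real) (auto simp: covariance_bound[OF C])
    qed measurable
    moreover have "filterlim ?d (at_right 0) sequentially"
      unfolding filterlim_at by (intro conjI always_eventually allI LIMSEQ_Suc[OF lim_1_over_n]) auto
    ultimately have "(\<lambda>n. LINT y|lborel. of_real (gauss (?d n) y) * complex_of_real (C (x + y))) \<longlonglongrightarrow> of_real (C (x + 0))"
      by (rule filterlim_compose)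
    moreover have "(LBINT k. of_real (spec C k * ?e n k) * cis (k \<bullet> x)) = (LBINT y. of_real (gauss (?d n) y) * complex_of_real (C (x + y)))" for n
      by (rule spec_regularised(2)[OF C int]) simp
    ultimately show ?thesis by (simp only: add_0_right)
  qed
  ultimately show "(LBINT k. of_real (spec C k) * cis (k \<bullet> x)) = of_real (C x)"
    by (rule LIMSEQ_unique)
qed

section \<open>Exact solutions with phases that are transported\<close>

lemma measurable_linear:
  fixes f :: "'a::euclidean_space \<Rightarrow> 'b::euclidean_space"
  shows "linear f \<Longrightarrow> f \<in> borel_measurable borel"
  by (intro borel_measurable_continuous_onI linear_continuous_on) (simp add: linear_conv_bounded_linear)

lemma measurable_vel [measurable]: "vel \<kappa> \<in> borel_measurable borel"
  by (rule measurable_linear[OF linear_vel])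

lemma measurable_symb [measurable]: "symb \<kappa> \<in> borel_measurable borel"
  unfolding symb_def[abs_def] by measurable

text \<open>By Fourier inversion the potential is an average of plane waves with total mass \<open>C 0\<close>.\<close>

lemma FS_covariance:
  fixes L :: "'e::euclidean_space \<Rightarrow> real^2"
  assumes C: "covariance_function C" and int: "integrable lborel C"
    and L: "linear L" and \<Lambda>: "\<And>k. adjoint L k \<in> \<Lambda>"
  shows "FS \<Lambda> (C 0) (\<lambda>w. of_real (C (L w)))"
proof -
  have [measurable]: "C \<in> borel_measurable borel" using int by auto
  have [measurable]: "adjoint L \<in> borel_measurable borel" by (intro measurable_linear adjoint_linear L)
  have "FS \<Lambda> (LBINT k. spec C k) (\<lambda>w. LINT k|lborel. of_real (spec C k) * cis (adjoint L k \<bullet> w))"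
  proof (rule FS_average)
    show "FS \<Lambda> (spec C k) (\<lambda>w. of_real (spec C k) * cis (adjoint L k \<bullet> w))" for k
      using FS_cmult[OF FS_cis[OF \<Lambda>[of k]], of "of_real (spec C k)"] spec_nonneg[OF C int, of k] by simp
  qed (use spec_inversion(1)[OF C int] lborel.sigma_finite_measure_axioms in auto)
  moreover have "(LBINT k. of_real (spec C k) * cis (adjoint L k \<bullet> w)) = of_real (C (L w))" for w
    using spec_inversion(2)[OF C int, of "L w"] adjoint_works[OF L, of w] by (simp add: inner_commute)
  moreover have "(LBINT k. spec C k) = C 0"
  proof -
    have "complex_of_real (LBINT k. spec C k) = of_real (C 0)" using spec_inversion(2)[OF C int, of 0] by simp
    then show ?thesis by (simp only: of_real_eq_iff)
  qed
  ultimately show ?thesis by simp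
qed

text \<open>The potential accumulated along the straight characteristic of velocity \<open>vel \<kappa> \<zeta>\<close> that ends
  in \<open>w\<close> at time \<open>z\<close>. The set \<open>J\<close> contains the linear maps \<open>L\<close> whose potentials \<open>C (L w)\<close> are
  taken into account.\<close>

definition phs :: "(real^2 \<Rightarrow> real) \<Rightarrow> real \<Rightarrow> ('e::euclidean_space \<Rightarrow> real) \<Rightarrow> ('e \<Rightarrow> real^2) set \<Rightarrow> 'e \<Rightarrow> real \<Rightarrow> 'e \<Rightarrow> real" where
  "phs C c \<kappa> J \<zeta> z w = c * (\<Sum>L\<in>J. LINT s|lborel. indicator {0..z} s * C (L (w - (z - s) *\<^sub>R vel \<kappa> \<zeta>)))"

text \<open>All frequencies that the potentials \<open>C (L w)\<close> with \<open>L \<in> J\<close> can produce.\<close>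

definition freqs :: "('e::euclidean_space \<Rightarrow> real^2) set \<Rightarrow> 'e set" where
  "freqs J = span (\<Union>L\<in>J. range (adjoint L))"

text \<open>The free evolution of the frequencies produced by the potentials is trivial, so that the
  phase is transported without dispersion. For pairs this is the cancellation between a field and
  a conjugated field.\<close>

definition isotropic :: "('e::euclidean_space \<Rightarrow> real) \<Rightarrow> ('e \<Rightarrow> real^2) set \<Rightarrow> bool" where
  "isotropic \<kappa> J \<longleftrightarrow> finite J \<and> (\<forall>L\<in>J. linear L) \<and> (\<forall>l\<in>freqs J. symb \<kappa> l = 0)"

text \<open>The solution with a plane wave of frequency \<open>\<zeta>\<close> as initial value, for the potential \<open>c *
  (\<Sum>L\<in>J. C (L w)) - \<gamma>\<close>.\<close>

definition sol :: "(real^2 \<Rightarrow> real) \<Rightarrow> real \<Rightarrow> ('e::euclidean_space \<Rightarrow> real) \<Rightarrow> real \<Rightarrow> ('e \<Rightarrow> real^2) set \<Rightarrow> 'e \<Rightarrow> real \<Rightarrow> 'e \<Rightarrow> complex" where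
  "sol C c \<kappa> \<gamma> J \<zeta> z w = cis (\<zeta> \<bullet> w - z * symb \<kappa> \<zeta>) * of_real (exp (phs C c \<kappa> J \<zeta> z w - \<gamma> * z))"

lemma freqs_0: "0 \<in> freqs J" and freqs_add: "k \<in> freqs J \<Longrightarrow> l \<in> freqs J \<Longrightarrow> k + l \<in> freqs J"
  and freqs_adjoint: "L \<in> J \<Longrightarrow> adjoint L x \<in> freqs J"
  unfolding freqs_def by (auto intro: span_0 span_add span_base)

lemma borel_measurable_phs:
  assumes C[measurable]: "C \<in> borel_measurable borel" and J: "\<And>L. L \<in> J \<Longrightarrow> linear L"
    and [measurable]: "f \<in> borel_measurable M" "g \<in> measurable M borel" "h \<in> measurable M borel"
  shows "(\<lambda>x. phs C c \<kappa> J (g x) (f x) (h x)) \<in> borel_measurable M"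
  unfolding phs_def
proof (intro borel_measurable_times borel_measurable_const borel_measurable_sum)
  fix L assume "L \<in> J"
  then have [measurable]: "L \<in> borel_measurable borel" by (intro measurable_linear J)
  have "(\<lambda>x. LINT s|lborel. (if 0 \<le> s \<and> s \<le> f x then C (L (h x - (f x - s) *\<^sub>R vel \<kappa> (g x))) else 0)) \<in> borel_measurable M"
    by measurable
  also have "(\<lambda>x. LINT s|lborel. (if 0 \<le> s \<and> s \<le> f x then C (L (h x - (f x - s) *\<^sub>R vel \<kappa> (g x))) else 0))
     = (\<lambda>x. LINT s|lborel. indicator {0..f x} s * C (L (h x - (f x - s) *\<^sub>R vel \<kappa> (g x))))"
    by (intro ext Bochner_Integration.integral_cong refl) (auto simp: indicator_def)
  finally show "(\<lambda>x. LINT s|lborel. indicator {0..f x} s * C (L (h x - (f x - s) *\<^sub>R vel \<kappa> (g x)))) \<in> borel_measurable M" .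
qed

lemma FS_phs:
  assumes C: "covariance_function C" and int: "integrable lborel C" and c: "0 \<le> c" and z: "0 \<le> z"
    and J: "isotropic \<kappa> J"
  shows "FS (freqs J) (c * (real (card J) * (z * C 0))) (\<lambda>w. of_real (phs C c \<kappa> J \<zeta> z w))"
proof -
  have [measurable]: "C \<in> borel_measurable borel" using int by auto
  let ?G = "\<lambda>L w. LINT s|lborel. indicator {0..z} s * C (L (w - (z - s) *\<^sub>R vel \<kappa> \<zeta>))"
  have "FS (freqs J) (z * C 0) (\<lambda>w. of_real (?G L w))" if L: "L \<in> J" for L
  proof -
    have lin: "linear L" using J L by (simp add: isotropic_def)
    note [measurable] = measurable_linear[OF lin]
    have "FS (freqs J) (LBINT s. indicator {0..z} s * C 0) (\<lambda>w. LINT s|lborel. of_real (indicator {0..z} s) * of_real (C (L (w - (z - s) *\<^sub>R vel \<kappa> \<zeta>))))"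
    proof (rule FS_average)
      show "FS (freqs J) (indicator {0..z} s * C 0) (\<lambda>w. of_real (indicator {0..z} s) * of_real (C (L (w - (z - s) *\<^sub>R vel \<kappa> \<zeta>))))" for s
        using FS_cmult[OF FS_translate[OF FS_covariance[OF C int lin freqs_adjoint[OF L]]], of "of_real (indicator {0..z} s)"] by simp
      show "integrable lborel (\<lambda>s. indicator {0..z} s * C 0)"
        by (intro integrable_mult_left integrable_real_indicator) (use z in auto)
    qed (use lborel.sigma_finite_measure_axioms in auto)
    moreover have "(LBINT s. indicator {0..z} s * C 0) = z * C 0" using z by simp
    moreover have "(LBINT s. of_real (indicator {0..z} s) * of_real (C (L (w - (z - s) *\<^sub>R vel \<kappa> \<zeta>)))) = complex_of_real (?G L w)" for w
      by (simp flip: of_real_mult)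
    ultimately show ?thesis using z by simp
  qed
  then have "FS (freqs J) (\<Sum>L\<in>J. z * C 0) (\<lambda>w. \<Sum>L\<in>J. of_real (?G L w))"
    by (intro FS_sum freqs_0)
  from FS_cmult[OF this, of "of_real c"] show ?thesis
    using c by (simp add: phs_def)
qed

lemma FS_exp_phs:
  assumes "covariance_function C" "integrable lborel C" "0 \<le> c" "0 \<le> z" "isotropic \<kappa> J"
  shows "FS (freqs J) (exp (c * (real (card J) * (z * C 0)))) (\<lambda>w. of_real (exp (phs C c \<kappa> J \<zeta> z w)))"
  using FS_exp[OF FS_phs[OF assms] freqs_0 freqs_add] by (simp add: exp_of_real)

lemma phs_bound:
  assumes "covariance_function C" "integrable lborel C" "0 \<le> c" "0 \<le> z" "isotropic \<kappa> J"
  shows "\<bar>phs C c \<kappa> J \<zeta> z w\<bar> \<le> c * (real (card J) * (z * C 0))"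
  using FS_bound[OF FS_phs[OF assms], of \<zeta> w] by simp

lemma phs_shift:
  "phs C c \<kappa> J \<zeta> s (w - (z - s) *\<^sub>R vel \<kappa> \<zeta>) = c * (\<Sum>L\<in>J. LINT r|lborel. indicator {0..s} r * C (L (w - (z - r) *\<^sub>R vel \<kappa> \<zeta>)))"
proof -
  have "w - (z - s) *\<^sub>R vel \<kappa> \<zeta> - (s - r) *\<^sub>R vel \<kappa> \<zeta> = w - (z - r) *\<^sub>R vel \<kappa> \<zeta>" for r
    by (simp add: algebra_simps)
  then show ?thesis unfolding phs_def by (simp only:)
qed

text \<open>The fundamental theorem of calculus along a characteristic.\<close>

lemma exp_phs_ftc:
  assumes cont: "continuous_on UNIV C" and J: "\<And>L. L \<in> J \<Longrightarrow> linear L" and z: "0 \<le> z"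
  shows "exp (phs C c \<kappa> J \<zeta> z w - \<gamma> * z) - 1 = (LBINT s. indicator {0..z} s *
     ((c * (\<Sum>L\<in>J. C (L (w - (z - s) *\<^sub>R vel \<kappa> \<zeta>))) - \<gamma>) * exp (phs C c \<kappa> J \<zeta> s (w - (z - s) *\<^sub>R vel \<kappa> \<zeta>) - \<gamma> * s)))"
proof -
  let ?q = "\<lambda>s. w - (z - s) *\<^sub>R vel \<kappa> \<zeta>"
  have cL: "continuous_on UNIV (\<lambda>s. C (L (?q s)))" if "L \<in> J" for L
    by (intro continuous_on_compose2[OF cont] continuous_on_compose2[OF linear_continuous_on[OF linear_conv_bounded_linear[THEN iffD1, OF J[OF that]]]] continuous_intros) auto
  let ?F = "\<lambda>s. exp (c * (\<Sum>L\<in>J. integral {0..s} (\<lambda>r. C (L (?q r)))) - \<gamma> * s)"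
  have Feq: "exp (phs C c \<kappa> J \<zeta> s (?q s) - \<gamma> * s) = ?F s" if "0 \<le> s" for s
  proof -
    have "(LBINT r. indicator {0..s} r * C (L (?q r))) = integral {0..s} (\<lambda>r. C (L (?q r)))" if "L \<in> J" for L
    proof -
      have "(LBINT r:{0..s}. C (L (?q r))) = integral {0..s} (\<lambda>r. C (L (?q r)))"
        by (intro set_borel_integral_eq_integral borel_integrable_atLeastAtMost' continuous_on_subset[OF cL[OF that]]) auto
      then show ?thesis by (simp add: set_lebesgue_integral_def)
    qed
    then show ?thesis unfolding phs_shift by simp
  qed
  have D: "(?F has_real_derivative ((c * (\<Sum>L\<in>J. C (L (?q s))) - \<gamma>) * ?F s)) (at s within {0..z})" if s: "s \<in> {0..z}" for s
  proof -
    have "((\<lambda>s. integral {0..s} (\<lambda>r. C (L (?q r)))) has_real_derivative C (L (?q s))) (at s within {0..z})" if "L \<in> J" for L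
      unfolding has_real_derivative_iff_has_vector_derivative
      by (intro integral_has_vector_derivative s continuous_on_subset[OF cL[OF that]]) auto
    then show ?thesis
      by (auto intro!: derivative_eq_intros DERIV_sum)
  qed
  have "(LBINT s. indicator {0..z} s *\<^sub>R ((c * (\<Sum>L\<in>J. C (L (?q s))) - \<gamma>) * ?F s)) = ?F z - ?F 0"
  proof (rule integral_FTC_atLeastAtMost[OF z])
    show "(?F has_vector_derivative ((c * (\<Sum>L\<in>J. C (L (?q s))) - \<gamma>) * ?F s)) (at s within {0..z})" if "0 \<le> s" "s \<le> z" for s
      using D[of s] that by (simp add: has_real_derivative_iff_has_vector_derivative)
    have contF: "continuous_on {0..z} ?F"
      using D by (meson DERIV_continuous continuous_on_eq_continuous_within)
    show "continuous_on {0..z} (\<lambda>s. (c * (\<Sum>L\<in>J. C (L (?q s))) - \<gamma>) * ?F s)"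
      by (rule continuous_on_mult[OF _ contF]) (intro continuous_intros continuous_on_sum continuous_on_subset[OF cL]; simp)
  qed
  also have "(LBINT s. indicator {0..z} s *\<^sub>R ((c * (\<Sum>L\<in>J. C (L (?q s))) - \<gamma>) * ?F s))
     = (LBINT s. indicator {0..z} s * ((c * (\<Sum>L\<in>J. C (L (?q s))) - \<gamma>) * exp (phs C c \<kappa> J \<zeta> s (?q s) - \<gamma> * s)))"
  proof (rule Bochner_Integration.integral_cong[OF refl])
    fix s
    show "indicator {0..z} s *\<^sub>R ((c * (\<Sum>L\<in>J. C (L (?q s))) - \<gamma>) * ?F s)
       = indicator {0..z} s * ((c * (\<Sum>L\<in>J. C (L (?q s))) - \<gamma>) * exp (phs C c \<kappa> J \<zeta> s (?q s) - \<gamma> * s))"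
    proof (cases "s \<in> {0..z}")
      case True
      then have "0 \<le> s" by simp
      then show ?thesis by (simp only: Feq real_scaleR_def)
    qed simp
  qed
  also have "?F z = exp (phs C c \<kappa> J \<zeta> z w - \<gamma> * z)" using Feq[OF z] by simp
  also have "?F 0 = 1" by simp
  finally show ?thesis by simp
qed

text \<open>For a function with frequencies in an isotropic subspace, free evolution of its product with
  a plane wave is transport with the velocity of the plane wave: no dispersion is left, since
  \<open>symb \<kappa> (\<zeta> + l) = symb \<kappa> \<zeta> + l \<bullet> vel \<kappa> \<zeta>\<close>.\<close>

lemma packet_transport:
  fixes a :: "'e::euclidean_space"
  assumes d: "d > 0" and J: "isotropic \<kappa> J" and G: "FS (freqs J) m G" and h: "0 \<le> h" and t: "0 \<le> \<tau>"
  shows "(LBINT w. cis (\<zeta> \<bullet> w) * G w * packet \<kappa> d a p (\<tau> + h) w)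
     = cis (- h * symb \<kappa> \<zeta>) * (LBINT w. cis (\<zeta> \<bullet> w) * G (w - h *\<^sub>R vel \<kappa> \<zeta>) * packet \<kappa> d a p \<tau> w)"
proof -
  note [measurable] = FS_measurable[OF G] borel_measurable_packet[OF d]
  let ?v = "h *\<^sub>R vel \<kappa> \<zeta>"
  define \<phi>1 where "\<phi>1 w = cis (\<zeta> \<bullet> w) * packet \<kappa> d a p (\<tau> + h) w" for w
  define \<phi>2 where "\<phi>2 w = cis (\<zeta> \<bullet> w) * packet \<kappa> d a p \<tau> w" for w
  have i1: "integrable lborel \<phi>1" unfolding \<phi>1_def
    by (intro integrable_bounded_mult[where m=1] integrable_packet d) auto
  have i2: "integrable lborel \<phi>2" unfolding \<phi>2_def
    by (intro integrable_bounded_mult[where m=1] integrable_packet d) auto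
  have i2': "integrable lborel (\<lambda>w. cis (- h * symb \<kappa> \<zeta>) * \<phi>2 (?v + w))"
    using i2 integral_lborel_translate(2)[of \<phi>2 ?v] by auto
  have zero: "norm (LBINT w. cis (l \<bullet> w) * (\<phi>1 w - cis (- h * symb \<kappa> \<zeta>) * \<phi>2 (?v + w))) \<le> 0" if l: "l \<in> freqs J" for l
  proof -
    let ?P = "LBINT w. cis ((\<zeta> + l) \<bullet> w) * packet \<kappa> d a p 0 w"
    have s: "symb \<kappa> (\<zeta> + l) = symb \<kappa> \<zeta> + l \<bullet> vel \<kappa> \<zeta>" using J l by (simp add: symb_add isotropic_def)
    have c: "cis (l \<bullet> w) * (cis (\<zeta> \<bullet> w) * x) = cis ((\<zeta> + l) \<bullet> w) * x" for w x
      by (simp add: inner_add_left add.commute flip: cis_mult mult.assoc)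
    have 1: "(LBINT w. cis (l \<bullet> w) * \<phi>1 w) = cis (- (\<tau> + h) * symb \<kappa> (\<zeta> + l)) * ?P"
      unfolding \<phi>1_def c by (rule packet_fourier[OF d]) (use h t in simp)
    have "(LBINT w. cis (l \<bullet> w) * \<phi>2 (?v + w)) = (LBINT w. cis (l \<bullet> (- ?v + w)) * \<phi>2 w)"
      by (subst integral_lborel_translate(1)[symmetric, of _ "- ?v"]) simp
    also have "\<dots> = (LBINT w. cis (- (l \<bullet> ?v)) * (cis (l \<bullet> w) * \<phi>2 w))"
      by (simp add: inner_diff_right cis_mult flip: mult.assoc)
    also have "\<dots> = cis (- (l \<bullet> ?v)) * (cis (- \<tau> * symb \<kappa> (\<zeta> + l)) * ?P)"
      unfolding \<phi>2_def c integral_mult_right_zero packet_fourier[OF d t] ..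
    finally have 2: "(LBINT w. cis (l \<bullet> w) * \<phi>2 (?v + w)) = cis (- (l \<bullet> ?v)) * (cis (- \<tau> * symb \<kappa> (\<zeta> + l)) * ?P)" .
    have ph: "cis (- h * symb \<kappa> \<zeta>) * (cis (- (l \<bullet> ?v)) * cis (- \<tau> * symb \<kappa> (\<zeta> + l))) = cis (- (\<tau> + h) * symb \<kappa> (\<zeta> + l))"
      unfolding cis_mult by (rule arg_cong[where f=cis]) (simp add: s algebra_simps)
    have "(LBINT w. cis (l \<bullet> w) * (\<phi>1 w - cis (- h * symb \<kappa> \<zeta>) * \<phi>2 (?v + w)))
      = (LBINT w. cis (l \<bullet> w) * \<phi>1 w - cis (- h * symb \<kappa> \<zeta>) * (cis (l \<bullet> w) * \<phi>2 (?v + w)))"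
      by (simp add: algebra_simps)
    also have "\<dots> = (LBINT w. cis (l \<bullet> w) * \<phi>1 w) - (LBINT w. cis (- h * symb \<kappa> \<zeta>) * (cis (l \<bullet> w) * \<phi>2 (?v + w)))"
    proof (rule Bochner_Integration.integral_diff)
      show "integrable lborel (\<lambda>w. cis (l \<bullet> w) * \<phi>1 w)" by (intro integrable_bounded_mult[where m=1] i1) auto
      have "integrable lborel (\<lambda>w. cis (l \<bullet> w) * (cis (- h * symb \<kappa> \<zeta>) * \<phi>2 (?v + w)))" by (intro integrable_bounded_mult[where m=1] i2') auto
      then show "integrable lborel (\<lambda>w. cis (- h * symb \<kappa> \<zeta>) * (cis (l \<bullet> w) * \<phi>2 (?v + w)))" by (simp add: mult.left_commute)
    qed
    also have "\<dots> = 0"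
      unfolding integral_mult_right_zero 1 2 ph[symmetric] by (simp only: mult.assoc) simp
    finally show ?thesis by simp
  qed
  have "norm (LBINT w. G w * (\<phi>1 w - cis (- h * symb \<kappa> \<zeta>) * \<phi>2 (?v + w))) \<le> m * 0"
    by (rule FS_dual[OF G Bochner_Integration.integrable_diff[OF i1 i2'] zero])
  then have "0 = (LBINT w. G w * (\<phi>1 w - cis (- h * symb \<kappa> \<zeta>) * \<phi>2 (?v + w)))" by simp
  also have "\<dots> = (LBINT w. G w * \<phi>1 w) - (LBINT w. G w * (cis (- h * symb \<kappa> \<zeta>) * \<phi>2 (?v + w)))"
    unfolding right_diff_distrib by (intro Bochner_Integration.integral_diff FS_integrable[OF G] i1 i2')
  also have "(LBINT w. G w * (cis (- h * symb \<kappa> \<zeta>) * \<phi>2 (?v + w))) = (LBINT w. G (w - ?v) * (cis (- h * symb \<kappa> \<zeta>) * \<phi>2 w))"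
    by (subst integral_lborel_translate(1)[symmetric, of _ "?v"]) simp
  finally have "(LBINT w. G w * \<phi>1 w) = (LBINT w. cis (- h * symb \<kappa> \<zeta>) * (G (w - ?v) * \<phi>2 w))"
    by (simp add: mult.left_commute)
  then show ?thesis unfolding \<phi>1_def \<phi>2_def integral_mult_right_zero by (simp add: mult_ac)
qed

lemma borel_measurable_sol:
  assumes C[measurable]: "C \<in> borel_measurable borel" and J: "\<And>L. L \<in> J \<Longrightarrow> linear L"
    and [measurable]: "f \<in> borel_measurable M" "g \<in> measurable M borel" "h \<in> measurable M borel"
  shows "(\<lambda>x. sol C c \<kappa> \<gamma> J (g x) (f x) (h x)) \<in> borel_measurable M"
proof -
  note [measurable] = borel_measurable_phs[OF C J]
  show ?thesis unfolding sol_def by measurable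
qed

lemma norm_sol_bound:
  assumes "covariance_function C" "integrable lborel C" "0 \<le> c" "0 \<le> z" "z \<le> Z" "isotropic \<kappa> J" "0 \<le> \<gamma>"
  shows "norm (sol C c \<kappa> \<gamma> J \<zeta> z w) \<le> exp (c * (real (card J) * (Z * C 0)))"
proof -
  have C0: "0 \<le> C 0" using covariance_bound[OF assms(1), of 0] by simp
  have "phs C c \<kappa> J \<zeta> z w - \<gamma> * z \<le> c * (real (card J) * (z * C 0))"
    using phs_bound[OF assms(1-4,6), of \<zeta> w] assms by (smt (verit) mult_nonneg_nonneg)
  also have "\<dots> \<le> c * (real (card J) * (Z * C 0))" using assms C0 by (intro mult_left_mono mult_right_mono) auto
  finally show ?thesis by (simp add: sol_def norm_mult)
qed

text \<open>Insert \<open>exp_phs_ftc\<close> and undo the transport with \<open>packet_transport\<close>.\<close>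

lemma sol_duhamel:
  fixes a :: "'e::euclidean_space"
  assumes C: "covariance_function C" and int: "integrable lborel C" and c: "0 \<le> c" and z: "0 \<le> z" and t: "0 \<le> \<tau>"
    and J: "isotropic \<kappa> J" and d: "d > 0"
  shows "(LBINT w. sol C c \<kappa> \<gamma> J \<zeta> z w * packet \<kappa> d a p \<tau> w)
     = (LBINT w. cis (\<zeta> \<bullet> w) * packet \<kappa> d a p (\<tau> + z) w)
     + (LBINT s:{0..z}. (LBINT w. sol C c \<kappa> \<gamma> J \<zeta> s w * (of_real (c * (\<Sum>L\<in>J. C (L w)) - \<gamma>) * packet \<kappa> d a p (\<tau> + z - s) w)))"
proof -
  note [measurable] = borel_measurable_packet[OF d]
  have C_meas[measurable]: "C \<in> borel_measurable borel" using int by auto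
  have lin: "linear L" if "L \<in> J" for L using J that by (simp add: isotropic_def)
  have fin: "finite J" using J by (simp add: isotropic_def)
  have cont: "continuous_on UNIV C" using C by (simp add: covariance_function_def)
  note [measurable] = borel_measurable_phs[OF C_meas lin]
  let ?v = "vel \<kappa> \<zeta>" let ?S = "symb \<kappa> \<zeta>"
  define U where "U w = c * (\<Sum>L\<in>J. C (L w)) - \<gamma>" for w
  have U_meas[measurable]: "U \<in> borel_measurable borel"
    unfolding U_def by (intro borel_measurable_diff borel_measurable_times borel_measurable_const borel_measurable_sum measurable_compose[OF measurable_linear[OF lin] C_meas])
  have FU: "FS (freqs J) (c * (real (card J) * C 0) + \<bar>\<gamma>\<bar>) (\<lambda>w. of_real (U w))"
  proof -
    have "FS (freqs J) (norm (of_real c :: complex) * (\<Sum>L\<in>J. C 0) + norm (- of_real \<gamma> :: complex)) (\<lambda>w. of_real c * (\<Sum>L\<in>J. of_real (C (L w))) + (- of_real \<gamma>))"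
      by (intro FS_add FS_cmult FS_sum FS_covariance[OF C int] FS_const lin freqs_0 freqs_adjoint)
    then show ?thesis using c by (simp add: U_def[abs_def])
  qed
  define E where "E s w = exp (phs C c \<kappa> J \<zeta> s w - \<gamma> * s)" for s w
  have FE: "FS (freqs J) (exp (- \<gamma> * s) * exp (c * (real (card J) * (s * C 0)))) (\<lambda>w. of_real (E s w))" if "0 \<le> s" for s
    using FS_cmult[OF FS_exp_phs[OF C int c that J, of \<zeta>], of "of_real (exp (- \<gamma> * s))"]
    by (simp add: E_def[abs_def] exp_diff exp_minus divide_inverse mult.commute norm_inverse)
  have sol: "sol C c \<kappa> \<gamma> J \<zeta> s w = cis (- s * ?S) * (cis (\<zeta> \<bullet> w) * of_real (E s w))" for s w
    by (simp add: sol_def E_def cis_mult flip: mult.assoc)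
  define G where "G s w = U w * E s w" for s w
  have FG: "FS (freqs J) ((c * (real (card J) * C 0) + \<bar>\<gamma>\<bar>) * (exp (- \<gamma> * s) * exp (c * (real (card J) * (s * C 0))))) (\<lambda>w. of_real (G s w))" if "0 \<le> s" for s
    using FS_mult[OF FU FE[OF that] freqs_add] by (simp add: G_def[abs_def])
  define H where "H s w = indicator {0..z} s * G s (w - (z - s) *\<^sub>R ?v)" for s w
  have ftc: "E z w = 1 + (LBINT s. H s w)" for w
    using exp_phs_ftc[OF cont lin z, of J c \<kappa> \<zeta> w \<gamma>] by (simp add: H_def G_def U_def E_def)
  have E0: "E 0 w = 1" for w
  proof -
    have "phs C c \<kappa> J \<zeta> 0 w = 0" using phs_bound[OF C int c order.refl J, of \<zeta> w] by simp
    then show ?thesis by (simp add: E_def)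
  qed
  define B where "B = (c * (real (card J) * C 0) + \<bar>\<gamma>\<bar>) * exp (\<bar>\<gamma>\<bar> * z + c * (real (card J) * (z * C 0)))"
  have C0: "0 \<le> C 0" using covariance_bound[OF C, of 0] by simp
  have Hb: "\<bar>H s w\<bar> \<le> indicator {0..z} s * B" for s w
  proof (cases "s \<in> {0..z}")
    case True
    then have s: "0 \<le> s" "s \<le> z" by auto
    have "\<bar>G s (w - (z - s) *\<^sub>R ?v)\<bar> \<le> (c * (real (card J) * C 0) + \<bar>\<gamma>\<bar>) * (exp (- \<gamma> * s) * exp (c * (real (card J) * (s * C 0))))"
      using FS_bound[OF FG[OF s(1)], of "w - (z - s) *\<^sub>R ?v"] by simp
    also have "\<dots> \<le> B"
    proof -
      have 1: "- \<gamma> * s \<le> \<bar>\<gamma>\<bar> * z"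
      proof -
        have "- \<gamma> * s \<le> \<bar>\<gamma>\<bar> * s" using s by (intro mult_right_mono) auto
        also have "\<dots> \<le> \<bar>\<gamma>\<bar> * z" using s by (intro mult_left_mono) auto
        finally show ?thesis .
      qed
      have 2: "c * (real (card J) * (s * C 0)) \<le> c * (real (card J) * (z * C 0))"
        using s c C0 by (intro mult_left_mono mult_right_mono) auto
      have "exp (- \<gamma> * s) * exp (c * (real (card J) * (s * C 0))) \<le> exp (\<bar>\<gamma>\<bar> * z + c * (real (card J) * (z * C 0)))"
        using add_mono[OF 1 2] by (simp flip: exp_add)
      then show ?thesis unfolding B_def using c C0 by (intro mult_left_mono) auto
    qed
    finally show ?thesis using True by (simp add: H_def)
  qed (simp add: H_def)
  have Hm: "(\<lambda>(s, w). of_real (H s w) * (cis (\<zeta> \<bullet> w) * packet \<kappa> d a p \<tau> w)) \<in> borel_measurable (lborel \<Otimes>\<^sub>M lborel)"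
    unfolding H_def G_def E_def by measurable
  have ipk: "integrable lborel (\<lambda>w. cis (\<zeta> \<bullet> w) * packet \<kappa> d a p \<tau> w)"
    by (intro integrable_bounded_mult[where m=1] integrable_packet d) auto
  have bi: "integrable lborel (\<lambda>s. indicator {0..z} s * B)"
    by (intro integrable_mult_left integrable_real_indicator) (use z in auto)
  note F = Fubini_bound[OF lborel.sigma_finite_measure_axioms lborel.sigma_finite_measure_axioms Hm bi ipk]
  have Hb': "norm (of_real (H s w) * (cis (\<zeta> \<bullet> w) * packet \<kappa> d a p \<tau> w)) \<le> indicator {0..z} s * B * norm (cis (\<zeta> \<bullet> w) * packet \<kappa> d a p \<tau> w)" for s w
    unfolding norm_mult[of "of_real _"] norm_of_real by (intro mult_right_mono Hb) auto
  have tr0: "(LBINT w. cis (\<zeta> \<bullet> w) * packet \<kappa> d a p (\<tau> + z) w) = cis (- z * ?S) * (LBINT w. cis (\<zeta> \<bullet> w) * packet \<kappa> d a p \<tau> w)"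
    using packet_transport[OF d J FS_const[OF freqs_0, where c=1] z t, of \<zeta> a p] by simp
  have inner: "(LBINT w. of_real (H s w) * (cis (\<zeta> \<bullet> w) * packet \<kappa> d a p \<tau> w))
     = indicator {0..z} s *\<^sub>R (cis (z * ?S) * (LBINT w. sol C c \<kappa> \<gamma> J \<zeta> s w * (of_real (U w) * packet \<kappa> d a p (\<tau> + z - s) w)))" for s
  proof (cases "s \<in> {0..z}")
    case True
    then have s: "0 \<le> s" "0 \<le> z - s" by auto
    have "(LBINT w. sol C c \<kappa> \<gamma> J \<zeta> s w * (of_real (U w) * packet \<kappa> d a p (\<tau> + z - s) w))
      = cis (- s * ?S) * (LBINT w. cis (\<zeta> \<bullet> w) * of_real (G s w) * packet \<kappa> d a p (\<tau> + (z - s)) w)"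
      unfolding sol G_def by (simp add: mult_ac add_diff_eq flip: integral_mult_right_zero)
    also have "\<dots> = cis (- s * ?S) * (cis (- (z - s) * ?S) * (LBINT w. cis (\<zeta> \<bullet> w) * of_real (G s (w - (z - s) *\<^sub>R ?v)) * packet \<kappa> d a p \<tau> w))"
      by (subst packet_transport[OF d J FG[OF s(1)] s(2) t]) simp
    also have "cis (- s * ?S) * (cis (- (z - s) * ?S) * x) = cis (- z * ?S) * x" for x
      by (simp add: cis_mult algebra_simps flip: mult.assoc)
    finally have e: "(LBINT w. sol C c \<kappa> \<gamma> J \<zeta> s w * (of_real (U w) * packet \<kappa> d a p (\<tau> + z - s) w))
      = cis (- z * ?S) * (LBINT w. cis (\<zeta> \<bullet> w) * of_real (G s (w - (z - s) *\<^sub>R ?v)) * packet \<kappa> d a p \<tau> w)" .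
    have "cis (z * ?S) * (cis (- z * ?S) * x) = x" for x by (simp add: cis_mult flip: mult.assoc)
    then show ?thesis unfolding e using True by (simp add: H_def mult_ac)
  qed (simp add: H_def)
  have "(LBINT w. sol C c \<kappa> \<gamma> J \<zeta> z w * packet \<kappa> d a p \<tau> w)
     = cis (- z * ?S) * (LBINT w. (1 + (LBINT s. of_real (H s w))) * (cis (\<zeta> \<bullet> w) * packet \<kappa> d a p \<tau> w))"
    unfolding sol ftc by (simp add: mult_ac flip: integral_mult_right_zero)
  also have "(LBINT w. (1 + (LBINT s. of_real (H s w))) * (cis (\<zeta> \<bullet> w) * packet \<kappa> d a p \<tau> w))
     = (LBINT w. cis (\<zeta> \<bullet> w) * packet \<kappa> d a p \<tau> w + (LBINT s. of_real (H s w) * (cis (\<zeta> \<bullet> w) * packet \<kappa> d a p \<tau> w)))"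
    by (simp add: distrib_right)
  also have "\<dots> = (LBINT w. cis (\<zeta> \<bullet> w) * packet \<kappa> d a p \<tau> w) + (LBINT w. LINT s|lborel. of_real (H s w) * (cis (\<zeta> \<bullet> w) * packet \<kappa> d a p \<tau> w))"
    by (rule Bochner_Integration.integral_add[OF ipk F(3)[OF Hb']])
  also have "(LBINT w. LINT s|lborel. of_real (H s w) * (cis (\<zeta> \<bullet> w) * packet \<kappa> d a p \<tau> w)) = (LBINT s. LINT w|lborel. of_real (H s w) * (cis (\<zeta> \<bullet> w) * packet \<kappa> d a p \<tau> w))"
    by (rule F(1)[OF Hb'])
  also have "\<dots> = cis (z * ?S) * (LBINT s:{0..z}. (LBINT w. sol C c \<kappa> \<gamma> J \<zeta> s w * (of_real (U w) * packet \<kappa> d a p (\<tau> + z - s) w)))"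
    unfolding inner set_lebesgue_integral_def by (simp flip: integral_mult_right_zero)
  finally show ?thesis unfolding tr0 distrib_left U_def
    by (simp add: cis_mult flip: mult.assoc)
qed

lemma borel_measurable_cnj [measurable (raw)]:
  "f \<in> borel_measurable M \<Longrightarrow> (\<lambda>x. cnj (f x)) \<in> borel_measurable M"
  by (rule borel_measurable_continuous_on[OF _ ]) (auto intro: continuous_intros)

section \<open>Finite measures for frequencies and times\<close>

text \<open>The spectral measure of \<open>C\<close>. As a finite measure of mass \<open>C 0\<close> it makes Fubini available for
  bounded integrands.\<close>

definition sm :: "(real^2 \<Rightarrow> real) \<Rightarrow> (real^2) measure" where
  "sm C = density lborel (\<lambda>k. ennreal (spec C k))"

definition iv :: "real \<Rightarrow> real measure" where
  "iv Z = density lborel (\<lambda>t. ennreal (indicator {0..Z} t))"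

lemma sets_sm [measurable_cong, simp]: "sets (sm C) = sets borel" and space_sm [simp]: "space (sm C) = UNIV"
  by (simp_all add: sm_def)

lemma sets_iv [measurable_cong, simp]: "sets (iv Z) = sets borel" and space_iv [simp]: "space (iv Z) = UNIV"
  by (simp_all add: iv_def)

lemma integral_iv:
  fixes f :: "real \<Rightarrow> 'b::{banach,second_countable_topology}"
  assumes "f \<in> borel_measurable borel"
  shows "(LINT t|iv Z. f t) = (LBINT t:{0..Z}. f t)"
  unfolding iv_def set_lebesgue_integral_def using assms by (subst integral_density) auto

lemma finite_measure_iv: "finite_measure (iv Z)"
  unfolding iv_def
  by (rule finite_measureI) (simp add: emeasure_density ennreal_indicator emeasure_lborel_Icc_eq)

lemma measure_iv: "0 \<le> Z \<Longrightarrow> measure (iv Z) (space (iv Z)) = Z"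
  unfolding iv_def measure_def
  by (simp add: emeasure_density ennreal_indicator)

lemma measure_sm:
  assumes C: "covariance_function C" and int: "integrable lborel C"
  shows "finite_measure (sm C)" "measure (sm C) (space (sm C)) = C 0"
proof -
  have [measurable]: "C \<in> borel_measurable borel" using int by auto
  have "complex_of_real (LBINT k. spec C k) = of_real (C 0)" using spec_inversion(2)[OF C int, of 0] by simp
  then have 1: "(LBINT k. spec C k) = C 0" by (simp only: of_real_eq_iff)
  have "emeasure (sm C) (space (sm C)) = ennreal (C 0)"
    unfolding sm_def using spec_nonneg[OF C int]
    by (simp add: emeasure_density nn_integral_eq_integral[OF spec_inversion(1)[OF C int]] 1)
  moreover have "0 \<le> C 0" using covariance_bound[OF C, of 0] by simp
  ultimately show "finite_measure (sm C)" "measure (sm C) (space (sm C)) = C 0"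
    by (auto intro: finite_measureI simp: measure_def)
qed

lemma integral_sm:
  fixes f :: "real^2 \<Rightarrow> 'b::{banach,second_countable_topology}"
  assumes C: "covariance_function C" and int: "integrable lborel C" and [measurable]: "f \<in> borel_measurable borel"
  shows "(LINT k|sm C. f k) = (LBINT k. spec C k *\<^sub>R f k)"
proof -
  have [measurable]: "C \<in> borel_measurable borel" using int by auto
  show ?thesis unfolding sm_def using spec_nonneg[OF C int] by (subst integral_density) auto
qed

lemma sm_char:
  assumes C: "covariance_function C" and int: "integrable lborel C"
  shows "(LINT k|sm C. cis (k \<bullet> x)) = of_real (C x)"
  using spec_inversion(2)[OF C int, of x] by (subst integral_sm[OF C int]) (auto simp: scaleR_conv_of_real)

lemma covariance_adjoint:
  fixes L :: "'e::euclidean_space \<Rightarrow> real^2"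
  assumes C: "covariance_function C" and int: "integrable lborel C" and L: "linear L"
  shows "of_real (C (L w)) = (LINT k|sm C. cis (adjoint L k \<bullet> w))"
  using sm_char[OF C int, of "L w"] adjoint_works[OF L, of w] by (simp add: inner_commute)

lemma Fubini_finite:
  fixes f :: "'a \<Rightarrow> 'b \<Rightarrow> complex"
  assumes "finite_measure M" "finite_measure N" and m: "(\<lambda>(x, y). f x y) \<in> borel_measurable (M \<Otimes>\<^sub>M N)"
    and b: "\<And>x y. norm (f x y) \<le> B"
  shows "(LINT y|N. LINT x|M. f x y) = (LINT x|M. LINT y|N. f x y)"
    and "integrable (M \<Otimes>\<^sub>M N) (\<lambda>(x, y). f x y)"
proof -
  interpret M: finite_measure M by fact
  interpret N: finite_measure N by fact
  have b': "norm (f x y) \<le> B * norm (1::complex)" for x y using b by simp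
  show "(LINT y|N. LINT x|M. f x y) = (LINT x|M. LINT y|N. f x y)"
    by (rule Fubini_bound(1)[OF M.sigma_finite_measure N.sigma_finite_measure m _ _ b']) auto
  show "integrable (M \<Otimes>\<^sub>M N) (\<lambda>(x, y). f x y)"
    by (rule integrable_pair_bound[OF M.sigma_finite_measure N.sigma_finite_measure m _ _ b']) auto
qed

lemma norm_integral_finite_le:
  fixes f :: "'a \<Rightarrow> complex"
  assumes "finite_measure M" "\<And>x. x \<in> space M \<Longrightarrow> norm (f x) \<le> B" "0 \<le> B"
  shows "norm (LINT x|M. f x) \<le> B * measure M (space M)"
proof -
  interpret finite_measure M by fact
  have "norm (LINT x|M. f x) \<le> (LINT x|M. norm (f x))" by (rule integral_norm_bound)
  also have "\<dots> \<le> (LINT x|M. B)" using assms by (intro integral_mono') auto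
  finally show ?thesis by (simp add: mult.commute)
qed

section \<open>Oscillatory integrals\<close>

text \<open>The time dependence of a wave that is switched on at \<open>s\<close>. The absolute value keeps it
  bounded for all real \<open>t\<close>.\<close>

definition wave :: "real \<Rightarrow> real \<Rightarrow> real \<Rightarrow> real \<Rightarrow> complex" where
  "wave \<gamma> s \<Omega> t = (if s \<le> t then of_real (exp (- \<gamma> * \<bar>t\<bar>)) * cis (t * \<Omega>) else 0)"

lemma borel_measurable_wave [measurable (raw)]:
  assumes [measurable]: "f \<in> borel_measurable M" "g \<in> borel_measurable M" "h \<in> borel_measurable M"
  shows "(\<lambda>x. wave \<gamma> (f x) (g x) (h x)) \<in> borel_measurable M"
  unfolding wave_def by measurable

lemma norm_wave_le: "0 \<le> \<gamma> \<Longrightarrow> norm (wave \<gamma> s \<Omega> t) \<le> 1"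
  by (simp add: wave_def norm_mult)

definition osc :: "real \<Rightarrow> real \<Rightarrow> real \<Rightarrow> real \<Rightarrow> complex" where
  "osc Z \<gamma> s \<Omega> = (LINT t|iv Z. wave \<gamma> s \<Omega> t)"

lemma borel_measurable_osc [measurable (raw)]:
  assumes [measurable]: "f \<in> borel_measurable M" "g \<in> borel_measurable M"
  shows "(\<lambda>x. osc Z \<gamma> (f x) (g x)) \<in> borel_measurable M"
proof -
  interpret finite_measure "iv Z" by (rule finite_measure_iv)
  show ?thesis unfolding osc_def by measurable
qed

lemma norm_osc_le: "0 \<le> Z \<Longrightarrow> 0 \<le> \<gamma> \<Longrightarrow> norm (osc Z \<gamma> s \<Omega>) \<le> Z"
  using norm_integral_finite_le[OF finite_measure_iv, of Z "wave \<gamma> s \<Omega>" 1] measure_iv[of Z]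
  by (simp add: norm_wave_le osc_def)

text \<open>Either bound \<open>\<bar>C\<bar>\<close> by \<open>C 0\<close>, or the spectral density by the integral of \<open>\<bar>C\<bar>\<close> and substitute
  \<open>(t / k0) k\<close>, which in dimension 2 yields \<open>(k0 / t)\<^sup>2\<close>. It is here that integrability of \<open>C\<close>
  produces decay.\<close>

lemma spectral_decay:
  assumes C: "covariance_function C" and int: "integrable lborel C" and k0: "k0 > 0"
  defines "K \<equiv> (C 0)\<^sup>2 + (LBINT x. \<bar>C x\<bar>)\<^sup>2 * k0\<^sup>2"
  shows "(LINT k|sm C. \<bar>C ((t / k0) *\<^sub>R k)\<bar>) \<le> K / (1 + t\<^sup>2)"
proof -
  interpret finite_measure "sm C" by (rule measure_sm[OF C int])
  have [measurable]: "C \<in> borel_measurable borel" using int by auto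
  let ?h = "LINT k|sm C. \<bar>C ((t / k0) *\<^sub>R k)\<bar>" and ?I = "LBINT x. \<bar>C x\<bar>"
  have C0: "0 \<le> C 0" using covariance_bound[OF C, of 0] by simp
  have 1: "?h \<le> (C 0)\<^sup>2"
  proof -
    have "?h \<le> (LINT k|sm C. C 0)" by (intro integral_mono') (use C0 covariance_bound[OF C] in auto)
    also have "\<dots> = C 0 * C 0" using measure_sm(2)[OF C int] by simp
    finally show ?thesis by (simp add: power2_eq_square)
  qed
  have 2: "?h * t\<^sup>2 \<le> ?I\<^sup>2 * k0\<^sup>2"
  proof (cases "t = 0")
    case False
    define r where "r = \<bar>t\<bar> / k0"
    have r: "r > 0" using False k0 by (simp add: r_def)
    have Cr: "C ((t / k0) *\<^sub>R k) = C (r *\<^sub>R k)" for k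
    proof (cases "t \<ge> 0")
      case False
      then have "(t / k0) *\<^sub>R k = - (r *\<^sub>R k)" by (simp add: r_def)
      then show ?thesis using C by (simp add: covariance_function_def)
    qed (simp add: r_def)
    have ai: "integrable lborel (\<lambda>k. \<bar>C (r *\<^sub>R k)\<bar>)" using integral_lborel_scale(1)[OF r int] by (rule integrable_abs)
    have "?h = (LBINT k. spec C k * \<bar>C (r *\<^sub>R k)\<bar>)" by (subst integral_sm[OF C int]) (auto simp: Cr)
    also have "\<dots> \<le> (LBINT k. ?I * \<bar>C (r *\<^sub>R k)\<bar>)"
    proof (rule integral_mono')
      show "integrable lborel (\<lambda>k. ?I * \<bar>C (r *\<^sub>R k)\<bar>)" by (intro integrable_mult_right ai)
      show "spec C k * \<bar>C (r *\<^sub>R k)\<bar> \<le> ?I * \<bar>C (r *\<^sub>R k)\<bar>" for k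
        using spec_bound[OF int, of k] by (intro mult_right_mono) auto
    qed auto
    also have "\<dots> = ?I * (?I / r\<^sup>2)"
      using integral_lborel_scale(2)[OF r, of "\<lambda>x. \<bar>C x\<bar>"] by (simp add: divide_inverse mult.commute)
    finally have "?h * r\<^sup>2 \<le> ?I\<^sup>2" using r by (simp add: power2_eq_square field_simps)
    then have "?h * r\<^sup>2 * k0\<^sup>2 \<le> ?I\<^sup>2 * k0\<^sup>2" by (intro mult_right_mono) auto
    moreover have "r\<^sup>2 * k0\<^sup>2 = t\<^sup>2" using k0 by (simp add: r_def power_divide)
    ultimately show ?thesis by (simp add: mult.assoc)
  qed auto
  have "?h * (1 + t\<^sup>2) \<le> K" using 1 2 by (simp add: K_def algebra_simps)
  moreover have "0 < 1 + t\<^sup>2" by (simp add: add_pos_nonneg)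
  ultimately show ?thesis by (simp add: pos_le_divide_eq)
qed

text \<open>The kernel has integral \<open>K pi\<close> in the difference of the times, so the double integral grows
  only linearly in \<open>Z\<close>.\<close>

lemma double_time_integral:
  assumes Z: "0 \<le> Z" and K: "0 \<le> K"
  shows "(LINT t|iv Z. LINT t'|iv Z. K / (1 + (t - t')\<^sup>2)) \<le> Z * (K * pi)"
proof -
  interpret finite_measure "iv Z" by (rule finite_measure_iv)
  have L: "integrable lborel (\<lambda>x::real. inverse (1 + x\<^sup>2))" "(LBINT x. inverse (1 + x\<^sup>2 :: real)) = pi"
    using integrable_inverse_1_plus_square LBINT_inverse_1_plus_square
    by (simp_all add: set_integrable_def set_lebesgue_integral_def interval_lebesgue_integral_def einterval_def)
  have i: "(LINT t'|iv Z. K / (1 + (t - t')\<^sup>2)) \<le> K * pi" for t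
  proof -
    have I: "integrable lborel (\<lambda>t'. K * inverse (1 + (t - t')\<^sup>2))"
      using lborel_integrable_real_affine[OF L(1), of "-1" t] by (intro integrable_mult_right) simp
    have "(LINT t'|iv Z. K / (1 + (t - t')\<^sup>2)) = (LBINT t'. indicator {0..Z} t' * (K * inverse (1 + (t - t')\<^sup>2)))"
    proof -
      have "(LINT t'|iv Z. K / (1 + (t - t')\<^sup>2)) = (LBINT t':{0..Z}. K / (1 + (t - t')\<^sup>2))" by (rule integral_iv) measurable
      then show ?thesis unfolding set_lebesgue_integral_def by (simp only: real_scaleR_def divide_inverse)
    qed
    also have "\<dots> \<le> (LBINT t'. K * inverse (1 + (t - t')\<^sup>2))"
      by (intro integral_mono' I) (use K in \<open>auto simp: indicator_def\<close>)
    also have "\<dots> = K * (LBINT t'. inverse (1 + (t + (-1) * t')\<^sup>2))" by simp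
    also have "(LBINT t'. inverse (1 + (t + (-1) * t')\<^sup>2)) = pi"
      using lborel_integral_real_affine[of "-1" "\<lambda>x. inverse (1 + x\<^sup>2 :: real)" t] L by simp
    finally show ?thesis .
  qed
  have "(LINT t|iv Z. LINT t'|iv Z. K / (1 + (t - t')\<^sup>2)) \<le> (LINT t|iv Z. K * pi)"
    by (intro integral_mono' i) (use K in auto)
  also have "\<dots> = Z * (K * pi)" using measure_iv[OF Z] by simp
  finally show ?thesis .
qed

text \<open>Expand the square as a double time integral. The average over \<open>k\<close> of the oscillation \<open>cis
  ((t - t') (k \<bullet> k') / k0)\<close> is \<open>C\<close> at a multiple of \<open>k'\<close>, and its average over \<open>k'\<close> decays by
  \<open>spectral_decay\<close>. So the mean square is of order \<open>Z\<close> instead of \<open>Z\<^sup>2\<close>.\<close>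

lemma osc_mean_square:
  assumes C: "covariance_function C" and int: "integrable lborel C" and k0: "k0 > 0"
    and Z: "0 \<le> Z" and \<gamma>: "0 \<le> \<gamma>" and \<sigma>: "\<sigma> = 1 \<or> \<sigma> = (-1::real)" and [measurable]: "\<alpha> \<in> borel_measurable borel"
  defines "K \<equiv> (C 0)\<^sup>2 + (LBINT x. \<bar>C x\<bar>)\<^sup>2 * k0\<^sup>2"
  shows "(LINT (k', k)|(sm C \<Otimes>\<^sub>M sm C). (norm (osc Z \<gamma> s (\<sigma> / k0 * (k \<bullet> k') + \<alpha> k')))\<^sup>2) \<le> Z * (K * pi)"
proof -
  interpret S: finite_measure "sm C" by (rule measure_sm[OF C int])
  interpret T: finite_measure "iv Z" by (rule finite_measure_iv)
  interpret SS: pair_sigma_finite "sm C" "sm C" ..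
  interpret TT: pair_sigma_finite "iv Z" "iv Z" ..
  have FS: "finite_measure (sm C \<Otimes>\<^sub>M sm C)" and FT: "finite_measure (iv Z \<Otimes>\<^sub>M iv Z)"
    by (intro finite_measure_pair_measure S.finite_measure_axioms T.finite_measure_axioms)+
  have [measurable]: "C \<in> borel_measurable borel" using int by auto
  define \<Omega> where "\<Omega> k' k = \<sigma> / k0 * (k \<bullet> k') + \<alpha> k'" for k' k
  have [measurable]: "(\<lambda>(x, y). \<Omega> x y) \<in> borel_measurable (borel \<Otimes>\<^sub>M borel)"
    unfolding \<Omega>_def by measurable
  define e where "e t \<Omega> = wave \<gamma> s \<Omega> t" for t \<Omega>
  have [measurable]: "(\<lambda>(x, y). e x y) \<in> borel_measurable (borel \<Otimes>\<^sub>M borel)"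
    unfolding e_def by measurable
  have eb: "norm (e t x) \<le> 1" for t x using \<gamma> by (simp add: e_def norm_wave_le)
  have sq: "of_real ((norm (osc Z \<gamma> s x))\<^sup>2) = (LINT (t, t')|(iv Z \<Otimes>\<^sub>M iv Z). e t x * cnj (e t' x))" for x
  proof -
    have I: "integrable (iv Z \<Otimes>\<^sub>M iv Z) (\<lambda>(t, t'). e t x * cnj (e t' x))"
      by (rule Fubini_finite(2)[where B=1]) (use T.finite_measure_axioms eb in \<open>auto simp: norm_mult intro!: mult_le_one\<close>)
    have "of_real ((norm (osc Z \<gamma> s x))\<^sup>2) = osc Z \<gamma> s x * cnj (osc Z \<gamma> s x)" by (simp only: complex_norm_square)
    also have "\<dots> = (LINT t|iv Z. LINT t'|iv Z. e t x * cnj (e t' x))" by (simp add: osc_def e_def[symmetric])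
    also have "\<dots> = (LINT (t, t')|(iv Z \<Otimes>\<^sub>M iv Z). e t x * cnj (e t' x))" using TT.integral_fst'[OF I] by simp
    finally show ?thesis .
  qed
  have inner: "norm (LINT (k', k)|(sm C \<Otimes>\<^sub>M sm C). e t (\<Omega> k' k) * cnj (e t' (\<Omega> k' k))) \<le> K / (1 + (t - t')\<^sup>2)" for t t'
  proof -
    have I: "integrable (sm C \<Otimes>\<^sub>M sm C) (\<lambda>(k', k). e t (\<Omega> k' k) * cnj (e t' (\<Omega> k' k)))"
      by (rule Fubini_finite(2)[where B=1]) (use S.finite_measure_axioms eb in \<open>auto simp: norm_mult intro!: mult_le_one\<close>)
    have eq: "norm (LINT k|sm C. e t (\<Omega> k' k) * cnj (e t' (\<Omega> k' k))) \<le> \<bar>C (((t - t') / k0) *\<^sub>R k')\<bar>" for k'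
    proof (cases "s \<le> t \<and> s \<le> t'")
      case True
      have "e t (\<Omega> k' k) * cnj (e t' (\<Omega> k' k)) = of_real (exp (- \<gamma> * \<bar>t\<bar>) * exp (- \<gamma> * \<bar>t'\<bar>)) * cis ((t - t') * \<alpha> k') * cis (k \<bullet> ((\<sigma> * (t - t') / k0) *\<^sub>R k'))" for k
      proof -
        have "(t - t') * \<Omega> k' k = (t - t') * \<alpha> k' + k \<bullet> ((\<sigma> * (t - t') / k0) *\<^sub>R k')"
          by (simp add: \<Omega>_def distrib_left mult_ac)
        then have c: "cis (t * \<Omega> k' k) * cnj (cis (t' * \<Omega> k' k)) = cis ((t - t') * \<alpha> k') * cis (k \<bullet> ((\<sigma> * (t - t') / k0) *\<^sub>R k'))"
          by (simp only: cis_cnj cis_mult flip: left_diff_distrib) (simp add: left_diff_distrib)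
        have "e t (\<Omega> k' k) * cnj (e t' (\<Omega> k' k)) = of_real (exp (- \<gamma> * \<bar>t\<bar>)) * of_real (exp (- \<gamma> * \<bar>t'\<bar>)) * (cis (t * \<Omega> k' k) * cnj (cis (t' * \<Omega> k' k)))"
          using True by (simp add: e_def wave_def)
        then show ?thesis unfolding c of_real_mult by (simp only: mult.assoc)
      qed
      then have "(LINT k|sm C. e t (\<Omega> k' k) * cnj (e t' (\<Omega> k' k))) = of_real (exp (- \<gamma> * \<bar>t\<bar>) * exp (- \<gamma> * \<bar>t'\<bar>)) * cis ((t - t') * \<alpha> k') * of_real (C ((\<sigma> * (t - t') / k0) *\<^sub>R k'))"
        by (simp only: integral_mult_right_zero sm_char[OF C int])
      also have "norm \<dots> = exp (- \<gamma> * \<bar>t\<bar>) * exp (- \<gamma> * \<bar>t'\<bar>) * \<bar>C ((\<sigma> * (t - t') / k0) *\<^sub>R k')\<bar>" by (simp add: norm_mult)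
      also have "\<dots> \<le> 1 * 1 * \<bar>C ((\<sigma> * (t - t') / k0) *\<^sub>R k')\<bar>" using \<gamma> by (intro mult_mono) auto
      also have "C ((\<sigma> * (t - t') / k0) *\<^sub>R k') = C (((t - t') / k0) *\<^sub>R k')"
        using \<sigma>
      proof
        assume "\<sigma> = - 1"
        then have "(\<sigma> * (t - t') / k0) *\<^sub>R k' = - (((t - t') / k0) *\<^sub>R k')"
          by (simp add: minus_divide_left flip: scaleR_minus_left)
        then show ?thesis using C by (simp add: covariance_function_def)
      qed simp
      finally show ?thesis by simp
    qed (auto simp: e_def wave_def)
    have "(LINT (k', k)|(sm C \<Otimes>\<^sub>M sm C). e t (\<Omega> k' k) * cnj (e t' (\<Omega> k' k))) = (LINT k'|sm C. LINT k|sm C. e t (\<Omega> k' k) * cnj (e t' (\<Omega> k' k)))"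
      using SS.integral_fst'[OF I] by simp
    also have "norm \<dots> \<le> (LINT k'|sm C. norm (LINT k|sm C. e t (\<Omega> k' k) * cnj (e t' (\<Omega> k' k))))" by (rule integral_norm_bound)
    also have "\<dots> \<le> (LINT k'|sm C. \<bar>C (((t - t') / k0) *\<^sub>R k')\<bar>)"
    proof (rule integral_mono'[OF _ eq])
      show "integrable (sm C) (\<lambda>k'. \<bar>C (((t - t') / k0) *\<^sub>R k')\<bar>)"
        by (rule S.integrable_const_bound[where B="C 0"]) (use covariance_bound[OF C] in auto)
    qed auto
    also have "\<dots> \<le> K / (1 + (t - t')\<^sup>2)" unfolding K_def by (rule spectral_decay[OF C int k0])
    finally show ?thesis .
  qed
  have K0: "0 \<le> K" unfolding K_def by simp
  have "complex_of_real (LINT (k', k)|(sm C \<Otimes>\<^sub>M sm C). (norm (osc Z \<gamma> s (\<Omega> k' k)))\<^sup>2)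
     = (LINT x|(sm C \<Otimes>\<^sub>M sm C). LINT y|(iv Z \<Otimes>\<^sub>M iv Z). e (fst y) (\<Omega> (fst x) (snd x)) * cnj (e (snd y) (\<Omega> (fst x) (snd x))))"
    by (simp add: case_prod_beta' sq flip: integral_complex_of_real of_real_power)
  also have "\<dots> = (LINT y|(iv Z \<Otimes>\<^sub>M iv Z). LINT x|(sm C \<Otimes>\<^sub>M sm C). e (fst y) (\<Omega> (fst x) (snd x)) * cnj (e (snd y) (\<Omega> (fst x) (snd x))))"
    by (rule Fubini_finite(1)[OF FT FS, where B=1]) (use eb in \<open>auto simp: norm_mult intro!: mult_le_one\<close>)
  also have "norm \<dots> \<le> (LINT y|(iv Z \<Otimes>\<^sub>M iv Z). norm (LINT x|(sm C \<Otimes>\<^sub>M sm C). e (fst y) (\<Omega> (fst x) (snd x)) * cnj (e (snd y) (\<Omega> (fst x) (snd x)))))"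
    by (rule integral_norm_bound)
  also have "\<dots> \<le> (LINT y|(iv Z \<Otimes>\<^sub>M iv Z). K / (1 + (fst y - snd y)\<^sup>2))"
  proof (rule integral_mono')
    interpret P: finite_measure "iv Z \<Otimes>\<^sub>M iv Z" by (rule FT)
    show "integrable (iv Z \<Otimes>\<^sub>M iv Z) (\<lambda>y. K / (1 + (fst y - snd y)\<^sup>2))"
      by (rule P.integrable_const_bound[where B=K]) (use K0 in \<open>auto simp: divide_le_eq mult_le_cancel_left1 add_pos_nonneg intro!: AE_I2\<close>)
    show "norm (LINT x|(sm C \<Otimes>\<^sub>M sm C). e (fst y) (\<Omega> (fst x) (snd x)) * cnj (e (snd y) (\<Omega> (fst x) (snd x)))) \<le> K / (1 + (fst y - snd y)\<^sup>2)" for y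
      using inner[of "fst y" "snd y"] by (simp add: case_prod_beta')
  qed (use K0 in auto)
  also have "\<dots> = (LINT t|iv Z. LINT t'|iv Z. K / (1 + (t - t')\<^sup>2))"
  proof -
    interpret P: finite_measure "iv Z \<Otimes>\<^sub>M iv Z" by (rule FT)
    have "integrable (iv Z \<Otimes>\<^sub>M iv Z) (\<lambda>(t, t'). K / (1 + (t - t')\<^sup>2))"
      by (rule P.integrable_const_bound[where B=K]) (use K0 in \<open>auto simp: divide_le_eq mult_le_cancel_left1 add_pos_nonneg intro!: AE_I2\<close>)
    from TT.integral_fst'[OF this] show ?thesis by (simp add: case_prod_beta')
  qed
  also have "\<dots> \<le> Z * (K * pi)" by (rule double_time_integral[OF Z K0])
  finally show ?thesis unfolding norm_of_real \<Omega>_def by (simp add: case_prod_beta')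
qed

text \<open>From the mean square to the mean by \<open>x \<le> x\<^sup>2 / sqrt Z + sqrt Z\<close>.\<close>

lemma osc_mean:
  assumes C: "covariance_function C" and int: "integrable lborel C" and k0: "k0 > 0"
    and Z: "0 < Z" and \<gamma>: "0 \<le> \<gamma>" and \<sigma>: "\<sigma> = 1 \<or> \<sigma> = (-1::real)" and [measurable]: "\<alpha> \<in> borel_measurable borel"
  defines "K \<equiv> (C 0)\<^sup>2 + (LBINT x. \<bar>C x\<bar>)\<^sup>2 * k0\<^sup>2"
  shows "(LINT k|sm C. LINT k'|sm C. norm (osc Z \<gamma> s (\<sigma> / k0 * (k \<bullet> k') + \<alpha> k'))) \<le> sqrt Z * (K * pi + (C 0)\<^sup>2)"
proof -
  interpret S: finite_measure "sm C" by (rule measure_sm[OF C int])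
  interpret SS: pair_sigma_finite "sm C" "sm C" ..
  interpret P: finite_measure "sm C \<Otimes>\<^sub>M sm C"
    by (intro finite_measure_pair_measure S.finite_measure_axioms)
  let ?o = "\<lambda>k' k. norm (osc Z \<gamma> s (\<sigma> / k0 * (k \<bullet> k') + \<alpha> k'))"
  have ob: "?o k' k \<le> Z" for k' k by (rule norm_osc_le) (use Z \<gamma> in auto)
  have I1: "integrable (sm C \<Otimes>\<^sub>M sm C) (\<lambda>(k', k). ?o k' k)"
    by (rule P.integrable_const_bound[where B=Z]) (use ob in auto)
  have I2: "integrable (sm C \<Otimes>\<^sub>M sm C) (\<lambda>(k', k). (?o k' k)\<^sup>2)"
    by (rule P.integrable_const_bound[where B="Z\<^sup>2"]) (use ob in \<open>auto intro!: power_mono AE_I2\<close>)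
  have pt: "x \<le> x\<^sup>2 / sqrt Z + sqrt Z" if "0 \<le> x" for x
  proof (cases "x \<le> sqrt Z")
    case True
    then show ?thesis using Z by (simp add: add_increasing)
  next
    case False
    then have "x * sqrt Z \<le> x * x" using that by (intro mult_left_mono) auto
    then have "x \<le> x\<^sup>2 / sqrt Z" using Z by (simp add: pos_le_divide_eq power2_eq_square)
    then show ?thesis using Z by (simp add: add_increasing2)
  qed
  have m: "measure (sm C \<Otimes>\<^sub>M sm C) (space (sm C \<Otimes>\<^sub>M sm C)) = (C 0)\<^sup>2"
  proof -
    have "measure (sm C \<Otimes>\<^sub>M sm C) (space (sm C) \<times> space (sm C)) = measure (sm C) (space (sm C)) * measure (sm C) (space (sm C))"
      using S.emeasure_pair_measure_Times[of UNIV "sm C" UNIV] by (simp add: measure_def enn2real_mult)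
    then show ?thesis using measure_sm(2)[OF C int] by (simp add: space_pair_measure power2_eq_square)
  qed
  have "(LINT k|sm C. LINT k'|sm C. ?o k' k) = (LINT (k', k)|(sm C \<Otimes>\<^sub>M sm C). ?o k' k)"
    using SS.integral_snd[OF I1] by simp
  also have "\<dots> \<le> (LINT (k', k)|(sm C \<Otimes>\<^sub>M sm C). (?o k' k)\<^sup>2 / sqrt Z + sqrt Z)"
    using I1 I2 pt by (intro integral_mono) (auto simp: case_prod_beta' intro!: Bochner_Integration.integrable_add integrable_divide)
  also have "\<dots> = (LINT (k', k)|(sm C \<Otimes>\<^sub>M sm C). (?o k' k)\<^sup>2) / sqrt Z + sqrt Z * (C 0)\<^sup>2"
    using I2 unfolding case_prod_beta' m[symmetric] by (subst Bochner_Integration.integral_add) (auto simp: mult.commute)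
  also have "\<dots> \<le> Z * (K * pi) / sqrt Z + sqrt Z * (C 0)\<^sup>2"
    unfolding K_def using Z by (intro add_right_mono divide_right_mono osc_mean_square[OF C int k0 _ \<gamma> \<sigma>]) auto
  also have "Z * (K * pi) / sqrt Z = sqrt Z * (K * pi)"
    using Z by (simp add: real_div_sqrt flip: times_divide_eq_left)
  finally show ?thesis by (simp add: distrib_left)
qed

section \<open>Comparison with the solution of an evolution equation\<close>

lemma residual_eq:
  fixes X Y :: complex
  assumes "X = F + A" shows "norm ((X - Y) - (A - B)) = norm (Y - F - B)"
proof -
  have "(X - Y) - (A - B) = - (Y - F - B)" using assms by simp
  then show ?thesis by (simp only: norm_minus_cancel)
qed

text \<open>The difference of a solution and an approximate solution satisfies the hypotheses of
  \<open>packet_gronwall\<close>, with an a priori bound from the square-integrability of \<open>m\<close> and the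
  boundedness of \<open>N\<close>.\<close>

lemma approximate_solution:
  fixes m N :: "real \<Rightarrow> 'e::euclidean_space \<Rightarrow> complex"
  assumes sol: "solves_evolution A V f0 m"
    and A: "\<And>d a p \<tau>. 0 < d \<Longrightarrow> A (packet \<kappa> d a p \<tau>) = schr \<kappa> (packet \<kappa> d a p \<tau>)"
    and V: "FS UNIV b (\<lambda>w. of_real (V w))" and b: "0 < b" and Z: "0 \<le> Z"
    and Ncont: "\<And>s. 0 \<le> s \<Longrightarrow> continuous_on UNIV (N s)"
    and Nbd: "\<And>s w. 0 \<le> s \<Longrightarrow> s \<le> Z \<Longrightarrow> norm (N s w) \<le> B"
    and Nint: "\<And>d a p s \<tau>. 0 < d \<Longrightarrow> 0 \<le> s \<Longrightarrow> 0 \<le> \<tau> \<Longrightarrow> s + \<tau> \<le> Z \<Longrightarrow>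
       set_integrable lborel {0..s} (\<lambda>r. LINT w|lborel. N r w * (of_real (V w) * packet \<kappa> d a p (\<tau> + s - r) w))"
    and Neq: "\<And>d a p s \<tau>. 0 < d \<Longrightarrow> 0 \<le> s \<Longrightarrow> 0 \<le> \<tau> \<Longrightarrow> s + \<tau> \<le> Z \<Longrightarrow>
       norm ((LBINT w. N s w * packet \<kappa> d a p \<tau> w) - (LBINT w. f0 w * packet \<kappa> d a p (\<tau> + s) w)
         - (LBINT r:{0..s}. (LBINT w. N r w * (of_real (V w) * packet \<kappa> d a p (\<tau> + s - r) w)))) \<le> \<alpha>"
  shows "norm (m Z x - N Z x) \<le> 2 * \<alpha> * exp (2 * b * Z)"
proof -
  have path: "continuous_L2_path m" and mcont: "continuous_on ({0..} \<times> UNIV) (\<lambda>(z, w). m z w)"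
    using sol by (auto simp: solves_evolution_def)
  have msq: "square_integrable (m s)" if "0 \<le> s" for s using path that by (simp add: continuous_L2_path_def)
  have Vm[measurable]: "V \<in> borel_measurable borel"
    using FS_measurable[OF V] by (simp add: borel_measurable_complex_iff)
  have Vb: "\<bar>V w\<bar> \<le> b" for w using FS_bound[OF V, of w] by simp
  have Nm: "N s \<in> borel_measurable borel" if "0 \<le> s" for s by (rule borel_measurable_continuous_onI[OF Ncont[OF that]])
  \<comment> \<open>Continuity in time bounds the norms of \<open>m s\<close> on the compact interval; the inner product \<open>m
    cnj m\<close> is used since its continuity is an instance of \<open>L2_pairing_tendsto\<close>.\<close>
  have "continuous_on {0..Z} (\<lambda>s. LINT w|lborel. m s w * cnj (m s w))"
    unfolding continuous_on_def
  proof
    fix s assume s: "s \<in> {0..Z}"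
    have l: "((\<lambda>t. LINT w|lborel. (norm (m t w - m s w))\<^sup>2) \<longlongrightarrow> 0) (at s within {0..Z})"
      using path s by (auto simp: continuous_L2_path_def intro: tendsto_within_subset)
    have cn: "square_integrable (\<lambda>w. cnj (m t w))" if "0 \<le> t" for t
      using msq[OF that] by (auto simp: square_integrable_def)
    show "((\<lambda>t. LINT w|lborel. m t w * cnj (m t w)) \<longlongrightarrow> (LBINT w. m s w * cnj (m s w))) (at s within {0..Z})"
    proof (rule L2_pairing_tendsto[where S="{0..Z}"])
      show "\<forall>\<^sub>F t in at s within {0..Z}. t \<in> {0..Z}" by (simp add: eventually_at_filter)
      show "((\<lambda>t. LINT w|lborel. (norm (cnj (m t w) - cnj (m s w)))\<^sup>2) \<longlongrightarrow> 0) (at s within {0..Z})"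
        using l by (simp flip: complex_cnj_diff)
    qed (use s l msq cn in auto)
  qed
  then have "bounded ((\<lambda>s. LINT w|lborel. m s w * cnj (m s w)) ` {0..Z})"
    by (intro compact_imp_bounded compact_continuous_image) auto
  then obtain Q0 where Q0: "\<And>s. s \<in> {0..Z} \<Longrightarrow> norm (LBINT w. m s w * cnj (m s w)) \<le> Q0"
    unfolding bounded_iff by blast
  have mb: "(LBINT w. (norm (m s w))\<^sup>2) \<le> Q0" if s: "s \<in> {0..Z}" for s
  proof -
    have "complex_of_real (LBINT w. (norm (m s w))\<^sup>2) = (LBINT w. m s w * cnj (m s w))"
      by (simp only: integral_complex_of_real[symmetric] complex_norm_square)
    then have "norm (complex_of_real (LBINT w. (norm (m s w))\<^sup>2)) \<le> Q0" using Q0[OF s] by simp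
    then show ?thesis by simp
  qed
  have Q00: "0 \<le> Q0" using order_trans[OF norm_ge_zero Q0[of 0]] Z by simp
  have Zin: "isCont (m Z) x"
  proof -
    have "continuous_on UNIV (\<lambda>w. (\<lambda>(z, w). m z w) (Z, w))"
      by (rule continuous_on_compose2[OF mcont]) (use Z in \<open>auto intro!: continuous_intros\<close>)
    then show ?thesis by (simp add: continuous_on_eq_continuous_at)
  qed
  have [measurable]: "m Z \<in> borel_measurable borel" "N Z \<in> borel_measurable borel"
    using msq[OF Z] Nm[OF Z] by (auto simp: square_integrable_def)
  let ?D = "\<lambda>s w. m s w - N s w"
  have pk: "norm (LBINT w. ?D Z w * packet \<kappa> d x 0 0 w) \<le> 2 * \<alpha> * exp (2 * b * Z)" if d: "d > 0" for d
  proof -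
    note [measurable] = borel_measurable_packet[OF d]
    obtain M where M: "M \<ge> 0" "\<And>a p \<tau>. \<bar>\<tau>\<bar> \<le> Z \<Longrightarrow> (LBINT w. norm (packet \<kappa> d a p \<tau> w)) \<le> M \<and>
       integrable lborel (\<lambda>w. (norm (packet \<kappa> d a p \<tau> w))\<^sup>2) \<and> (LBINT w. (norm (packet \<kappa> d a p \<tau> w))\<^sup>2) \<le> M"
      using packet_norms_bounded[OF d, of Z \<kappa>] by blast
    have psq: "square_integrable (packet \<kappa> d a p \<tau>)" if "0 \<le> \<tau>" "\<tau> \<le> Z" for a p \<tau>
      using M(2)[of \<tau> a p] that unfolding square_integrable_def by auto
    have mi: "integrable lborel (\<lambda>w. m s w * packet \<kappa> d a p \<tau> w)" if "0 \<le> s" "0 \<le> \<tau>" "s + \<tau> \<le> Z" for s a p \<tau>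
      by (intro square_integrable_mult msq psq) (use that in auto)
    have Ni: "integrable lborel (\<lambda>w. N s w * packet \<kappa> d a p \<tau> w)" if "0 \<le> s" "0 \<le> \<tau>" "s + \<tau> \<le> Z" for s a p \<tau>
      by (rule integrable_bounded_mult[OF integrable_packet(1)[OF d] _ Nbd]) (use that Nm in auto)
    have di: "integrable lborel (\<lambda>w. ?D s w * packet \<kappa> d a p \<tau> w)" if "0 \<le> s" "0 \<le> \<tau>" "s + \<tau> \<le> Z" for s a p \<tau>
      unfolding left_diff_distrib by (intro Bochner_Integration.integrable_diff mi Ni that)
    have ds: "(LBINT w. ?D s w * packet \<kappa> d a p \<tau> w) = (LBINT w. m s w * packet \<kappa> d a p \<tau> w) - (LBINT w. N s w * packet \<kappa> d a p \<tau> w)"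
      if "0 \<le> s" "0 \<le> \<tau>" "s + \<tau> \<le> Z" for s a p \<tau>
      unfolding left_diff_distrib by (intro Bochner_Integration.integral_diff mi Ni that)
    have VI: "integrable lborel (\<lambda>w. f w * (of_real (V w) * packet \<kappa> d a p \<tau> w))" if "integrable lborel (\<lambda>w. f w * packet \<kappa> d a p \<tau> w)" for f :: "'e \<Rightarrow> complex" and a p \<tau>
      using integrable_bounded_mult[OF that, of "\<lambda>w. of_real (V w)" b] Vb by (simp add: mult.left_commute)
    have dV: "(LBINT w. ?D r w * (of_real (V w) * packet \<kappa> d a p \<tau> w)) = (LBINT w. m r w * (of_real (V w) * packet \<kappa> d a p \<tau> w)) - (LBINT w. N r w * (of_real (V w) * packet \<kappa> d a p \<tau> w))"
      if "0 \<le> r" "0 \<le> \<tau>" "r + \<tau> \<le> Z" for r a p \<tau>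
      unfolding left_diff_distrib by (intro Bochner_Integration.integral_diff VI mi Ni that)
    show ?thesis
    proof (rule packet_gronwall[OF d b V, where D="?D" and Z=Z and M="sqrt Q0 * sqrt M + \<bar>B\<bar> * M"])
      fix s a p \<tau> assume st: "0 \<le> s" "0 \<le> (\<tau>::real)" "s + \<tau> \<le> Z"
      show "integrable lborel (\<lambda>w. ?D s w * packet \<kappa> d a p \<tau> w)" by (rule di[OF st])
      have "norm (LBINT w. m s w * packet \<kappa> d a p \<tau> w) \<le> sqrt (LBINT w. (norm (m s w))\<^sup>2) * sqrt (LBINT w. (norm (packet \<kappa> d a p \<tau> w))\<^sup>2)"
        by (intro square_integrable_mult msq psq) (use st in auto)
      also have "\<dots> \<le> sqrt Q0 * sqrt M" using mb[of s] M(2)[of \<tau> a p] st Q00 by (intro mult_mono real_sqrt_le_mono) auto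
      finally have 1: "norm (LBINT w. m s w * packet \<kappa> d a p \<tau> w) \<le> sqrt Q0 * sqrt M" .
      have "norm (LBINT w. N s w * packet \<kappa> d a p \<tau> w) \<le> (LBINT w. norm (N s w * packet \<kappa> d a p \<tau> w))" by (rule integral_norm_bound)
      also have "\<dots> \<le> (LBINT w. \<bar>B\<bar> * norm (packet \<kappa> d a p \<tau> w))"
      proof (rule integral_mono')
        show "integrable lborel (\<lambda>w. \<bar>B\<bar> * norm (packet \<kappa> d a p \<tau> w))" by (intro integrable_mult_right integrable_norm integrable_packet d)
        show "norm (N s w * packet \<kappa> d a p \<tau> w) \<le> \<bar>B\<bar> * norm (packet \<kappa> d a p \<tau> w)" for w
          unfolding norm_mult using Nbd[of s w] st by (intro mult_right_mono) auto
      qed auto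
      also have "\<dots> \<le> \<bar>B\<bar> * M" using M(2)[of \<tau> a p] st by (simp add: mult_left_mono)
      finally have 2: "norm (LBINT w. N s w * packet \<kappa> d a p \<tau> w) \<le> \<bar>B\<bar> * M" .
      show "norm (LBINT w. ?D s w * packet \<kappa> d a p \<tau> w) \<le> sqrt Q0 * sqrt M + \<bar>B\<bar> * M"
        unfolding ds[OF st] by (rule order_trans[OF norm_triangle_ineq4 add_mono[OF 1 2]])
      note duh = packet_duhamel[OF sol A[OF d] Vm Vb d st(1), of a p \<tau>]
      have "(LBINT r:{0..s}. (LBINT w. ?D r w * (of_real (V w) * packet \<kappa> d a p (\<tau> + s - r) w)))
        = (LBINT r:{0..s}. (LBINT w. m r w * (of_real (V w) * packet \<kappa> d a p (\<tau> + s - r) w)) - (LBINT w. N r w * (of_real (V w) * packet \<kappa> d a p (\<tau> + s - r) w)))"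
        by (intro set_lebesgue_integral_cong allI impI dV) (use st in auto)
      also have "\<dots> = (LBINT r:{0..s}. (LBINT w. m r w * (of_real (V w) * packet \<kappa> d a p (\<tau> + s - r) w))) - (LBINT r:{0..s}. (LBINT w. N r w * (of_real (V w) * packet \<kappa> d a p (\<tau> + s - r) w)))"
        by (intro set_integral_diff duh Nint d st)
      finally have i: "(LBINT r:{0..s}. (LBINT w. ?D r w * (of_real (V w) * packet \<kappa> d a p (\<tau> + s - r) w)))
        = (LBINT r:{0..s}. (LBINT w. m r w * (of_real (V w) * packet \<kappa> d a p (\<tau> + s - r) w))) - (LBINT r:{0..s}. (LBINT w. N r w * (of_real (V w) * packet \<kappa> d a p (\<tau> + s - r) w)))" .
      show "norm ((LBINT w. ?D s w * packet \<kappa> d a p \<tau> w) - (LBINT r:{0..s}. (LBINT w. ?D r w * (of_real (V w) * packet \<kappa> d a p (\<tau> + s - r) w)))) \<le> \<alpha>"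
        unfolding ds[OF st] i residual_eq[OF duh(1)] by (rule Neq[OF d st])
    qed (use Z in auto)
  qed
  show ?thesis
  proof (rule pointwise_bound_from_packets[OF _ _ _ pk])
    show "isCont (\<lambda>w. m Z w - N Z w) x"
      using Zin Ncont[OF Z] by (intro isCont_diff) (auto simp: continuous_on_eq_continuous_at)
    show "integrable lborel (\<lambda>w. (m Z w - N Z w) * of_real (exp (- c * (norm (w - x))\<^sup>2)))" if c: "c > 0" for c
    proof -
      let ?g = "\<lambda>w. complex_of_real (exp (- c * (norm (w - x))\<^sup>2))"
      have gi: "integrable lborel ?g"
        using gaussian_integrable'[OF c, where 'e='e] integral_lborel_translate(2)[of "\<lambda>w. complex_of_real (exp (- c * (norm (w::'e))\<^sup>2))" "- x"] by simp
      have "square_integrable ?g"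
      proof -
        have "integrable lborel (\<lambda>w. exp (- (2 * c) * (norm (- x + w::'e))\<^sup>2))"
          using gaussian_integrable'[of "2 * c", where 'e='e] c by (subst integral_lborel_translate(2)[of "\<lambda>w. exp (- (2 * c) * (norm (w::'e))\<^sup>2)"]) auto
        then show ?thesis unfolding square_integrable_def
          by (simp add: power2_eq_square mult.assoc flip: exp_add)
      qed
      then have "integrable lborel (\<lambda>w. m Z w * ?g w)" by (intro square_integrable_mult msq Z)
      moreover have "integrable lborel (\<lambda>w. N Z w * ?g w)"
        by (rule integrable_bounded_mult[OF gi _ Nbd]) (use Z in auto)
      ultimately show ?thesis unfolding left_diff_distrib by (rule Bochner_Integration.integrable_diff)
    qed
  qed measurable
qed

section \<open>Source terms\<close>

text \<open>The integrand of a source term \<open>C (L w)\<close> times an unscattered wave, paired with a packet, in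
  coordinates moving along the characteristics of the wave.\<close>

definition src :: "(real^2 \<Rightarrow> real) \<Rightarrow> ('e::euclidean_space \<Rightarrow> real) \<Rightarrow> real \<Rightarrow> ('e \<Rightarrow> real^2) \<Rightarrow> 'e \<Rightarrow> real \<Rightarrow> 'e \<Rightarrow> 'e \<Rightarrow> real \<Rightarrow> real \<Rightarrow> 'e \<Rightarrow> complex" where
  "src C \<kappa> \<gamma> L \<zeta> d a p T t w = of_real (exp (- \<gamma> * \<bar>t\<bar>) * C (L (w + t *\<^sub>R vel \<kappa> \<zeta>)))
     * (cis (\<zeta> \<bullet> (w + t *\<^sub>R vel \<kappa> \<zeta>) - t * symb \<kappa> \<zeta>) * packet \<kappa> d a p (T - t) (w + t *\<^sub>R vel \<kappa> \<zeta>))"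

lemma borel_measurable_src:
  assumes [measurable]: "C \<in> borel_measurable borel" and L: "linear L" and d: "d > 0"
    and [measurable]: "f \<in> borel_measurable M" "g \<in> measurable M borel"
  shows "(\<lambda>x. src C \<kappa> \<gamma> L \<zeta> d a p T (f x) (g x)) \<in> borel_measurable M"
proof -
  note [measurable] = borel_measurable_packet[OF d] measurable_linear[OF L]
  show ?thesis unfolding src_def by measurable
qed

lemma AE_iv: "AE t in iv Z. 0 \<le> t \<and> t \<le> Z"
  unfolding iv_def by (subst AE_density) (auto simp: indicator_def)

lemma integrable_src:
  fixes a :: "'e::euclidean_space"
  assumes C: "covariance_function C" and int: "integrable lborel C" and L: "linear L" and d: "d > 0"
    and \<gamma>: "0 \<le> \<gamma>"
  shows "integrable (iv Z \<Otimes>\<^sub>M lborel) (\<lambda>(t, w). src C \<kappa> \<gamma> L \<zeta> d a p T t w)"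
proof -
  interpret T: finite_measure "iv Z" by (rule finite_measure_iv)
  interpret P: pair_sigma_finite "iv Z" "lborel :: 'e measure" ..
  have C_meas[measurable]: "C \<in> borel_measurable borel" using int by auto
  note [measurable] = borel_measurable_src[OF C_meas L d] measurable_linear[OF L]
  have C0: "0 \<le> C 0" using covariance_bound[OF C, of 0] by simp
  let ?S = "src C \<kappa> \<gamma> L \<zeta> d a p T"
  let ?v = "vel \<kappa> \<zeta>"
  have b: "norm (?S t w) \<le> C 0 * norm (packet \<kappa> d a p (T - t) (t *\<^sub>R ?v + w))" for t w
  proof -
    have "exp (- \<gamma> * \<bar>t\<bar>) * \<bar>C (L (w + t *\<^sub>R ?v))\<bar> \<le> 1 * C 0"
      using \<gamma> covariance_bound[OF C] by (intro mult_mono) auto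
    then have "exp (- \<gamma> * \<bar>t\<bar>) * \<bar>C (L (w + t *\<^sub>R ?v))\<bar> * norm (packet \<kappa> d a p (T - t) (w + t *\<^sub>R ?v)) \<le> 1 * C 0 * norm (packet \<kappa> d a p (T - t) (w + t *\<^sub>R ?v))"
      by (intro mult_right_mono) auto
    then show ?thesis by (simp add: src_def norm_mult add.commute abs_mult)
  qed
  have pi: "integrable lborel (\<lambda>w. packet \<kappa> d a p (T - t) (t *\<^sub>R ?v + w))" for t
    using integrable_packet(1)[OF d, of \<kappa> a p "T - t"] by (simp add: integral_lborel_translate(2))
  have pn: "(LBINT w. norm (packet \<kappa> d a p (T - t) (t *\<^sub>R ?v + w))) = (LBINT w. norm (packet \<kappa> d a p (T - t) w))" for t
    by (rule integral_lborel_translate(1))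
  have I: "integrable lborel (?S t)" for t
    by (rule Bochner_Integration.integrable_bound[OF integrable_mult_right[OF integrable_norm[OF pi], of "C 0"]])
       (use b C0 in \<open>auto simp: abs_mult\<close>)
  obtain M where M: "M \<ge> 0" "\<And>\<tau>. \<bar>\<tau>\<bar> \<le> \<bar>T\<bar> + \<bar>Z\<bar> \<Longrightarrow> (LBINT w. norm (packet \<kappa> d a p \<tau> w)) \<le> M"
    using packet_norms_bounded[OF d, of "\<bar>T\<bar> + \<bar>Z\<bar>" \<kappa>] by blast
  show ?thesis
  proof (rule P.Fubini_integrable)
    show "integrable (iv Z) (\<lambda>t. LINT w|lborel. norm (case (t, w) of (t, w) \<Rightarrow> ?S t w))"
    proof (rule T.integrable_const_bound[where B="C 0 * M"])
      show "AE t in iv Z. norm (LBINT w. norm (case (t, w) of (t, w) \<Rightarrow> ?S t w)) \<le> C 0 * M"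
        using AE_iv
      proof eventually_elim
        case (elim t)
        have "(LBINT w. norm (?S t w)) \<le> (LBINT w. C 0 * norm (packet \<kappa> d a p (T - t) (t *\<^sub>R ?v + w)))"
          by (intro integral_mono integrable_norm I integrable_mult_right pi b)
        also have "\<dots> \<le> C 0 * M" proof -
          have "\<bar>T - t\<bar> \<le> \<bar>T\<bar> + \<bar>Z\<bar>" using elim by linarith
          from mult_left_mono[OF M(2)[OF this] C0] show ?thesis by (simp add: pn)
        qed
        finally show ?case by simp
      qed
    qed measurable
  qed (use I in auto)
qed

text \<open>Expand the potential in plane waves. For each frequency \<open>k\<close> the pairing with the packet
  depends on \<open>t\<close> only through a wave whose frequency is the mismatch between free evolution before
  and after the scattering; the remaining factor is bounded by 1, uniformly over the packets.\<close>

lemma src_fourier_bound: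
  fixes a :: "'e::euclidean_space"
  assumes C: "covariance_function C" and int: "integrable lborel C" and L: "linear L" and d: "d > 0"
    and \<gamma>: "0 \<le> \<gamma>" and Z: "0 \<le> Z" and T: "Z \<le> T" and q: "symb \<kappa> q = 0"
  shows "norm (LBINT w. cis (q \<bullet> w) * (LINT t|iv Z. (if s \<le> t then src C \<kappa> \<gamma> L \<zeta> d a p T t w else 0)))
    \<le> (LINT k|sm C. norm (osc Z \<gamma> s (adjoint L k \<bullet> vel \<kappa> (q + \<zeta>) + symb \<kappa> (adjoint L k))))"
proof -
  interpret T: finite_measure "iv Z" by (rule finite_measure_iv)
  interpret S: finite_measure "sm C" by (rule measure_sm[OF C int])
  interpret P: pair_sigma_finite "iv Z" "lborel :: 'e measure" ..
  have C_meas[measurable]: "C \<in> borel_measurable borel" using int by auto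
  note [measurable] = borel_measurable_src[OF C_meas L d] measurable_linear[OF L] measurable_linear[OF adjoint_linear[OF L]] borel_measurable_packet[OF d]
  let ?S = "src C \<kappa> \<gamma> L \<zeta> d a p T" let ?v = "vel \<kappa> \<zeta>"
  define \<eta> where "\<eta> k = q + \<zeta> + adjoint L k" for k
  define P0 where "P0 l = (LBINT w. cis (l \<bullet> w) * packet \<kappa> d a p 0 w)" for l
  define R where "R k = cis (- T * symb \<kappa> (\<eta> k)) * P0 (\<eta> k)" for k
  define \<Omega> where "\<Omega> k = adjoint L k \<bullet> vel \<kappa> (q + \<zeta>) + symb \<kappa> (adjoint L k)" for k
  have [measurable]: "R \<in> borel_measurable borel" "\<Omega> \<in> borel_measurable borel"
    unfolding R_def P0_def \<eta>_def \<Omega>_def by measurable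
  have Rb: "norm (R k) \<le> 1" for k unfolding R_def P0_def using norm_packet_fourier_0[OF d] by (simp add: norm_mult)
  have I: "integrable (iv Z \<Otimes>\<^sub>M lborel) (\<lambda>(t, w). cis (q \<bullet> w) * (if s \<le> t then ?S t w else 0))"
    by (rule Bochner_Integration.integrable_bound[OF integrable_src[OF C int L d \<gamma>, of Z \<kappa> \<zeta> a p T]])
       (auto simp: norm_mult)
  have per_t: "(LBINT w. cis (q \<bullet> w) * (if s \<le> t then ?S t w else 0)) = (LINT k|sm C. wave \<gamma> s (\<Omega> k) t * R k)" if t: "0 \<le> t" "t \<le> Z" for t
  proof (cases "s \<le> t")
    case True
    let ?E = "complex_of_real (exp (- \<gamma> * \<bar>t\<bar>))"
    have "(LBINT w. cis (q \<bullet> w) * ?S t w) = (LBINT w. cis (q \<bullet> (- (t *\<^sub>R ?v) + w)) * ?S t (- (t *\<^sub>R ?v) + w))"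
      by (rule integral_lborel_translate(1)[symmetric])
    also have "\<dots> = (LBINT w. (?E * cis (- t * (q \<bullet> ?v + symb \<kappa> \<zeta>))) * (of_real (C (L w)) * (cis ((q + \<zeta>) \<bullet> w) * packet \<kappa> d a p (T - t) w)))"
    proof (rule Bochner_Integration.integral_cong[OF refl])
      fix w
      have "cis (q \<bullet> (- (t *\<^sub>R ?v) + w)) * cis (\<zeta> \<bullet> w - t * symb \<kappa> \<zeta>) = cis (- t * (q \<bullet> ?v + symb \<kappa> \<zeta>)) * cis ((q + \<zeta>) \<bullet> w)"
        unfolding cis_mult by (rule arg_cong[where f=cis]) (simp add: inner_diff_right inner_add_left algebra_simps)
      then show "cis (q \<bullet> (- (t *\<^sub>R ?v) + w)) * ?S t (- (t *\<^sub>R ?v) + w) = (?E * cis (- t * (q \<bullet> ?v + symb \<kappa> \<zeta>))) * (of_real (C (L w)) * (cis ((q + \<zeta>) \<bullet> w) * packet \<kappa> d a p (T - t) w))"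
        by (simp add: src_def)
    qed
    also have "\<dots> = (?E * cis (- t * (q \<bullet> ?v + symb \<kappa> \<zeta>))) * (LBINT w. LINT k|sm C. cis (adjoint L k \<bullet> w) * (cis ((q + \<zeta>) \<bullet> w) * packet \<kappa> d a p (T - t) w))"
      by (simp add: covariance_adjoint[OF C int L])
    also have "(LBINT w. LINT k|sm C. cis (adjoint L k \<bullet> w) * (cis ((q + \<zeta>) \<bullet> w) * packet \<kappa> d a p (T - t) w))
       = (LINT k|sm C. LINT w|lborel. cis (adjoint L k \<bullet> w) * (cis ((q + \<zeta>) \<bullet> w) * packet \<kappa> d a p (T - t) w))"
      by (rule Fubini_bound(1)[where b="\<lambda>_. 1" and \<phi>="packet \<kappa> d a p (T - t)"])
         (auto simp: norm_mult intro: S.sigma_finite_measure lborel.sigma_finite_measure_axioms integrable_packet d)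
    also have "\<dots> = (LINT k|sm C. cis (- (T - t) * symb \<kappa> (\<eta> k)) * P0 (\<eta> k))"
    proof (rule Bochner_Integration.integral_cong[OF refl])
      fix k
      have eq: "cis (adjoint L k \<bullet> w) * (cis ((q + \<zeta>) \<bullet> w) * packet \<kappa> d a p (T - t) w) = cis (\<eta> k \<bullet> w) * packet \<kappa> d a p (T - t) w" for w
        by (simp add: \<eta>_def inner_add_left cis_mult add_ac flip: mult.assoc)
      show "(LBINT w. cis (adjoint L k \<bullet> w) * (cis ((q + \<zeta>) \<bullet> w) * packet \<kappa> d a p (T - t) w)) = cis (- (T - t) * symb \<kappa> (\<eta> k)) * P0 (\<eta> k)"
        unfolding P0_def eq using t T by (intro packet_fourier[OF d]) auto
    qed
    also have "(?E * cis (- t * (q \<bullet> ?v + symb \<kappa> \<zeta>))) * \<dots> = (LINT k|sm C. (?E * cis (- t * (q \<bullet> ?v + symb \<kappa> \<zeta>))) * (cis (- (T - t) * symb \<kappa> (\<eta> k)) * P0 (\<eta> k)))"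
      by (rule integral_mult_right_zero[symmetric])
    also have "\<dots> = (LINT k|sm C. wave \<gamma> s (\<Omega> k) t * R k)"
    proof (rule Bochner_Integration.integral_cong[OF refl])
      fix k
      have s: "symb \<kappa> (\<eta> k) = symb \<kappa> \<zeta> + q \<bullet> ?v + \<Omega> k"
        unfolding \<eta>_def \<Omega>_def using symb_add[of \<kappa> \<zeta> q] symb_add[of \<kappa> "q + \<zeta>" "adjoint L k"] q by (simp add: add.commute[of q \<zeta>])
      have "cis (- t * (q \<bullet> ?v + symb \<kappa> \<zeta>)) * cis (- (T - t) * symb \<kappa> (\<eta> k)) = cis (t * \<Omega> k) * cis (- T * symb \<kappa> (\<eta> k))"
        unfolding cis_mult by (rule arg_cong[where f=cis]) (simp add: s algebra_simps)
      then show "(?E * cis (- t * (q \<bullet> ?v + symb \<kappa> \<zeta>))) * (cis (- (T - t) * symb \<kappa> (\<eta> k)) * P0 (\<eta> k)) = wave \<gamma> s (\<Omega> k) t * R k"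
        unfolding wave_def R_def using True by (simp add: mult.assoc)
    qed
    finally show ?thesis using True by simp
  qed (simp add: wave_def)
  have "(LBINT w. cis (q \<bullet> w) * (LINT t|iv Z. (if s \<le> t then ?S t w else 0)))
     = (LBINT w. LINT t|iv Z. cis (q \<bullet> w) * (if s \<le> t then ?S t w else 0))" by simp
  also have "\<dots> = (LINT t|iv Z. LINT w|lborel. cis (q \<bullet> w) * (if s \<le> t then ?S t w else 0))"
    by (rule P.Fubini_integral[OF I])
  also have "\<dots> = (LINT t|iv Z. LINT k|sm C. wave \<gamma> s (\<Omega> k) t * R k)"
  proof (rule integral_cong_AE)
    show "AE t in iv Z. (LBINT w. cis (q \<bullet> w) * (if s \<le> t then ?S t w else 0)) = (LINT k|sm C. wave \<gamma> s (\<Omega> k) t * R k)"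
      using AE_iv by eventually_elim (simp only: per_t)
  qed measurable
  also have "\<dots> = (LINT k|sm C. LINT t|iv Z. wave \<gamma> s (\<Omega> k) t * R k)"
    by (rule Fubini_finite(1)[OF S.finite_measure_axioms T.finite_measure_axioms, where B=1])
       (use norm_wave_le[OF \<gamma>] Rb in \<open>auto simp: norm_mult intro!: mult_le_one\<close>)
  also have "\<dots> = (LINT k|sm C. osc Z \<gamma> s (\<Omega> k) * R k)" by (simp add: osc_def)
  also have "norm \<dots> \<le> (LINT k|sm C. norm (osc Z \<gamma> s (\<Omega> k) * R k))" by (rule integral_norm_bound)
  also have "\<dots> \<le> (LINT k|sm C. norm (osc Z \<gamma> s (\<Omega> k)))"
  proof (rule integral_mono')
    show "integrable (sm C) (\<lambda>k. norm (osc Z \<gamma> s (\<Omega> k)))"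
      by (rule S.integrable_const_bound[where B=Z]) (use norm_osc_le[OF Z \<gamma>] in auto)
    show "norm (osc Z \<gamma> s (\<Omega> k) * R k) \<le> norm (osc Z \<gamma> s (\<Omega> k))" for k
      unfolding norm_mult using Rb by (intro mult_left_le) auto
  qed auto
  finally show ?thesis unfolding \<Omega>_def .
qed

lemma phs_empty [simp]: "phs C c \<kappa> {} \<zeta> z w = 0"
  by (simp add: phs_def)

text \<open>The case \<open>q = 0\<close>, \<open>s = 0\<close> of \<open>src_fourier_bound\<close>.\<close>

lemma oscillating_source:
  fixes a :: "'e::euclidean_space"
  assumes C: "covariance_function C" and int: "integrable lborel C" and L: "linear L" and d: "d > 0"
    and \<gamma>: "0 \<le> \<gamma>" and Z: "0 \<le> Z" and T: "Z \<le> T"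
  shows "norm (LBINT t:{0..Z}. (LBINT w. of_real (C (L w)) * (sol C c \<kappa> \<gamma> {} \<zeta> t w * packet \<kappa> d a p (T - t) w)))
    \<le> (LINT k|sm C. norm (osc Z \<gamma> 0 (adjoint L k \<bullet> vel \<kappa> \<zeta> + symb \<kappa> (adjoint L k))))"
proof -
  interpret T: finite_measure "iv Z" by (rule finite_measure_iv)
  interpret P: pair_sigma_finite "iv Z" "lborel :: 'e measure" ..
  have C_meas[measurable]: "C \<in> borel_measurable borel" using int by auto
  note [measurable] = borel_measurable_src[OF C_meas L d] measurable_linear[OF L] borel_measurable_packet[OF d]
  let ?S = "src C \<kappa> \<gamma> L \<zeta> d a p T" let ?v = "vel \<kappa> \<zeta>"
  have [measurable]: "(\<lambda>(t, w). sol C c \<kappa> \<gamma> {} \<zeta> t w) \<in> borel_measurable (borel \<Otimes>\<^sub>M borel)"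
    unfolding sol_def by simp
  have I: "integrable (iv Z \<Otimes>\<^sub>M lborel) (\<lambda>(t, w). if 0 \<le> t then ?S t w else 0)"
    by (rule Bochner_Integration.integrable_bound[OF integrable_src[OF C int L d \<gamma>, of Z \<kappa> \<zeta> a p T]]) auto
  have eq: "(LBINT w. of_real (C (L w)) * (sol C c \<kappa> \<gamma> {} \<zeta> t w * packet \<kappa> d a p (T - t) w)) = (LBINT w. (if 0 \<le> t then ?S t w else 0))" if t: "0 \<le> t \<and> t \<le> Z" for t
    by (subst integral_lborel_translate(1)[symmetric, of _ "t *\<^sub>R ?v"]) (use t in \<open>simp add: sol_def src_def mult_ac add.commute\<close>)
  have "(LBINT t:{0..Z}. (LBINT w. of_real (C (L w)) * (sol C c \<kappa> \<gamma> {} \<zeta> t w * packet \<kappa> d a p (T - t) w)))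
    = (LINT t|iv Z. (LBINT w. of_real (C (L w)) * (sol C c \<kappa> \<gamma> {} \<zeta> t w * packet \<kappa> d a p (T - t) w)))"
    by (rule integral_iv[symmetric]) measurable
  also have "\<dots> = (LINT t|iv Z. LINT w|lborel. (if 0 \<le> t then ?S t w else 0))"
  proof (rule integral_cong_AE)
    show "AE t in iv Z. (LBINT w. of_real (C (L w)) * (sol C c \<kappa> \<gamma> {} \<zeta> t w * packet \<kappa> d a p (T - t) w)) = (LBINT w. (if 0 \<le> t then ?S t w else 0))"
      using AE_iv by eventually_elim (rule eq)
  qed measurable
  also have "\<dots> = (LBINT w. LINT t|iv Z. (if 0 \<le> t then ?S t w else 0))"
    by (rule P.Fubini_integral[OF I, symmetric])
  finally show ?thesis
    using src_fourier_bound[OF C int L d \<gamma> Z T, of \<kappa> 0 0 \<zeta> a p] by (simp add: symb_def)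
qed

text \<open>A wave scattered at least once is written as an integral over the time \<open>s\<close> of its last
  scattering, with frequency \<open>adjoint L' k\<close>. The subsequent source, with frequency \<open>adjoint L k'\<close>,
  then oscillates at a rate that contains \<open>k \<bullet> k' / k0\<close>, and \<open>osc_mean\<close> gives \<open>sqrt Z\<close> in place of
  \<open>Z\<close>. All scatterings before \<open>s\<close> are summed up in an exponential, which \<open>FS_dual\<close> removes; its
  frequencies are isotropic and enter only through a shift that does not depend on \<open>k\<close>.\<close>

lemma scattered_source:
  fixes a :: "'e::euclidean_space"
  assumes C: "covariance_function C" and int: "integrable lborel C" and L: "linear L" and d: "d > 0"
    and c: "0 \<le> c" and \<gamma>: "0 \<le> \<gamma>" and Z: "0 < Z" and T: "Z \<le> T" and J: "isotropic \<kappa> J" and k0: "k0 > 0"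
    and cross: "\<And>L'. L' \<in> J \<Longrightarrow> \<exists>\<sigma>. (\<sigma> = 1 \<or> \<sigma> = (-1::real)) \<and> (\<forall>k k'. adjoint L k' \<bullet> vel \<kappa> (adjoint L' k) = \<sigma> / k0 * (k \<bullet> k'))"
  defines "K \<equiv> (C 0)\<^sup>2 + (LBINT x. \<bar>C x\<bar>)\<^sup>2 * k0\<^sup>2"
  shows "norm (LBINT t:{0..Z}. (LBINT w. of_real (C (L w)) * ((sol C c \<kappa> \<gamma> J \<zeta> t w - sol C c \<kappa> \<gamma> {} \<zeta> t w) * packet \<kappa> d a p (T - t) w)))
    \<le> Z * (exp (c * (real (card J) * (Z * C 0))) * (c * (real (card J) * (sqrt Z * (K * pi + (C 0)\<^sup>2)))))"
proof -
  interpret T: finite_measure "iv Z" by (rule finite_measure_iv)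
  interpret S: finite_measure "sm C" by (rule measure_sm[OF C int])
  interpret P: pair_sigma_finite "iv Z" "lborel :: 'e measure" ..
  have C_meas[measurable]: "C \<in> borel_measurable borel" using int by auto
  have cont: "continuous_on UNIV C" using C by (simp add: covariance_function_def)
  have lin: "linear L'" if "L' \<in> J" for L' using J that by (simp add: isotropic_def)
  have C0: "0 \<le> C 0" using covariance_bound[OF C, of 0] by simp
  note [measurable] = borel_measurable_src[OF C_meas L d] measurable_linear[OF L] borel_measurable_packet[OF d] borel_measurable_phs[OF C_meas lin]
    borel_measurable_sol[OF C_meas lin] measurable_linear[OF adjoint_linear[OF L]]
  let ?S = "src C \<kappa> \<gamma> L \<zeta> d a p T" let ?v = "vel \<kappa> \<zeta>"
  have Z0: "0 \<le> Z" using Z by simp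
  define V where "V s w = c * (\<Sum>L'\<in>J. C (L' (w + s *\<^sub>R ?v)))" for s w
  have Vm[measurable]: "(\<lambda>(s, w). V s w) \<in> borel_measurable (borel \<Otimes>\<^sub>M borel)"
  proof -
    have "(\<lambda>x. C (L' (snd x + fst x *\<^sub>R ?v))) \<in> borel_measurable (borel \<Otimes>\<^sub>M borel)" if "L' \<in> J" for L'
    proof -
      note [measurable] = measurable_linear[OF lin[OF that]]
      show ?thesis by measurable
    qed
    then show ?thesis unfolding V_def case_prod_beta' by (intro borel_measurable_times borel_measurable_const borel_measurable_sum)
  qed
  define U where "U s w = (if 0 \<le> s \<and> s \<le> Z then V s w * exp (phs C c \<kappa> J \<zeta> s (w + s *\<^sub>R ?v)) else 0)" for s w
  have Um[measurable]: "(\<lambda>(s, w). U s w) \<in> borel_measurable (borel \<Otimes>\<^sub>M borel)"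
    unfolding U_def by measurable
  have Vb: "\<bar>V s w\<bar> \<le> c * (real (card J) * C 0)" for s w
  proof -
    have "\<bar>\<Sum>L'\<in>J. C (L' (w + s *\<^sub>R ?v))\<bar> \<le> (\<Sum>L'\<in>J. C 0)"
      by (rule order_trans[OF sum_abs]) (intro sum_mono covariance_bound[OF C])
    then show ?thesis using c by (simp add: V_def abs_mult mult_left_mono)
  qed
  define E where "E = exp (c * (real (card J) * (Z * C 0)))"
  have Eb: "exp (c * (real (card J) * (s * C 0))) \<le> E" if "s \<le> Z" for s
    unfolding E_def using that c C0 by (auto intro!: mult_left_mono mult_right_mono)
  have Ub: "\<bar>U s w\<bar> \<le> c * (real (card J) * C 0) * E" for s w
  proof (cases "0 \<le> s \<and> s \<le> Z")
    case True
    have "exp (phs C c \<kappa> J \<zeta> s (w + s *\<^sub>R ?v)) \<le> exp (c * (real (card J) * (s * C 0)))"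
      using phs_bound[OF C int c _ J, of s \<zeta> "w + s *\<^sub>R ?v"] True by simp
    also have "\<dots> \<le> E" using True by (intro Eb) auto
    finally have "\<bar>V s w\<bar> * exp (phs C c \<kappa> J \<zeta> s (w + s *\<^sub>R ?v)) \<le> c * (real (card J) * C 0) * E"
      using Vb[of s w] c C0 by (intro mult_mono) auto
    then show ?thesis using True by (simp add: U_def abs_mult)
  next
    case False
    then have "U s w = 0" by (auto simp: U_def)
    then show ?thesis using c C0 by (simp add: E_def)
  qed
  \<comment> \<open>The parameter \<open>s\<close> is the time of the last scattering before \<open>t\<close>; the exponential in \<open>U s\<close>
    collects the earlier ones.\<close>
  have last: "exp (phs C c \<kappa> J \<zeta> t (w + t *\<^sub>R ?v)) - 1 = (LINT s|iv Z. (if s \<le> t then U s w else 0))" if t: "0 \<le> t" "t \<le> Z" for t w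
  proof -
    have sh: "w + t *\<^sub>R ?v - (t - s) *\<^sub>R ?v = w + s *\<^sub>R ?v" for s by (simp add: algebra_simps)
    have "exp (phs C c \<kappa> J \<zeta> t (w + t *\<^sub>R ?v)) - 1 = (LBINT s. indicator {0..t} s * (V s w * exp (phs C c \<kappa> J \<zeta> s (w + s *\<^sub>R ?v))))"
      using exp_phs_ftc[OF cont lin t(1), of J c \<kappa> \<zeta> "w + t *\<^sub>R ?v" 0] unfolding sh V_def by simp
    also have "\<dots> = (LBINT s:{0..Z}. (if s \<le> t then U s w else 0))"
      unfolding set_lebesgue_integral_def
      by (intro Bochner_Integration.integral_cong refl) (use t in \<open>auto simp: U_def indicator_def\<close>)
    also have "\<dots> = (LINT s|iv Z. (if s \<le> t then U s w else 0))" by (rule integral_iv[symmetric]) measurable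
    finally show ?thesis .
  qed
  have per_t: "(LBINT w. of_real (C (L w)) * ((sol C c \<kappa> \<gamma> J \<zeta> t w - sol C c \<kappa> \<gamma> {} \<zeta> t w) * packet \<kappa> d a p (T - t) w))
     = (LBINT w. (LINT s|iv Z. of_real (if s \<le> t then U s w else 0) * ?S t w))" if t: "0 \<le> t \<and> t \<le> Z" for t
  proof -
    have "(LBINT w. of_real (C (L w)) * ((sol C c \<kappa> \<gamma> J \<zeta> t w - sol C c \<kappa> \<gamma> {} \<zeta> t w) * packet \<kappa> d a p (T - t) w))
      = (LBINT w. of_real (exp (phs C c \<kappa> J \<zeta> t (w + t *\<^sub>R ?v)) - 1) * ?S t w)"
    proof (subst integral_lborel_translate(1)[symmetric, of _ "t *\<^sub>R ?v"], rule Bochner_Integration.integral_cong[OF refl])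
      fix w
      show "of_real (C (L (t *\<^sub>R ?v + w))) * ((sol C c \<kappa> \<gamma> J \<zeta> t (t *\<^sub>R ?v + w) - sol C c \<kappa> \<gamma> {} \<zeta> t (t *\<^sub>R ?v + w)) * packet \<kappa> d a p (T - t) (t *\<^sub>R ?v + w))
         = of_real (exp (phs C c \<kappa> J \<zeta> t (w + t *\<^sub>R ?v)) - 1) * ?S t w"
        unfolding add.commute[of "t *\<^sub>R ?v" w] using t
        by (simp add: sol_def src_def exp_diff exp_minus divide_inverse algebra_simps)
    qed
    also have "\<dots> = (LBINT w. (LINT s|iv Z. of_real (if s \<le> t then U s w else 0) * ?S t w))"
      using last t by (simp del: of_real_diff)
    finally show ?thesis .
  qed
  let ?N = "iv Z \<Otimes>\<^sub>M (lborel :: 'e measure)"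
  have N: "sigma_finite_measure ?N" by (rule sigma_finite_pair_measure) (auto intro: T.sigma_finite_measure lborel.sigma_finite_measure_axioms)
  define H where "H s x = of_real (if s \<le> fst x then U s (snd x) else 0) * ?S (fst x) (snd x)" for s x
  have Hm[measurable]: "(\<lambda>(s, x). H s x) \<in> borel_measurable (iv Z \<Otimes>\<^sub>M ?N)"
    unfolding H_def by measurable
  have iS: "integrable ?N (\<lambda>x. ?S (fst x) (snd x))"
    using integrable_src[OF C int L d \<gamma>, of Z \<kappa> \<zeta> a p T] by (simp add: case_prod_beta')
  have Hb: "norm (H s x) \<le> c * (real (card J) * C 0) * E * norm (?S (fst x) (snd x))" for s x
    unfolding H_def norm_mult using Ub[of s "snd x"] c C0
    by (intro mult_right_mono) (auto simp: E_def)
  note F = Fubini_bound[OF T.sigma_finite_measure N Hm, where b="\<lambda>_. c * (real (card J) * C 0) * E" and \<phi>="\<lambda>x. ?S (fst x) (snd x)"]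
  have Hi: "integrable ?N (H s)" for s
    by (rule Bochner_Integration.integrable_bound[OF integrable_mult_right[OF integrable_norm[OF iS], of "c * (real (card J) * C 0) * E"]])
       (use Hb c C0 in \<open>auto intro!: AE_I2 simp: E_def abs_mult\<close>)
  have Hs: "integrable ?N (\<lambda>x. LINT s|iv Z. H s x)"
    by (rule F(3)) (use Hb iS in auto)
  \<comment> \<open>What happens after the last scattering does not involve \<open>U\<close>, so the integral over \<open>t\<close> can be
    done first.\<close>
  define \<phi> where "\<phi> s w = (LINT t|iv Z. (if s \<le> t then ?S t w else 0))" for s w
  have \<phi>i: "integrable lborel (\<phi> s)" for s
  proof -
    have "integrable ?N (\<lambda>(t, w). if s \<le> t then ?S t w else 0)"
      by (rule Bochner_Integration.integrable_bound[OF integrable_src[OF C int L d \<gamma>, of Z \<kappa> \<zeta> a p T]]) auto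
    from P.integrable_snd[OF this] show ?thesis by (simp add: \<phi>_def[abs_def])
  qed
  have per_s: "(LINT x|?N. H s x) = (LBINT w. of_real (U s w) * \<phi> s w)" for s
  proof -
    have "(LINT x|?N. H s x) = (LBINT w. LINT t|iv Z. H s (t, w))"
      using P.integral_snd[of "\<lambda>t w. H s (t, w)"] Hi[of s] by simp
    also have "\<dots> = (LBINT w. LINT t|iv Z. of_real (U s w) * (if s \<le> t then ?S t w else 0))"
      by (intro Bochner_Integration.integral_cong refl) (simp add: H_def)
    finally show ?thesis by (simp add: \<phi>_def)
  qed
  have bound_s: "norm (LBINT w. of_real (U s w) * \<phi> s w) \<le> E * (c * (real (card J) * (sqrt Z * (K * pi + (C 0)\<^sup>2))))" for s
  proof (cases "0 \<le> s \<and> s \<le> Z")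
    case True
    have K0: "0 \<le> K" unfolding K_def by simp
    have FE: "FS (freqs J) (exp (c * (real (card J) * (s * C 0)))) (\<lambda>w. of_real (exp (phs C c \<kappa> J \<zeta> s (w + s *\<^sub>R ?v))))"
      using FS_translate[OF FS_exp_phs[OF C int c _ J, of s \<zeta>], of "- (s *\<^sub>R ?v)"] True by simp
    have Vphi: "integrable lborel (\<lambda>w. of_real (V s w) * \<phi> s w)"
      by (rule integrable_bounded_mult[OF \<phi>i]) (use Vb in auto)
    have one: "norm (LBINT w. of_real (C (L' (w + s *\<^sub>R ?v))) * (cis (l \<bullet> w) * \<phi> s w)) \<le> sqrt Z * (K * pi + (C 0)\<^sup>2)"
      if L': "L' \<in> J" and l: "l \<in> freqs J" for L' l
    proof -
      note [measurable] = measurable_linear[OF adjoint_linear[OF lin[OF L']]]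
      obtain \<sigma> where \<sigma>: "\<sigma> = 1 \<or> \<sigma> = (-1::real)" "\<And>k k'. adjoint L k' \<bullet> vel \<kappa> (adjoint L' k) = \<sigma> / k0 * (k \<bullet> k')"
        using cross[OF L'] by blast
      have [measurable]: "\<phi> s \<in> borel_measurable borel" using \<phi>i[of s] by auto
      have "(LBINT w. of_real (C (L' (w + s *\<^sub>R ?v))) * (cis (l \<bullet> w) * \<phi> s w))
        = (LBINT w. LINT k|sm C. cis (adjoint L' k \<bullet> (w + s *\<^sub>R ?v)) * (cis (l \<bullet> w) * \<phi> s w))"
        by (simp add: covariance_adjoint[OF C int lin[OF L']])
      also have "\<dots> = (LINT k|sm C. LINT w|lborel. cis (adjoint L' k \<bullet> (w + s *\<^sub>R ?v)) * (cis (l \<bullet> w) * \<phi> s w))"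
        by (rule Fubini_bound(1)[where b="\<lambda>_. 1" and \<phi>="\<phi> s"])
           (auto simp: norm_mult intro: S.sigma_finite_measure lborel.sigma_finite_measure_axioms \<phi>i)
      also have "norm \<dots> \<le> (LINT k|sm C. norm (LBINT w. cis (adjoint L' k \<bullet> (w + s *\<^sub>R ?v)) * (cis (l \<bullet> w) * \<phi> s w)))" by (rule integral_norm_bound)
      also have "\<dots> \<le> (LINT k|sm C. LINT k'|sm C. norm (osc Z \<gamma> s (\<sigma> / k0 * (k \<bullet> k') + (adjoint L k' \<bullet> vel \<kappa> (l + \<zeta>) + symb \<kappa> (adjoint L k')))))"
      proof (rule integral_mono')
        have nb: "norm (LINT k'|sm C. norm (osc Z \<gamma> s (\<sigma> / k0 * (k \<bullet> k') + (adjoint L k' \<bullet> vel \<kappa> (l + \<zeta>) + symb \<kappa> (adjoint L k'))))) \<le> Z * C 0" for k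
        proof -
          have "(LINT k'|sm C. norm (osc Z \<gamma> s (\<sigma> / k0 * (k \<bullet> k') + (adjoint L k' \<bullet> vel \<kappa> (l + \<zeta>) + symb \<kappa> (adjoint L k'))))) \<le> (LINT k'|sm C. Z)"
            by (intro integral_mono') (use norm_osc_le[OF Z0 \<gamma>] Z0 in auto)
          also have "\<dots> = Z * C 0" using measure_sm(2)[OF C int] by (simp add: mult.commute)
          finally show ?thesis by simp
        qed
        show "integrable (sm C) (\<lambda>k. LINT k'|sm C. norm (osc Z \<gamma> s (\<sigma> / k0 * (k \<bullet> k') + (adjoint L k' \<bullet> vel \<kappa> (l + \<zeta>) + symb \<kappa> (adjoint L k')))))"
          by (rule S.integrable_const_bound[where B="Z * C 0"]) (use nb in \<open>auto\<close>)
        fix k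
        have ql: "l + adjoint L' k \<in> freqs J" by (intro freqs_add l freqs_adjoint L')
        have "cis (adjoint L' k \<bullet> (w + s *\<^sub>R ?v)) * (cis (l \<bullet> w) * \<phi> s w) = cis (adjoint L' k \<bullet> (s *\<^sub>R ?v)) * (cis ((l + adjoint L' k) \<bullet> w) * \<phi> s w)" for w
          by (simp add: inner_add_left inner_add_right cis_mult add_ac flip: mult.assoc)
        then have "norm (LBINT w. cis (adjoint L' k \<bullet> (w + s *\<^sub>R ?v)) * (cis (l \<bullet> w) * \<phi> s w)) = norm (LBINT w. cis ((l + adjoint L' k) \<bullet> w) * \<phi> s w)"
          by (simp only: integral_mult_right_zero norm_mult norm_cis mult_1)
        also have "\<dots> \<le> (LINT k'|sm C. norm (osc Z \<gamma> s (adjoint L k' \<bullet> vel \<kappa> (l + adjoint L' k + \<zeta>) + symb \<kappa> (adjoint L k'))))"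
          unfolding \<phi>_def using J ql by (intro src_fourier_bound[OF C int L d \<gamma> Z0 T]) (auto simp: isotropic_def)
        also have "\<dots> = (LINT k'|sm C. norm (osc Z \<gamma> s (\<sigma> / k0 * (k \<bullet> k') + (adjoint L k' \<bullet> vel \<kappa> (l + \<zeta>) + symb \<kappa> (adjoint L k')))))"
          by (simp add: vel_add inner_add_right \<sigma>(2) add_ac)
        finally show "norm (LBINT w. cis (adjoint L' k \<bullet> (w + s *\<^sub>R ?v)) * (cis (l \<bullet> w) * \<phi> s w))
          \<le> (LINT k'|sm C. norm (osc Z \<gamma> s (\<sigma> / k0 * (k \<bullet> k') + (adjoint L k' \<bullet> vel \<kappa> (l + \<zeta>) + symb \<kappa> (adjoint L k')))))" .
      qed auto
      also have "\<dots> \<le> sqrt Z * (K * pi + (C 0)\<^sup>2)"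
        unfolding K_def by (rule osc_mean[OF C int k0 Z \<gamma> \<sigma>(1)]) measurable
      finally show ?thesis .
    qed
    have "norm (LBINT w. of_real (exp (phs C c \<kappa> J \<zeta> s (w + s *\<^sub>R ?v))) * (of_real (V s w) * \<phi> s w))
      \<le> exp (c * (real (card J) * (s * C 0))) * (c * (real (card J) * (sqrt Z * (K * pi + (C 0)\<^sup>2))))"
    proof (rule FS_dual[OF FE Vphi])
      fix l assume l: "l \<in> freqs J"
      have "cis (l \<bullet> w) * (of_real (V s w) * \<phi> s w) = of_real c * (\<Sum>L'\<in>J. of_real (C (L' (w + s *\<^sub>R ?v))) * (cis (l \<bullet> w) * \<phi> s w))" for w
        by (simp add: V_def mult_ac flip: sum_distrib_left sum_distrib_right)
      then have "(LBINT w. cis (l \<bullet> w) * (of_real (V s w) * \<phi> s w)) = of_real c * (LBINT w. (\<Sum>L'\<in>J. of_real (C (L' (w + s *\<^sub>R ?v))) * (cis (l \<bullet> w) * \<phi> s w)))"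
        by (simp only: integral_mult_right_zero)
      also have "(LBINT w. (\<Sum>L'\<in>J. of_real (C (L' (w + s *\<^sub>R ?v))) * (cis (l \<bullet> w) * \<phi> s w))) = (\<Sum>L'\<in>J. LINT w|lborel. of_real (C (L' (w + s *\<^sub>R ?v))) * (cis (l \<bullet> w) * \<phi> s w))"
      proof (rule Bochner_Integration.integral_sum)
        fix L' assume L': "L' \<in> J"
        note [measurable] = measurable_linear[OF lin[OF L']]
        show "integrable lborel (\<lambda>w. of_real (C (L' (w + s *\<^sub>R ?v))) * (cis (l \<bullet> w) * \<phi> s w))"
          by (intro integrable_bounded_mult[where m="C 0"] integrable_bounded_mult[where m=1] \<phi>i) (use covariance_bound[OF C] in auto)
      qed
      also have "norm (of_real c * \<dots>) \<le> c * (\<Sum>L'\<in>J. sqrt Z * (K * pi + (C 0)\<^sup>2))"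
        unfolding norm_mult using c by (intro mult_mono order_trans[OF norm_sum] sum_mono one l) auto
      finally show "norm (LBINT w. cis (l \<bullet> w) * (of_real (V s w) * \<phi> s w)) \<le> c * (real (card J) * (sqrt Z * (K * pi + (C 0)\<^sup>2)))" by simp
    qed
    also have "\<dots> \<le> E * (c * (real (card J) * (sqrt Z * (K * pi + (C 0)\<^sup>2))))"
      using True Eb[of s] c K0 Z0 by (intro mult_right_mono) auto
    finally show ?thesis using True by (simp add: U_def mult_ac)
  next
    case False
    have "0 \<le> K" unfolding K_def by simp
    moreover have "U s w = 0" for w using False by (auto simp: U_def)
    ultimately show ?thesis using c Z0 by (simp add: E_def)
  qed
  have "(LBINT t:{0..Z}. (LBINT w. of_real (C (L w)) * ((sol C c \<kappa> \<gamma> J \<zeta> t w - sol C c \<kappa> \<gamma> {} \<zeta> t w) * packet \<kappa> d a p (T - t) w)))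
    = (LINT t|iv Z. (LBINT w. of_real (C (L w)) * ((sol C c \<kappa> \<gamma> J \<zeta> t w - sol C c \<kappa> \<gamma> {} \<zeta> t w) * packet \<kappa> d a p (T - t) w)))"
    by (rule integral_iv[symmetric]) (measurable, use d in \<open>auto simp: sol_def\<close>)
  also have "\<dots> = (LINT t|iv Z. LINT w|lborel. LINT s|iv Z. H s (t, w))"
  proof (rule integral_cong_AE)
    show "AE t in iv Z. (LBINT w. of_real (C (L w)) * ((sol C c \<kappa> \<gamma> J \<zeta> t w - sol C c \<kappa> \<gamma> {} \<zeta> t w) * packet \<kappa> d a p (T - t) w)) = (LBINT w. LINT s|iv Z. H s (t, w))"
      using AE_iv by eventually_elim (simp only: per_t H_def fst_conv snd_conv)
  qed (measurable, use d in \<open>auto simp: sol_def\<close>)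
  also have "\<dots> = (LINT x|?N. LINT s|iv Z. H s x)"
    using P.integral_fst'[of "\<lambda>x. LINT s|iv Z. H s x"] Hs by simp
  also have "\<dots> = (LINT s|iv Z. LINT x|?N. H s x)"
    by (rule F(1)) (use Hb iS in auto)
  also have "\<dots> = (LINT s|iv Z. LINT w|lborel. of_real (U s w) * \<phi> s w)" by (simp only: per_s)
  also have "norm \<dots> \<le> (E * (c * (real (card J) * (sqrt Z * (K * pi + (C 0)\<^sup>2))))) * measure (iv Z) (space (iv Z))"
  proof (rule norm_integral_finite_le[OF T.finite_measure_axioms bound_s])
    have "0 \<le> K" unfolding K_def by simp
    then show "0 \<le> E * (c * (real (card J) * (sqrt Z * (K * pi + (C 0)\<^sup>2))))" using c Z0 by (simp add: E_def)
  qed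
  finally show ?thesis using measure_iv[OF Z0] by (simp add: E_def mult.commute)
qed

section \<open>Averages over the Gaussian frequencies of the initial beam\<close>

text \<open>The law of the frequencies that make up a beam of radius \<open>r0\<close>, see \<open>gm_char\<close>.\<close>

definition gm :: "real \<Rightarrow> ('e::euclidean_space) measure" where
  "gm r0 = density lborel (\<lambda>k. ennreal (gauss (1 / r0\<^sup>2) k))"

lemma sets_gm [measurable_cong, simp]: "sets (gm r0) = sets borel" and space_gm [simp]: "space (gm r0) = UNIV"
  by (simp_all add: gm_def)

lemma finite_measure_gm:
  assumes "r0 > 0" shows "finite_measure (gm r0 :: ('e::euclidean_space) measure)"
    and "measure (gm r0 :: 'e measure) (space (gm r0)) = 1"
proof -
  have d: "1 / r0\<^sup>2 > 0" using assms by simp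
  have "emeasure (gm r0 :: 'e measure) (space (gm r0)) = ennreal 1"
    unfolding gm_def using gauss_nonneg[OF d, where 'a='e]
    by (simp add: emeasure_density nn_integral_eq_integral[OF integrable_gauss[OF d]] integral_gauss[OF d])
  then show "finite_measure (gm r0 :: 'e measure)" "measure (gm r0 :: 'e measure) (space (gm r0)) = 1"
    by (auto intro: finite_measureI simp: measure_def)
qed

lemma gm_char:
  assumes "r0 > 0"
  shows "(LINT k|gm r0. cis (k \<bullet> (x::'e::euclidean_space))) = of_real (exp (- ((norm x)\<^sup>2 / (2 * r0\<^sup>2))))"
proof -
  have d: "1 / r0\<^sup>2 > 0" using assms by simp
  have "(LINT k|gm r0. cis (k \<bullet> x)) = (LBINT k. of_real (gauss (1 / r0\<^sup>2) k) * cis (x \<bullet> k))"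
    unfolding gm_def using gauss_nonneg[OF d, where 'a='e]
    by (subst integral_density) (auto simp: scaleR_conv_of_real inner_commute)
  also have "\<dots> = of_real (exp (- ((norm x)\<^sup>2 / (2 * r0\<^sup>2))))" by (subst gauss_char[OF d]) simp
  finally show ?thesis .
qed

definition msol :: "(real^2 \<Rightarrow> real) \<Rightarrow> real \<Rightarrow> ('e::euclidean_space \<Rightarrow> real) \<Rightarrow> real \<Rightarrow> ('e \<Rightarrow> real^2) set \<Rightarrow> real \<Rightarrow> real \<Rightarrow> real \<Rightarrow> 'e \<Rightarrow> complex" where
  "msol C c \<kappa> \<gamma> J r0 \<epsilon> z w = (LINT k|gm r0. sol C c \<kappa> \<gamma> J (\<epsilon> *\<^sub>R k) z w)"

definition pot_int :: "('e::euclidean_space \<Rightarrow> real) \<Rightarrow> real \<Rightarrow> 'e \<Rightarrow> 'e \<Rightarrow> real \<Rightarrow> real \<Rightarrow> (real \<Rightarrow> 'e \<Rightarrow> complex) \<Rightarrow> complex" where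
  "pot_int \<kappa> d a p \<tau> s h = (LBINT r:{0..s}. (LBINT w. h r w * packet \<kappa> d a p (\<tau> + s - r) w))"

text \<open>The defect in the Duhamel formula, paired with a packet.\<close>

definition residual :: "('e::euclidean_space \<Rightarrow> real) \<Rightarrow> real \<Rightarrow> 'e \<Rightarrow> 'e \<Rightarrow> real \<Rightarrow> real \<Rightarrow> ('e \<Rightarrow> real) \<Rightarrow> (real \<Rightarrow> 'e \<Rightarrow> complex) \<Rightarrow> complex" where
  "residual \<kappa> d a p \<tau> s V n = (LBINT w. n s w * packet \<kappa> d a p \<tau> w) - (LBINT w. n 0 w * packet \<kappa> d a p (\<tau> + s) w)
     - pot_int \<kappa> d a p \<tau> s (\<lambda>r w. n r w * of_real (V w))"

definition bounded_path :: "real \<Rightarrow> real \<Rightarrow> (real \<Rightarrow> 'e::euclidean_space \<Rightarrow> complex) \<Rightarrow> bool" where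
  "bounded_path s B h \<longleftrightarrow> (\<lambda>(r, w). h r w) \<in> borel_measurable (borel \<Otimes>\<^sub>M borel) \<and> (\<forall>r w. 0 \<le> r \<longrightarrow> r \<le> s \<longrightarrow> norm (h r w) \<le> B)"

lemma bounded_path_nonneg: "bounded_path s B h \<Longrightarrow> 0 \<le> s \<Longrightarrow> 0 \<le> B"
  unfolding bounded_path_def using norm_ge_zero order_trans by blast

lemma bounded_path_add: "bounded_path s B h \<Longrightarrow> bounded_path s B' h' \<Longrightarrow> bounded_path s (B + B') (\<lambda>r w. h r w + h' r w)"
  unfolding bounded_path_def case_prod_beta' by (auto intro!: norm_triangle_mono borel_measurable_add)

lemma bounded_path_diff: "bounded_path s B h \<Longrightarrow> bounded_path s B' h' \<Longrightarrow> bounded_path s (B + B') (\<lambda>r w. h r w - h' r w)"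
  unfolding bounded_path_def case_prod_beta' by (auto intro!: order_trans[OF norm_triangle_ineq4] add_mono borel_measurable_diff)

lemma bounded_path_mult:
  assumes h: "bounded_path s B h" and V: "V \<in> borel_measurable borel" "\<And>w. norm (V w) \<le> v" and s: "0 \<le> s"
  shows "bounded_path s (B * v) (\<lambda>r w. h r w * V w)"
  unfolding bounded_path_def
proof (intro conjI allI impI)
  have [measurable]: "(\<lambda>(r, w). h r w) \<in> borel_measurable (borel \<Otimes>\<^sub>M borel)" "V \<in> borel_measurable borel"
    using h V by (auto simp: bounded_path_def)
  show "(\<lambda>(r, w). h r w * V w) \<in> borel_measurable (borel \<Otimes>\<^sub>M borel)" by measurable
  fix r w assume "0 \<le> r" "r \<le> s"
  then show "norm (h r w * V w) \<le> B * v"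
    unfolding norm_mult using h bounded_path_nonneg[OF h s] V(2) by (intro mult_mono) (auto simp: bounded_path_def)
qed

lemma pot_int_integrable:
  fixes h :: "real \<Rightarrow> 'e::euclidean_space \<Rightarrow> complex"
  assumes d: "d > 0" and h: "bounded_path s B h" and s: "0 \<le> s" and t: "0 \<le> \<tau>"
  shows "\<And>r. 0 \<le> r \<Longrightarrow> r \<le> s \<Longrightarrow> integrable lborel (\<lambda>w. h r w * packet \<kappa> d a p t' w)"
    and "set_integrable lborel {0..s} (\<lambda>r. LINT w|lborel. h r w * packet \<kappa> d a p (\<tau> + s - r) w)"
    and "\<exists>M\<ge>0. \<forall>r. 0 \<le> r \<longrightarrow> r \<le> s \<longrightarrow> norm (LBINT w. h r w * packet \<kappa> d a p (\<tau> + s - r) w) \<le> B * M"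
proof -
  note [measurable] = borel_measurable_packet[OF d]
  have [measurable]: "(\<lambda>(r, w). h r w) \<in> borel_measurable (borel \<Otimes>\<^sub>M borel)" using h by (auto simp: bounded_path_def)
  have hb: "norm (h r w) \<le> B" if "0 \<le> r" "r \<le> s" for r w using h that by (auto simp: bounded_path_def)
  have B: "0 \<le> B" using bounded_path_nonneg[OF h s] .
  show 1: "integrable lborel (\<lambda>w. h r w * packet \<kappa> d a p t' w)" if "0 \<le> r" "r \<le> s" for r t'
    by (rule integrable_bounded_mult[OF integrable_packet(1)[OF d] _ hb[OF that]]) measurable
  obtain M where M: "M \<ge> 0" "\<And>t. \<bar>t\<bar> \<le> \<tau> + s \<Longrightarrow> (LBINT w. norm (packet \<kappa> d a p t w)) \<le> M"
    using packet_norms_bounded[OF d, of "\<tau> + s" \<kappa>] by blast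
  have 2: "norm (LBINT w. h r w * packet \<kappa> d a p (\<tau> + s - r) w) \<le> B * M" if r: "0 \<le> r" "r \<le> s" for r
  proof -
    have "norm (LBINT w. h r w * packet \<kappa> d a p (\<tau> + s - r) w) \<le> (LBINT w. norm (h r w * packet \<kappa> d a p (\<tau> + s - r) w))" by (rule integral_norm_bound)
    also have "\<dots> \<le> (LBINT w. B * norm (packet \<kappa> d a p (\<tau> + s - r) w))"
      by (intro integral_mono integrable_norm 1 r integrable_mult_right integrable_packet d) (simp add: norm_mult mult_right_mono hb r)
    also have "\<dots> \<le> B * M"
    proof -
      have "\<bar>\<tau> + s - r\<bar> \<le> \<tau> + s" using r t by linarith
      from mult_left_mono[OF M(2)[OF this] B] show ?thesis by simp
    qed
    finally show ?thesis .
  qed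
  show "\<exists>M\<ge>0. \<forall>r. 0 \<le> r \<longrightarrow> r \<le> s \<longrightarrow> norm (LBINT w. h r w * packet \<kappa> d a p (\<tau> + s - r) w) \<le> B * M"
    using M(1) 2 by blast
  have "integrable lborel (\<lambda>r. indicator {0..s} r * (B * M))"
    by (intro integrable_mult_left integrable_real_indicator) (use s in auto)
  then show "set_integrable lborel {0..s} (\<lambda>r. LINT w|lborel. h r w * packet \<kappa> d a p (\<tau> + s - r) w)"
    unfolding set_integrable_def
    by (rule Bochner_Integration.integrable_bound) (use 2 B M in \<open>auto simp: indicator_def intro!: AE_I2 order_trans[OF 2]\<close>)
qed

lemma pot_int_add:
  fixes h :: "real \<Rightarrow> 'e::euclidean_space \<Rightarrow> complex"
  assumes d: "d > 0" and h: "bounded_path s B h" "bounded_path s B' h'" and s: "0 \<le> s" and t: "0 \<le> \<tau>"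
  shows "pot_int \<kappa> d a p \<tau> s (\<lambda>r w. h r w + h' r w) = pot_int \<kappa> d a p \<tau> s h + pot_int \<kappa> d a p \<tau> s h'"
proof -
  have "pot_int \<kappa> d a p \<tau> s (\<lambda>r w. h r w + h' r w) = (LBINT r:{0..s}. (LBINT w. h r w * packet \<kappa> d a p (\<tau> + s - r) w) + (LBINT w. h' r w * packet \<kappa> d a p (\<tau> + s - r) w))"
    unfolding pot_int_def distrib_right
    by (intro set_lebesgue_integral_cong allI impI Bochner_Integration.integral_add pot_int_integrable(1)[OF d h(1) s t] pot_int_integrable(1)[OF d h(2) s t]) auto
  also have "\<dots> = pot_int \<kappa> d a p \<tau> s h + pot_int \<kappa> d a p \<tau> s h'"
    unfolding pot_int_def by (intro set_integral_add pot_int_integrable(2)[OF d h(1) s t] pot_int_integrable(2)[OF d h(2) s t])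
  finally show ?thesis .
qed

lemma pot_int_cmult: "pot_int \<kappa> d a p \<tau> s (\<lambda>r w. c * h r w) = c * pot_int \<kappa> d a p \<tau> s h"
  unfolding pot_int_def by (simp add: mult.assoc)

lemma pot_int_diff:
  fixes h :: "real \<Rightarrow> 'e::euclidean_space \<Rightarrow> complex"
  assumes d: "d > 0" and h: "bounded_path s B h" "bounded_path s B' h'" and s: "0 \<le> s" and t: "0 \<le> \<tau>"
  shows "pot_int \<kappa> d a p \<tau> s (\<lambda>r w. h r w - h' r w) = pot_int \<kappa> d a p \<tau> s h - pot_int \<kappa> d a p \<tau> s h'"
proof -
  have "bounded_path s B' (\<lambda>r w. (-1) * h' r w)"
    using h(2) unfolding bounded_path_def case_prod_beta' by (auto simp: norm_mult)
  from pot_int_add[OF d h(1) this s t] show ?thesis unfolding pot_int_cmult by simp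
qed

text \<open>The residual is linear in the function, so the residual of an average is the average of the
  residuals.\<close>

lemma residual_average:
  fixes n :: "'k \<Rightarrow> real \<Rightarrow> 'e::euclidean_space \<Rightarrow> complex"
  assumes mu: "finite_measure M" and d: "d > 0" and s: "0 \<le> s" and t: "0 \<le> \<tau>"
    and n: "\<And>k. bounded_path s B (n k)"
    and nm: "(\<lambda>(k, r, w). n k r w) \<in> borel_measurable (M \<Otimes>\<^sub>M borel \<Otimes>\<^sub>M borel)"
    and V[measurable]: "V \<in> borel_measurable borel" and Vb: "\<And>w. \<bar>V w\<bar> \<le> v"
    and \<alpha>: "integrable M \<alpha>" and res: "\<And>k. norm (residual \<kappa> d a p \<tau> s V (n k)) \<le> \<alpha> k"
  defines "N \<equiv> \<lambda>r w. LINT k|M. n k r w"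
  shows "bounded_path s (B * measure M (space M)) N"
    and "norm (residual \<kappa> d a p \<tau> s V N) \<le> (LINT k|M. \<alpha> k)"
proof -
  interpret M: finite_measure M by fact
  interpret T: finite_measure "iv s" by (rule finite_measure_iv)
  note [measurable] = borel_measurable_packet[OF d]
  have [measurable (raw)]: "(\<lambda>x. n (f x) (g x) (h x)) \<in> borel_measurable A"
    if "f \<in> measurable A M" "g \<in> borel_measurable A" "h \<in> measurable A borel" for f g h and A :: "'z measure"
    using measurable_compose[OF measurable_Pair[OF that(1) measurable_Pair[OF that(2,3)]] nm] by simp
  have nb: "norm (n k r w) \<le> B" if "0 \<le> r" "r \<le> s" for k r w using n that by (auto simp: bounded_path_def)
  have B: "0 \<le> B" using bounded_path_nonneg[OF n s] .
  have v: "0 \<le> v" using order_trans[OF abs_ge_zero Vb] .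
  have [measurable]: "(\<lambda>(r, w). N r w) \<in> borel_measurable (borel \<Otimes>\<^sub>M borel)"
    unfolding N_def by measurable
  show "bounded_path s (B * measure M (space M)) N"
    unfolding bounded_path_def
  proof (intro conjI allI impI)
    show "norm (N r w) \<le> B * measure M (space M)" if "0 \<le> r" "r \<le> s" for r w
      unfolding N_def using that by (intro norm_integral_finite_le[OF mu nb B])
  qed measurable
  have avg: "(LBINT w. N r w * (g w * packet \<kappa> d a p t' w)) = (LINT k|M. LINT w|lborel. n k r w * (g w * packet \<kappa> d a p t' w))"
    and avgi: "integrable M (\<lambda>k. LINT w|lborel. n k r w * (g w * packet \<kappa> d a p t' w))"
    if r: "0 \<le> r" "r \<le> s" and [measurable]: "g \<in> borel_measurable borel" and g: "\<And>w. norm (g w) \<le> u" for r t' u and g :: "'e \<Rightarrow> complex"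
  proof -
    have gi: "integrable lborel (\<lambda>w. g w * packet \<kappa> d a p t' w)"
      by (rule integrable_bounded_mult[OF integrable_packet(1)[OF d] _ g]) measurable
    have m: "(\<lambda>(k, w). n k r w * (g w * packet \<kappa> d a p t' w)) \<in> borel_measurable (M \<Otimes>\<^sub>M lborel)" by measurable
    note F = Fubini_bound[OF M.sigma_finite_measure lborel.sigma_finite_measure_axioms m, where b="\<lambda>_. B" and \<phi>="\<lambda>w. g w * packet \<kappa> d a p t' w"]
    have b: "norm (n k r w * (g w * packet \<kappa> d a p t' w)) \<le> B * norm (g w * packet \<kappa> d a p t' w)" for k w
      unfolding norm_mult[of "n k r w"] by (intro mult_right_mono nb r) auto
    have "(LBINT w. N r w * (g w * packet \<kappa> d a p t' w)) = (LBINT w. LINT k|M. n k r w * (g w * packet \<kappa> d a p t' w))"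
      by (simp add: N_def)
    then show "(LBINT w. N r w * (g w * packet \<kappa> d a p t' w)) = (LINT k|M. LINT w|lborel. n k r w * (g w * packet \<kappa> d a p t' w))"
      using F(1)[OF _ gi b] by simp
    show "integrable M (\<lambda>k. LINT w|lborel. n k r w * (g w * packet \<kappa> d a p t' w))" using F(2)[OF _ gi b] by simp
  qed
  have one: "norm (1::complex) \<le> 1" by simp
  have m1: "(\<lambda>_. 1::complex) \<in> borel_measurable borel" by simp
  note avg1 = avg[OF _ _ m1 one, simplified] and avgi1 = avgi[OF _ _ m1 one, simplified]
  have mV: "(\<lambda>w. complex_of_real (V w)) \<in> borel_measurable borel" by measurable
  have VbC: "norm (complex_of_real (V w)) \<le> v" for w using Vb by simp
  note avgV = avg[OF _ _ mV VbC] and avgiV = avgi[OF _ _ mV VbC]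
  define g where "g k r = (if 0 \<le> r \<and> r \<le> s then LBINT w. n k r w * (of_real (V w) * packet \<kappa> d a p (\<tau> + s - r) w) else 0)" for k r
  have gm: "(\<lambda>(k, r). g k r) \<in> borel_measurable (M \<Otimes>\<^sub>M iv s)" unfolding g_def by measurable
  obtain Mp where Mp: "Mp \<ge> 0" "\<And>t. \<bar>t\<bar> \<le> \<tau> + s \<Longrightarrow> (LBINT w. norm (packet \<kappa> d a p t w)) \<le> Mp"
    using packet_norms_bounded[OF d, of "\<tau> + s" \<kappa>] by blast
  have gb: "norm (g k r) \<le> B * (v * Mp)" for k r
  proof (cases "0 \<le> r \<and> r \<le> s")
    case True
    have "norm (LBINT w. n k r w * (of_real (V w) * packet \<kappa> d a p (\<tau> + s - r) w)) \<le> (LBINT w. norm (n k r w * (of_real (V w) * packet \<kappa> d a p (\<tau> + s - r) w)))" by (rule integral_norm_bound)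
    also have "\<dots> \<le> (LBINT w. B * (v * norm (packet \<kappa> d a p (\<tau> + s - r) w)))"
    proof (rule integral_mono')
      show "integrable lborel (\<lambda>w. B * (v * norm (packet \<kappa> d a p (\<tau> + s - r) w)))"
        by (intro integrable_mult_right integrable_norm integrable_packet d)
      show "norm (n k r w * (of_real (V w) * packet \<kappa> d a p (\<tau> + s - r) w)) \<le> B * (v * norm (packet \<kappa> d a p (\<tau> + s - r) w))" for w
        unfolding norm_mult using True nb VbC B v by (intro mult_mono) auto
    qed (use B v in auto)
    also have "\<dots> = B * (v * (LBINT w. norm (packet \<kappa> d a p (\<tau> + s - r) w)))" by simp
    also have "\<dots> \<le> B * (v * Mp)"
    proof -
      have "\<bar>\<tau> + s - r\<bar> \<le> \<tau> + s" using True t by linarith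
      then show ?thesis by (intro mult_left_mono Mp(2) B v)
    qed
    finally show ?thesis using True by (simp add: g_def)
  next
    case False
    then have "g k r = 0" by (auto simp: g_def)
    then show ?thesis using B v Mp by simp
  qed
  have potk: "pot_int \<kappa> d a p \<tau> s (\<lambda>r w. n k r w * of_real (V w)) = (LINT r|iv s. g k r)" if k: "k \<in> space M" for k
  proof -
    have "(\<lambda>r. g k r) \<in> borel_measurable borel" using measurable_compose[OF measurable_Pair1'[OF k] gm] by (simp cong: measurable_cong_sets)
    then have "(LINT r|iv s. g k r) = (LBINT r:{0..s}. g k r)" by (rule integral_iv)
    then show ?thesis unfolding pot_int_def g_def
      by (simp add: mult.assoc cong: set_lebesgue_integral_cong) (intro set_lebesgue_integral_cong; auto simp: mult.assoc)
  qed
  have potN: "pot_int \<kappa> d a p \<tau> s (\<lambda>r w. N r w * of_real (V w)) = (LINT k|M. LINT r|iv s. g k r)"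
  proof -
    have "pot_int \<kappa> d a p \<tau> s (\<lambda>r w. N r w * of_real (V w)) = (LBINT r:{0..s}. (LINT k|M. g k r))"
      unfolding pot_int_def g_def
      by (intro set_lebesgue_integral_cong allI impI) (auto simp: mult.assoc avgV)
    also have "\<dots> = (LINT r|iv s. LINT k|M. g k r)"
      using gm by (intro integral_iv[symmetric]) (measurable, simp_all cong: measurable_cong_sets)
    also have "\<dots> = (LINT k|M. LINT r|iv s. g k r)"
      by (rule Fubini_finite(1)[OF mu T.finite_measure_axioms gm gb])
    finally show ?thesis .
  qed
  have poti: "integrable M (\<lambda>k. LINT r|iv s. g k r)"
  proof -
    interpret P: pair_sigma_finite M "iv s" ..
    from P.integrable_fst[OF Fubini_finite(2)[OF mu T.finite_measure_axioms gm gb]] show ?thesis .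
  qed
  have "residual \<kappa> d a p \<tau> s V N = (LINT k|M. LINT w|lborel. n k s w * packet \<kappa> d a p \<tau> w) - (LINT k|M. LINT w|lborel. n k 0 w * packet \<kappa> d a p (\<tau> + s) w) - (LINT k|M. LINT r|iv s. g k r)"
    unfolding residual_def potN using avg1[of s] avg1[of 0] s by simp
  also have "\<dots> = (LINT k|M. (LBINT w. n k s w * packet \<kappa> d a p \<tau> w) - (LBINT w. n k 0 w * packet \<kappa> d a p (\<tau> + s) w) - (LINT r|iv s. g k r))"
    using avgi1[of s \<tau>] avgi1[of 0 "\<tau> + s"] s poti
    by (simp only: Bochner_Integration.integral_diff Bochner_Integration.integrable_diff order.refl)
  also have "\<dots> = (LINT k|M. residual \<kappa> d a p \<tau> s V (n k))"
    by (intro Bochner_Integration.integral_cong refl) (simp add: residual_def potk)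
  also have "norm \<dots> \<le> (LINT k|M. norm (residual \<kappa> d a p \<tau> s V (n k)))" by (rule integral_norm_bound)
  also have "\<dots> \<le> (LINT k|M. \<alpha> k)"
    by (intro integral_mono' \<alpha> res order_trans[OF norm_ge_zero res])
  finally show "norm (residual \<kappa> d a p \<tau> s V N) \<le> (LINT k|M. \<alpha> k)" .
qed

lemma sol_0:
  shows "sol C c \<kappa> \<gamma> J \<zeta> 0 w = cis (\<zeta> \<bullet> w)"
proof -
  have "(LBINT s. indicator {0..0::real} s * f s) = 0" for f :: "real \<Rightarrow> real"
  proof (rule integral_eq_zero_AE)
    show "AE s in lborel. indicator {0..0} s * f s = 0"
      using AE_lborel_singleton[of "0::real"] by eventually_elim (simp add: indicator_def)
  qed
  then have "phs C c \<kappa> J \<zeta> 0 w = 0" by (simp add: phs_def)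
  then show ?thesis by (simp add: sol_def)
qed

lemma continuous_sol:
  fixes \<kappa> :: "'e::euclidean_space \<Rightarrow> real"
  assumes C: "covariance_function C" and int: "integrable lborel C" and J: "isotropic \<kappa> J" and z: "0 \<le> z"
  shows "continuous_on UNIV (sol C c \<kappa> \<gamma> J \<zeta> z)"
proof -
  have [measurable]: "C \<in> borel_measurable borel" using int by auto
  have cont: "continuous_on UNIV C" using C by (simp add: covariance_function_def)
  have "continuous_on UNIV (\<lambda>w. LINT s|lborel. indicator {0..z} s * C (L (w - (z - s) *\<^sub>R vel \<kappa> \<zeta>)))" if L: "L \<in> J" for L
    unfolding continuous_on_sequentially comp_def
  proof (intro allI ballI impI)
    have lin: "linear L" using J L by (simp add: isotropic_def)
    note [measurable] = measurable_linear[OF lin]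
    fix x :: "nat \<Rightarrow> 'e" and w assume x: "(\<forall>n. x n \<in> UNIV) \<and> x \<longlonglongrightarrow> w"
    show "(\<lambda>n. LINT s|lborel. indicator {0..z} s * C (L (x n - (z - s) *\<^sub>R vel \<kappa> \<zeta>))) \<longlonglongrightarrow> (LBINT s. indicator {0..z} s * C (L (w - (z - s) *\<^sub>R vel \<kappa> \<zeta>)))"
    proof (rule integral_dominated_convergence[where w="\<lambda>s. indicator {0..z} s * C 0"])
      show "AE s in lborel. (\<lambda>n. indicator {0..z} s * C (L (x n - (z - s) *\<^sub>R vel \<kappa> \<zeta>))) \<longlonglongrightarrow> indicator {0..z} s * C (L (w - (z - s) *\<^sub>R vel \<kappa> \<zeta>))"
      proof (rule AE_I2)
        fix s
        have "continuous_on UNIV L" by (intro linear_continuous_on) (use lin in \<open>simp add: linear_conv_bounded_linear\<close>)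
        then have "(\<lambda>n. L (x n - (z - s) *\<^sub>R vel \<kappa> \<zeta>)) \<longlonglongrightarrow> L (w - (z - s) *\<^sub>R vel \<kappa> \<zeta>)"
          by (rule continuous_on_tendsto_compose) (use x in \<open>auto intro!: tendsto_intros\<close>)
        then have "(\<lambda>n. C (L (x n - (z - s) *\<^sub>R vel \<kappa> \<zeta>))) \<longlonglongrightarrow> C (L (w - (z - s) *\<^sub>R vel \<kappa> \<zeta>))"
          by (intro continuous_on_tendsto_compose[OF cont]) auto
        then show "(\<lambda>n. indicator {0..z} s * C (L (x n - (z - s) *\<^sub>R vel \<kappa> \<zeta>))) \<longlonglongrightarrow> indicator {0..z} s * C (L (w - (z - s) *\<^sub>R vel \<kappa> \<zeta>))"
          by (intro tendsto_intros)
      qed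
      show "integrable lborel (\<lambda>s. indicator {0..z} s * C 0)"
        by (intro integrable_mult_left integrable_real_indicator) (use z in auto)
      show "AE s in lborel. norm (indicator {0..z} s * C (L (x n - (z - s) *\<^sub>R vel \<kappa> \<zeta>))) \<le> indicator {0..z} s * C 0" for n
        using covariance_bound[OF C] by (auto simp: indicator_def)
    qed measurable
  qed
  then show ?thesis
    unfolding sol_def phs_def by (intro continuous_intros) auto
qed

section \<open>Several particles\<close>

text \<open>The dispersion of two independent systems. On a product space every basis vector has exactly
  one nonzero component, which selects the system.\<close>

definition pd :: "('a::euclidean_space \<Rightarrow> real) \<Rightarrow> ('b::euclidean_space \<Rightarrow> real) \<Rightarrow> 'a \<times> 'b \<Rightarrow> real" where
  "pd \<kappa> \<kappa>' = (\<lambda>(u, v). if u \<noteq> 0 then \<kappa> u else \<kappa>' v)"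

lemma sum_Basis_prod:
  "(\<Sum>e\<in>(Basis :: ('a::euclidean_space \<times> 'b::euclidean_space) set). f e) = (\<Sum>u\<in>Basis. f (u, 0)) + (\<Sum>v\<in>Basis. f (0, v))"
  unfolding Basis_prod_def by (subst sum.union_disjoint) (auto simp: sum.reindex inj_on_def)

lemma vel_pd: "vel (pd \<kappa> \<kappa>') (p, q) = (vel \<kappa> p, vel \<kappa>' q)"
proof -
  have 1: "(\<Sum>u\<in>Basis. (pd \<kappa> \<kappa>' (u, 0) * ((p, q) \<bullet> (u, 0))) *\<^sub>R (u, 0)) = (\<Sum>u\<in>Basis. ((\<kappa> u * (p \<bullet> u)) *\<^sub>R u, 0))"
    by (intro sum.cong refl) (auto simp: pd_def)
  have 2: "(\<Sum>v\<in>Basis. (pd \<kappa> \<kappa>' (0, v) * ((p, q) \<bullet> (0, v))) *\<^sub>R (0, v)) = (\<Sum>v\<in>Basis. (0, (\<kappa>' v * (q \<bullet> v)) *\<^sub>R v))"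
    by (intro sum.cong refl) (auto simp: pd_def)
  show ?thesis
    unfolding vel_def sum_Basis_prod 1 2
    by (rule prod_eqI) (simp_all only: fst_add snd_add fst_sum snd_sum fst_conv snd_conv sum.neutral_const add_0_left add_0_right)
qed

lemma vel_const: "vel (\<lambda>_. a) p = a *\<^sub>R p"
  by (rule euclidean_eqI) (simp add: vel_inner_Basis)

lemma partial_fst: "partial (u, 0) \<phi> (x, y) = partial u (\<lambda>\<xi>. \<phi> (\<xi>, y)) x"
  and partial_snd: "partial (0, v) \<phi> (x, y) = partial v (\<lambda>\<eta>. \<phi> (x, \<eta>)) y"
  by (simp_all add: partial_def)

lemma schr_pd: "schr (pd \<kappa> \<kappa>') \<phi> (x, y) = schr \<kappa> (\<lambda>\<xi>. \<phi> (\<xi>, y)) x + schr \<kappa>' (\<lambda>\<eta>. \<phi> (x, \<eta>)) y"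
proof -
  have "(\<Sum>u\<in>Basis. of_real (pd \<kappa> \<kappa>' (u, 0)) * partial (u, 0) (partial (u, 0) \<phi>) (x, y)) = (\<Sum>u\<in>Basis. of_real (\<kappa> u) * partial u (partial u (\<lambda>\<xi>. \<phi> (\<xi>, y))) x)"
    by (intro sum.cong refl) (auto simp: pd_def partial_fst)
  moreover have "(\<Sum>v\<in>Basis. of_real (pd \<kappa> \<kappa>' (0, v)) * partial (0, v) (partial (0, v) \<phi>) (x, y)) = (\<Sum>v\<in>Basis. of_real (\<kappa>' v) * partial v (partial v (\<lambda>\<eta>. \<phi> (x, \<eta>))) y)"
    by (intro sum.cong refl) (auto simp: pd_def partial_snd)
  ultimately show ?thesis unfolding schr_def sum_Basis_prod by (simp add: distrib_left)
qed

lemma schr_const: "schr (\<lambda>_. a) \<phi> x = (\<i> / 2) * of_real a * laplacian \<phi> x"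
  by (simp add: schr_def laplacian_def sum_distrib_left mult_ac)

type_synonym R2 = "real^2"
type_synonym R8 = "R2 \<times> R2 \<times> R2 \<times> R2"

text \<open>A single field has the operator \<open>\<i> / (2 k0) \<Delta>\<close>, a conjugated one has the opposite sign.\<close>

definition d1 :: "real \<Rightarrow> R2 \<Rightarrow> real" where "d1 k0 = (\<lambda>_. 1 / k0)"
definition d1' :: "real \<Rightarrow> R2 \<Rightarrow> real" where "d1' k0 = (\<lambda>_. - (1 / k0))"
definition d2 :: "real \<Rightarrow> R2 \<times> R2 \<Rightarrow> real" where "d2 k0 = pd (d1 k0) (d1' k0)"
definition d4 :: "real \<Rightarrow> R8 \<Rightarrow> real" where
  "d4 k0 = pd (d1 k0) (pd (d1 k0) (pd (d1' k0) (d1' k0)))"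

lemma vel_d1: "vel (d1 k0) p = p /\<^sub>R k0" by (simp add: d1_def vel_const inverse_eq_divide)
lemma vel_d1': "vel (d1' k0) p = - (p /\<^sub>R k0)" by (simp add: d1'_def vel_const inverse_eq_divide)
lemma vel_d2: "vel (d2 k0) (p, q) = (p /\<^sub>R k0, - (q /\<^sub>R k0))" by (simp add: d2_def vel_pd vel_d1 vel_d1')
lemma vel_d4: "vel (d4 k0) (p1, p2, q1, q2) = (p1 /\<^sub>R k0, p2 /\<^sub>R k0, - (q1 /\<^sub>R k0), - (q2 /\<^sub>R k0))"
  by (simp add: d4_def vel_pd vel_d1 vel_d1')

lemma symb_d1: "symb (d1 k0) p = (p \<bullet> p) / (2 * k0)" by (simp add: symb_def vel_d1 inverse_eq_divide)
lemma symb_d2: "symb (d2 k0) (p, q) = (p \<bullet> p - q \<bullet> q) / (2 * k0)" by (simp add: symb_def vel_d2 inverse_eq_divide diff_divide_distrib)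
lemma symb_d4: "symb (d4 k0) (p1, p2, q1, q2) = (p1 \<bullet> p1 + p2 \<bullet> p2 - q1 \<bullet> q1 - q2 \<bullet> q2) / (2 * k0)"
  by (simp add: symb_def vel_d4 inverse_eq_divide diff_divide_distrib add_divide_distrib)

text \<open>Differences of positions; the digits number the components of \<open>(x1, x2, y1, y2)\<close>.\<close>

definition diff2 :: "R2 \<times> R2 \<Rightarrow> R2" where "diff2 = (\<lambda>(x, y). x - y)"
definition l13 :: "R8 \<Rightarrow> R2" where "l13 = (\<lambda>(x1, x2, y1, y2). x1 - y1)"
definition l24 :: "R8 \<Rightarrow> R2" where "l24 = (\<lambda>(x1, x2, y1, y2). x2 - y2)"
definition l14 :: "R8 \<Rightarrow> R2" where "l14 = (\<lambda>(x1, x2, y1, y2). x1 - y2)"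
definition l23 :: "R8 \<Rightarrow> R2" where "l23 = (\<lambda>(x1, x2, y1, y2). x2 - y1)"
definition l12 :: "R8 \<Rightarrow> R2" where "l12 = (\<lambda>(x1, x2, y1, y2). x1 - x2)"
definition l34 :: "R8 \<Rightarrow> R2" where "l34 = (\<lambda>(x1, x2, y1, y2). y1 - y2)"

lemmas l_defs = l13_def l24_def l14_def l23_def l12_def l34_def

lemma adjoint_diff2: "adjoint diff2 = (\<lambda>k. (k, - k))"
  by (rule adjoint_unique) (auto simp: diff2_def inner_diff_left)

lemma adjoint_l:
  "adjoint l13 = (\<lambda>k. (k, 0, - k, 0))" "adjoint l24 = (\<lambda>k. (0, k, 0, - k))"
  "adjoint l14 = (\<lambda>k. (k, 0, 0, - k))" "adjoint l23 = (\<lambda>k. (0, k, - k, 0))"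
  "adjoint l12 = (\<lambda>k. (k, - k, 0, 0))" "adjoint l34 = (\<lambda>k. (0, 0, k, - k))"
  by (rule adjoint_unique, auto simp: l_defs inner_diff_left)+

lemma linear_l: "linear diff2" "linear l13" "linear l24" "linear l14" "linear l23" "linear l12" "linear l34"
  by (auto simp: l_defs diff2_def intro!: linearI simp: algebra_simps scaleR_diff_right)

lemma l_distinct: "l13 \<noteq> l24" "l14 \<noteq> l23"
proof -
  have "(1::R2) \<noteq> 0" by (simp add: vec_eq_iff)
  moreover have "l13 (1, 0, 0, 0) = 1" "l24 (1, 0, 0, 0) = 0" "l14 (1, 0, 0, 0) = 1" "l23 (1, 0, 0, 0) = 0" by (simp_all add: l_defs)
  ultimately show "l13 \<noteq> l24" "l14 \<noteq> l23" by metis+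
qed

text \<open>It is enough to exhibit a subspace that contains the frequencies and on which the symbol
  vanishes.\<close>

lemma isotropicI:
  assumes "finite J" "\<And>L. L \<in> J \<Longrightarrow> linear L" "subspace S" "\<And>L k. L \<in> J \<Longrightarrow> adjoint L k \<in> S" "\<And>l. l \<in> S \<Longrightarrow> symb \<kappa> l = 0"
  shows "isotropic \<kappa> J"
proof -
  have "freqs J \<subseteq> S" unfolding freqs_def by (rule span_minimal) (use assms in auto)
  then show ?thesis using assms by (auto simp: isotropic_def)
qed

lemma isotropic_empty: "isotropic \<kappa> {}"
  by (rule isotropicI[where S="{0}"]) (auto simp: symb_def)

lemma isotropic_2: "isotropic (d2 k0) {diff2}"
proof (rule isotropicI[where S="{(a, b). b = - a}"])
  show "subspace {(a, b). b = - (a::R2)}" by (auto simp: subspace_def zero_prod_def)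
qed (auto simp: linear_l adjoint_diff2 symb_d2)

lemma isotropic_13_24: "isotropic (d4 k0) {l13, l24}"
proof (rule isotropicI[where S="{(a, b, c, d). c = - a \<and> d = - b}"])
  show "subspace {(a::R2, b::R2, c, d). c = - a \<and> d = - b}" by (auto simp: subspace_def zero_prod_def)
qed (auto simp: linear_l adjoint_l symb_d4)

lemma isotropic_14_23: "isotropic (d4 k0) {l14, l23}"
proof (rule isotropicI[where S="{(a, b, c, d). c = - b \<and> d = - a}"])
  show "subspace {(a::R2, b::R2, c, d). c = - b \<and> d = - a}" by (auto simp: subspace_def zero_prod_def)
qed (auto simp: linear_l adjoint_l symb_d4)

text \<open>Scattering by one pairing changes the group velocity in the direction that matters for any
  other difference, by \<open>\<plusminus>k / k0\<close>; this is the source of the decay in \<open>scattered_source\<close>.\<close>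

lemma cross_13_24:
  assumes "L \<in> {l14, l23, l12, l34}" "L' \<in> {l13, l24}"
  shows "\<exists>\<sigma>. (\<sigma> = 1 \<or> \<sigma> = (-1::real)) \<and> (\<forall>k k'. adjoint L k' \<bullet> vel (d4 k0) (adjoint L' k) = \<sigma> / k0 * (k \<bullet> k'))"
proof -
  have "(\<forall>k k'. adjoint L k' \<bullet> vel (d4 k0) (adjoint L' k) = 1 / k0 * (k \<bullet> k')) \<or> (\<forall>k k'. adjoint L k' \<bullet> vel (d4 k0) (adjoint L' k) = (-1) / k0 * (k \<bullet> k'))"
    using assms by (auto simp: adjoint_l vel_d4 inverse_eq_divide inner_commute)
  then show ?thesis by blast
qed

lemma cross_14_23:
  assumes "L \<in> {l13, l24, l12, l34}" "L' \<in> {l14, l23}"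
  shows "\<exists>\<sigma>. (\<sigma> = 1 \<or> \<sigma> = (-1::real)) \<and> (\<forall>k k'. adjoint L k' \<bullet> vel (d4 k0) (adjoint L' k) = \<sigma> / k0 * (k \<bullet> k'))"
proof -
  have "(\<forall>k k'. adjoint L k' \<bullet> vel (d4 k0) (adjoint L' k) = 1 / k0 * (k \<bullet> k')) \<or> (\<forall>k k'. adjoint L k' \<bullet> vel (d4 k0) (adjoint L' k) = (-1) / k0 * (k \<bullet> k'))"
    using assms by (auto simp: adjoint_l vel_d4 inverse_eq_divide inner_commute)
  then show ?thesis by blast
qed

section \<open>The residual of the Gaussian summation formula\<close>

text \<open>A bound for the integral of an oscillation of frequency \<open>\<Omega>\<close> over an interval of length at
  most \<open>Z\<close>.\<close>

definition oscb :: "real \<Rightarrow> real \<Rightarrow> real" where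
  "oscb Z \<Omega> = (if \<Omega> = 0 then Z else min Z (2 / \<bar>\<Omega>\<bar>))"

lemma borel_measurable_oscb [measurable (raw)]:
  assumes [measurable]: "f \<in> borel_measurable M"
  shows "(\<lambda>x. oscb Z (f x)) \<in> borel_measurable M"
  unfolding oscb_def by measurable

lemma oscb_bounds: "0 \<le> Z \<Longrightarrow> 0 \<le> oscb Z \<Omega>" "oscb Z \<Omega> \<le> Z" "\<Omega> \<noteq> 0 \<Longrightarrow> oscb Z \<Omega> \<le> 2 / \<bar>\<Omega>\<bar>"
  by (auto simp: oscb_def)

text \<open>Integrate the damped exponential \<open>exp ((- \<gamma> + \<i> \<Omega>) t)\<close> explicitly.\<close>

lemma norm_osc_le_oscb:
  assumes s: "0 \<le> s" "s \<le> Z" and \<gamma>: "0 \<le> \<gamma>"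
  shows "norm (osc s \<gamma> 0 \<Omega>) \<le> oscb Z \<Omega>"
proof (cases "\<Omega> = 0")
  case True
  then show ?thesis using norm_osc_le[OF s(1) \<gamma>, of 0 \<Omega>] s by (simp add: oscb_def)
next
  case False
  define w where "w = Complex (- \<gamma>) \<Omega>"
  have w: "w \<noteq> 0" using False by (simp add: w_def complex_eq_iff)
  have "osc s \<gamma> 0 \<Omega> = (LBINT t:{0..s}. wave \<gamma> 0 \<Omega> t)" unfolding osc_def by (rule integral_iv) measurable
  also have "\<dots> = (LBINT t. indicator {0..s} t *\<^sub>R exp (w * of_real t))"
    unfolding set_lebesgue_integral_def
  proof (rule Bochner_Integration.integral_cong[OF refl])
    fix t
    have "exp (w * of_real t) = of_real (exp (- \<gamma> * t)) * cis (t * \<Omega>)"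
      by (simp add: w_def exp_eq_polar mult.commute)
    then show "indicator {0..s} t *\<^sub>R wave \<gamma> 0 \<Omega> t = indicator {0..s} t *\<^sub>R exp (w * of_real t)"
      by (auto simp: wave_def indicator_def)
  qed
  also have "\<dots> = exp (w * of_real s) / w - exp (w * of_real 0) / w"
  proof (rule integral_FTC_atLeastAtMost[OF s(1)])
    fix t assume "0 \<le> t" "t \<le> s"
    have "((\<lambda>t. exp (w * t) / w) has_field_derivative exp (w * of_real t)) (at (of_real t))"
      using w by (auto intro!: derivative_eq_intros)
    then show "((\<lambda>t. exp (w * of_real t) / w) has_vector_derivative exp (w * of_real t)) (at t within {0..s})"
      by (rule has_vector_derivative_real_field)
  qed (intro continuous_intros)
  also have "\<dots> = (exp (w * of_real s) - 1) / w" by (simp add: diff_divide_distrib)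
  finally have "norm (osc s \<gamma> 0 \<Omega>) = norm (exp (w * of_real s) - 1) / norm w" by (simp add: norm_divide)
  also have "\<dots> \<le> 2 / \<bar>\<Omega>\<bar>"
  proof (rule frac_le)
    have "norm (exp (w * of_real s)) \<le> 1" using s \<gamma> by (simp add: w_def)
    then show "norm (exp (w * of_real s) - 1) \<le> 2" using norm_triangle_ineq4[of "exp (w * of_real s)" 1] unfolding norm_one by linarith
    show "\<bar>\<Omega>\<bar> \<le> norm w" using abs_Im_le_cmod[of w] by (simp add: w_def)
  qed (use False in auto)
  finally show ?thesis using norm_osc_le[OF s(1) \<gamma>, of 0 \<Omega>] s False by (simp add: oscb_def)
qed

text \<open>The bound of \<open>scattered_source\<close> for at most two potentials, made monotone in the time.\<close>

definition scat_bound :: "(real^2 \<Rightarrow> real) \<Rightarrow> real \<Rightarrow> real \<Rightarrow> real \<Rightarrow> real" where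
  "scat_bound C k0 c Z = Z * (exp (c * (2 * (Z * C 0))) * (c * (2 * (sqrt Z * (((C 0)\<^sup>2 + (LBINT x. \<bar>C x\<bar>)\<^sup>2 * k0\<^sup>2) * pi + (C 0)\<^sup>2)))))"

lemma pot_int_scattered:
  fixes a :: "'e::euclidean_space"
  assumes C: "covariance_function C" and int: "integrable lborel C" and L: "linear L" and d: "d > 0"
    and c: "0 \<le> c" and \<gamma>: "0 \<le> \<gamma>" and s: "0 \<le> s" "s \<le> Z" and t: "0 \<le> \<tau>" and J: "isotropic \<kappa> J" "card J \<le> 2" and k0: "k0 > 0"
    and cross: "\<And>L'. L' \<in> J \<Longrightarrow> \<exists>\<sigma>. (\<sigma> = 1 \<or> \<sigma> = (-1::real)) \<and> (\<forall>k k'. adjoint L k' \<bullet> vel \<kappa> (adjoint L' k) = \<sigma> / k0 * (k \<bullet> k'))"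
  shows "norm (pot_int \<kappa> d a p \<tau> s (\<lambda>r w. of_real (C (L w)) * (sol C c \<kappa> \<gamma> J \<zeta> r w - sol C c \<kappa> \<gamma> {} \<zeta> r w))) \<le> scat_bound C k0 c Z"
proof -
  have C0: "0 \<le> C 0" using covariance_bound[OF C, of 0] by simp
  let ?K = "((C 0)\<^sup>2 + (LBINT x. \<bar>C x\<bar>)\<^sup>2 * k0\<^sup>2) * pi + (C 0)\<^sup>2"
  have K: "0 \<le> ?K" by simp
  have nn: "0 \<le> scat_bound C k0 c Z" unfolding scat_bound_def using s c K by (intro mult_nonneg_nonneg) auto
  show ?thesis
  proof (cases "s = 0")
    case True
    have "(LBINT r:{0..0::real}. f r) = 0" for f :: "real \<Rightarrow> complex"
      unfolding set_lebesgue_integral_def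
    proof (rule integral_eq_zero_AE)
      show "AE r in lborel. indicator {0..0} r *\<^sub>R f r = 0"
        using AE_lborel_singleton[of "0::real"] by eventually_elim (simp add: indicator_def)
    qed
    then show ?thesis using True nn by (simp add: pot_int_def)
  next
    case False
    then have s0: "0 < s" using s by simp
    have "norm (pot_int \<kappa> d a p \<tau> s (\<lambda>r w. of_real (C (L w)) * (sol C c \<kappa> \<gamma> J \<zeta> r w - sol C c \<kappa> \<gamma> {} \<zeta> r w)))
      \<le> s * (exp (c * (real (card J) * (s * C 0))) * (c * (real (card J) * (sqrt s * ?K))))"
      unfolding pot_int_def mult.assoc
      using t by (intro scattered_source[OF C int L d c \<gamma> s0 _ J(1) k0 cross]) auto
    also have "\<dots> \<le> scat_bound C k0 c Z"
      unfolding scat_bound_def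
      using s c C0 K J(2) by (intro mult_mono mult_left_mono exp_le_cancel_iff[THEN iffD2] mult_nonneg_nonneg real_sqrt_le_mono) auto
    finally show ?thesis .
  qed
qed

lemma pot_int_oscillating:
  fixes a :: "'e::euclidean_space"
  assumes C: "covariance_function C" and int: "integrable lborel C" and L: "linear L" and d: "d > 0"
    and \<gamma>: "0 \<le> \<gamma>" and s: "0 \<le> s" "s \<le> Z" and t: "0 \<le> \<tau>"
  shows "norm (pot_int \<kappa> d a p \<tau> s (\<lambda>r w. of_real (C (L w)) * sol C c \<kappa> \<gamma> {} \<zeta> r w))
    \<le> (LINT k|sm C. oscb Z (adjoint L k \<bullet> vel \<kappa> \<zeta> + symb \<kappa> (adjoint L k)))"
proof -
  interpret S: finite_measure "sm C" by (rule measure_sm[OF C int])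
  have [measurable]: "adjoint L \<in> borel_measurable borel" by (intro measurable_linear adjoint_linear L)
  have "norm (pot_int \<kappa> d a p \<tau> s (\<lambda>r w. of_real (C (L w)) * sol C c \<kappa> \<gamma> {} \<zeta> r w))
    \<le> (LINT k|sm C. norm (osc s \<gamma> 0 (adjoint L k \<bullet> vel \<kappa> \<zeta> + symb \<kappa> (adjoint L k))))"
    unfolding pot_int_def mult.assoc by (rule oscillating_source[OF C int L d \<gamma> s(1)]) (use t in simp)
  also have "\<dots> \<le> (LINT k|sm C. oscb Z (adjoint L k \<bullet> vel \<kappa> \<zeta> + symb \<kappa> (adjoint L k)))"
  proof (rule integral_mono')
    show "integrable (sm C) (\<lambda>k. oscb Z (adjoint L k \<bullet> vel \<kappa> \<zeta> + symb \<kappa> (adjoint L k)))"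
      by (rule S.integrable_const_bound[where B=Z]) (use oscb_bounds s in auto)
    show "norm (osc s \<gamma> 0 (adjoint L k \<bullet> vel \<kappa> \<zeta> + symb \<kappa> (adjoint L k))) \<le> oscb Z (adjoint L k \<bullet> vel \<kappa> \<zeta> + symb \<kappa> (adjoint L k))" for k
      by (rule norm_osc_le_oscb[OF s \<gamma>])
    show "0 \<le> oscb Z (adjoint L k \<bullet> vel \<kappa> \<zeta> + symb \<kappa> (adjoint L k))" for k using oscb_bounds(1)[of Z] s by simp
  qed
  finally show ?thesis .
qed

lemma bounded_path_sol:
  fixes \<kappa> :: "'e::euclidean_space \<Rightarrow> real"
  assumes C: "covariance_function C" and int: "integrable lborel C" and c: "0 \<le> c" and J: "isotropic \<kappa> J" and \<gamma>: "0 \<le> \<gamma>"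
  shows "bounded_path s (exp (c * (real (card J) * (s * C 0)))) (sol C c \<kappa> \<gamma> J \<zeta>)"
proof -
  have Cm: "C \<in> borel_measurable borel" using int by auto
  have lin: "linear L" if "L \<in> J" for L using J that by (simp add: isotropic_def)
  note [measurable] = borel_measurable_sol[OF Cm lin]
  show ?thesis unfolding bounded_path_def
    by (intro conjI allI impI norm_sol_bound[OF C int c _ _ J \<gamma>]) measurable
qed

lemma residual_sol:
  fixes a :: "'e::euclidean_space"
  assumes C: "covariance_function C" and int: "integrable lborel C" and c: "0 \<le> c" and s: "0 \<le> s" and t: "0 \<le> \<tau>"
    and J: "isotropic \<kappa> J" and d: "d > 0"
  shows "residual \<kappa> d a p \<tau> s (\<lambda>w. c * (\<Sum>L\<in>J. C (L w)) - \<gamma>) (sol C c \<kappa> \<gamma> J \<zeta>) = 0"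
  using sol_duhamel[OF C int c s t J d, of \<gamma> \<zeta> a p] by (simp add: residual_def pot_int_def sol_0 mult.assoc)

definition fourth_potential :: "(real^2 \<Rightarrow> real) \<Rightarrow> real \<Rightarrow> R8 \<Rightarrow> real" where
  "fourth_potential C c w = c * (C (l13 w) + C (l14 w) + C (l23 w) + C (l24 w) - C (l12 w) - C (l34 w)) - 2 * c * C 0"

text \<open>Inclusion and exclusion over the two pairings; the plane wave without interactions is
  contained in both.\<close>

definition fourth_sol :: "(real^2 \<Rightarrow> real) \<Rightarrow> real \<Rightarrow> real \<Rightarrow> R8 \<Rightarrow> real \<Rightarrow> R8 \<Rightarrow> complex" where
  "fourth_sol C k0 c \<zeta> r w = sol C c (d4 k0) (2 * c * C 0) {l13, l24} \<zeta> r w + sol C c (d4 k0) (2 * c * C 0) {l14, l23} \<zeta> r w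
     - sol C c (d4 k0) (2 * c * C 0) {} \<zeta> r w"

definition osc_bound :: "(real^2 \<Rightarrow> real) \<Rightarrow> real \<Rightarrow> real \<Rightarrow> R8 \<Rightarrow> real" where
  "osc_bound C k0 Z \<zeta> = (\<Sum>L\<in>{l12, l34}. LINT k|sm C. oscb Z (adjoint L k \<bullet> vel (d4 k0) \<zeta> + symb (d4 k0) (adjoint L k)))"

lemma l12_neq_l34: "l12 \<noteq> l34"
proof -
  have "(1::R2) \<noteq> 0" by (simp add: vec_eq_iff)
  moreover have "l12 (1, 0, 0, 0) = 1" "l34 (1, 0, 0, 0) = 0" by (simp_all add: l_defs)
  ultimately show ?thesis by metis
qed

lemma sum_of_three_balances:
  fixes a1 :: complex
  assumes "a1 - b1 - p1 = 0" "a2 - b2 - p2 = 0" "a0 - b0 - p0 = 0"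
  shows "(a1 + a2 - a0) - (b1 + b2 - b0) - q = p1 + p2 - p0 - q"
  using assms by algebra

text \<open>With \<open>u1\<close>, \<open>u2\<close> the scattered parts of the two pairings, the residual is a combination of
  ten source terms: the six in which \<open>C (x1 - x2)\<close> or \<open>C (y1 - y2)\<close> acts on \<open>u1\<close>, \<open>u2\<close> or the
  unscattered wave, and the four in which the potentials of one pairing act on the scattered part
  of the other.\<close>

lemma fourth_residual:
  assumes C: "covariance_function C" and int: "integrable lborel C" and k0: "k0 > 0" and c: "0 \<le> c" and d: "d > 0"
    and s: "0 \<le> s" "s \<le> Z" and t: "0 \<le> \<tau>"
  shows "norm (residual (d4 k0) d a p \<tau> s (fourth_potential C c) (fourth_sol C k0 c \<zeta>)) \<le> c * (8 * scat_bound C k0 c Z + osc_bound C k0 Z \<zeta>)"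
proof -
  have C0: "0 \<le> C 0" using covariance_bound[OF C, of 0] by simp
  have Cm[measurable]: "C \<in> borel_measurable borel" using int by auto
  define \<gamma> where "\<gamma> = 2 * c * C 0"
  have \<gamma>: "0 \<le> \<gamma>" using c C0 by (simp add: \<gamma>_def)
  let ?\<kappa> = "d4 k0"
  define s1 where "s1 = sol C c ?\<kappa> \<gamma> {l13, l24} \<zeta>"
  define s2 where "s2 = sol C c ?\<kappa> \<gamma> {l14, l23} \<zeta>"
  define s0 where "s0 = sol C c ?\<kappa> \<gamma> {} \<zeta>"
  define bp where "bp h \<longleftrightarrow> (\<exists>B. bounded_path s B h)" for h :: "real \<Rightarrow> R8 \<Rightarrow> complex"
  let ?I = "pot_int ?\<kappa> d a p \<tau> s"
  have bp_add: "bp (\<lambda>r w. h r w + h' r w)" if "bp h" "bp h'" for h h' using that bounded_path_add unfolding bp_def by blast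
  have bp_diff: "bp (\<lambda>r w. h r w - h' r w)" if "bp h" "bp h'" for h h' using that bounded_path_diff unfolding bp_def by blast
  have bp_V: "bp (\<lambda>r w. h r w * of_real (V w))" if h: "bp h" and [measurable]: "V \<in> borel_measurable borel" and V: "\<And>w. \<bar>V w\<bar> \<le> v" for h V v
  proof -
    obtain B where "bounded_path s B h" using h unfolding bp_def by blast
    from bounded_path_mult[OF this _ _ s(1), of "\<lambda>w. of_real (V w)" v] V show ?thesis unfolding bp_def by auto
  qed
  have bp_s: "bp s1" "bp s2" "bp s0"
    unfolding bp_def s1_def s2_def s0_def
    using bounded_path_sol[OF C int c isotropic_13_24 \<gamma>] bounded_path_sol[OF C int c isotropic_14_23 \<gamma>] bounded_path_sol[OF C int c isotropic_empty \<gamma>] by blast+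
  have I_add: "?I (\<lambda>r w. h r w + h' r w) = ?I h + ?I h'" if "bp h" "bp h'" for h h'
    using that pot_int_add[OF d _ _ s(1) t] unfolding bp_def by blast
  have I_diff: "?I (\<lambda>r w. h r w - h' r w) = ?I h - ?I h'" if "bp h" "bp h'" for h h'
    using that pot_int_diff[OF d _ _ s(1) t] unfolding bp_def by blast
  have CLm: "(\<lambda>w. C (L w)) \<in> borel_measurable borel" if "linear L" for L :: "R8 \<Rightarrow> R2"
    by (rule measurable_compose[OF measurable_linear[OF that] Cm])
  note [measurable] = CLm[OF linear_l(2)] CLm[OF linear_l(3)] CLm[OF linear_l(4)] CLm[OF linear_l(5)] CLm[OF linear_l(6)] CLm[OF linear_l(7)]
  have bp_C: "bp (\<lambda>r w. of_real (C (L w)) * h r w)" if "bp h" "linear L" for h L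
    using bp_V[OF that(1) CLm[OF that(2)] covariance_bound[OF C]] by (simp add: mult.commute)
  define U1 where "U1 w = c * (C (l13 w) + C (l24 w)) - \<gamma>" for w
  define U2 where "U2 w = c * (C (l14 w) + C (l23 w)) - \<gamma>" for w
  define V where "V = fourth_potential C c"
  have Veq: "V w = c * (C (l13 w) + C (l14 w) + C (l23 w) + C (l24 w) - C (l12 w) - C (l34 w)) - \<gamma>" for w
    by (simp add: V_def fourth_potential_def \<gamma>_def)
  have Um[measurable]: "U1 \<in> borel_measurable borel" "U2 \<in> borel_measurable borel" "V \<in> borel_measurable borel"
    unfolding U1_def[abs_def] U2_def[abs_def] Veq[abs_def] by measurable
  have cb: "\<bar>c * x\<bar> \<le> c * y" if "\<bar>x\<bar> \<le> y" for x y using that c by (simp add: abs_mult mult_left_mono)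
  note b = covariance_bound[OF C]
  have U1b: "\<bar>U1 w\<bar> \<le> c * (2 * C 0) + \<gamma>" for w
    using cb[of "C (l13 w) + C (l24 w)" "2 * C 0"] b[of "l13 w"] b[of "l24 w"] \<gamma> unfolding U1_def by linarith
  have U2b: "\<bar>U2 w\<bar> \<le> c * (2 * C 0) + \<gamma>" for w
    using cb[of "C (l14 w) + C (l23 w)" "2 * C 0"] b[of "l14 w"] b[of "l23 w"] \<gamma> unfolding U2_def by linarith
  have Vb: "\<bar>V w\<bar> \<le> c * (6 * C 0) + \<gamma>" for w
    using cb[of "C (l13 w) + C (l14 w) + C (l23 w) + C (l24 w) - C (l12 w) - C (l34 w)" "6 * C 0"]
      b[of "l14 w"] b[of "l23 w"] b[of "l13 w"] b[of "l24 w"] b[of "l12 w"] b[of "l34 w"] \<gamma> unfolding Veq by linarith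
  have r1: "residual ?\<kappa> d a p \<tau> s U1 s1 = 0"
    using residual_sol[OF C int c s(1) t isotropic_13_24 d, of k0 a p \<gamma> \<zeta>] l_distinct unfolding s1_def U1_def[abs_def] by simp
  have r2: "residual ?\<kappa> d a p \<tau> s U2 s2 = 0"
    using residual_sol[OF C int c s(1) t isotropic_14_23 d, of k0 a p \<gamma> \<zeta>] l_distinct unfolding s2_def U2_def[abs_def] by simp
  have r0: "residual ?\<kappa> d a p \<tau> s (\<lambda>_. - \<gamma>) s0 = 0"
    using residual_sol[OF C int c s(1) t isotropic_empty d, of ?\<kappa> a p \<gamma> \<zeta>] unfolding s0_def by simp
  have fs: "fourth_sol C k0 c \<zeta> = (\<lambda>r w. s1 r w + s2 r w - s0 r w)"
    by (simp add: fun_eq_iff fourth_sol_def s1_def s2_def s0_def \<gamma>_def)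
  have lin: "(LBINT w. (s1 r w + s2 r w - s0 r w) * packet ?\<kappa> d a p t' w)
     = (LBINT w. s1 r w * packet ?\<kappa> d a p t' w) + (LBINT w. s2 r w * packet ?\<kappa> d a p t' w) - (LBINT w. s0 r w * packet ?\<kappa> d a p t' w)"
    if r: "0 \<le> r" "r \<le> s" for r t'
  proof -
    have i: "integrable lborel (\<lambda>w. h r w * packet ?\<kappa> d a p t' w)" if "bp h" for h
      using that pot_int_integrable(1)[OF d _ s(1) t r] unfolding bp_def by blast
    show ?thesis unfolding left_diff_distrib distrib_right
      using i[OF bp_s(1)] i[OF bp_s(2)] i[OF bp_s(3)] by simp
  qed
  have g0: "\<bar>- \<gamma>\<bar> \<le> \<gamma>" using \<gamma> by simp
  have gm0: "(\<lambda>_. - \<gamma>) \<in> borel_measurable borel" by simp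
  note bU1 = bp_V[OF bp_s(1) Um(1) U1b] and bU2 = bp_V[OF bp_s(2) Um(2) U2b] and bU0 = bp_V[OF bp_s(3) gm0 g0]
  have bn: "bp (\<lambda>r w. s1 r w + s2 r w - s0 r w)" by (intro bp_add bp_diff bp_s)
  note bV = bp_V[OF bn Um(3) Vb]
  define u1 where "u1 = (\<lambda>r w. s1 r w - s0 r w)"
  define u2 where "u2 = (\<lambda>r w. s2 r w - s0 r w)"
  have bu: "bp u1" "bp u2" unfolding u1_def u2_def by (intro bp_diff bp_s)+
  define T where "T L h = (\<lambda>r w. of_real (C (L w)) * h r w :: complex)" for L :: "R8 \<Rightarrow> R2" and h :: "real \<Rightarrow> R8 \<Rightarrow> complex"
  have bT: "bp (T L h)" if "bp h" "linear L" for L h unfolding T_def by (rule bp_C[OF that])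
  \<comment> \<open>\<open>A\<close> collects what \<open>C (x1 - x2)\<close> and \<open>C (y1 - y2)\<close> act on, \<open>B\<close> the cross terms of the two
    pairings.\<close>
  define A where "A = (\<lambda>r w. T l12 u1 r w + T l12 u2 r w + T l12 s0 r w + T l34 u1 r w + T l34 u2 r w + T l34 s0 r w)"
  define B where "B = (\<lambda>r w. T l14 u1 r w + T l23 u1 r w + T l13 u2 r w + T l24 u2 r w)"
  have bA: "bp A" and bB: "bp B" unfolding A_def B_def by (intro bp_add bT bu bp_s linear_l)+
  have "residual ?\<kappa> d a p \<tau> s V (\<lambda>r w. s1 r w + s2 r w - s0 r w)
    = ?I (\<lambda>r w. s1 r w * of_real (U1 w)) + ?I (\<lambda>r w. s2 r w * of_real (U2 w)) - ?I (\<lambda>r w. s0 r w * of_real (- \<gamma>)) - ?I (\<lambda>r w. (s1 r w + s2 r w - s0 r w) * of_real (V w))"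
    unfolding residual_def lin[OF s(1) order_refl] lin[OF order_refl s(1)]
    by (rule sum_of_three_balances[OF r1[unfolded residual_def] r2[unfolded residual_def] r0[unfolded residual_def]])
  also have "\<dots> = ?I (\<lambda>r w. s1 r w * of_real (U1 w) + s2 r w * of_real (U2 w) - s0 r w * of_real (- \<gamma>) - (s1 r w + s2 r w - s0 r w) * of_real (V w))"
    by (simp only: I_add I_diff bU1 bU2 bU0 bV bp_add bp_diff)
  also have "(\<lambda>r w. s1 r w * of_real (U1 w) + s2 r w * of_real (U2 w) - s0 r w * of_real (- \<gamma>) - (s1 r w + s2 r w - s0 r w) * of_real (V w))
    = (\<lambda>r w. of_real c * (A r w - B r w))"
    by (simp add: fun_eq_iff A_def B_def T_def u1_def u2_def U1_def U2_def Veq algebra_simps)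
  also have "?I (\<lambda>r w. of_real c * (A r w - B r w)) = of_real c * (?I A - ?I B)"
    unfolding pot_int_cmult I_diff[OF bA bB] ..
  finally have res: "residual ?\<kappa> d a p \<tau> s V (\<lambda>r w. s1 r w + s2 r w - s0 r w) = of_real c * (?I A - ?I B)" .
  have AI: "?I A = ?I (T l12 u1) + ?I (T l12 u2) + ?I (T l12 s0) + ?I (T l34 u1) + ?I (T l34 u2) + ?I (T l34 s0)"
    unfolding A_def by (simp only: I_add bT bu bp_s linear_l bp_add)
  have BI: "?I B = ?I (T l14 u1) + ?I (T l23 u1) + ?I (T l13 u2) + ?I (T l24 u2)"
    unfolding B_def by (simp only: I_add bT bu bp_s linear_l bp_add)
  let ?Y = "scat_bound C k0 c Z"
  have card2: "card {l13, l24} \<le> 2" "card {l14, l23} \<le> 2" by (simp_all add: card_insert_if)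
  have Y1: "norm (?I (T L u1)) \<le> ?Y" if "L \<in> {l14, l23, l12, l34}" for L
    unfolding T_def u1_def s1_def s0_def
    by (rule pot_int_scattered[OF C int _ d c \<gamma> s t isotropic_13_24 card2(1) k0 cross_13_24[OF that]]) (use that linear_l in auto)
  have Y2: "norm (?I (T L u2)) \<le> ?Y" if "L \<in> {l13, l24, l12, l34}" for L
    unfolding T_def u2_def s2_def s0_def
    by (rule pot_int_scattered[OF C int _ d c \<gamma> s t isotropic_14_23 card2(2) k0 cross_14_23[OF that]]) (use that linear_l in auto)
  have O: "norm (?I (T L s0)) \<le> (LINT k|sm C. oscb Z (adjoint L k \<bullet> vel ?\<kappa> \<zeta> + symb ?\<kappa> (adjoint L k)))" if "linear L" for L
    unfolding T_def s0_def by (rule pot_int_oscillating[OF C int that d \<gamma> s t])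
  have "norm (?I A - ?I B) \<le> 8 * ?Y + osc_bound C k0 Z \<zeta>"
  proof -
    have "norm (?I A) \<le> ?Y + ?Y + (LINT k|sm C. oscb Z (adjoint l12 k \<bullet> vel ?\<kappa> \<zeta> + symb ?\<kappa> (adjoint l12 k))) + ?Y + ?Y + (LINT k|sm C. oscb Z (adjoint l34 k \<bullet> vel ?\<kappa> \<zeta> + symb ?\<kappa> (adjoint l34 k)))"
      unfolding AI by (intro norm_triangle_mono Y1 Y2 O linear_l) auto
    moreover have "norm (?I B) \<le> ?Y + ?Y + ?Y + ?Y"
      unfolding BI by (intro norm_triangle_mono Y1 Y2) auto
    ultimately have "norm (?I A) + norm (?I B) \<le> 8 * ?Y + osc_bound C k0 Z \<zeta>"
      using l12_neq_l34 by (simp add: osc_bound_def)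
    then show ?thesis using norm_triangle_ineq4[of "?I A" "?I B"] by linarith
  qed
  then show ?thesis unfolding fs V_def[symmetric] res norm_mult using c by (simp add: mult_left_mono)
qed

section \<open>Averaged solutions and the moment equations\<close>

text \<open>The form of \<open>approximate_solution\<close> for averages of plane wave solutions.\<close>

lemma solution_near_average:
  fixes m :: "real \<Rightarrow> 'e::euclidean_space \<Rightarrow> complex" and n :: "'k \<Rightarrow> real \<Rightarrow> 'e \<Rightarrow> complex"
  assumes sol: "solves_evolution A V f0 m"
    and A: "\<And>d a p \<tau>. 0 < d \<Longrightarrow> A (packet \<kappa> d a p \<tau>) = schr \<kappa> (packet \<kappa> d a p \<tau>)"
    and V: "FS UNIV b (\<lambda>w. of_real (V w))" and b: "0 < b" and Z: "0 \<le> Z" and M: "finite_measure M"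
    and n: "\<And>k s. 0 \<le> s \<Longrightarrow> bounded_path s (B s) (n k)"
    and nm: "(\<lambda>(k, r, w). n k r w) \<in> borel_measurable (M \<Otimes>\<^sub>M borel \<Otimes>\<^sub>M borel)"
    and ncont: "\<And>k s. 0 \<le> s \<Longrightarrow> continuous_on UNIV (n k s)"
    and \<alpha>: "integrable M \<alpha>"
    and res: "\<And>k d a p s \<tau>. 0 < d \<Longrightarrow> 0 \<le> s \<Longrightarrow> 0 \<le> \<tau> \<Longrightarrow> s \<le> Z \<Longrightarrow> norm (residual \<kappa> d a p \<tau> s V (n k)) \<le> \<alpha> k"
    and init: "\<And>w. f0 w = (LINT k|M. n k 0 w)"
  shows "norm (m Z x - (LINT k|M. n k Z x)) \<le> 2 * (LINT k|M. \<alpha> k) * exp (2 * b * Z)"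
proof -
  interpret M: finite_measure M by fact
  have "(\<lambda>w. Re (of_real (V w))) \<in> borel_measurable borel" using FS_measurable[OF V] by measurable
  then have Vm[measurable]: "V \<in> borel_measurable borel" by simp
  have Vb: "\<bar>V w\<bar> \<le> b" for w using FS_bound[OF V, of w] by simp
  have nb: "norm (n k r w) \<le> B s" if "0 \<le> r" "r \<le> s" for k r s w
    using n[of s k] that unfolding bounded_path_def by (meson order_trans)
  have [measurable (raw)]: "(\<lambda>x. n (f x) (g x) (h x)) \<in> borel_measurable M'"
    if "f \<in> measurable M' M" "g \<in> borel_measurable M'" "h \<in> measurable M' borel" for f g h and M' :: "'z measure"
    using measurable_compose[OF measurable_Pair[OF that(1) measurable_Pair[OF that(2,3)]] nm] by simp
  define N where "N r w = (LINT k|M. n k r w)" for r w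
  note avg = residual_average[OF M _ _ _ n nm Vm Vb \<alpha> res, folded N_def[abs_def]]
  have Npath: "bounded_path s (B s * measure M (space M)) N" if s: "0 \<le> s" "s \<le> Z" for s
    using avg(1)[of 1 s 0] s by simp
  show ?thesis unfolding N_def[symmetric]
  proof (rule approximate_solution[OF sol A V b Z])
    show "continuous_on UNIV (N s)" if s: "0 \<le> s" for s
      unfolding continuous_on_sequentially comp_def N_def
    proof (intro allI ballI impI)
      fix X :: "nat \<Rightarrow> 'e" and a assume X: "(\<forall>i. X i \<in> UNIV) \<and> X \<longlonglongrightarrow> a"
      show "(\<lambda>i. LINT k|M. n k s (X i)) \<longlonglongrightarrow> (LINT k|M. n k s a)"
      proof (rule integral_dominated_convergence[where w="\<lambda>_. B s"])
        have "(\<lambda>i. n k s (X i)) \<longlonglongrightarrow> n k s a" for k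
          using ncont[OF s, of k] X by (auto simp: continuous_on_eq_continuous_at intro: isCont_tendsto_compose)
        then show "AE k in M. (\<lambda>i. n k s (X i)) \<longlonglongrightarrow> n k s a" by simp
        show "AE k in M. norm (n k s (X i)) \<le> B s" for i using nb[OF s order_refl] by simp
      qed measurable
    qed
    show "norm (N s w) \<le> B Z * measure M (space M)" if "0 \<le> s" "s \<le> Z" for s w
      using Npath[OF Z order_refl] that by (auto simp: bounded_path_def)
    show "set_integrable lborel {0..s} (\<lambda>r. LINT w|lborel. N r w * (of_real (V w) * packet \<kappa> d a p (\<tau> + s - r) w))"
      if "0 < d" "0 \<le> s" "0 \<le> \<tau>" "s + \<tau> \<le> Z" for d a p s \<tau>
    proof -
      have sZ: "s \<le> Z" using that by linarith
      have "bounded_path s (B s * measure M (space M) * b) (\<lambda>r w. N r w * of_real (V w))"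
        by (rule bounded_path_mult[OF Npath[OF that(2) sZ] _ _ that(2)]) (use Vb in auto)
      from pot_int_integrable(2)[OF that(1) this that(2,3)] show ?thesis by (simp add: mult.assoc)
    qed
    show "norm ((LBINT w. N s w * packet \<kappa> d a p \<tau> w) - (LBINT w. f0 w * packet \<kappa> d a p (\<tau> + s) w)
         - (LBINT r:{0..s}. (LBINT w. N r w * (of_real (V w) * packet \<kappa> d a p (\<tau> + s - r) w)))) \<le> (LINT k|M. \<alpha> k)"
      if "0 < d" "0 \<le> s" "0 \<le> \<tau>" "s + \<tau> \<le> Z" for d a p s \<tau>
    proof -
      have "s \<le> Z" using that by linarith
      then have "norm (residual \<kappa> d a p \<tau> s V N) \<le> (LINT k|M. \<alpha> k)" using that by (intro avg(2))
      then show ?thesis by (simp add: residual_def pot_int_def mult.assoc init N_def)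
    qed
  qed
qed

lemma sol_family:
  fixes \<kappa> :: "'e::euclidean_space \<Rightarrow> real"
  assumes int: "integrable lborel C" and J: "isotropic \<kappa> J"
  shows "(\<lambda>(k, r, w). sol C c \<kappa> \<gamma> J (\<epsilon> *\<^sub>R k) r w) \<in> borel_measurable (gm r0 \<Otimes>\<^sub>M borel \<Otimes>\<^sub>M borel)"
proof -
  have Cm: "C \<in> borel_measurable borel" using int by auto
  have lin: "linear L" if "L \<in> J" for L using J that by (simp add: isotropic_def)
  note [measurable] = borel_measurable_sol[OF Cm lin]
  show ?thesis by measurable
qed

text \<open>The residual vanishes, so the solution of the moment equation is identified exactly.\<close>

lemma moment_eq_msol:
  fixes \<kappa> :: "'e::euclidean_space \<Rightarrow> real"
  assumes C: "covariance_function C" and int: "integrable lborel C" and c: "0 \<le> c" and \<gamma>: "0 \<le> \<gamma>" and J: "isotropic \<kappa> J"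
    and r0: "r0 > 0" and sol: "solves_evolution A V f0 m"
    and A: "\<And>\<phi>. A \<phi> = schr \<kappa> \<phi>"
    and V: "\<And>w. V w = c * (\<Sum>L\<in>J. C (L w)) - \<gamma>"
    and f0: "\<And>w. f0 w = of_real (exp (- ((norm (\<epsilon> *\<^sub>R w))\<^sup>2 / (2 * r0\<^sup>2))))"
    and z: "0 \<le> z"
  shows "m z w = msol C c \<kappa> \<gamma> J r0 \<epsilon> z w"
proof -
  have C0: "0 \<le> C 0" using covariance_bound[OF C, of 0] by simp
  have lin: "linear L" if "L \<in> J" for L using J that by (simp add: isotropic_def)
  have Veq: "V = (\<lambda>w. c * (\<Sum>L\<in>J. C (L w)) - \<gamma>)" using V by blast
  have "FS UNIV (norm (of_real c :: complex) * (\<Sum>L\<in>J. C 0) + norm (of_real (- \<gamma>) :: complex)) (\<lambda>w. of_real c * (\<Sum>L\<in>J. of_real (C (L w))) + of_real (- \<gamma>))"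
    by (intro FS_add FS_cmult FS_sum FS_const FS_covariance C int lin) auto
  also have "(\<lambda>w. of_real c * (\<Sum>L\<in>J. of_real (C (L w))) + of_real (- \<gamma>)) = (\<lambda>w. complex_of_real (V w))"
    by (simp add: V fun_eq_iff)
  finally have FSV: "FS UNIV (c * (real (card J) * C 0) + \<gamma> + 1) (\<lambda>w. of_real (V w))"
    by (rule FS_mono) (use c \<gamma> in auto)
  have "norm (m z w - (LINT k|gm r0. sol C c \<kappa> \<gamma> J (\<epsilon> *\<^sub>R k) z w)) \<le> 2 * (LINT k|(gm r0 :: 'e measure). 0) * exp (2 * (c * (real (card J) * C 0) + \<gamma> + 1) * z)"
  proof (rule solution_near_average[OF sol A FSV _ z finite_measure_gm(1)[OF r0] bounded_path_sol[OF C int c J \<gamma>] sol_family[OF int J] continuous_sol[OF C int J]])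
    show "0 < c * (real (card J) * C 0) + \<gamma> + 1" using c \<gamma> C0 by (simp add: add_nonneg_pos)
    show "f0 w = (LINT k|gm r0. sol C c \<kappa> \<gamma> J (\<epsilon> *\<^sub>R k) 0 w)" for w
      using gm_char[OF r0, of "\<epsilon> *\<^sub>R w"] by (simp add: sol_0 f0)
    show "norm (residual \<kappa> d a p \<tau> s V (sol C c \<kappa> \<gamma> J (\<epsilon> *\<^sub>R k))) \<le> 0" if "0 < d" "0 \<le> s" "0 \<le> \<tau>" for k d a p s \<tau>
      unfolding Veq using residual_sol[OF C int c that(2,3) J that(1)] by simp
  qed auto
  then show ?thesis by (simp add: msol_def)
qed

lemma FS_fourth_potential:
  assumes C: "covariance_function C" and int: "integrable lborel C" and c: "0 \<le> c"
  shows "FS UNIV (8 * c * C 0 + c) (\<lambda>w. of_real (fourth_potential C c w))"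
proof -
  let ?T = "\<lambda>L w. complex_of_real (C (L w))"
  have T: "FS UNIV (C 0) (?T L)" if "linear L" for L :: "R8 \<Rightarrow> R2"
    using FS_covariance[OF C int that] by simp
  have T': "FS UNIV (norm (- 1 :: complex) * C 0) (\<lambda>w. - 1 * ?T L w)" if "linear L" for L :: "R8 \<Rightarrow> R2"
    by (rule FS_cmult[OF T[OF that]])
  have "FS UNIV (norm (of_real c :: complex) * (C 0 + C 0 + C 0 + C 0 + norm (- 1 :: complex) * C 0 + norm (- 1 :: complex) * C 0) + norm (of_real (- (2 * c * C 0)) :: complex))
    (\<lambda>w. of_real c * (?T l13 w + ?T l14 w + ?T l23 w + ?T l24 w + - 1 * ?T l12 w + - 1 * ?T l34 w) + of_real (- (2 * c * C 0)))"
    by (intro FS_add FS_cmult[of UNIV _ _ "of_real c"] FS_const T T' linear_l) simp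
  also have "(\<lambda>w. of_real c * (?T l13 w + ?T l14 w + ?T l23 w + ?T l24 w + - 1 * ?T l12 w + - 1 * ?T l34 w) + of_real (- (2 * c * C 0)))
    = (\<lambda>w. of_real (fourth_potential C c w))" by (simp add: fun_eq_iff fourth_potential_def)
  finally show ?thesis
    by (rule FS_mono) (use covariance_bound[OF C, of 0] c in \<open>auto simp: norm_mult algebra_simps\<close>)
qed

lemma osc_bound_props:
  assumes C: "covariance_function C" and int: "integrable lborel C" and Z: "0 \<le> Z"
  shows "osc_bound C k0 Z \<in> borel_measurable borel" "0 \<le> osc_bound C k0 Z \<zeta>" "osc_bound C k0 Z \<zeta> \<le> 2 * (Z * C 0)"
proof -
  interpret S: finite_measure "sm C" by (rule measure_sm[OF C int])
  have adj: "adjoint L \<in> borel_measurable borel" if "linear L" for L :: "R8 \<Rightarrow> R2"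
    by (intro measurable_linear adjoint_linear that)
  have m: "(\<lambda>k. oscb Z (adjoint L k \<bullet> vel (d4 k0) \<zeta> + symb (d4 k0) (adjoint L k))) \<in> borel_measurable (sm C)" if "linear L" for L \<zeta>
    using adj[OF that] by measurable
  have m2: "(\<lambda>\<zeta>. LINT k|sm C. oscb Z (adjoint L k \<bullet> vel (d4 k0) \<zeta> + symb (d4 k0) (adjoint L k))) \<in> borel_measurable borel" if "linear L" for L
    using adj[OF that] by measurable
  show "osc_bound C k0 Z \<in> borel_measurable borel"
    unfolding osc_bound_def[abs_def] by (intro borel_measurable_sum m2) (use linear_l in auto)
  show "0 \<le> osc_bound C k0 Z \<zeta>"
    unfolding osc_bound_def by (intro sum_nonneg Bochner_Integration.integral_nonneg oscb_bounds Z)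
  have "(LINT k|sm C. oscb Z (adjoint L k \<bullet> vel (d4 k0) \<zeta> + symb (d4 k0) (adjoint L k))) \<le> Z * C 0" if "linear L" for L
  proof -
    have "(LINT k|sm C. oscb Z (adjoint L k \<bullet> vel (d4 k0) \<zeta> + symb (d4 k0) (adjoint L k))) \<le> (LINT k|sm C. Z)"
      by (rule integral_mono') (use oscb_bounds Z in auto)
    also have "\<dots> = Z * C 0" using measure_sm(2)[OF C int] by simp
    finally show ?thesis .
  qed
  from this[OF linear_l(6)] this[OF linear_l(7)] show "osc_bound C k0 Z \<zeta> \<le> 2 * (Z * C 0)"
    using l12_neq_l34 by (simp add: osc_bound_def)
qed

definition fourth_error :: "(real^2 \<Rightarrow> real) \<Rightarrow> real \<Rightarrow> real \<Rightarrow> real \<Rightarrow> real \<Rightarrow> real \<Rightarrow> real" where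
  "fourth_error C k0 r0 c \<epsilon> Z = 2 * (LINT k|gm r0. c * (8 * scat_bound C k0 c Z + osc_bound C k0 Z (\<epsilon> *\<^sub>R k))) * exp (2 * (8 * c * C 0 + c) * Z)"

lemma fourth_moment_near_average:
  assumes C: "covariance_function C" and int: "integrable lborel C" and c: "0 < c" and k0: "k0 > 0" and r0: "r0 > 0"
    and sol: "solves_evolution A V f0 m" and A: "\<And>\<phi>. A \<phi> = schr (d4 k0) \<phi>" and V: "\<And>w. V w = fourth_potential C c w"
    and f0: "\<And>w. f0 w = of_real (exp (- ((norm (\<epsilon> *\<^sub>R w))\<^sup>2 / (2 * r0\<^sup>2))))"
    and z: "0 \<le> z"
  shows "norm (m z w - (LINT k|gm r0. fourth_sol C k0 c (\<epsilon> *\<^sub>R k) z w)) \<le> fourth_error C k0 r0 c \<epsilon> z"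
proof -
  have C0: "0 \<le> C 0" using covariance_bound[OF C, of 0] by simp
  have c': "0 \<le> c" using c by simp
  interpret G: finite_measure "gm r0 :: R8 measure" by (rule finite_measure_gm[OF r0])
  have Veq: "V = fourth_potential C c" using V by blast
  have FSV: "FS UNIV (8 * c * C 0 + c) (\<lambda>w. of_real (V w))" unfolding Veq by (rule FS_fourth_potential[OF C int c'])
  define \<gamma> where "\<gamma> = 2 * c * C 0"
  have \<gamma>: "0 \<le> \<gamma>" using c C0 by (simp add: \<gamma>_def)
  note iso = isotropic_13_24[of k0] isotropic_14_23[of k0] isotropic_empty[of "d4 k0"]
  have fs: "fourth_sol C k0 c \<zeta> = (\<lambda>r w. sol C c (d4 k0) \<gamma> {l13, l24} \<zeta> r w + sol C c (d4 k0) \<gamma> {l14, l23} \<zeta> r w - sol C c (d4 k0) \<gamma> {} \<zeta> r w)" for \<zeta>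
    by (simp add: fourth_sol_def fun_eq_iff \<gamma>_def)
  define B where "B s = exp (c * (real (card {l13, l24}) * (s * C 0))) + exp (c * (real (card {l14, l23}) * (s * C 0))) + exp (c * (real (card ({} :: (R8 \<Rightarrow> R2) set)) * (s * C 0)))" for s
  show ?thesis unfolding fourth_error_def
  proof (rule solution_near_average[OF sol A FSV _ z finite_measure_gm(1)[OF r0], where B=B])
    show "0 < 8 * c * C 0 + c" using c C0 by (simp add: add_nonneg_pos)
    show "bounded_path s (B s) (fourth_sol C k0 c (\<epsilon> *\<^sub>R k))" for k s
      unfolding fs B_def by (intro bounded_path_add bounded_path_diff bounded_path_sol C int c' iso \<gamma>)
    show "(\<lambda>(k, r, w). fourth_sol C k0 c (\<epsilon> *\<^sub>R k) r w) \<in> borel_measurable (gm r0 \<Otimes>\<^sub>M borel \<Otimes>\<^sub>M borel)"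
      using sol_family[OF int iso(1)] sol_family[OF int iso(2)] sol_family[OF int iso(3)]
      unfolding fs case_prod_beta' by (intro borel_measurable_add borel_measurable_diff)
    show "continuous_on UNIV (fourth_sol C k0 c (\<epsilon> *\<^sub>R k) s)" if "0 \<le> s" for k s
      unfolding fs by (intro continuous_on_add continuous_on_diff continuous_sol[OF C int _ that] iso)
    show "integrable (gm r0) (\<lambda>k. c * (8 * scat_bound C k0 c z + osc_bound C k0 z (\<epsilon> *\<^sub>R k)))"
    proof (intro integrable_mult_right Bochner_Integration.integrable_add)
      show "integrable (gm r0) (\<lambda>k. osc_bound C k0 z (\<epsilon> *\<^sub>R k))"
        by (rule G.integrable_const_bound[where B="2 * (z * C 0)"]) (use osc_bound_props[OF C int z] in auto)
    qed auto
    show "f0 w = (LINT k|gm r0. fourth_sol C k0 c (\<epsilon> *\<^sub>R k) 0 w)" for w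
      using gm_char[OF r0, of "\<epsilon> *\<^sub>R w"] by (simp add: fs sol_0 f0)
    show "norm (residual (d4 k0) d a p \<tau> s V (fourth_sol C k0 c (\<epsilon> *\<^sub>R k))) \<le> c * (8 * scat_bound C k0 c z + osc_bound C k0 z (\<epsilon> *\<^sub>R k))"
      if "0 < d" "0 \<le> s" "0 \<le> \<tau>" "s \<le> z" for k d a p s \<tau>
      unfolding Veq by (rule fourth_residual[OF C int k0 c' that(1,2,4,3)])
  qed
qed

section \<open>Limits\<close>

lemma dominated_at_right:
  fixes f :: "real \<Rightarrow> 'k \<Rightarrow> 'b::{banach, second_countable_topology}"
  assumes M: "finite_measure M" and f: "\<And>\<epsilon>. 0 < \<epsilon> \<Longrightarrow> f \<epsilon> \<in> borel_measurable M" and g: "g \<in> borel_measurable M"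
    and b: "\<And>\<epsilon> k. 0 < \<epsilon> \<Longrightarrow> norm (f \<epsilon> k) \<le> B" and lim: "AE k in M. ((\<lambda>\<epsilon>. f \<epsilon> k) \<longlongrightarrow> g k) (at_right 0)"
  shows "((\<lambda>\<epsilon>. LINT k|M. f \<epsilon> k) \<longlongrightarrow> (LINT k|M. g k)) (at_right 0)"
  unfolding tendsto_at_iff_sequentially comp_def
proof (intro allI impI)
  interpret finite_measure M by fact
  fix X :: "nat \<Rightarrow> real" assume X: "\<forall>i. X i \<in> {0<..} - {0}" "X \<longlonglongrightarrow> 0"
  show "(\<lambda>i. LINT k|M. f (X i) k) \<longlonglongrightarrow> (LINT k|M. g k)"
  proof (rule integral_dominated_convergence[where w="\<lambda>_. B"])
    show "AE k in M. (\<lambda>i. f (X i) k) \<longlonglongrightarrow> g k"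
      using lim by eventually_elim (use X in \<open>auto simp: tendsto_at_iff_sequentially comp_def\<close>)
  qed (use f g b X in auto)
qed

lemma symb_scaleR: "symb \<kappa> (\<epsilon> *\<^sub>R k) = \<epsilon>\<^sup>2 * symb \<kappa> k"
  by (simp add: symb_def vel_scaleR power2_eq_square)

text \<open>Over the distance \<open>z / \<epsilon>\<close> a potential of strength \<open>\<epsilon>\<close> accumulates a phase of order 1, and a
  frequency \<open>\<epsilon> k\<close> moves the characteristic by a distance of order 1: substitute \<open>\<epsilon> s\<close> for the
  time. The large displacement \<open>\<rho> / \<epsilon>\<close> of all points is invisible to differences.\<close>

lemma phs_rescaled:
  fixes \<rho> :: "'e::euclidean_space"
  assumes \<epsilon>: "\<epsilon> > 0" and J: "\<And>L. L \<in> J \<Longrightarrow> linear L" and \<rho>: "\<And>L. L \<in> J \<Longrightarrow> L \<rho> = 0"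
  shows "phs C (\<epsilon> * c) \<kappa> J (\<epsilon> *\<^sub>R k) (z / \<epsilon>) (\<rho> /\<^sub>R \<epsilon> + w) = phs C c \<kappa> J k z w"
proof -
  have "\<epsilon> * (LBINT s. indicator {0..z/\<epsilon>} s * C (L (\<rho> /\<^sub>R \<epsilon> + w - (z/\<epsilon> - s) *\<^sub>R vel \<kappa> (\<epsilon> *\<^sub>R k))))
     = (LBINT s. indicator {0..z} s * C (L (w - (z - s) *\<^sub>R vel \<kappa> k)))" if L: "L \<in> J" for L
  proof -
    have 1: "L (\<rho> /\<^sub>R \<epsilon> + w - (z/\<epsilon> - s) *\<^sub>R vel \<kappa> (\<epsilon> *\<^sub>R k)) = L (w - (z - \<epsilon> * s) *\<^sub>R vel \<kappa> k)" for s
    proof -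
      have "(z/\<epsilon> - s) *\<^sub>R vel \<kappa> (\<epsilon> *\<^sub>R k) = (z - \<epsilon> * s) *\<^sub>R vel \<kappa> k"
      proof -
        have "(z/\<epsilon> - s) * \<epsilon> = z - \<epsilon> * s" using \<epsilon> by (simp add: field_simps)
        then show ?thesis by (simp only: vel_scaleR scaleR_scaleR)
      qed
      then show ?thesis using J[OF L] \<rho>[OF L] by (simp add: linear_add linear_diff linear_scale)
    qed
    have 2: "indicator {0..z/\<epsilon>} s = (indicator {0..z} (\<epsilon> * s) :: real)" for s
      using \<epsilon> by (simp add: indicator_def pos_le_divide_eq zero_le_mult_iff mult.commute)
    show ?thesis unfolding 1 2
      using lborel_integral_real_affine[of \<epsilon> "\<lambda>s. indicator {0..z} s * C (L (w - (z - s) *\<^sub>R vel \<kappa> k))" 0] \<epsilon> by simp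
  qed
  then show ?thesis unfolding phs_def by (simp add: sum_distrib_left mult.assoc mult.left_commute[of _ c])
qed

text \<open>The limit moments. The macroscopic position \<open>\<rho>\<close> only enters through the plane wave \<open>cis (k \<bullet>
  \<rho>)\<close>, the microscopic one only through the phase.\<close>

definition mlim :: "(real^2 \<Rightarrow> real) \<Rightarrow> real \<Rightarrow> ('e::euclidean_space \<Rightarrow> real) \<Rightarrow> real \<Rightarrow> ('e \<Rightarrow> real^2) set \<Rightarrow> real \<Rightarrow> real \<Rightarrow> 'e \<Rightarrow> 'e \<Rightarrow> complex" where
  "mlim C c \<kappa> \<gamma> J r0 z \<rho> w = (LINT k|gm r0. cis (k \<bullet> \<rho>) * of_real (exp (phs C c \<kappa> J k z w - \<gamma> * z)))"

lemma msol_limit: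
  fixes \<rho> :: "'e::euclidean_space"
  assumes C: "covariance_function C" and int: "integrable lborel C" and J: "isotropic \<kappa> J" and z: "0 \<le> z"
    and c: "0 \<le> c" and \<gamma>: "0 \<le> \<gamma>" and r0: "r0 > 0" and \<rho>: "\<And>L. L \<in> J \<Longrightarrow> L \<rho> = 0"
  shows "((\<lambda>\<epsilon>. msol C (\<epsilon> * c) \<kappa> (\<epsilon> * \<gamma>) J r0 \<epsilon> (z / \<epsilon>) (\<rho> /\<^sub>R \<epsilon> + w)) \<longlongrightarrow> mlim C c \<kappa> \<gamma> J r0 z \<rho> w) (at_right 0)"
  unfolding msol_def mlim_def
proof (rule dominated_at_right[OF finite_measure_gm(1)[OF r0]])
  have Cm: "C \<in> borel_measurable borel" using int by auto
  have lin: "linear L" if "L \<in> J" for L using J that by (simp add: isotropic_def)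
  note [measurable] = borel_measurable_sol[OF Cm lin] borel_measurable_phs[OF Cm lin]
  show "(\<lambda>k. sol C (\<epsilon> * c) \<kappa> (\<epsilon> * \<gamma>) J (\<epsilon> *\<^sub>R k) (z / \<epsilon>) (\<rho> /\<^sub>R \<epsilon> + w)) \<in> borel_measurable (gm r0)" for \<epsilon> by measurable
  show "(\<lambda>k. cis (k \<bullet> \<rho>) * of_real (exp (phs C c \<kappa> J k z w - \<gamma> * z))) \<in> borel_measurable (gm r0)" by measurable
  show "norm (sol C (\<epsilon> * c) \<kappa> (\<epsilon> * \<gamma>) J (\<epsilon> *\<^sub>R k) (z / \<epsilon>) (\<rho> /\<^sub>R \<epsilon> + w)) \<le> exp (c * (real (card J) * (z * C 0)))" if "0 < \<epsilon>" for \<epsilon> k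
    using norm_sol_bound[OF C int _ _ order_refl J, of "\<epsilon> * c" "z / \<epsilon>" "\<epsilon> * \<gamma>"] that c \<gamma> z by simp
  have "((\<lambda>\<epsilon>. sol C (\<epsilon> * c) \<kappa> (\<epsilon> * \<gamma>) J (\<epsilon> *\<^sub>R k) (z / \<epsilon>) (\<rho> /\<^sub>R \<epsilon> + w)) \<longlongrightarrow> cis (k \<bullet> \<rho>) * of_real (exp (phs C c \<kappa> J k z w - \<gamma> * z))) (at_right 0)" for k
  proof (rule Lim_transform_eventually)
    have "((\<lambda>\<epsilon>. k \<bullet> \<rho> + \<epsilon> * (k \<bullet> w) - \<epsilon> * (z * symb \<kappa> k)) \<longlongrightarrow> k \<bullet> \<rho> + 0 * (k \<bullet> w) - 0 * (z * symb \<kappa> k)) (at_right 0)"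
      by (intro tendsto_intros)
    then have t: "((\<lambda>\<epsilon>. k \<bullet> \<rho> + \<epsilon> * (k \<bullet> w) - \<epsilon> * (z * symb \<kappa> k)) \<longlongrightarrow> k \<bullet> \<rho>) (at_right 0)"
      by simp
    have "((\<lambda>\<epsilon>. cis (k \<bullet> \<rho> + \<epsilon> * (k \<bullet> w) - \<epsilon> * (z * symb \<kappa> k))) \<longlongrightarrow> cis (k \<bullet> \<rho>)) (at_right 0)"
      unfolding cis_conv_exp by (intro tendsto_exp tendsto_mult tendsto_const tendsto_of_real t)
    then show "((\<lambda>\<epsilon>. cis (k \<bullet> \<rho> + \<epsilon> * (k \<bullet> w) - \<epsilon> * (z * symb \<kappa> k)) * of_real (exp (phs C c \<kappa> J k z w - \<gamma> * z))) \<longlongrightarrow> cis (k \<bullet> \<rho>) * of_real (exp (phs C c \<kappa> J k z w - \<gamma> * z))) (at_right 0)"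
      by (intro tendsto_mult tendsto_const)
    show "\<forall>\<^sub>F \<epsilon> in at_right 0. cis (k \<bullet> \<rho> + \<epsilon> * (k \<bullet> w) - \<epsilon> * (z * symb \<kappa> k)) * of_real (exp (phs C c \<kappa> J k z w - \<gamma> * z))
       = sol C (\<epsilon> * c) \<kappa> (\<epsilon> * \<gamma>) J (\<epsilon> *\<^sub>R k) (z / \<epsilon>) (\<rho> /\<^sub>R \<epsilon> + w)"
      using eventually_at_right_less[of "0::real"]
    proof eventually_elim
      fix \<epsilon> :: real assume \<epsilon>: "0 < \<epsilon>"
      have "(\<epsilon> *\<^sub>R k) \<bullet> (\<rho> /\<^sub>R \<epsilon> + w) - z / \<epsilon> * symb \<kappa> (\<epsilon> *\<^sub>R k) = k \<bullet> \<rho> + \<epsilon> * (k \<bullet> w) - \<epsilon> * (z * symb \<kappa> k)"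
        using \<epsilon> by (simp add: symb_scaleR inner_add_right power2_eq_square distrib_left)
      moreover have "phs C (\<epsilon> * c) \<kappa> J (\<epsilon> *\<^sub>R k) (z / \<epsilon>) (\<rho> /\<^sub>R \<epsilon> + w) = phs C c \<kappa> J k z w"
        by (rule phs_rescaled[OF \<epsilon> lin \<rho>])
      ultimately show "cis (k \<bullet> \<rho> + \<epsilon> * (k \<bullet> w) - \<epsilon> * (z * symb \<kappa> k)) * of_real (exp (phs C c \<kappa> J k z w - \<gamma> * z))
       = sol C (\<epsilon> * c) \<kappa> (\<epsilon> * \<gamma>) J (\<epsilon> *\<^sub>R k) (z / \<epsilon>) (\<rho> /\<^sub>R \<epsilon> + w)"
        using \<epsilon> by (simp only: sol_def) simp
    qed
  qed
  then show "AE k in gm r0. ((\<lambda>\<epsilon>. sol C (\<epsilon> * c) \<kappa> (\<epsilon> * \<gamma>) J (\<epsilon> *\<^sub>R k) (z / \<epsilon>) (\<rho> /\<^sub>R \<epsilon> + w)) \<longlongrightarrow> cis (k \<bullet> \<rho>) * of_real (exp (phs C c \<kappa> J k z w - \<gamma> * z))) (at_right 0)"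
    by simp
qed

text \<open>As \<open>\<epsilon> \<rightarrow> 0\<close> the frequency of the oscillation tends to \<open>\<plusminus>\<bar>l\<bar>\<^sup>2 / k0\<close>, which is not 0.\<close>

lemma rescaled_oscb_limit:
  assumes q: "0 \<le> q" and k0: "k0 > 0" and L: "L \<in> {l12, l34}" and l: "l \<noteq> 0" and z: "0 \<le> z"
  shows "((\<lambda>\<epsilon>. \<epsilon> * q * oscb (z / \<epsilon>) (adjoint L l \<bullet> vel (d4 k0) (\<epsilon> *\<^sub>R k) + symb (d4 k0) (adjoint L l))) \<longlongrightarrow> 0) (at_right 0)"
    (is "((\<lambda>\<epsilon>. \<epsilon> * q * oscb (z / \<epsilon>) (?\<Omega> \<epsilon>)) \<longlongrightarrow> 0) _")
proof -
  let ?s = "symb (d4 k0) (adjoint L l)"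
  have "?s = (l \<bullet> l) / k0 \<or> ?s = - ((l \<bullet> l) / k0)"
    using L by (auto simp: adjoint_l symb_d4 add_divide_distrib diff_divide_distrib)
  then have s0: "?s \<noteq> 0" using l k0 by auto
  have "((\<lambda>\<epsilon>. \<epsilon> * (adjoint L l \<bullet> vel (d4 k0) k) + ?s) \<longlongrightarrow> 0 * (adjoint L l \<bullet> vel (d4 k0) k) + ?s) (at_right 0)"
    by (intro tendsto_intros)
  then have lim: "(?\<Omega> \<longlongrightarrow> ?s) (at_right 0)" by (simp add: vel_scaleR)
  have "((\<lambda>\<epsilon>. \<epsilon> * q * (2 / \<bar>?\<Omega> \<epsilon>\<bar>)) \<longlongrightarrow> 0 * q * (2 / \<bar>?s\<bar>)) (at_right 0)"
    using s0 by (intro tendsto_intros lim) auto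
  then have u: "((\<lambda>\<epsilon>. \<epsilon> * q * (2 / \<bar>?\<Omega> \<epsilon>\<bar>)) \<longlongrightarrow> 0) (at_right 0)" by simp
  have ne: "\<forall>\<^sub>F \<epsilon> in at_right 0. ?\<Omega> \<epsilon> \<noteq> 0" using lim s0 by (rule tendsto_imp_eventually_ne)
  show ?thesis
  proof (rule tendsto_sandwich[OF _ _ tendsto_const u])
    show "\<forall>\<^sub>F \<epsilon> in at_right 0. 0 \<le> \<epsilon> * q * oscb (z / \<epsilon>) (?\<Omega> \<epsilon>)"
      using eventually_at_right_less[of "0::real"] by eventually_elim (use q z in \<open>auto intro!: mult_nonneg_nonneg oscb_bounds\<close>)
    show "\<forall>\<^sub>F \<epsilon> in at_right 0. \<epsilon> * q * oscb (z / \<epsilon>) (?\<Omega> \<epsilon>) \<le> \<epsilon> * q * (2 / \<bar>?\<Omega> \<epsilon>\<bar>)"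
      using ne eventually_at_right_less[of "0::real"]
      by eventually_elim (rule mult_left_mono[OF oscb_bounds(3)], use q in auto)
  qed
qed

text \<open>Dominated convergence with respect to the spectral measure, which has a density and so does
  not charge the nonoscillating frequency \<open>l = 0\<close>.\<close>

lemma rescaled_osc_bound_limit:
  assumes C: "covariance_function C" and int: "integrable lborel C" and q: "0 \<le> q" and k0: "k0 > 0" and z: "0 \<le> z"
  shows "((\<lambda>\<epsilon>. \<epsilon> * q * osc_bound C k0 (z / \<epsilon>) (\<epsilon> *\<^sub>R k)) \<longlongrightarrow> 0) (at_right 0)"
proof -
  have "((\<lambda>\<epsilon>. LINT l|sm C. \<epsilon> * q * oscb (z / \<epsilon>) (adjoint L l \<bullet> vel (d4 k0) (\<epsilon> *\<^sub>R k) + symb (d4 k0) (adjoint L l))) \<longlongrightarrow> (LINT l|sm C. 0)) (at_right 0)"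
    if L: "L \<in> {l12, l34}" for L
  proof (rule dominated_at_right[OF measure_sm(1)[OF C int]])
    have [measurable]: "adjoint L \<in> borel_measurable borel" using L linear_l by (auto intro!: measurable_linear adjoint_linear)
    show "(\<lambda>l. \<epsilon> * q * oscb (z / \<epsilon>) (adjoint L l \<bullet> vel (d4 k0) (\<epsilon> *\<^sub>R k) + symb (d4 k0) (adjoint L l))) \<in> borel_measurable (sm C)" for \<epsilon> by measurable
    show "norm (\<epsilon> * q * oscb (z / \<epsilon>) \<Omega>) \<le> q * z" if "0 < \<epsilon>" for \<epsilon> \<Omega>
    proof -
      have "\<epsilon> * q * oscb (z / \<epsilon>) \<Omega> \<le> \<epsilon> * q * (z / \<epsilon>)" using that q z by (intro mult_left_mono oscb_bounds) auto
      then show ?thesis using that q z oscb_bounds(1)[of "z / \<epsilon>" \<Omega>] by (simp add: abs_mult)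
    qed
    have "AE l in sm C. l \<noteq> 0"
      unfolding sm_def using int AE_lborel_singleton[of "0::R2"] borel_measurable_spec[of C] by (subst AE_density) auto
    then show "AE l in sm C. ((\<lambda>\<epsilon>. \<epsilon> * q * oscb (z / \<epsilon>) (adjoint L l \<bullet> vel (d4 k0) (\<epsilon> *\<^sub>R k) + symb (d4 k0) (adjoint L l))) \<longlongrightarrow> 0) (at_right 0)"
      by eventually_elim (rule rescaled_oscb_limit[OF q k0 L _ z])
  qed simp
  from tendsto_sum[of "{l12, l34}", OF this] show ?thesis by (simp add: osc_bound_def sum_distrib_left)
qed

text \<open>In the growth factor and in the exponentials only \<open>(\<epsilon> q) (z / \<epsilon>) = q z\<close> occurs; what is left
  is \<open>\<epsilon> sqrt (z / \<epsilon>) = sqrt (\<epsilon> z)\<close> for the scattered terms and \<open>rescaled_osc_bound_limit\<close> for the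
  others.\<close>

lemma fourth_error_limit:
  assumes C: "covariance_function C" and int: "integrable lborel C" and q: "0 \<le> q" and k0: "k0 > 0" and z: "0 \<le> z" and r0: "r0 > 0"
  shows "((\<lambda>\<epsilon>. fourth_error C k0 r0 (\<epsilon> * q) \<epsilon> (z / \<epsilon>)) \<longlongrightarrow> 0) (at_right 0)"
proof -
  interpret G: finite_measure "gm r0 :: R8 measure" by (rule finite_measure_gm[OF r0])
  have C0: "0 \<le> C 0" using covariance_bound[OF C, of 0] by simp
  let ?K = "((C 0)\<^sup>2 + (LBINT x. \<bar>C x\<bar>)\<^sup>2 * k0\<^sup>2) * pi + (C 0)\<^sup>2"
  let ?O = "\<lambda>\<epsilon> k. \<epsilon> * q * osc_bound C k0 (z / \<epsilon>) (\<epsilon> *\<^sub>R k)"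
  have "((\<lambda>\<epsilon>. LINT k|gm r0. ?O \<epsilon> k) \<longlongrightarrow> (LINT k|(gm r0 :: R8 measure). 0)) (at_right 0)"
  proof (rule dominated_at_right[OF G.finite_measure_axioms])
    show "?O \<epsilon> \<in> borel_measurable (gm r0)" if "0 < \<epsilon>" for \<epsilon>
      using osc_bound_props(1)[OF C int, of "z / \<epsilon>" k0] that z by simp
    show "norm (?O \<epsilon> k) \<le> 2 * (q * z * C 0)" if "0 < \<epsilon>" for \<epsilon> k
    proof -
      have zp: "0 \<le> z / \<epsilon>" using that z by simp
      have "?O \<epsilon> k \<le> \<epsilon> * q * (2 * (z / \<epsilon> * C 0))" using that q by (intro mult_left_mono osc_bound_props[OF C int zp]) auto
      then show ?thesis using that q osc_bound_props(2)[OF C int zp, of k0 "\<epsilon> *\<^sub>R k"] by (simp add: abs_mult)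
    qed
  qed (use rescaled_osc_bound_limit[OF C int q k0 z] in auto)
  then have 1: "((\<lambda>\<epsilon>. LINT k|gm r0. ?O \<epsilon> k) \<longlongrightarrow> 0) (at_right 0)" by simp
  let ?W = "\<lambda>\<epsilon>. q * z * (exp (q * (2 * (z * C 0))) * (q * (2 * (sqrt (\<epsilon> * z) * ?K))))"
  have "((\<lambda>\<epsilon>. 2 * (8 * ?W \<epsilon> + (LINT k|gm r0. ?O \<epsilon> k)) * exp (2 * (8 * q * C 0 + q) * z)) \<longlongrightarrow>
      2 * (8 * (q * z * (exp (q * (2 * (z * C 0))) * (q * (2 * (sqrt (0 * z) * ?K))))) + 0) * exp (2 * (8 * q * C 0 + q) * z)) (at_right 0)"
    by (intro tendsto_intros 1)
  then have 2: "((\<lambda>\<epsilon>. 2 * (8 * ?W \<epsilon> + (LINT k|gm r0. ?O \<epsilon> k)) * exp (2 * (8 * q * C 0 + q) * z)) \<longlongrightarrow> 0) (at_right 0)"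
    by simp
  show ?thesis
  proof (rule Lim_transform_eventually[OF 2])
    show "\<forall>\<^sub>F \<epsilon> in at_right 0. 2 * (8 * ?W \<epsilon> + (LINT k|gm r0. ?O \<epsilon> k)) * exp (2 * (8 * q * C 0 + q) * z) = fourth_error C k0 r0 (\<epsilon> * q) \<epsilon> (z / \<epsilon>)"
      using eventually_at_right_less[of "0::real"]
    proof eventually_elim
      fix \<epsilon> :: real assume \<epsilon>: "0 < \<epsilon>"
      have zp: "0 \<le> z / \<epsilon>" using \<epsilon> z by simp
      have cz: "\<epsilon> * q * (z / \<epsilon>) = q * z" using \<epsilon> by simp
      have "\<epsilon> * sqrt (z / \<epsilon>) = sqrt (\<epsilon>\<^sup>2 * (z / \<epsilon>))" using \<epsilon> by (subst real_sqrt_mult) simp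
      also have "\<epsilon>\<^sup>2 * (z / \<epsilon>) = \<epsilon> * z" using \<epsilon> by (simp add: power2_eq_square)
      finally have sq: "\<epsilon> * sqrt (z / \<epsilon>) = sqrt (\<epsilon> * z)" .
      have "\<epsilon> * q * scat_bound C k0 (\<epsilon> * q) (z / \<epsilon>) = \<epsilon> * q * (z / \<epsilon>) * (exp (\<epsilon> * q * (z / \<epsilon>) * (2 * C 0)) * (q * (2 * (\<epsilon> * sqrt (z / \<epsilon>) * ?K))))"
        unfolding scat_bound_def by (simp add: mult_ac)
      also have "\<dots> = ?W \<epsilon>" unfolding cz sq by (simp add: mult_ac)
      finally have sc: "\<epsilon> * q * scat_bound C k0 (\<epsilon> * q) (z / \<epsilon>) = ?W \<epsilon>" .
      have oi: "integrable (gm r0) (\<lambda>k. ?O \<epsilon> k)"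
        by (intro integrable_mult_right G.integrable_const_bound[where B="2 * (z / \<epsilon> * C 0)"]) (use osc_bound_props[OF C int zp] in auto)
      have "(LINT k|gm r0. \<epsilon> * q * (8 * scat_bound C k0 (\<epsilon> * q) (z / \<epsilon>) + osc_bound C k0 (z / \<epsilon>) (\<epsilon> *\<^sub>R k)))
        = (LINT k|gm r0. 8 * ?W \<epsilon> + ?O \<epsilon> k)" by (simp only: distrib_left mult.left_commute[of _ 8] sc)
      also have "\<dots> = (LINT k|(gm r0 :: R8 measure). 8 * ?W \<epsilon>) + (LINT k|gm r0. ?O \<epsilon> k)"
        by (rule Bochner_Integration.integral_add) (use oi in auto)
      also have "(LINT k|(gm r0 :: R8 measure). 8 * ?W \<epsilon>) = 8 * ?W \<epsilon>"
        using finite_measure_gm(2)[OF r0, where 'e=R8] by (simp del: space_gm)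
      finally have ii: "(LINT k|gm r0. \<epsilon> * q * (8 * scat_bound C k0 (\<epsilon> * q) (z / \<epsilon>) + osc_bound C k0 (z / \<epsilon>) (\<epsilon> *\<^sub>R k))) = 8 * ?W \<epsilon> + (LINT k|gm r0. ?O \<epsilon> k)" .
      have ex: "2 * (8 * (\<epsilon> * q) * C 0 + \<epsilon> * q) * (z / \<epsilon>) = 2 * (8 * q * C 0 + q) * z" using \<epsilon> by (simp add: field_simps)
      show "2 * (8 * ?W \<epsilon> + (LINT k|gm r0. ?O \<epsilon> k)) * exp (2 * (8 * q * C 0 + q) * z) = fourth_error C k0 r0 (\<epsilon> * q) \<epsilon> (z / \<epsilon>)"
        unfolding fourth_error_def ii ex ..
    qed
  qed
qed

section \<open>Factorisation of the averages\<close>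

lemma gauss_Pair: "gauss d (k, l) = gauss d k * gauss d l"
proof -
  have "- ((norm (k, l))\<^sup>2 / (2 * d)) = - ((norm k)\<^sup>2 / (2 * d)) + - ((norm l)\<^sup>2 / (2 * d))"
    by (simp add: norm_Pair add_divide_distrib)
  then show ?thesis by (simp only: gauss_def exp_add power_add DIM_prod) simp
qed

lemma gm_prod:
  assumes r0: "r0 > 0"
  shows "(gm r0 :: ('a::euclidean_space \<times> 'b::euclidean_space) measure) = gm r0 \<Otimes>\<^sub>M gm r0"
proof -
  have d: "1 / r0\<^sup>2 > 0" using r0 by simp
  interpret B: finite_measure "density lborel (\<lambda>k::'b. ennreal (gauss (1 / r0\<^sup>2) k))"
    using finite_measure_gm(1)[OF r0, where 'e='b] by (simp add: gm_def)
  have "(gm r0 :: 'a measure) \<Otimes>\<^sub>M (gm r0 :: 'b measure) = density (lborel \<Otimes>\<^sub>M lborel) (\<lambda>(k, l). ennreal (gauss (1 / r0\<^sup>2) k) * ennreal (gauss (1 / r0\<^sup>2) l))"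
    unfolding gm_def by (rule pair_measure_density) (auto intro: lborel.sigma_finite_measure_axioms B.sigma_finite_measure_axioms)
  also have "(\<lambda>(k :: 'a, l :: 'b). ennreal (gauss (1 / r0\<^sup>2) k) * ennreal (gauss (1 / r0\<^sup>2) l)) = (\<lambda>p. ennreal (gauss (1 / r0\<^sup>2) p))"
    by (auto simp: fun_eq_iff gauss_Pair ennreal_mult'[OF gauss_nonneg[OF d]])
  finally show ?thesis by (simp add: gm_def lborel_prod)
qed

lemma gm_iterate:
  fixes F :: "'a::euclidean_space \<times> 'b::euclidean_space \<Rightarrow> complex"
  assumes r0: "r0 > 0" and F: "F \<in> borel_measurable borel" and b: "\<And>p. norm (F p) \<le> B"
  shows "(LINT p|gm r0. F p) = (LINT k|gm r0. LINT l|gm r0. F (k, l))"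
proof -
  interpret A: finite_measure "gm r0 :: 'a measure" by (rule finite_measure_gm[OF r0])
  interpret B: finite_measure "gm r0 :: 'b measure" by (rule finite_measure_gm[OF r0])
  interpret AB: finite_measure "gm r0 :: ('a \<times> 'b) measure" by (rule finite_measure_gm[OF r0])
  interpret P: pair_sigma_finite "gm r0 :: 'a measure" "gm r0 :: 'b measure" ..
  have "integrable (gm r0) F" by (rule AB.integrable_const_bound[where B=B]) (use F b in auto)
  then show ?thesis unfolding gm_prod[OF r0, where 'a='a and 'b='b] by (rule P.integral_fst'[symmetric])
qed

lemma gm_iterate4:
  fixes F :: "'a::euclidean_space \<times> 'b::euclidean_space \<times> 'c::euclidean_space \<times> 'd::euclidean_space \<Rightarrow> complex"
  assumes r0: "r0 > 0" and F: "F \<in> borel_measurable borel" and b: "\<And>p. norm (F p) \<le> B"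
  shows "(LINT p|gm r0. F p) = (LINT k1|gm r0. LINT k2|gm r0. LINT k3|gm r0. LINT k4|gm r0. F (k1, k2, k3, k4))"
proof -
  have "(LINT p|gm r0. F p) = (LINT k1|gm r0. LINT p|gm r0. F (k1, p))" by (rule gm_iterate[OF r0 F b])
  also have "\<dots> = (LINT k1|gm r0. LINT k2|gm r0. LINT p|gm r0. F (k1, k2, p))"
    by (intro Bochner_Integration.integral_cong refl gm_iterate[OF r0 _ b])
       (rule measurable_compose[OF _ F], simp add: borel_prod[symmetric])
  also have "\<dots> = (LINT k1|gm r0. LINT k2|gm r0. LINT k3|gm r0. LINT k4|gm r0. F (k1, k2, k3, k4))"
    by (intro Bochner_Integration.integral_cong refl gm_iterate[OF r0 _ b])
       (rule measurable_compose[OF _ F], simp add: borel_prod[symmetric])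
  finally show ?thesis .
qed

text \<open>Symmetry of the frequencies; it is needed because the conjugate of a plane wave has the
  opposite frequency.\<close>

lemma gm_reflect:
  fixes f :: "'e::euclidean_space \<Rightarrow> complex"
  assumes r0: "r0 > 0" and [measurable]: "f \<in> borel_measurable borel"
  shows "(LINT k|gm r0. f (- k)) = (LINT k|gm r0. f k)"
proof -
  have d: "1 / r0\<^sup>2 > 0" using r0 by simp
  have g: "gauss (1 / r0\<^sup>2) (- k) = gauss (1 / r0\<^sup>2) k" for k :: 'e by (simp add: gauss_def)
  have e: "(LINT k|gm r0. h k) = (LBINT k. gauss (1 / r0\<^sup>2) k *\<^sub>R h k)" if "h \<in> borel_measurable borel" for h :: "'e \<Rightarrow> complex"
    unfolding gm_def using that gauss_nonneg[OF d, where 'a='e] by (subst integral_density) auto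
  have "(LINT k|gm r0. f (- k)) = (LBINT k. gauss (1 / r0\<^sup>2) (- k) *\<^sub>R f (- k))"
    unfolding g by (rule e) measurable
  also have "\<dots> = (LBINT k. gauss (1 / r0\<^sup>2) k *\<^sub>R f k)"
    by (rule integral_lborel_reflect)
  finally show ?thesis by (simp add: e)
qed

context
  fixes C :: "real^2 \<Rightarrow> real" and k0 c r0 \<epsilon> z :: real
  assumes C: "covariance_function C" and int: "integrable lborel C" and c: "0 \<le> c" and r0: "r0 > 0" and z: "0 \<le> z"
begin

abbreviation "S1 \<equiv> \<lambda>k x. sol C c (d1 k0) (c * C 0 / 2) {} (\<epsilon> *\<^sub>R k) z x"
abbreviation "S2 \<equiv> \<lambda>k w. sol C c (d2 k0) (c * C 0) {diff2} (\<epsilon> *\<^sub>R k) z w"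

text \<open>Velocities and symbols of the four components are independent, so phases add up and the
  exponential decay rates \<open>2 C 0 = C 0 + C 0 = 4 (C 0 / 2)\<close> match.\<close>

lemma sol_4_pairs:
  shows "sol C c (d4 k0) (2 * c * C 0) {l13, l24} (\<epsilon> *\<^sub>R (k1, k2, k3, k4)) z (x1, x2, y1, y2) = S2 (k1, k3) (x1, y1) * S2 (k2, k4) (x2, y2)"
    and "sol C c (d4 k0) (2 * c * C 0) {l14, l23} (\<epsilon> *\<^sub>R (k1, k2, k3, k4)) z (x1, x2, y1, y2) = S2 (k1, k4) (x1, y2) * S2 (k2, k3) (x2, y1)"
    and "sol C c (d4 k0) (2 * c * C 0) {} (\<epsilon> *\<^sub>R (k1, k2, k3, k4)) z (x1, x2, y1, y2) = S1 k1 x1 * S1 k2 x2 * cnj (S1 (- k3) y1) * cnj (S1 (- k4) y2)"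
proof -
  let ?\<zeta> = "\<epsilon> *\<^sub>R (k1, k2, k3, k4)" and ?w = "(x1, x2, y1, y2)"
  have two: "complex_of_real (exp (a - 2 * c * C 0 * z)) = of_real (exp (b - c * C 0 * z)) * of_real (exp (d - c * C 0 * z))" if "a = b + d" for a b d
    unfolding of_real_mult[symmetric] exp_add[symmetric] that by (simp add: algebra_simps)
  have p1: "phs C c (d4 k0) {l13, l24} ?\<zeta> z ?w = phs C c (d2 k0) {diff2} (\<epsilon> *\<^sub>R (k1, k3)) z (x1, y1) + phs C c (d2 k0) {diff2} (\<epsilon> *\<^sub>R (k2, k4)) z (x2, y2)"
    using l_distinct(1) by (simp add: phs_def vel_d4 vel_d2 l13_def l24_def diff2_def distrib_left)
  have p2: "phs C c (d4 k0) {l14, l23} ?\<zeta> z ?w = phs C c (d2 k0) {diff2} (\<epsilon> *\<^sub>R (k1, k4)) z (x1, y2) + phs C c (d2 k0) {diff2} (\<epsilon> *\<^sub>R (k2, k3)) z (x2, y1)"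
    using l_distinct(2) by (simp add: phs_def vel_d4 vel_d2 l14_def l23_def diff2_def distrib_left)
  have c1: "cis (?\<zeta> \<bullet> ?w - z * symb (d4 k0) ?\<zeta>) = cis ((\<epsilon> *\<^sub>R (k1, k3)) \<bullet> (x1, y1) - z * symb (d2 k0) (\<epsilon> *\<^sub>R (k1, k3))) * cis ((\<epsilon> *\<^sub>R (k2, k4)) \<bullet> (x2, y2) - z * symb (d2 k0) (\<epsilon> *\<^sub>R (k2, k4)))"
    unfolding cis_mult by (rule arg_cong[where f=cis]) (simp add: symb_d4 symb_d2 add_divide_distrib diff_divide_distrib algebra_simps)
  have c2: "cis (?\<zeta> \<bullet> ?w - z * symb (d4 k0) ?\<zeta>) = cis ((\<epsilon> *\<^sub>R (k1, k4)) \<bullet> (x1, y2) - z * symb (d2 k0) (\<epsilon> *\<^sub>R (k1, k4))) * cis ((\<epsilon> *\<^sub>R (k2, k3)) \<bullet> (x2, y1) - z * symb (d2 k0) (\<epsilon> *\<^sub>R (k2, k3)))"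
    unfolding cis_mult by (rule arg_cong[where f=cis]) (simp add: symb_d4 symb_d2 add_divide_distrib diff_divide_distrib algebra_simps)
  have c3: "cis (?\<zeta> \<bullet> ?w - z * symb (d4 k0) ?\<zeta>) = cis ((\<epsilon> *\<^sub>R k1) \<bullet> x1 - z * symb (d1 k0) (\<epsilon> *\<^sub>R k1)) * cis ((\<epsilon> *\<^sub>R k2) \<bullet> x2 - z * symb (d1 k0) (\<epsilon> *\<^sub>R k2))
      * cnj (cis ((\<epsilon> *\<^sub>R (- k3)) \<bullet> y1 - z * symb (d1 k0) (\<epsilon> *\<^sub>R (- k3)))) * cnj (cis ((\<epsilon> *\<^sub>R (- k4)) \<bullet> y2 - z * symb (d1 k0) (\<epsilon> *\<^sub>R (- k4))))"
    unfolding cis_mult cis_cnj by (rule arg_cong[where f=cis]) (simp add: symb_d4 symb_d1 add_divide_distrib diff_divide_distrib algebra_simps)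
  show "sol C c (d4 k0) (2 * c * C 0) {l13, l24} ?\<zeta> z ?w = S2 (k1, k3) (x1, y1) * S2 (k2, k4) (x2, y2)"
    unfolding sol_def c1 two[OF p1] by (simp only: mult_ac)
  show "sol C c (d4 k0) (2 * c * C 0) {l14, l23} ?\<zeta> z ?w = S2 (k1, k4) (x1, y2) * S2 (k2, k3) (x2, y1)"
    unfolding sol_def c2 two[OF p2] by (simp only: mult_ac)
  have "complex_of_real (exp (0 - 2 * c * C 0 * z)) = of_real (exp (0 - c * C 0 / 2 * z)) * of_real (exp (0 - c * C 0 / 2 * z)) * of_real (exp (0 - c * C 0 / 2 * z)) * of_real (exp (0 - c * C 0 / 2 * z))"
    unfolding of_real_mult[symmetric] exp_add[symmetric] by (simp add: algebra_simps)
  then show "sol C c (d4 k0) (2 * c * C 0) {} ?\<zeta> z ?w = S1 k1 x1 * S1 k2 x2 * cnj (S1 (- k3) y1) * cnj (S1 (- k4) y2)"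
    unfolding sol_def c3 phs_empty complex_cnj_mult complex_cnj_complex_of_real by (simp only: mult_ac)
qed

text \<open>The four frequencies are independent, so averages of the products in \<open>sol_4_pairs\<close> are
  products of averages.\<close>

lemma fourth_average_factorises:
  "(LINT k|gm r0. fourth_sol C k0 c (\<epsilon> *\<^sub>R k) z (x1, x2, y1, y2))
    = msol C c (d2 k0) (c * C 0) {diff2} r0 \<epsilon> z (x1, y1) * msol C c (d2 k0) (c * C 0) {diff2} r0 \<epsilon> z (x2, y2)
    + msol C c (d2 k0) (c * C 0) {diff2} r0 \<epsilon> z (x1, y2) * msol C c (d2 k0) (c * C 0) {diff2} r0 \<epsilon> z (x2, y1)
    - msol C c (d1 k0) (c * C 0 / 2) {} r0 \<epsilon> z x1 * msol C c (d1 k0) (c * C 0 / 2) {} r0 \<epsilon> z x2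
      * cnj (msol C c (d1 k0) (c * C 0 / 2) {} r0 \<epsilon> z y1) * cnj (msol C c (d1 k0) (c * C 0 / 2) {} r0 \<epsilon> z y2)"
proof -
  have C0: "0 \<le> C 0" using covariance_bound[OF C, of 0] by simp
  have Cm: "C \<in> borel_measurable borel" using int by auto
  have \<gamma>: "0 \<le> 2 * c * C 0" using c C0 by simp
  let ?w = "(x1, x2, y1, y2)"
  let ?s = "\<lambda>J k. sol C c (d4 k0) (2 * c * C 0) J (\<epsilon> *\<^sub>R k) z ?w"
  interpret G: finite_measure "gm r0 :: R8 measure" by (rule finite_measure_gm[OF r0])
  have m: "?s J \<in> borel_measurable borel" if J: "isotropic (d4 k0) J" for J
  proof -
    have lin: "linear L" if "L \<in> J" for L using J that by (simp add: isotropic_def)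
    note [measurable] = borel_measurable_sol[OF Cm lin]
    show ?thesis by measurable
  qed
  note b = norm_sol_bound[OF C int c z order_refl _ \<gamma>]
  have i: "integrable (gm r0) (?s J)" if J: "isotropic (d4 k0) J" for J
    by (rule G.integrable_const_bound[OF AE_I2[OF b[OF J]]]) (use m[OF J] in simp)
  have m1: "(\<lambda>k. S1 k x) \<in> borel_measurable borel" for x
  proof -
    have lin: "linear L" if "L \<in> {}" for L :: "R2 \<Rightarrow> R2" using that by simp
    note [measurable] = borel_measurable_sol[OF Cm lin]
    show ?thesis by measurable
  qed
  have conj: "(LINT k|gm r0. cnj (S1 (- k) y)) = cnj (LINT k|gm r0. S1 k y)" for y
    using gm_reflect[OF r0 m1[of y]] by (simp add: integral_cnj[symmetric] del: integral_cnj)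
  note iso = isotropic_13_24[of k0] isotropic_14_23[of k0] isotropic_empty[of "d4 k0"]
  have "(LINT k|gm r0. fourth_sol C k0 c (\<epsilon> *\<^sub>R k) z ?w) = (LINT k|gm r0. ?s {l13, l24} k) + (LINT k|gm r0. ?s {l14, l23} k) - (LINT k|gm r0. ?s {} k)"
    unfolding fourth_sol_def using i[OF iso(1)] i[OF iso(2)] i[OF iso(3)] by simp
  also have "(LINT k|gm r0. ?s {l13, l24} k) = (LINT k1|gm r0. LINT k2|gm r0. LINT k3|gm r0. LINT k4|gm r0. S2 (k1, k3) (x1, y1) * S2 (k2, k4) (x2, y2))"
    unfolding gm_iterate4[OF r0 m[OF iso(1)] b[OF iso(1)]] sol_4_pairs ..
  also have "\<dots> = (LINT k1|gm r0. LINT k3|gm r0. S2 (k1, k3) (x1, y1)) * (LINT k2|gm r0. LINT k4|gm r0. S2 (k2, k4) (x2, y2))"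
    by simp
  also have "(LINT k|gm r0. ?s {l14, l23} k) = (LINT k1|gm r0. LINT k2|gm r0. LINT k3|gm r0. LINT k4|gm r0. S2 (k1, k4) (x1, y2) * S2 (k2, k3) (x2, y1))"
    unfolding gm_iterate4[OF r0 m[OF iso(2)] b[OF iso(2)]] sol_4_pairs ..
  also have "\<dots> = (LINT k1|gm r0. LINT k4|gm r0. S2 (k1, k4) (x1, y2)) * (LINT k2|gm r0. LINT k3|gm r0. S2 (k2, k3) (x2, y1))"
    by simp
  also have "(LINT k|gm r0. ?s {} k) = (LINT k1|gm r0. LINT k2|gm r0. LINT k3|gm r0. LINT k4|gm r0. S1 k1 x1 * S1 k2 x2 * cnj (S1 (- k3) y1) * cnj (S1 (- k4) y2))"
    unfolding gm_iterate4[OF r0 m[OF iso(3)] b[OF iso(3)]] sol_4_pairs ..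
  also have "\<dots> = (LINT k|gm r0. S1 k x1) * (LINT k|gm r0. S1 k x2) * (LINT k|gm r0. cnj (S1 (- k) y1)) * (LINT k|gm r0. cnj (S1 (- k) y2))"
    by simp
  finally have fact: "(LINT k|gm r0. fourth_sol C k0 c (\<epsilon> *\<^sub>R k) z ?w)
    = (LINT k1|gm r0. LINT k3|gm r0. S2 (k1, k3) (x1, y1)) * (LINT k2|gm r0. LINT k4|gm r0. S2 (k2, k4) (x2, y2))
    + (LINT k1|gm r0. LINT k4|gm r0. S2 (k1, k4) (x1, y2)) * (LINT k2|gm r0. LINT k3|gm r0. S2 (k2, k3) (x2, y1))
    - (LINT k|gm r0. S1 k x1) * (LINT k|gm r0. S1 k x2) * (LINT k|gm r0. cnj (S1 (- k) y1)) * (LINT k|gm r0. cnj (S1 (- k) y2))" .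
  have "(LINT k|gm r0. LINT l|gm r0. S2 (k, l) w) = (LINT p|gm r0. S2 p w)" for w
  proof (rule gm_iterate[OF r0, symmetric])
    have lin: "linear L" if "L \<in> {diff2}" for L using that linear_l by simp
    note [measurable] = borel_measurable_sol[OF Cm lin]
    show "(\<lambda>p. S2 p w) \<in> borel_measurable borel" by measurable
    show "norm (S2 p w) \<le> exp (c * (real (card {diff2}) * (z * C 0)))" for p
      by (rule norm_sol_bound[OF C int c z order_refl isotropic_2]) (use c C0 in simp)
  qed
  then show ?thesis unfolding fact conj msol_def by simp
qed

end

lemma tendsto_at_level:
  assumes "((\<lambda>\<epsilon>. f (\<epsilon>::real)) \<longlongrightarrow> l) (at_right 0)" "\<And>\<epsilon>. 0 < \<epsilon> \<Longrightarrow> f \<epsilon> = g \<epsilon>"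
  shows "(g \<longlongrightarrow> l) (at_right 0)"
  by (rule Lim_transform_eventually[OF assms(1)], use eventually_at_right_less[of "0::real"] in eventually_elim) (simp add: assms(2))

theorem proposition9p1:
  fixes k0 r0 :: real
    and C :: "real^2 \<Rightarrow> real"
    and M :: "real \<Rightarrow> 'a measure"
    and B :: "real \<Rightarrow> real \<Rightarrow> real^2 \<Rightarrow> 'a \<Rightarrow> real"
    and u :: "real \<Rightarrow> real \<Rightarrow> real^2 \<Rightarrow> 'a \<Rightarrow> complex"
  assumes "k0 > 0" and "r0 > 0"
    and "covariance_function C" and "integrable lborel C"
    and "\<And>\<epsilon>. \<epsilon> > 0 \<Longrightarrow> prob_space (M \<epsilon>)"
    and "\<And>\<epsilon>. \<epsilon> > 0 \<Longrightarrow> brownian_field (M \<epsilon>) (\<lambda>x. \<epsilon> * C x) (B \<epsilon>)"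
    and "\<And>\<epsilon>. \<epsilon> > 0 \<Longrightarrow>
           ito_schroedinger_solution (M \<epsilon>) k0 (B \<epsilon>) (gaussian_beam r0 \<epsilon>) (u \<epsilon>)"
    and "\<And>\<epsilon>. \<epsilon> > 0 \<Longrightarrow>
           satisfies_moment_equations (M \<epsilon>) k0 (\<lambda>x. \<epsilon> * C x) (gaussian_beam r0 \<epsilon>) (u \<epsilon>)"
  defines "\<mu>1 \<equiv> \<lambda>\<epsilon> z r x. moment1 (M \<epsilon>) (u \<epsilon>) (z / \<epsilon>) (r /\<^sub>R \<epsilon> + x)"
    and "\<mu>2 \<equiv> \<lambda>\<epsilon> z r x y. moment2 (M \<epsilon>) (u \<epsilon>) (z / \<epsilon>) (r /\<^sub>R \<epsilon> + x) (r /\<^sub>R \<epsilon> + y)"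
    and "\<mu>4 \<equiv> \<lambda>\<epsilon> z r x1 x2 y1 y2. moment4 (M \<epsilon>) (u \<epsilon>) (z / \<epsilon>)
                  (r /\<^sub>R \<epsilon> + x1) (r /\<^sub>R \<epsilon> + x2) (r /\<^sub>R \<epsilon> + y1) (r /\<^sub>R \<epsilon> + y2)"
  shows "\<exists>\<mu>1\<^sub>0 \<mu>2\<^sub>0 \<mu>4\<^sub>0. \<forall>z\<ge>0. \<forall>r.
     (\<forall>x. ((\<lambda>\<epsilon>. \<mu>1 \<epsilon> z r x) \<longlongrightarrow> \<mu>1\<^sub>0 z r x) (at_right 0)) \<and>
     (\<forall>x y. ((\<lambda>\<epsilon>. \<mu>2 \<epsilon> z r x y) \<longlongrightarrow> \<mu>2\<^sub>0 z r x y) (at_right 0)) \<and>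
     (\<forall>x1 x2 y1 y2.
        ((\<lambda>\<epsilon>. \<mu>4 \<epsilon> z r x1 x2 y1 y2) \<longlongrightarrow> \<mu>4\<^sub>0 z r x1 x2 y1 y2) (at_right 0) \<and>
        \<mu>4\<^sub>0 z r x1 x2 y1 y2 =
          \<mu>2\<^sub>0 z r x1 y1 * \<mu>2\<^sub>0 z r x2 y2 + \<mu>2\<^sub>0 z r x1 y2 * \<mu>2\<^sub>0 z r x2 y1
          - \<mu>1\<^sub>0 z r x1 * \<mu>1\<^sub>0 z r x2 * cnj (\<mu>1\<^sub>0 z r y1) * cnj (\<mu>1\<^sub>0 z r y2))"
proof -
  note k0 = assms(1) and r0 = assms(2) and C = assms(3) and int = assms(4)
  \<comment> \<open>The potentials in the equation for the moments at level \<open>\<epsilon>\<close> have strength \<open>\<epsilon> q\<close>.\<close>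
  define q where "q = k0\<^sup>2 / 4"
  have q: "0 < q" using k0 by (simp add: q_def)
  have C0: "0 \<le> C 0" using covariance_bound[OF C, of 0] by simp
  let ?m1 = "\<lambda>\<epsilon>. msol C (\<epsilon> * q) (d1 k0) (\<epsilon> * q * C 0 / 2) {} r0 \<epsilon>"
  let ?m2 = "\<lambda>\<epsilon>. msol C (\<epsilon> * q) (d2 k0) (\<epsilon> * q * C 0) {diff2} r0 \<epsilon>"
  have beam: "gaussian_beam r0 \<epsilon> x = of_real (exp (- ((norm (\<epsilon> *\<^sub>R x))\<^sup>2 / (2 * r0\<^sup>2))))" for \<epsilon> x
    by (simp add: gaussian_beam_def power_mult_distrib)
  have m1: "moment1 (M \<epsilon>) (u \<epsilon>) z x = ?m1 \<epsilon> z x" if \<epsilon>: "0 < \<epsilon>" and z: "0 \<le> z" for \<epsilon> z x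
  proof (rule moment_eq_msol[OF C int _ _ isotropic_empty r0 assms(8)[OF \<epsilon>, unfolded satisfies_moment_equations_def, THEN conjunct2, THEN conjunct1] _ _ _ z])
    show "(\<lambda>x. \<i> / (2 * of_real k0) * laplacian \<phi> x) = schr (d1 k0) \<phi>" for \<phi>
      by (simp add: fun_eq_iff d1_def schr_const)
    show "- (k0\<^sup>2 * (\<epsilon> * C 0) / 8) = \<epsilon> * q * (\<Sum>L\<in>{}. C (L w)) - \<epsilon> * q * C 0 / 2" for w by (simp add: q_def)
  qed (use \<epsilon> q C0 in \<open>simp_all add: beam\<close>)
  have m2: "moment2 (M \<epsilon>) (u \<epsilon>) z x y = ?m2 \<epsilon> z (x, y)" if \<epsilon>: "0 < \<epsilon>" and z: "0 \<le> z" for \<epsilon> z x y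
  proof -
    have "(case (x, y) of (x, y) \<Rightarrow> moment2 (M \<epsilon>) (u \<epsilon>) z x y) = ?m2 \<epsilon> z (x, y)"
    proof (rule moment_eq_msol[OF C int _ _ isotropic_2 r0 assms(8)[OF \<epsilon>, unfolded satisfies_moment_equations_def, THEN conjunct2, THEN conjunct2, THEN conjunct1] _ _ _ z])
      show "(\<lambda>(x, y). \<i> / (2 * of_real k0) * (laplacian (\<lambda>\<xi>. \<phi> (\<xi>, y)) x - laplacian (\<lambda>\<xi>. \<phi> (x, \<xi>)) y)) = schr (d2 k0) \<phi>" for \<phi>
        by (simp add: fun_eq_iff d2_def d1_def d1'_def schr_pd schr_const right_diff_distrib)
      show "(case w of (x, y) \<Rightarrow> k0\<^sup>2 / 4 * (\<epsilon> * C (x - y) - \<epsilon> * C 0)) = \<epsilon> * q * (\<Sum>L\<in>{diff2}. C (L w)) - \<epsilon> * q * C 0" for w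
        by (simp add: q_def diff2_def case_prod_beta' algebra_simps)
      show "(case w of (x, y) \<Rightarrow> gaussian_beam r0 \<epsilon> x * cnj (gaussian_beam r0 \<epsilon> y)) = of_real (exp (- ((norm (\<epsilon> *\<^sub>R w))\<^sup>2 / (2 * r0\<^sup>2))))" for w
      proof (cases w)
        case (Pair x y)
        show ?thesis unfolding Pair prod.case beam complex_cnj_complex_of_real of_real_mult[symmetric] exp_add[symmetric] scaleR_Pair norm_Pair
          by (simp add: add_divide_distrib)
      qed
    qed (use \<epsilon> q C0 in auto)
    then show ?thesis by simp
  qed
  have m4: "norm (moment4 (M \<epsilon>) (u \<epsilon>) z x1 x2 y1 y2 - (?m2 \<epsilon> z (x1, y1) * ?m2 \<epsilon> z (x2, y2) + ?m2 \<epsilon> z (x1, y2) * ?m2 \<epsilon> z (x2, y1)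
      - ?m1 \<epsilon> z x1 * ?m1 \<epsilon> z x2 * cnj (?m1 \<epsilon> z y1) * cnj (?m1 \<epsilon> z y2))) \<le> fourth_error C k0 r0 (\<epsilon> * q) \<epsilon> z"
    if \<epsilon>: "0 < \<epsilon>" and z: "0 \<le> z" for \<epsilon> z x1 x2 y1 y2
  proof -
    have cp: "0 < \<epsilon> * q" using \<epsilon> q by simp
    have "norm ((case (x1, x2, y1, y2) of (x1, x2, y1, y2) \<Rightarrow> moment4 (M \<epsilon>) (u \<epsilon>) z x1 x2 y1 y2) - (LINT k|gm r0. fourth_sol C k0 (\<epsilon> * q) (\<epsilon> *\<^sub>R k) z (x1, x2, y1, y2)))
      \<le> fourth_error C k0 r0 (\<epsilon> * q) \<epsilon> z"
    proof (rule fourth_moment_near_average[OF C int cp k0 r0 assms(8)[OF \<epsilon>, unfolded satisfies_moment_equations_def, THEN conjunct2, THEN conjunct2, THEN conjunct2] _ _ _ z])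
      show "(\<lambda>(x1, x2, y1, y2). \<i> / (2 * of_real k0) *
          (laplacian (\<lambda>\<xi>. \<phi> (\<xi>, x2, y1, y2)) x1 + laplacian (\<lambda>\<xi>. \<phi> (x1, \<xi>, y1, y2)) x2
           - laplacian (\<lambda>\<xi>. \<phi> (x1, x2, \<xi>, y2)) y1 - laplacian (\<lambda>\<xi>. \<phi> (x1, x2, y1, \<xi>)) y2)) = schr (d4 k0) \<phi>" for \<phi>
        by (simp add: fun_eq_iff d4_def d1_def d1'_def schr_pd schr_const distrib_left right_diff_distrib)
      show "(case w of (x1, x2, y1, y2) \<Rightarrow> k0\<^sup>2 / 4 *
          (\<epsilon> * C (x1 - y1) + \<epsilon> * C (x1 - y2) + \<epsilon> * C (x2 - y1) + \<epsilon> * C (x2 - y2)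
           - \<epsilon> * C (x1 - x2) - \<epsilon> * C (y1 - y2) - 2 * (\<epsilon> * C 0))) = fourth_potential C (\<epsilon> * q) w" for w
        by (simp add: fourth_potential_def l_defs q_def case_prod_beta' algebra_simps)
      show "(case w of (x1, x2, y1, y2) \<Rightarrow> gaussian_beam r0 \<epsilon> x1 * gaussian_beam r0 \<epsilon> x2 * cnj (gaussian_beam r0 \<epsilon> y1) * cnj (gaussian_beam r0 \<epsilon> y2))
         = of_real (exp (- ((norm (\<epsilon> *\<^sub>R w))\<^sup>2 / (2 * r0\<^sup>2))))" for w
      proof (cases w)
        case (fields x1 x2 y1 y2)
        show ?thesis unfolding fields prod.case beam complex_cnj_complex_of_real of_real_mult[symmetric] exp_add[symmetric] scaleR_Pair norm_Pair
          by (simp add: add_divide_distrib)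
      qed
    qed
    then show ?thesis using fourth_average_factorises[OF C int less_imp_le[OF cp] r0 z, of k0 \<epsilon> x1 x2 y1 y2] by simp
  qed
  define \<nu>1 where "\<nu>1 z r x = mlim C q (d1 k0) (q * C 0 / 2) {} r0 z r x" for z r x
  define \<nu>2 where "\<nu>2 z r x y = mlim C q (d2 k0) (q * C 0) {diff2} r0 z (r, r) (x, y)" for z r x y
  have l1: "((\<lambda>\<epsilon>. \<mu>1 \<epsilon> z r x) \<longlongrightarrow> \<nu>1 z r x) (at_right 0)" if z: "0 \<le> z" for z r x
    unfolding \<nu>1_def
  proof (rule tendsto_at_level[OF msol_limit[OF C int isotropic_empty z _ _ r0]])
    show "msol C (\<epsilon> * q) (d1 k0) (\<epsilon> * (q * C 0 / 2)) {} r0 \<epsilon> (z / \<epsilon>) (r /\<^sub>R \<epsilon> + x) = \<mu>1 \<epsilon> z r x" if "0 < \<epsilon>" for \<epsilon>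
      using m1[of \<epsilon> "z / \<epsilon>"] that z by (simp add: \<mu>1_def mult.assoc)
  qed (use q C0 in auto)
  have l2: "((\<lambda>\<epsilon>. \<mu>2 \<epsilon> z r x y) \<longlongrightarrow> \<nu>2 z r x y) (at_right 0)" if z: "0 \<le> z" for z r x y
    unfolding \<nu>2_def
  proof (rule tendsto_at_level[OF msol_limit[OF C int isotropic_2 z _ _ r0]])
    show "msol C (\<epsilon> * q) (d2 k0) (\<epsilon> * (q * C 0)) {diff2} r0 \<epsilon> (z / \<epsilon>) ((r, r) /\<^sub>R \<epsilon> + (x, y)) = \<mu>2 \<epsilon> z r x y" if "0 < \<epsilon>" for \<epsilon>
      using m2[of \<epsilon> "z / \<epsilon>"] that z by (simp add: \<mu>2_def mult.assoc)
  qed (use q C0 in \<open>auto simp: diff2_def\<close>)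
  define \<nu>4 where "\<nu>4 z r x1 x2 y1 y2 = \<nu>2 z r x1 y1 * \<nu>2 z r x2 y2 + \<nu>2 z r x1 y2 * \<nu>2 z r x2 y1
          - \<nu>1 z r x1 * \<nu>1 z r x2 * cnj (\<nu>1 z r y1) * cnj (\<nu>1 z r y2)" for z r x1 x2 y1 y2
  have l4: "((\<lambda>\<epsilon>. \<mu>4 \<epsilon> z r x1 x2 y1 y2) \<longlongrightarrow> \<nu>4 z r x1 x2 y1 y2) (at_right 0)" if z: "0 \<le> z" for z r x1 x2 y1 y2
  proof -
    let ?G = "\<lambda>\<epsilon>. \<mu>2 \<epsilon> z r x1 y1 * \<mu>2 \<epsilon> z r x2 y2 + \<mu>2 \<epsilon> z r x1 y2 * \<mu>2 \<epsilon> z r x2 y1 - \<mu>1 \<epsilon> z r x1 * \<mu>1 \<epsilon> z r x2 * cnj (\<mu>1 \<epsilon> z r y1) * cnj (\<mu>1 \<epsilon> z r y2)"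
    have G: "(?G \<longlongrightarrow> \<nu>4 z r x1 x2 y1 y2) (at_right 0)"
      unfolding \<nu>4_def by (intro tendsto_intros l1[OF z] l2[OF z])
    have "((\<lambda>\<epsilon>. \<mu>4 \<epsilon> z r x1 x2 y1 y2 - ?G \<epsilon>) \<longlongrightarrow> 0) (at_right 0)"
    proof (rule Lim_null_comparison[OF _ fourth_error_limit[OF C int less_imp_le[OF q] k0 z r0]])
      show "\<forall>\<^sub>F \<epsilon> in at_right 0. norm (\<mu>4 \<epsilon> z r x1 x2 y1 y2 - ?G \<epsilon>) \<le> fourth_error C k0 r0 (\<epsilon> * q) \<epsilon> (z / \<epsilon>)"
        using eventually_at_right_less[of "0::real"]
      proof eventually_elim
        fix \<epsilon> :: real assume \<epsilon>: "0 < \<epsilon>"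
        then have zp: "0 \<le> z / \<epsilon>" using z by simp
        show "norm (\<mu>4 \<epsilon> z r x1 x2 y1 y2 - ?G \<epsilon>) \<le> fourth_error C k0 r0 (\<epsilon> * q) \<epsilon> (z / \<epsilon>)"
          using m4[OF \<epsilon> zp] unfolding \<mu>1_def \<mu>2_def \<mu>4_def m1[OF \<epsilon> zp] m2[OF \<epsilon> zp] .
      qed
    qed
    from tendsto_add[OF this G] show ?thesis by simp
  qed
  show ?thesis
    by (rule exI[of _ \<nu>1], rule exI[of _ \<nu>2], rule exI[of _ \<nu>4]) (intro allI impI conjI l1 l2 l4 \<nu>4_def; assumption)
qed

end
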